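(* Let $S$ be a Zariski open subset of a complex manifold $\bar S$ such that $D=\bar S-S$ is a normal crossing divisor. Let $\mathcal V\to S$ be an oriented graded-polarized Hodge–Tate variation of mixed Hodge structure with length $\ell(\mathcal V)\ge 4$. Assume $\mathcal V$ is admissible with respect to $\bar S$ and has unipotent local monodromy about $D$. Let $p\in D$. Then the limit mixed Hodge structure $\mathcal V_p$ of $\mathcal V$ at $p\in D$ is an oriented Hodge–Tate structure with the same weight filtration as $\mathcal V$. Moreover, $$\lim_{s\to p}\mathrm{ht}(\mathcal V_s)=\mathrm{ht}(\mathcal V_p).$$
   Context: **Height of an oriented mixed Hodge structure.** A mixed Hodge structure $H=(F,W)$ on $V$ has its Deligne bigrading $V_{\mathbb C}=\bigoplus I^{a,b}$: the unique functorial bigrading with $F^a=\bigoplus_{\alpha\ge a,\beta}I^{\alpha,\beta}$, $W_k=\bigoplus_{\alpha+\beta\le k}I^{\alpha,\beta}$, $\overline{I^{a,b}}\equiv I^{b,a}$ mod $\bigoplus_{\beta<b,\alpha<a}I^{\beta,\alpha}$. Let $Y$ act on $I^{a,b}$ as multiplication by $a+b$; let $\mathfrak{gl}(V_{\mathbb C})^{a,b}=\{\alpha:\alpha(I^{c,d})\subseteq I^{a+c,b+d}\}$ and $\Lambda^{-1,-1}=\bigoplus_{a<0,b<0}\mathfrak{gl}(V_{\mathbb C})^{a,b}$. The Deligne splitting $\delta_H$ is the unique real element of $\Lambda^{-1,-1}$ with $\overline{Y}=\mathrm{Ad}(e^{-2i\delta_H})Y$; $\delta_H^{a,b}$ are its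 components. Let $\max(H),\min(H)$ be the largest/smallest $k$ with $\mathrm{Gr}^W_k\ne0$ and $\ell(H)=\max(H)-\min(H)$ (the length). $H$ is oriented if $\mathrm{Gr}^W_{\max}$ and $\mathrm{Gr}^W_{\min}$ have rank 1 (so $\max=2a$, $\min=2c$ are even) and Betti generators $\mathbf 1_H$, $\mathbf 1_H^\vee$ of these have been chosen. The height $\mathrm{ht}(H)$ is defined by $\delta_H^{r,r}(e)=\mathrm{ht}(H)e^\vee$, $r=-\ell(H)/2$, with $e\in I^{a,a}$ lifting $\mathbf 1_H$ and $e^\vee$ the image of $\mathbf 1_H^\vee$ in $W_{\min}V_{\mathbb C}$. **Variations.** An oriented variation is one equipped with a choice of flat global sections inducing an orientation on each fiber. Hodge–Tate means that $\mathrm{Gr}^W_{k}=0$ for odd $k$ and each $\mathrm{Gr}^W_{2k}$ is pure of type $(k,k)$. Length $\ell(\mathcal V)$ is the length of any fiber. **Limit mixed Hodge structure.** Near $p$ choose a polydisk $\Delta^r$ with coordinates $(s_1,\dots,s_r)$ vanishing at $p$ such that $D$ is $s_1\cdots s_k=0$. Let $V$ be a reference fiber, $T_j=e^{N_j}$ the local monodromy about $s_j=0$, and $F(z,s)$ the lift of the period map to $U^k\times\Delta^{r-k}$ ($U$ the upper half-plane, $s_j=e^{2\pi iz_j}$ for $j\le k$). By admissibility $e^{-\sum z_jN_j}\cdot F(z,s)$ descends and extends holomorphically to $\Delta^r$; its value at $s=0$ is $F_\infty$. With $N=\sum_ja_jN_j$, $a_j>0$, and $M=M(N,W)$ the relative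 weight filtration of $N$ and $W$, $\mathcal V_p:=(F_\infty,M)$. ($F_\infty$ depends on the local coordinates only up to $F_\infty\mapsto e^{\sum\lambda_jN_j}\cdot F_\infty$, $\lambda_j\in\mathbb{C}$.) The orientation of $\mathcal V_p$ is the one induced by the flat sections orienting $\mathcal V$. *)

theory Defs
  imports "HOL-Analysis.Analysis"
begin

section \<open>Linear algebra over the complex numbers\<close>

text \<open>
  The complex vector space underlying every mixed Hodge structure is \<^typ>\<open>complex^'n\<close> with its
  standard real structure, and operators are matrices. Complex subspaces are those of the
  interpretation \<open>vec\<close>, that is \<open>vec.subspace\<close>, \<open>vec.span\<close>, \<open>vec.dim\<close>; the unqualified
  \<open>subspace\<close>, \<open>span\<close>, \<open>dim\<close> refer to the real vector space structure.
\<close>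

definition conj_vec :: "complex^'n \<Rightarrow> complex^'n" where
  "conj_vec v = (\<chi> i. cnj (v $ i))"

definition conj_mat :: "complex^'n^'n \<Rightarrow> complex^'n^'n" where
  "conj_mat X = (\<chi> i j. cnj (X $ i $ j))"

definition scale_mat :: "complex \<Rightarrow> complex^'n^'n \<Rightarrow> complex^'n^'n" where
  "scale_mat c X = (\<chi> i j. c * X $ i $ j)"

definition mat_pow :: "complex^'n^'n \<Rightarrow> nat \<Rightarrow> complex^'n^'n" where
  "mat_pow X k = (((**) X) ^^ k) (mat 1)"

definition mat_exp :: "complex^'n^'n \<Rightarrow> complex^'n^'n" where
  "mat_exp X = (\<Sum>k. (1 / fact k) *\<^sub>R mat_pow X k)"

definition nilpotent_mat :: "complex^'n^'n \<Rightarrow> bool" where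
  "nilpotent_mat X \<longleftrightarrow> (\<exists>m. mat_pow X m = 0)"

definition unipotent_mat :: "complex^'n^'n \<Rightarrow> bool" where
  "unipotent_mat T \<longleftrightarrow> nilpotent_mat (T - mat 1)"

definition sum_sets :: "(complex^'n) set \<Rightarrow> (complex^'n) set \<Rightarrow> (complex^'n) set" where
  "sum_sets E E' = {u + v | u v. u \<in> E \<and> v \<in> E'}"

definition increasing_filtration :: "(int \<Rightarrow> (complex^'n) set) \<Rightarrow> bool" where
  "increasing_filtration W \<longleftrightarrow>
     (\<forall>k. vec.subspace (W k)) \<and> mono W \<and> (\<exists>k. W k = {0}) \<and> (\<exists>k. W k = UNIV)"

definition decreasing_filtration :: "(int \<Rightarrow> (complex^'n) set) \<Rightarrow> bool" where
  "decreasing_filtration F \<longleftrightarrow> increasing_filtration (\<lambda>k. F (- k))"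


section \<open>Mixed Hodge structures\<close>

text \<open>
  The ring of coefficients \<open>A\<close> is the ring of integers, the field of rational numbers or the field
  of real numbers; the \<open>A\<close>-module of a mixed Hodge structure on \<^typ>\<open>complex^'n\<close> is the standard
  one, \<open>A\<^sup>n\<close>.
\<close>

definition coeff_ring :: "real set \<Rightarrow> bool" where
  "coeff_ring A \<longleftrightarrow> A = \<int> \<or> A = \<rat> \<or> A = UNIV"

definition frac_field :: "real set \<Rightarrow> real set" where
  "frac_field A = {x / y | x y. x \<in> A \<and> y \<in> A}"

definition A_points :: "real set \<Rightarrow> (complex^'n) set" where
  "A_points A = {v. \<forall>i. v $ i \<in> complex_of_real ` A}"

definition GL_A :: "real set \<Rightarrow> (complex^'n^'n) set" where
  "GL_A A = {X. (\<forall>i j. X $ i $ j \<in> complex_of_real ` A) \<and>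
     (\<exists>X'. (\<forall>i j. X' $ i $ j \<in> complex_of_real ` A) \<and> X ** X' = mat 1 \<and> X' ** X = mat 1)}"

text \<open>
  A subspace of the graded piece \<open>W\<^sub>k / W\<^sub>k\<^sub>-\<^sub>1\<close> is represented by its preimage in \<open>W\<^sub>k\<close>: the next two
  sets are the preimages of \<open>F\<^sup>p Gr\<^sub>k\<close> and of the Hodge component \<open>F\<^sup>p Gr \<inter> conj (F\<^sup>q Gr)\<close> of
  \<open>Gr\<^sub>p\<^sub>+\<^sub>q\<close>. A component vanishes if its preimage is \<open>W\<^sub>p\<^sub>+\<^sub>q\<^sub>-\<^sub>1\<close>.
\<close>

definition F_gr ::
  "(int \<Rightarrow> (complex^'n) set) \<Rightarrow> (int \<Rightarrow> (complex^'n) set) \<Rightarrow> int \<Rightarrow> int \<Rightarrow> (complex^'n) set" where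
  "F_gr F W p k = sum_sets (F p \<inter> W k) (W (k - 1))"

definition hodge_comp ::
  "(int \<Rightarrow> (complex^'n) set) \<Rightarrow> (int \<Rightarrow> (complex^'n) set) \<Rightarrow> int \<Rightarrow> int \<Rightarrow> (complex^'n) set" where
  "hodge_comp F W p q = F_gr F W p (p + q) \<inter> conj_vec ` F_gr F W q (p + q)"

definition is_mhs ::
  "real set \<Rightarrow> (int \<Rightarrow> (complex^'n) set) \<Rightarrow> (int \<Rightarrow> (complex^'n) set) \<Rightarrow> bool" where
  "is_mhs A F W \<longleftrightarrow>
     decreasing_filtration F \<and> increasing_filtration W \<and>
     (\<forall>k. W k = vec.span (W k \<inter> A_points A)) \<and>
     (\<forall>p k. sum_sets (F_gr F W p k) (conj_vec ` F_gr F W (k + 1 - p) k) = W k \<and>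
            F_gr F W p k \<inter> conj_vec ` F_gr F W (k + 1 - p) k = W (k - 1))"

definition hodge_tate ::
  "(int \<Rightarrow> (complex^'n) set) \<Rightarrow> (int \<Rightarrow> (complex^'n) set) \<Rightarrow> bool" where
  "hodge_tate F W \<longleftrightarrow>
     (\<forall>k. odd k \<longrightarrow> W k = W (k - 1)) \<and>
     (\<forall>p q. p \<noteq> q \<longrightarrow> hodge_comp F W p q = W (p + q - 1))"

definition wt_max :: "(int \<Rightarrow> (complex^'n) set) \<Rightarrow> int" where
  "wt_max W = Max {k. W k \<noteq> W (k - 1)}"

definition wt_min :: "(int \<Rightarrow> (complex^'n) set) \<Rightarrow> int" where
  "wt_min W = Min {k. W k \<noteq> W (k - 1)}"

definition wt_length :: "(int \<Rightarrow> (complex^'n) set) \<Rightarrow> int" where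
  "wt_length W = wt_max W - wt_min W"

text \<open>A generator of \<open>Gr\<^sub>k\<close>, assumed of rank 1, is given by a representative in \<open>W\<^sub>k\<close>.\<close>

definition betti_generator ::
  "real set \<Rightarrow> (int \<Rightarrow> (complex^'n) set) \<Rightarrow> int \<Rightarrow> complex^'n \<Rightarrow> bool" where
  "betti_generator A W k u \<longleftrightarrow>
     vec.dim (W k) = Suc (vec.dim (W (k - 1))) \<and>
     u \<in> W k \<inter> A_points A \<and>
     W k \<inter> A_points A =
       {complex_of_real x *s u + v | x v. x \<in> A \<and> v \<in> W (k - 1) \<inter> A_points A}"

definition oriented_mhs ::
  "real set \<Rightarrow> (int \<Rightarrow> (complex^'n) set) \<Rightarrow> (int \<Rightarrow> (complex^'n) set) \<Rightarrow>
   complex^'n \<Rightarrow> complex^'n \<Rightarrow> bool" where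
  "oriented_mhs A F W one one_dual \<longleftrightarrow>
     is_mhs A F W \<and> betti_generator A W (wt_max W) one \<and> betti_generator A W (wt_min W) one_dual"


section \<open>Deligne bigrading, Deligne splitting and height\<close>

definition bigrading :: "(int \<times> int \<Rightarrow> (complex^'n) set) \<Rightarrow> bool" where
  "bigrading I \<longleftrightarrow>
     (\<forall>j. vec.subspace (I j)) \<and> vec.span (\<Union>j. I j) = UNIV \<and>
     (\<forall>J c. finite J \<and> (\<forall>j\<in>J. c j \<in> I j) \<and> sum c J = 0 \<longrightarrow> (\<forall>j\<in>J. c j = 0))"

definition is_deligne_bigrading ::
  "(int \<Rightarrow> (complex^'n) set) \<Rightarrow> (int \<Rightarrow> (complex^'n) set) \<Rightarrow>
   (int \<times> int \<Rightarrow> (complex^'n) set) \<Rightarrow> bool" where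
  "is_deligne_bigrading F W I \<longleftrightarrow>
     bigrading I \<and>
     (\<forall>a. F a = vec.span (\<Union>(\<alpha>, \<beta>) \<in> {(\<alpha>, \<beta>). \<alpha> \<ge> a}. I (\<alpha>, \<beta>))) \<and>
     (\<forall>k. W k = vec.span (\<Union>(\<alpha>, \<beta>) \<in> {(\<alpha>, \<beta>). \<alpha> + \<beta> \<le> k}. I (\<alpha>, \<beta>))) \<and>
     (\<forall>a b. let R = vec.span (\<Union>(\<beta>, \<alpha>) \<in> {(\<beta>, \<alpha>). \<beta> < b \<and> \<alpha> < a}. I (\<beta>, \<alpha>))
            in sum_sets (conj_vec ` I (a, b)) R = sum_sets (I (b, a)) R)"

definition deligne_bigrading ::
  "(int \<Rightarrow> (complex^'n) set) \<Rightarrow> (int \<Rightarrow> (complex^'n) set) \<Rightarrow>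
   int \<times> int \<Rightarrow> (complex^'n) set" where
  "deligne_bigrading F W = (THE I. is_deligne_bigrading F W I)"

definition grading_op :: "(int \<times> int \<Rightarrow> (complex^'n) set) \<Rightarrow> complex^'n^'n" where
  "grading_op I = (THE Y. \<forall>a b. \<forall>v \<in> I (a, b). Y *v v = of_int (a + b) *s v)"

definition gl_piece :: "(int \<times> int \<Rightarrow> (complex^'n) set) \<Rightarrow> int \<times> int \<Rightarrow> (complex^'n^'n) set" where
  "gl_piece I = (\<lambda>(a, b). {X. \<forall>c d. \<forall>v \<in> I (c, d). X *v v \<in> I (a + c, b + d)})"

definition Lambda :: "(int \<times> int \<Rightarrow> (complex^'n) set) \<Rightarrow> (complex^'n^'n) set" where
  "Lambda I = {sum c J | c J. finite J \<and> J \<subseteq> {(a, b). a < 0 \<and> b < 0} \<and> (\<forall>j\<in>J. c j \<in> gl_piece I j)}"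

definition gl_component ::
  "(int \<times> int \<Rightarrow> (complex^'n) set) \<Rightarrow> complex^'n^'n \<Rightarrow> int \<times> int \<Rightarrow> complex^'n^'n" where
  "gl_component I X =
     (THE c. (\<forall>j. c j \<in> gl_piece I j) \<and> finite {j. c j \<noteq> 0} \<and> X = sum c {j. c j \<noteq> 0})"

definition deligne_splitting ::
  "(int \<Rightarrow> (complex^'n) set) \<Rightarrow> (int \<Rightarrow> (complex^'n) set) \<Rightarrow> complex^'n^'n" where
  "deligne_splitting F W =
     (let I = deligne_bigrading F W; Y = grading_op I in
      THE \<delta>. \<delta> \<in> Lambda I \<and> conj_mat \<delta> = \<delta> \<and>
        conj_mat Y = mat_exp (scale_mat (- 2 * \<i>) \<delta>) ** Y ** mat_exp (scale_mat (2 * \<i>) \<delta>))"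

definition height ::
  "(int \<Rightarrow> (complex^'n) set) \<Rightarrow> (int \<Rightarrow> (complex^'n) set) \<Rightarrow>
   complex^'n \<Rightarrow> complex^'n \<Rightarrow> real" where
  "height F W one one_dual =
     (let I = deligne_bigrading F W; a = wt_max W div 2; r = - (wt_length W div 2) in
      THE h. \<exists>e \<in> I (a, a). e - one \<in> W (wt_max W - 1) \<and>
        gl_component I (deligne_splitting F W) (r, r) *v e = complex_of_real h *s one_dual)"


section \<open>Complex manifolds and normal crossing divisors\<close>

definition holo_on :: "(complex^'r \<Rightarrow> complex^'n) \<Rightarrow> (complex^'r) set \<Rightarrow> bool" where
  "holo_on f X \<longleftrightarrow> (\<forall>x\<in>X. \<exists>L :: complex^'r^'n. (f has_derivative (\<lambda>h. L *v h)) (at x))"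

type_synonym ('m, 'r) chart = "'m set \<times> ('m \<Rightarrow> complex^'r)"

definition holo_chart ::
  "('m::t2_space, 'r::finite) chart set \<Rightarrow> 'm set \<Rightarrow> ('m \<Rightarrow> complex^'r) \<Rightarrow> bool" where
  "holo_chart atlas U \<psi> \<longleftrightarrow>
     open U \<and> open (\<psi> ` U) \<and> homeomorphism U (\<psi> ` U) \<psi> (inv_into U \<psi>) \<and>
     (\<forall>(U', \<psi>') \<in> atlas.
        holo_on (\<lambda>s. \<psi>' (inv_into U \<psi> s)) (\<psi> ` (U \<inter> U')) \<and>
        holo_on (\<lambda>s. \<psi> (inv_into U' \<psi>' s)) (\<psi>' ` (U \<inter> U')))"

definition complex_manifold :: "('m::t2_space, 'r::finite) chart set \<Rightarrow> bool" where
  "complex_manifold atlas \<longleftrightarrow>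
     (\<forall>(U, \<psi>) \<in> atlas. holo_chart atlas U \<psi>) \<and> (\<Union>(U, \<psi>) \<in> atlas. U) = UNIV"

definition mfd_holo_on ::
  "('m::t2_space, 'r::finite) chart set \<Rightarrow> ('m \<Rightarrow> complex^'n) \<Rightarrow> 'm set \<Rightarrow> bool" where
  "mfd_holo_on atlas f X \<longleftrightarrow>
     (\<forall>(U, \<psi>) \<in> atlas. holo_on (\<lambda>s. f (inv_into U \<psi> s)) (\<psi> ` (X \<inter> U)))"

definition polydisk :: "(complex^'r) set" where
  "polydisk = {s. \<forall>j. cmod (s $ j) < 1}"

text \<open>Coordinates at \<open>p\<close> with values in the unit polydisk such that \<open>D\<close> is \<open>\<Prod>j\<in>K. s\<^sub>j = 0\<close>.\<close>

definition adapted_coords ::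
  "('m::t2_space, 'r::finite) chart set \<Rightarrow> 'm set \<Rightarrow> 'm \<Rightarrow> 'm set \<Rightarrow> ('m \<Rightarrow> complex^'r) \<Rightarrow> 'r set \<Rightarrow> bool"
  where
  "adapted_coords atlas D p P \<psi> K \<longleftrightarrow>
     holo_chart atlas P \<psi> \<and> p \<in> P \<and> \<psi> p = 0 \<and> \<psi> ` P = polydisk \<and>
     D \<inter> P = {x \<in> P. (\<exists>j\<in>K. \<psi> x $ j = 0)}"

definition normal_crossing_divisor :: "('m::t2_space, 'r::finite) chart set \<Rightarrow> 'm set \<Rightarrow> bool" where
  "normal_crossing_divisor atlas D \<longleftrightarrow> (\<forall>p. \<exists>P \<psi> K. adapted_coords atlas D p P \<psi> K)"


section \<open>Variations of mixed Hodge structure\<close>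

text \<open>
  The base of a variation is an open set \<open>S\<close> of the manifold, and a basis has been chosen in each
  fibre of the underlying local system of free \<open>A\<close>-modules, so that all fibres are \<open>A\<^sup>n\<close>. The bases
  at different points are unrelated; the local system is the set of its local flat frames \<open>(U, \<phi>)\<close>,
  with \<open>\<phi> x\<close> in \<open>GL\<^sub>n(A)\<close> the value at \<open>x\<close> of a flat isomorphism from the local system on \<open>U\<close> to the
  constant one. The polarization of \<open>Gr\<^sub>k\<close> is given by a form on \<open>W\<^sub>k\<close> with kernel containing
  \<open>W\<^sub>k\<^sub>-\<^sub>1\<close>, written as the restriction to \<open>W\<^sub>k\<close> of the form defined by a matrix.
\<close>

record ('m, 'n::finite) variation =
  frames :: "('m set \<times> ('m \<Rightarrow> complex^'n^'n)) set"
  weight :: "'m \<Rightarrow> int \<Rightarrow> (complex^'n) set"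
  hodge :: "'m \<Rightarrow> int \<Rightarrow> (complex^'n) set"
  polar :: "'m \<Rightarrow> int \<Rightarrow> complex^'n^'n"

definition locally_constant_on :: "'a::topological_space set \<Rightarrow> ('a \<Rightarrow> 'b) \<Rightarrow> bool" where
  "locally_constant_on X f \<longleftrightarrow> (\<forall>x\<in>X. \<forall>\<^sub>F y in at x within X. f y = f x)"

text \<open>A flat frame of the pullback of the local system by a map \<open>c\<close> defined on \<open>X\<close>.\<close>

definition flat_frame ::
  "real set \<Rightarrow> ('m, 'n::finite) variation \<Rightarrow> 'a::topological_space set \<Rightarrow> ('a \<Rightarrow> 'm) \<Rightarrow>
   ('a \<Rightarrow> complex^'n^'n) \<Rightarrow> bool" where
  "flat_frame A V X c \<Phi> \<longleftrightarrow>
     (\<forall>x\<in>X. \<Phi> x \<in> GL_A A) \<and>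
     (\<forall>(U, \<phi>) \<in> frames V.
        locally_constant_on {x\<in>X. c x \<in> U} (\<lambda>x. \<Phi> x ** matrix_inv (\<phi> (c x))))"

definition local_system :: "real set \<Rightarrow> 'm::t2_space set \<Rightarrow> ('m, 'n::finite) variation \<Rightarrow> bool" where
  "local_system A S V \<longleftrightarrow>
     (\<forall>(U, \<phi>) \<in> frames V. open U \<and> U \<subseteq> S \<and> flat_frame A V U (\<lambda>x. x) \<phi>) \<and>
     (\<Union>(U, \<phi>) \<in> frames V. U) = S"

text \<open>
  Holomorphic subbundles of a trivial bundle: the first argument is the notion of holomorphy for
  vector-valued functions on open subsets of the base. The \<open>d\<close> sections \<open>b i\<close> form a basis since they
  span a space of dimension \<open>d\<close>.
\<close>

definition holo_subbundle ::
  "(('a::topological_space \<Rightarrow> complex^'n) \<Rightarrow> 'a set \<Rightarrow> bool) \<Rightarrow> 'a set \<Rightarrow>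
   ('a \<Rightarrow> (complex^'n) set) \<Rightarrow> bool" where
  "holo_subbundle hol X E \<longleftrightarrow>
     (\<forall>x\<in>X. \<exists>N (d::nat) b. open N \<and> x \<in> N \<and> N \<subseteq> X \<and> (\<forall>i<d. hol (b i) N) \<and>
        (\<forall>y\<in>N. vec.dim (E y) = d \<and> E y = vec.span ((\<lambda>i. b i y) ` {..<d})))"

definition disk_holo_on :: "(complex \<Rightarrow> complex^'n) \<Rightarrow> complex set \<Rightarrow> bool" where
  "disk_holo_on f X \<longleftrightarrow> (\<forall>i. (\<lambda>t. f t $ i) holomorphic_on X)"

definition griffiths_transversal ::
  "('m::t2_space, 'r::finite) chart set \<Rightarrow> ('m, 'n::finite) variation \<Rightarrow> bool" where
  "griffiths_transversal atlas V \<longleftrightarrow>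
     (\<forall>(U, \<phi>) \<in> frames V. \<forall>p N b.
        open N \<and> N \<subseteq> U \<and> mfd_holo_on atlas b N \<and> (\<forall>y\<in>N. b y \<in> (*v) (\<phi> y) ` hodge V y p) \<longrightarrow>
        (\<forall>(U', \<psi>) \<in> atlas. \<forall>y \<in> N \<inter> U'. \<forall>L :: complex^'r^'n.
           ((\<lambda>s. b (inv_into U' \<psi> s)) has_derivative (\<lambda>h. L *v h)) (at (\<psi> y)) \<longrightarrow>
           (\<forall>h. L *v h \<in> (*v) (\<phi> y) ` hodge V y (p - 1))))"

definition bform :: "complex^'n^'n \<Rightarrow> complex^'n \<Rightarrow> complex^'n \<Rightarrow> complex" where
  "bform Q u v = (\<Sum>i\<in>UNIV. \<Sum>j\<in>UNIV. u $ i * Q $ i $ j * v $ j)"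

definition graded_polarization ::
  "real set \<Rightarrow> (int \<Rightarrow> (complex^'n) set) \<Rightarrow> (int \<Rightarrow> (complex^'n) set) \<Rightarrow>
   (int \<Rightarrow> complex^'n^'n) \<Rightarrow> bool" where
  "graded_polarization A F W Q \<longleftrightarrow>
     (\<forall>k.
       (\<forall>u \<in> W k \<inter> A_points A. \<forall>v \<in> W k \<inter> A_points A.
          bform (Q k) u v \<in> complex_of_real ` frac_field A) \<and>
       (\<forall>u \<in> W k. \<forall>v \<in> W k. bform (Q k) v u = (- 1) powi k * bform (Q k) u v) \<and>
       (\<forall>u \<in> W (k - 1). \<forall>v \<in> W k. bform (Q k) u v = 0) \<and>
       (\<forall>p. \<forall>u \<in> F_gr F W p k. \<forall>v \<in> F_gr F W (k + 1 - p) k. bform (Q k) u v = 0) \<and>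
       (\<forall>p q. p + q = k \<longrightarrow>
          (\<forall>u \<in> hodge_comp F W p q - W (k - 1).
             \<exists>x>0. \<i> powi (p - q) * bform (Q k) u (conj_vec u) = complex_of_real x)))"

definition gp_vmhs ::
  "real set \<Rightarrow> ('m::t2_space, 'r::finite) chart set \<Rightarrow> 'm set \<Rightarrow> ('m, 'n::finite) variation \<Rightarrow> bool" where
  "gp_vmhs A atlas S V \<longleftrightarrow>
     local_system A S V \<and>
     (\<forall>x\<in>S. is_mhs A (hodge V x) (weight V x)) \<and>
     (\<forall>x\<in>S. graded_polarization A (hodge V x) (weight V x) (polar V x)) \<and>
     (\<forall>(U, \<phi>) \<in> frames V. \<forall>k.
        locally_constant_on U (\<lambda>x. (*v) (\<phi> x) ` weight V x k) \<and>
        locally_constant_on U (\<lambda>x. {(\<phi> x *v u, \<phi> x *v v, bform (polar V x k) u v) | u v.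
                                     u \<in> weight V x k \<and> v \<in> weight V x k})) \<and>
     (\<forall>(U, \<phi>) \<in> frames V. \<forall>p.
        holo_subbundle (mfd_holo_on atlas) U (\<lambda>x. (*v) (\<phi> x) ` hodge V x p)) \<and>
     griffiths_transversal atlas V"

text \<open>The section of \<open>Gr\<^sub>k\<close> represented by \<open>u\<close> is flat.\<close>

definition flat_gr_section ::
  "('m::t2_space, 'n::finite) variation \<Rightarrow> ('m \<Rightarrow> int) \<Rightarrow> ('m \<Rightarrow> complex^'n) \<Rightarrow> bool" where
  "flat_gr_section V k u \<longleftrightarrow>
     (\<forall>(U, \<phi>) \<in> frames V.
        locally_constant_on U (\<lambda>x. (\<lambda>v. \<phi> x *v (u x + v)) ` weight V x (k x - 1)))"

definition oriented_variation ::
  "real set \<Rightarrow> 'm::t2_space set \<Rightarrow> ('m, 'n::finite) variation \<Rightarrow>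
   ('m \<Rightarrow> complex^'n) \<Rightarrow> ('m \<Rightarrow> complex^'n) \<Rightarrow> bool" where
  "oriented_variation A S V one one_dual \<longleftrightarrow>
     (\<forall>x\<in>S. oriented_mhs A (hodge V x) (weight V x) (one x) (one_dual x)) \<and>
     flat_gr_section V (\<lambda>x. wt_max (weight V x)) one \<and>
     flat_gr_section V (\<lambda>x. wt_min (weight V x)) one_dual"


section \<open>Degenerations\<close>

text \<open>
  The universal cover of the complement of \<open>\<Prod>j\<in>K. s\<^sub>j = 0\<close> in the polydisk, with the coordinates
  of index in \<open>K\<close> in the upper half-plane. For a flat frame \<open>\<Phi>\<close> of the local system on the cover, the
  lift of the period map is \<open>F(z) = \<Phi>(z) F\<close>, and \<open>\<Phi>(z + e\<^sub>j) = T\<^sub>j \<Phi>(z)\<close> where \<open>T\<^sub>j\<close> is the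
  monodromy, so that \<open>F(z + e\<^sub>j) = T\<^sub>j F(z)\<close>.
\<close>

definition cover_dom :: "'r set \<Rightarrow> (complex^'r) set" where
  "cover_dom K = {z. \<forall>j. if j \<in> K then 0 < Im (z $ j) else cmod (z $ j) < 1}"

definition cover_map :: "'r set \<Rightarrow> complex^'r \<Rightarrow> complex^'r" where
  "cover_map K z = (\<chi> j. if j \<in> K then exp (2 * of_real pi * \<i> * z $ j) else z $ j)"

definition cover_pt :: "'m set \<Rightarrow> ('m \<Rightarrow> complex^'r) \<Rightarrow> 'r set \<Rightarrow> complex^'r \<Rightarrow> 'm" where
  "cover_pt P \<psi> K z = inv_into P \<psi> (cover_map K z)"

definition unipotent_local_monodromy ::
  "real set \<Rightarrow> ('m::t2_space, 'r::finite) chart set \<Rightarrow> 'm set \<Rightarrow> ('m, 'n::finite) variation \<Rightarrow> bool" where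
  "unipotent_local_monodromy A atlas D V \<longleftrightarrow>
     (\<forall>p\<in>D. \<forall>P \<psi> K \<Phi>.
        adapted_coords atlas D p P \<psi> K \<and> flat_frame A V (cover_dom K) (cover_pt P \<psi> K) \<Phi> \<longrightarrow>
        (\<forall>j\<in>K. \<exists>T. unipotent_mat T \<and> (\<forall>z \<in> cover_dom K. \<Phi> (z + axis j 1) = T ** \<Phi> z)))"

text \<open>
  \<open>M\<close> is the filtration \<open>M(N, W)\<close>: the subspaces below are \<open>M\<^sub>m \<inter> W\<^sub>k\<close> and the kernel
  \<open>M\<^sub>m\<^sub>-\<^sub>1 \<inter> W\<^sub>k + M\<^sub>m \<inter> W\<^sub>k\<^sub>-\<^sub>1\<close> of its projection to \<open>Gr\<^sup>M\<^sub>m Gr\<^sup>W\<^sub>k\<close>, and the last two conditions say that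
  \<open>N\<^sup>j\<close> induces an isomorphism from \<open>Gr\<^sup>M\<^sub>k\<^sub>+\<^sub>j Gr\<^sup>W\<^sub>k\<close> to \<open>Gr\<^sup>M\<^sub>k\<^sub>-\<^sub>j Gr\<^sup>W\<^sub>k\<close>.
\<close>

definition rel_weight_filtration ::
  "complex^'n^'n \<Rightarrow> (int \<Rightarrow> (complex^'n) set) \<Rightarrow> (int \<Rightarrow> (complex^'n) set) \<Rightarrow> bool" where
  "rel_weight_filtration N W M \<longleftrightarrow>
     increasing_filtration M \<and>
     (\<forall>k. (*v) N ` W k \<subseteq> W k) \<and> (\<forall>m. (*v) N ` M m \<subseteq> M (m - 2)) \<and>
     (let G = (\<lambda>m k. M m \<inter> W k);
          B = (\<lambda>m k. sum_sets (M (m - 1) \<inter> W k) (M m \<inter> W (k - 1)))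
      in \<forall>k. \<forall>j\<ge>1.
           (\<forall>v \<in> G (k + int j) k. mat_pow N j *v v \<in> B (k - int j) k \<longrightarrow> v \<in> B (k + int j) k) \<and>
           G (k - int j) k = sum_sets ((*v) (mat_pow N j) ` G (k + int j) k) (B (k - int j) k))"

text \<open>
  Admissibility is tested on the holomorphic maps \<open>f\<close> from the unit disk to the manifold which send the
  punctured disk to the complement of \<open>D\<close>. If the pullback of the variation has unipotent monodromy
  \<open>e\<^sup>N\<close>, then \<open>M(N, W)\<close> exists and the Hodge filtration extends to the canonical extension, where
  \<open>e\<^sup>-\<^sup>z\<^sup>N \<Phi>(z)\<close> is the trivialization, with \<open>Gr\<^sub>F Gr\<^sup>W\<close> locally free; equivalently, the \<open>F\<^sup>p \<inter> W\<^sub>k\<close> extend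
  to subbundles. If the monodromy is only quasi-unipotent then this is imposed after the
  base changes \<open>t \<mapsto> t\<^sup>m\<close>, which are included in the quantification over \<open>f\<close>.
\<close>

definition upper_half_plane :: "complex set" where
  "upper_half_plane = {z. 0 < Im z}"

definition test_disk ::
  "('m::t2_space, 'r::finite) chart set \<Rightarrow> 'm set \<Rightarrow> (complex \<Rightarrow> 'm) \<Rightarrow> bool" where
  "test_disk atlas D f \<longleftrightarrow>
     continuous_on (ball 0 1) f \<and>
     (\<forall>(U, \<psi>) \<in> atlas. disk_holo_on (\<lambda>t. \<psi> (f t)) {t \<in> ball 0 1. f t \<in> U}) \<and>
     (\<forall>t \<in> ball 0 1 - {0}. f t \<notin> D)"

definition disk_pt :: "(complex \<Rightarrow> 'm) \<Rightarrow> complex \<Rightarrow> 'm" where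
  "disk_pt f z = f (exp (2 * of_real pi * \<i> * z))"

definition disk_admissible ::
  "('m, 'n::finite) variation \<Rightarrow> (complex \<Rightarrow> 'm) \<Rightarrow> (complex \<Rightarrow> complex^'n^'n) \<Rightarrow> complex^'n^'n \<Rightarrow> bool"
  where
  "disk_admissible V f \<Phi> N \<longleftrightarrow>
     (\<forall>z0 \<in> upper_half_plane.
        let W = (\<lambda>k. (*v) (\<Phi> z0) ` weight V (disk_pt f z0) k) in
        (\<exists>M. rel_weight_filtration N W M) \<and>
        (\<exists>Ft. (\<forall>z \<in> upper_half_plane. \<forall>p.
                 Ft (exp (2 * of_real pi * \<i> * z)) p =
                   (*v) (mat_exp (scale_mat (- z) N) ** \<Phi> z) ` hodge V (disk_pt f z) p) \<and>
              (\<forall>p. holo_subbundle disk_holo_on (ball 0 1) (\<lambda>t. Ft t p)) \<and>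
              (\<forall>p k. holo_subbundle disk_holo_on (ball 0 1) (\<lambda>t. Ft t p \<inter> W k))))"

definition admissible ::
  "real set \<Rightarrow> ('m::t2_space, 'r::finite) chart set \<Rightarrow> 'm set \<Rightarrow> ('m, 'n::finite) variation \<Rightarrow> bool" where
  "admissible A atlas D V \<longleftrightarrow>
     (\<forall>f \<Phi>. test_disk atlas D f \<and> flat_frame A V upper_half_plane (disk_pt f) \<Phi> \<longrightarrow>
        (\<exists>m::nat. m > 0 \<and> (\<exists>T. unipotent_mat T \<and>
           (\<forall>z \<in> upper_half_plane. \<Phi> (z + of_nat m) = T ** \<Phi> z))) \<and>
        (\<forall>N. nilpotent_mat N \<and> (\<forall>z \<in> upper_half_plane. \<Phi> (z + 1) = mat_exp N ** \<Phi> z) \<longrightarrow>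
           disk_admissible V f \<Phi> N))"

text \<open>
  \<open>(F, M)\<close> is the limit mixed Hodge structure in the coordinates \<open>\<psi>\<close> on \<open>P\<close>, on the reference fibre
  defined by the flat frame \<open>\<Phi>\<close> on the cover; \<open>Ft\<close> is the extension of \<open>e\<^sup>-\<^sup>\<Sigma>\<^sup>z\<^sup>N F(z)\<close> to the polydisk.
\<close>

definition limit_mhs ::
  "('m, 'n::finite) variation \<Rightarrow> 'm set \<Rightarrow> ('m \<Rightarrow> complex^'r) \<Rightarrow> 'r set \<Rightarrow>
   (complex^'r \<Rightarrow> complex^'n^'n) \<Rightarrow> ('r \<Rightarrow> real) \<Rightarrow>
   (int \<Rightarrow> (complex^'n) set) \<Rightarrow> (int \<Rightarrow> (complex^'n) set) \<Rightarrow> bool" where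
  "limit_mhs V P \<psi> K \<Phi> a F M \<longleftrightarrow>
     (\<exists>N Ft.
        (\<forall>j\<in>K. nilpotent_mat (N j) \<and>
           (\<forall>z \<in> cover_dom K. \<Phi> (z + axis j 1) = mat_exp (N j) ** \<Phi> z)) \<and>
        (\<forall>z \<in> cover_dom K. \<forall>p.
           Ft (cover_map K z) p =
             (*v) (mat_exp (- (\<Sum>j\<in>K. scale_mat (z $ j) (N j))) ** \<Phi> z) `
               hodge V (cover_pt P \<psi> K z) p) \<and>
        (\<forall>p. holo_subbundle holo_on polydisk (\<lambda>s. Ft s p)) \<and>
        (\<forall>p. F p = Ft 0 p) \<and>
        (\<forall>z \<in> cover_dom K.
           rel_weight_filtration (\<Sum>j\<in>K. scale_mat (complex_of_real (a j)) (N j))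
             (\<lambda>k. (*v) (\<Phi> z) ` weight V (cover_pt P \<psi> K z) k) M))"

end

theory Submission
  imports Defs "HOL-Complex_Analysis.Complex_Analysis"
begin

text \<open>
  A Hodge--Tate structure is the same as a filtration \<open>F\<close> such that \<open>F\<^sup>p\<close> is complementary to
  \<open>W\<^sub>2\<^sub>p\<^sub>-\<^sub>2\<close> for every \<open>p\<close> (\<open>mhs_ht_pair\<close>, \<open>ht_pair_mhs\<close>). It is therefore described by the projections
  \<open>P b\<close> onto \<open>W\<^sub>2\<^sub>b\<close> with kernel \<open>F\<^sup>b\<^sup>+\<^sup>1\<close>. The Deligne bigrading is concentrated on the diagonal, its
  summands are the images of the \<open>P b - P (b - 1)\<close>, and \<open>exp (-2\<i>\<delta>)\<close> is the operator, inducing the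
  identity on \<open>Gr\<^sup>W\<close>, which carries this grading to its complex conjugate. So the height is a polynomial
  in the entries of the \<open>P b\<close> and of their conjugates (\<open>height_eq\<close>). Convergence of heights becomes a
  question about the behaviour of these projections.

  On a graded piece of type \<open>(p, p)\<close> a polarization is a definite form. Unipotent monodromy preserving
  it is trivial there (\<open>unipotent_definite\<close>). Hence all the \<open>N\<^sub>j\<close> lower the weight filtration, the relative
  weight filtration exists and is \<open>W\<close> itself (\<open>rel_weight_filtration_self\<close>,
  \<open>rel_weight_filtration_unique\<close>). Let \<open>q\<close> be the projections of the untwisted filtration
  \<open>exp (- \<Sum> z\<^sub>j N\<^sub>j) F(z)\<close>, a function on the complement of the divisor in the polydisk. On a disk which
  meets one branch of the divisor, admissibility extends the filtration to the centre, together with its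
  intersections with \<open>W\<close>; since these have constant rank the extended filtration is still complementary
  to \<open>W\<close>, and \<open>q\<close> stays bounded (\<open>q_bounded\<close>). By the theorem on removable singularities, applied in one
  variable at a time, \<open>q\<close> extends to a holomorphic function \<open>qe\<close> on the whole polydisk
  (\<open>extension_across_hyperplanes\<close>). The projection conditions are identities between matrices, so they
  persist, and the limit filtration with \<open>W\<close> is Hodge--Tate.

  The height of the fibre at \<open>s\<close> is the height of \<open>exp (\<Sum> z\<^sub>j N\<^sub>j) F(s)\<close>, with \<open>F(s)\<close> the extended
  filtration and \<open>s\<^sub>j = exp (2\<pi>\<i> z\<^sub>j)\<close>. This is a polynomial in the \<open>z\<^sub>j\<close> and their conjugates, whose
  coefficients are Lipschitz functions of \<open>s\<close>, and the task is to control the logarithms \<open>z\<^sub>j\<close>. By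
  Griffiths transversality, \<open>N\<^sub>j\<close> maps \<open>F\<^sup>p(s)\<close> to \<open>F\<^sup>p\<^sup>-\<^sup>1(s)\<close> at the points where \<open>s\<^sub>j = 0\<close>
  (\<open>transversality\<close>), so there it shifts the Deligne grading by one step, and twisting by
  \<open>exp (u N\<^sub>j)\<close> changes \<open>\<delta>\<close> by a multiple of \<open>N\<^sub>j\<close>, up to conjugation. The height is the component of
  \<open>\<delta>\<close> which goes down by half the length, that is by at least two steps; it does not see this change
  (\<open>height_vec_nilpotent_orbit\<close>). So where \<open>s\<^sub>j = 0\<close> the polynomial does not involve \<open>z\<^sub>j\<close>, and elsewhere its
  dependence on \<open>z\<^sub>j\<close> comes with a factor \<open>s\<^sub>j\<close>, which beats every power of \<open>log |s\<^sub>j|\<close>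
  (\<open>logarithmic_limit\<close>).
\<close>

section \<open>Matrices\<close>

no_notation fps_nth (infixl "$" 75)

lemma bounded_bilinear_matrix_mult:
  "bounded_bilinear ((**) :: complex^'n^'m \<Rightarrow> complex^'k^'n \<Rightarrow> complex^'k^'m)"
  unfolding bilinear_conv_bounded_bilinear [symmetric] bilinear_def
  by (auto intro!: linearI
      simp: matrix_add_ldistrib matrix_matrix_mult_def vec_eq_iff sum.distrib
        scaleR_sum_right distrib_right distrib_left)

lemma bounded_bilinear_matrix_vector_mult:
  "bounded_bilinear ((*v) :: complex^'n^'m \<Rightarrow> complex^'n \<Rightarrow> complex^'m)"
  unfolding bilinear_conv_bounded_bilinear [symmetric] bilinear_def
  by (auto intro!: linearI
      simp: matrix_vector_mult_def vec_eq_iff sum.distrib scaleR_sum_right distrib_right distrib_left)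

lemma bounded_bilinear_scale_mat:
  "bounded_bilinear (scale_mat :: complex \<Rightarrow> complex^'n^'n \<Rightarrow> complex^'n^'n)"
  unfolding bilinear_conv_bounded_bilinear [symmetric] bilinear_def
  by (auto intro!: linearI simp: scale_mat_def vec_eq_iff distrib_right distrib_left)

interpretation mm: bounded_bilinear "(**) :: complex^'n^'m \<Rightarrow> complex^'k^'n \<Rightarrow> complex^'k^'m"
  by (rule bounded_bilinear_matrix_mult)

interpretation mv: bounded_bilinear "(*v) :: complex^'n^'m \<Rightarrow> complex^'n \<Rightarrow> complex^'m"
  by (rule bounded_bilinear_matrix_vector_mult)

interpretation sm: bounded_bilinear "scale_mat :: complex \<Rightarrow> complex^'n^'n \<Rightarrow> complex^'n^'n"
  by (rule bounded_bilinear_scale_mat)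

lemmas mat_distribs = mm.add_left mm.add_right mm.diff_left mm.diff_right mm.minus_left mm.minus_right

lemma scale_mat_mult_left: "scale_mat c A ** B = scale_mat c (A ** B)"
  by (simp add: scale_mat_def matrix_matrix_mult_def vec_eq_iff sum_distrib_left mult.assoc)

lemma scale_mat_mult_right: "A ** scale_mat c B = scale_mat c (A ** B)"
  by (simp add: scale_mat_def matrix_matrix_mult_def vec_eq_iff sum_distrib_left mult_ac)

lemma scale_mat_vec: "scale_mat c A *v v = c *s (A *v v)"
  by (simp add: scale_mat_def matrix_vector_mult_def vec_eq_iff sum_distrib_left mult_ac)

lemma scale_mat_scale: "scale_mat c (scale_mat d A) = scale_mat (c * d) A"
  by (simp add: scale_mat_def vec_eq_iff)

lemma scale_mat_1 [simp]: "scale_mat 1 A = A"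
  by (simp add: scale_mat_def vec_eq_iff)

lemma scale_mat_of_real: "scale_mat (complex_of_real r) A = r *\<^sub>R A"
  by (simp add: scale_mat_def vec_eq_iff scaleR_conv_of_real [where 'a = complex])

lemma matrix_mult_scale_vec: "A *v (c *s v) = c *s (A *v (v :: complex^'n))"
  by (simp add: matrix_vector_mult_def vec_eq_iff sum_distrib_left mult_ac)

lemma conj_vec_conj_vec [simp]: "conj_vec (conj_vec v) = v"
  by (simp add: conj_vec_def vec_eq_iff)

lemma conj_mat_conj_mat [simp]: "conj_mat (conj_mat X) = X"
  by (simp add: conj_mat_def vec_eq_iff)

lemma bounded_linear_conj_mat: "bounded_linear (conj_mat :: complex^'n^'n \<Rightarrow> _)"
  unfolding linear_conv_bounded_linear [symmetric]
  by (auto intro!: linearI simp: conj_mat_def vec_eq_iff)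

lemma bounded_linear_conj_vec: "bounded_linear (conj_vec :: complex^'n \<Rightarrow> _)"
  unfolding linear_conv_bounded_linear [symmetric]
  by (auto intro!: linearI simp: conj_vec_def vec_eq_iff)

lemmas linear_conj_mat = bounded_linear.linear [OF bounded_linear_conj_mat]
lemmas linear_conj_vec = bounded_linear.linear [OF bounded_linear_conj_vec]

lemmas conj_mat_diff = linear_diff [OF linear_conj_mat]
  and conj_mat_0 = linear_0 [OF linear_conj_mat]
  and conj_mat_minus = linear_neg [OF linear_conj_mat]
  and conj_mat_sum = linear_sum [OF linear_conj_mat]
  and conj_mat_scaleR = linear_cmul [OF linear_conj_mat]

lemmas conj_vec_add = linear_add [OF linear_conj_vec]
  and conj_vec_0 = linear_0 [OF linear_conj_vec]

lemma conj_mat_mult: "conj_mat (A ** B) = conj_mat A ** conj_mat B"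
  by (simp add: conj_mat_def matrix_matrix_mult_def vec_eq_iff)

lemma conj_mat_vec: "conj_vec (A *v v) = conj_mat A *v conj_vec v"
  by (simp add: conj_mat_def conj_vec_def matrix_vector_mult_def vec_eq_iff)

lemma conj_mat_scale: "conj_mat (scale_mat c A) = scale_mat (cnj c) (conj_mat A)"
  by (simp add: conj_mat_def scale_mat_def vec_eq_iff)

lemma conj_mat_one [simp]: "conj_mat (mat 1) = mat 1"
  by (simp add: conj_mat_def mat_def vec_eq_iff)

lemma conj_vec_scale: "conj_vec (c *s v) = cnj c *s conj_vec v"
  by (simp add: conj_vec_def vec_eq_iff)


section \<open>Exponentials and logarithms of nilpotent matrices\<close>

lemma mat_pow_0 [simp]: "mat_pow X 0 = mat 1"
  by (simp add: mat_pow_def)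

lemma mat_pow_Suc: "mat_pow X (Suc k) = X ** mat_pow X k"
  by (simp add: mat_pow_def)

lemma mat_pow_1 [simp]: "mat_pow X (Suc 0) = X"
  by (simp add: mat_pow_Suc)

lemma mat_pow_add: "mat_pow X (k + l) = mat_pow X k ** mat_pow X l"
  by (induction k) (simp_all add: mat_pow_Suc matrix_mul_assoc)

lemma mat_pow_eq_0: "mat_pow X m = 0 \<Longrightarrow> m \<le> k \<Longrightarrow> mat_pow X k = 0"
  using mat_pow_add [of X m "k - m"] by (simp add: mm.zero_left)

lemma mat_pow_scale: "mat_pow (scale_mat c X) k = scale_mat (c ^ k) (mat_pow X k)"
  by (induction k) (simp_all add: mat_pow_Suc scale_mat_mult_left scale_mat_mult_right
      scale_mat_scale mult.commute)

lemma mat_pow_uminus: "mat_pow (- X) k = (- 1) ^ k *\<^sub>R mat_pow X k"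
  by (induction k) (simp_all add: mat_pow_Suc mm.minus_left mm.scaleR_right)

lemma conj_mat_pow: "conj_mat (mat_pow X k) = mat_pow (conj_mat X) k"
  by (induction k) (simp_all add: mat_pow_Suc conj_mat_mult)

lemma mat_pow_commute:
  assumes "A ** B = B ** A" shows "mat_pow A k ** B = B ** mat_pow A k"
  by (induction k) (simp_all add: mat_pow_Suc, metis assms matrix_mul_assoc)

lemma mat_pow_intertwine:
  assumes "g ** A = B ** g" shows "g ** mat_pow A k = mat_pow B k ** g"
  by (induction k) (simp_all add: mat_pow_Suc, metis assms matrix_mul_assoc)

lemma mat_exp_nilpotent:
  assumes "mat_pow X m = 0"
  shows "mat_exp X = (\<Sum>k<m. (1 / fact k) *\<^sub>R mat_pow X k)"
  unfolding mat_exp_def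
  by (rule suminf_finite) (use mat_pow_eq_0 [OF assms] in \<open>auto simp: not_less\<close>)

lemma mat_exp_0 [simp]: "mat_exp 0 = mat 1"
  using mat_exp_nilpotent [of 0 1] by (simp add: mat_pow_Suc mm.zero_left)

lemma mat_exp_intertwine:
  assumes "g ** A = B ** g" "mat_pow A m = 0" "mat_pow B m = 0"
  shows "g ** mat_exp A = mat_exp B ** g"
  using mat_exp_nilpotent [OF assms(2)] mat_exp_nilpotent [OF assms(3)]
  by (simp add: mm.sum_left mm.sum_right mm.scaleR_left mm.scaleR_right
      mat_pow_intertwine [OF assms(1)])

lemma conj_mat_exp:
  assumes "mat_pow X m = 0"
  shows "conj_mat (mat_exp X) = mat_exp (conj_mat X)"
proof -
  have "mat_pow (conj_mat X) m = 0"
    using assms by (simp flip: conj_mat_pow add: conj_mat_0)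
  then show ?thesis
    by (simp add: mat_exp_nilpotent [OF assms] mat_exp_nilpotent conj_mat_sum conj_mat_scaleR conj_mat_pow)
qed

lemma mat_pow_add_commuting:
  fixes A B :: "complex^'n^'n"
  defines "S \<equiv> \<lambda>X k. (1 / fact k) *\<^sub>R mat_pow X k"
  assumes comm: "A ** B = B ** A"
  shows "S (A + B) n = (\<Sum>i\<le>n. S A i ** S B (n - i))"
proof (induction n)
  case 0
  then show ?case by (simp add: S_def)
next
  case (Suc n)
  have S_Suc: "real (Suc k) *\<^sub>R S X (Suc k) = X ** S X k" for X :: "complex^'n^'n" and k
    by (simp add: S_def mat_pow_Suc mm.scaleR_right del: of_nat_Suc)
  have comB: "B ** S A k = S A k ** B" for k
    using mat_pow_commute [OF comm, of k] by (simp add: S_def mm.scaleR_right mm.scaleR_left)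
  have "real (Suc n) *\<^sub>R S (A + B) (Suc n) = (A + B) ** (\<Sum>i\<le>n. S A i ** S B (n - i))"
    by (simp only: S_Suc Suc)
  also have "\<dots> = (\<Sum>i\<le>n. (A ** S A i) ** S B (n - i)) + (\<Sum>i\<le>n. S A i ** (B ** S B (n - i)))"
    by (simp add: mm.add_left mm.sum_right matrix_mul_assoc comB sum.distrib)
  also have "\<dots> = (\<Sum>i\<le>n. real (Suc i) *\<^sub>R (S A (Suc i) ** S B (n - i)))
      + (\<Sum>i\<le>n. real (Suc n - i) *\<^sub>R (S A i ** S B (Suc n - i)))"
    by (simp flip: S_Suc add: mm.scaleR_left mm.scaleR_right Suc_diff_le)
  also have "(\<Sum>i\<le>n. real (Suc i) *\<^sub>R (S A (Suc i) ** S B (n - i)))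
      = (\<Sum>i\<le>Suc n. real i *\<^sub>R (S A i ** S B (Suc n - i)))"
    by (simp del: sum.atMost_Suc add: sum.atMost_Suc_shift)
  also have "(\<Sum>i\<le>n. real (Suc n - i) *\<^sub>R (S A i ** S B (Suc n - i)))
      = (\<Sum>i\<le>Suc n. real (Suc n - i) *\<^sub>R (S A i ** S B (Suc n - i)))"
    by simp
  also have "(\<Sum>i\<le>Suc n. real i *\<^sub>R (S A i ** S B (Suc n - i)))
      + (\<Sum>i\<le>Suc n. real (Suc n - i) *\<^sub>R (S A i ** S B (Suc n - i)))
      = real (Suc n) *\<^sub>R (\<Sum>i\<le>Suc n. S A i ** S B (Suc n - i))"
    by (simp del: sum.atMost_Suc flip: sum.distrib scaleR_add_left of_nat_add
        add: scaleR_sum_right)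
  finally show ?case
    by (simp del: sum.atMost_Suc of_nat_Suc)
qed

lemma nilpotent_add_commuting:
  assumes comm: "A ** B = B ** A" and "mat_pow A m = 0" "mat_pow B m = 0"
  shows "mat_pow (A + B) (m + m) = 0"
proof -
  have "mat_pow A i ** mat_pow B (m + m - i) = 0" for i
    using mat_pow_eq_0 [OF assms(2), of i] mat_pow_eq_0 [OF assms(3), of "m + m - i"]
    by (cases "m \<le> i") (auto simp: mm.zero_left mm.zero_right)
  then have "(1 / fact (m + m)) *\<^sub>R mat_pow (A + B) (m + m) = 0"
    unfolding mat_pow_add_commuting [OF comm] by (simp add: mm.scaleR_left mm.scaleR_right)
  then show ?thesis by simp
qed

lemma mat_exp_add:
  fixes A B :: "complex^'n^'n"
  assumes comm: "A ** B = B ** A" and A: "mat_pow A m = 0" and B: "mat_pow B m = 0"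
  shows "mat_exp (A + B) = mat_exp A ** mat_exp B"
proof -
  define S where "S \<equiv> \<lambda>(X :: complex^'n^'n) k. (1 / fact k) *\<^sub>R mat_pow X k"
  have *: "S X k = 0" if "mat_pow X m = 0" "m \<le> k" for X k
    using mat_pow_eq_0 [OF that] by (simp add: S_def)
  have "mat_exp (A + B) = (\<Sum>n<m + m. \<Sum>i\<le>n. S A i ** S B (n - i))"
    using nilpotent_add_commuting [OF assms] mat_pow_add_commuting [OF comm]
    by (simp add: mat_exp_nilpotent S_def)
  also have "\<dots> = (\<Sum>(i, j)\<in>{(i, j). i + j < m + m}. S A i ** S B j)"
    by (rule sum.triangle_reindex [symmetric])
  also have "\<dots> = (\<Sum>(i, j)\<in>{..<m} \<times> {..<m}. S A i ** S B j)"
  proof (rule sum.mono_neutral_right)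
    show "finite {(i, j). i + j < m + m}"
      by (rule finite_subset [of _ "{..<m+m} \<times> {..<m+m}"]) auto
    have "S A i ** S B j = 0" if "\<not> (i < m \<and> j < m)" for i j
      using that * [OF A, of i] * [OF B, of j] by (auto simp: mm.zero_left mm.zero_right not_less)
    then show "\<forall>x\<in>{(i, j). i + j < m + m} - {..<m} \<times> {..<m}. (case x of (i, j) \<Rightarrow> S A i ** S B j) = 0"
      by auto
  qed auto
  also have "\<dots> = mat_exp A ** mat_exp B"
    by (simp add: mat_exp_nilpotent [OF A] mat_exp_nilpotent [OF B] S_def mm.sum_left mm.sum_right
        sum.cartesian_product [symmetric] del: mm.scaleR_left mm.scaleR_right)
      (rule sum.swap)
  finally show ?thesis .
qed

lemma mat_exp_minus:
  assumes "mat_pow A m = 0"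
  shows "mat_exp A ** mat_exp (- A) = mat 1" "mat_exp (- A) ** mat_exp A = mat 1"
proof -
  have B: "mat_pow (- A) m = 0"
    using assms by (simp add: mat_pow_uminus)
  show "mat_exp A ** mat_exp (- A) = mat 1" "mat_exp (- A) ** mat_exp A = mat 1"
    using mat_exp_add [OF _ assms B] mat_exp_add [OF _ B assms]
    by (simp_all add: mm.minus_left mm.minus_right)
qed

lemma mat_1_neq_0: "(mat 1 :: complex^'n^'n) \<noteq> 0"
  by (auto simp: mat_def vec_eq_iff)

text \<open>A nilpotent matrix can be substituted into a formal power series, compatibly with products and
  composition. The logarithm and the exponential of matrices are then inverse to each other because
  the series are.\<close>

definition fps_eval :: "nat \<Rightarrow> complex^'n^'n \<Rightarrow> real fps \<Rightarrow> complex^'n^'n" where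
  "fps_eval m X f = (\<Sum>k<m. fps_nth f k *\<^sub>R mat_pow X k)"

lemma fps_eval_1: "0 < m \<Longrightarrow> fps_eval m X 1 = mat 1"
  by (simp add: fps_eval_def if_distrib [of "\<lambda>x. x *\<^sub>R _"] cong: if_cong)

lemma fps_eval_X: "mat_pow X m = 0 \<Longrightarrow> fps_eval m X fps_X = X"
  using mat_pow_eq_0 [of X m 1]
  by (cases "1 < m")
    (auto simp: fps_eval_def fps_X_def if_distrib [of "\<lambda>x. x *\<^sub>R _"] cong: if_cong)

lemma fps_eval_mult:
  assumes "mat_pow X m = 0"
  shows "fps_eval m X (f * g) = fps_eval m X f ** fps_eval m X g"
proof -
  have "fps_eval m X (f * g)
      = (\<Sum>n<m. \<Sum>i\<le>n. (fps_nth f i *\<^sub>R mat_pow X i) ** (fps_nth g (n - i) *\<^sub>R mat_pow X (n - i)))"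
    by (simp add: fps_eval_def fps_mult_nth mm.scaleR_left mm.scaleR_right atLeast0AtMost
        scaleR_sum_left mult.commute flip: mat_pow_add)
  also have "\<dots> = (\<Sum>(i, j)\<in>{(i, j). i + j < m}.
      (fps_nth f i *\<^sub>R mat_pow X i) ** (fps_nth g j *\<^sub>R mat_pow X j))"
    by (rule sum.triangle_reindex [symmetric])
  also have "\<dots> = (\<Sum>(i, j)\<in>{..<m} \<times> {..<m}.
      (fps_nth f i *\<^sub>R mat_pow X i) ** (fps_nth g j *\<^sub>R mat_pow X j))"
  proof (rule sum.mono_neutral_left)
    have "(fps_nth f i *\<^sub>R mat_pow X i) ** (fps_nth g j *\<^sub>R mat_pow X j) = 0" if "\<not> i + j < m" for i j
      using that mat_pow_eq_0 [OF assms, of "i + j"]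
      by (simp add: mm.scaleR_left mm.scaleR_right mat_pow_add)
    then show "\<forall>x\<in>{..<m} \<times> {..<m} - {(i, j). i + j < m}. (case x of (i, j) \<Rightarrow>
        (fps_nth f i *\<^sub>R mat_pow X i) ** (fps_nth g j *\<^sub>R mat_pow X j)) = 0"
      by auto
  qed auto
  also have "\<dots> = fps_eval m X f ** fps_eval m X g"
    by (simp add: fps_eval_def mm.sum_left mm.sum_right sum.cartesian_product [symmetric])
      (rule sum.swap)
  finally show ?thesis .
qed

lemma fps_eval_power:
  assumes "mat_pow X m = 0" "0 < m"
  shows "fps_eval m X (f ^ k) = mat_pow (fps_eval m X f) k"
  by (induction k) (simp_all add: fps_eval_1 assms fps_eval_mult mat_pow_Suc)

lemma fps_eval_compose:
  assumes X: "mat_pow X m = 0" "0 < m" and g: "fps_nth g 0 = 0"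
  shows "fps_eval m X (f oo g) = fps_eval m (fps_eval m X g) f"
proof -
  have "fps_eval m X (f oo g) = (\<Sum>n<m. \<Sum>i<m. (fps_nth f i * fps_nth (g ^ i) n) *\<^sub>R mat_pow X n)"
    unfolding fps_eval_def fps_compose_nth scaleR_sum_left
    by (intro sum.cong [OF refl] sum.mono_neutral_left)
      (auto simp: startsby_zero_power_prefix [OF g])
  also have "\<dots> = (\<Sum>i<m. fps_nth f i *\<^sub>R fps_eval m X (g ^ i))"
    by (subst sum.swap) (simp add: fps_eval_def scaleR_sum_right)
  also have "\<dots> = fps_eval m (fps_eval m X g) f"
    unfolding fps_eval_power [OF X] by (simp only: fps_eval_def [of m "fps_eval m X g"])
  finally show ?thesis .
qed

lemma fps_eval_nilpotent:
  assumes X: "mat_pow X m = 0" "0 < m" and g: "fps_nth g 0 = 0"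
  shows "mat_pow (fps_eval m X g) m = 0"
  unfolding fps_eval_power [OF X, symmetric]
  by (simp add: fps_eval_def startsby_zero_power_prefix [OF g])

text \<open>The term of index 0 vanishes because it is a division by zero. The truncation is exact if the
  \<open>m\<close>-th power of \<open>T - 1\<close> is zero.\<close>

definition mat_log :: "nat \<Rightarrow> complex^'n^'n \<Rightarrow> complex^'n^'n" where
  "mat_log m T = (\<Sum>k<m. ((- 1) ^ (k - 1) / real k) *\<^sub>R mat_pow (T - mat 1) k)"

lemma mat_log_fps: "mat_log m (mat 1 + X) = fps_eval m X (fps_ln 1)"
  by (auto simp: mat_log_def fps_eval_def fps_ln_nth intro!: sum.cong)

lemma mat_exp_fps: "mat_pow X m = 0 \<Longrightarrow> mat_exp X = fps_eval m X (fps_exp 1)"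
  by (simp add: mat_exp_nilpotent fps_eval_def)

lemma fps_eval_diff: "fps_eval m X (f - g) = fps_eval m X f - fps_eval m X g"
  by (simp add: fps_eval_def algebra_simps sum_subtractf)

lemma mat_log_nilpotent:
  assumes "mat_pow (T - mat 1) m = 0"
  shows "mat_pow (mat_log m T) m = 0"
proof -
  have "0 < m"
    using assms by (intro gr0I) (auto simp: mat_1_neq_0)
  then show ?thesis
    using fps_eval_nilpotent [OF assms, of "fps_ln 1"] mat_log_fps [of m "T - mat 1"] by simp
qed

lemma mat_exp_log:
  assumes "mat_pow (T - mat 1) m = 0"
  shows "mat_exp (mat_log m T) = T"
proof -
  have m: "0 < m"
    using assms by (intro gr0I) (auto simp: mat_1_neq_0)
  define L :: "real fps" where "L = fps_ln 1"
  have L0: "fps_nth L 0 = 0"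
    by (simp add: L_def)
  have log: "mat_log m T = fps_eval m (T - mat 1) L"
    using mat_log_fps [of m "T - mat 1"] by (simp add: L_def)
  have "(fps_exp 1 - 1) oo L = fps_X"
    using fps_inv_fps_exp_compose(2) [of "1 :: real"] fps_ln_fps_exp_inv [of "1 :: real"]
    by (simp add: L_def)
  then have "fps_eval m (mat_log m T) (fps_exp 1 - 1) = T - mat 1"
    unfolding log fps_eval_compose [OF assms m L0, symmetric] by (simp add: fps_eval_X assms)
  then show ?thesis
    using mat_exp_fps [OF mat_log_nilpotent [OF assms]] by (simp add: fps_eval_diff fps_eval_1 m)
qed

lemma mat_log_exp:
  assumes N: "mat_pow N m = 0"
  shows "mat_log m (mat_exp N) = N" "mat_pow (mat_exp N - mat 1) m = 0"
proof -
  have m: "0 < m"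
    using assms by (intro gr0I) (auto simp: mat_1_neq_0)
  define L :: "real fps" where "L = fps_exp 1 - 1"
  have L0: "fps_nth L 0 = 0"
    by (simp add: L_def)
  have X: "mat_exp N - mat 1 = fps_eval m N L"
    by (simp add: mat_exp_fps [OF N] fps_eval_1 m fps_eval_diff L_def)
  show "mat_pow (mat_exp N - mat 1) m = 0"
    unfolding X by (rule fps_eval_nilpotent [OF N m L0])
  have "fps_ln 1 oo L = fps_X"
    using fps_inv_fps_exp_compose(1) [of "1 :: real"] fps_ln_fps_exp_inv [of "1 :: real"]
    by (simp add: L_def)
  then have "fps_eval m (fps_eval m N L) (fps_ln 1) = N"
    unfolding fps_eval_compose [OF N m L0, symmetric] by (simp add: fps_eval_X N)
  then show "mat_log m (mat_exp N) = N"
    using mat_log_fps [of m "mat_exp N - mat 1"] unfolding X [symmetric] by simp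
qed

lemma mat_log_intertwine:
  assumes "g ** A = B ** g" shows "g ** mat_log m A = mat_log m B ** g"
proof -
  have "g ** (A - mat 1) = (B - mat 1) ** g"
    by (simp add: mat_distribs assms)
  then show ?thesis
    by (simp add: mat_log_def mm.sum_left mm.sum_right mm.scaleR_left mm.scaleR_right
        mat_pow_intertwine)
qed

lemma conj_mat_log: "conj_mat (mat_log m T) = mat_log m (conj_mat T)"
  by (simp add: mat_log_def conj_mat_sum conj_mat_scaleR conj_mat_pow conj_mat_diff)


section \<open>Operators lowering a filtration\<close>

lemma scaleR_vec_conv: "r *\<^sub>R (v :: complex^'n) = complex_of_real r *s v"
  by (simp add: vec_eq_iff scaleR_conv_of_real [where 'a = complex])

definition preserves :: "(int \<Rightarrow> (complex^'n) set) \<Rightarrow> complex^'n^'n \<Rightarrow> bool" where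
  "preserves W X \<longleftrightarrow> (\<forall>k. \<forall>v\<in>W k. X *v v \<in> W k)"

definition lowers :: "(int \<Rightarrow> (complex^'n) set) \<Rightarrow> complex^'n^'n \<Rightarrow> bool" where
  "lowers W X \<longleftrightarrow> (\<forall>k. \<forall>v\<in>W k. X *v v \<in> W (k - 1))"

lemma increasing_filtration_subspace: "increasing_filtration W \<Longrightarrow> vec.subspace (W k)"
  by (simp add: increasing_filtration_def)

lemma increasing_filtration_mono: "increasing_filtration W \<Longrightarrow> k \<le> l \<Longrightarrow> W k \<subseteq> W l"
  by (simp add: increasing_filtration_def monoD)

lemma lowers_preserves: "increasing_filtration W \<Longrightarrow> lowers W X \<Longrightarrow> preserves W X"
  using increasing_filtration_mono [of W "k - 1" k for k] by (force simp: preserves_def lowers_def)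

lemma lowers_mult:
  "lowers W X \<Longrightarrow> preserves W Y \<Longrightarrow> lowers W (X ** Y)"
  "preserves W X \<Longrightarrow> lowers W Y \<Longrightarrow> lowers W (X ** Y)"
  by (auto simp: preserves_def lowers_def simp flip: matrix_vector_mul_assoc)

lemma preserves_one: "preserves W (mat 1)"
  by (simp add: preserves_def)

context
  fixes W :: "int \<Rightarrow> (complex^'n) set"
  assumes W: "increasing_filtration W"
begin

lemmas filtration_subspace_simps =
  vec.subspace_0 [OF increasing_filtration_subspace [OF W]]
  vec.subspace_add [OF increasing_filtration_subspace [OF W]]
  vec.subspace_diff [OF increasing_filtration_subspace [OF W]]
  vec.subspace_neg [OF increasing_filtration_subspace [OF W]]
  vec.subspace_scale [OF increasing_filtration_subspace [OF W]]
  vec.subspace_sum [OF increasing_filtration_subspace [OF W]]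

lemma lowers_closed:
  "lowers W 0"
  "lowers W X \<Longrightarrow> lowers W Y \<Longrightarrow> lowers W (X + Y)"
  "lowers W X \<Longrightarrow> lowers W Y \<Longrightarrow> lowers W (X - Y)"
  "lowers W X \<Longrightarrow> lowers W (- X)"
  "lowers W X \<Longrightarrow> lowers W (scale_mat c X)"
  "lowers W X \<Longrightarrow> lowers W (r *\<^sub>R X)"
  by (auto simp: lowers_def mv.add_left mv.diff_left mv.minus_left mv.scaleR_left scale_mat_vec
      scaleR_vec_conv filtration_subspace_simps)

lemma lowers_sum: "(\<And>i. i \<in> I \<Longrightarrow> lowers W (X i)) \<Longrightarrow> lowers W (sum X I)"
  by (auto simp: lowers_def mv.sum_left filtration_subspace_simps)

lemma preserves_add: "preserves W X \<Longrightarrow> preserves W Y \<Longrightarrow> preserves W (X + Y)"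
  by (auto simp: preserves_def mv.add_left filtration_subspace_simps)

lemma lowers_pow: "lowers W X \<Longrightarrow> 0 < k \<Longrightarrow> lowers W (mat_pow X k)"
proof (induction k)
  case (Suc k)
  then show ?case
    by (cases k) (auto simp: mat_pow_Suc intro: lowers_mult lowers_preserves [OF W])
qed simp

lemma lowers_log: "lowers W (T - mat 1) \<Longrightarrow> lowers W (mat_log m T)"
  unfolding mat_log_def
proof (rule lowers_sum)
  fix k assume T: "lowers W (T - mat 1)"
  then show "lowers W (((- 1) ^ (k - 1) / real k) *\<^sub>R mat_pow (T - mat 1) k)"
    by (cases k) (auto simp: lowers_pow intro!: lowers_closed)
qed

lemma lowers_exp:
  assumes X: "lowers W X" and m: "mat_pow X m = 0"
  shows "lowers W (mat_exp X - mat 1)"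
proof -
  obtain l where l: "m = Suc l"
    using m by (cases m) (auto simp: mat_1_neq_0)
  have "mat_exp X - mat 1 = (\<Sum>k<l. (1 / fact (Suc k)) *\<^sub>R mat_pow X (Suc k))"
    by (simp add: mat_exp_nilpotent [OF m] l sum.lessThan_Suc_shift del: sum.lessThan_Suc)
  also have "lowers W \<dots>"
    by (intro lowers_sum lowers_closed lowers_pow X) simp
  finally show ?thesis .
qed

lemma preserves_exp:
  assumes X: "lowers W X" and m: "mat_pow X m = 0"
  shows "preserves W (mat_exp X)"
  using preserves_add [OF lowers_preserves [OF W lowers_exp [OF assms]] preserves_one] by simp

text \<open>The filtration has finitely many steps, so that one truncation of the exponential and of the
  logarithm serves for all operators which lower it.\<close>

lemma lowers_uniformly_nilpotent: "\<exists>m. \<forall>X. lowers W X \<longrightarrow> mat_pow X m = 0"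
proof -
  obtain l u where l: "W l = {0}" and u: "W u = UNIV"
    using W by (auto simp: increasing_filtration_def)
  have *: "mat_pow X k *v v \<in> W (u - int k)" if "lowers W X" for X k v
  proof (induction k)
    case (Suc k)
    then have "X *v (mat_pow X k *v v) \<in> W (u - int k - 1)"
      using that by (auto simp: lowers_def)
    then show ?case
      by (simp add: mat_pow_Suc diff_diff_eq add.commute flip: matrix_vector_mul_assoc)
  qed (simp add: u)
  have "mat_pow X (nat (u - l)) = 0" if "lowers W X" for X
  proof -
    have "W (u - int (nat (u - l))) \<subseteq> {0}"
    proof (cases "l \<le> u")
      case True
      then show ?thesis by (simp add: l)
    next
      case False
      then have "W u \<subseteq> {0}"
        using increasing_filtration_mono [OF W, of u l] l by auto
      then show ?thesis using u by auto
    qed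
    then show ?thesis
      using * [OF that, of "nat (u - l)"] by (auto simp: matrix_eq mv.zero_left)
  qed
  then show ?thesis by blast
qed

end

lemma filtration_no_jump:
  assumes W: "increasing_filtration W" and eq: "\<And>i. k < i \<Longrightarrow> i \<le> l \<Longrightarrow> W i = W (i - 1)" and "k \<le> l"
  shows "W l = W k"
  using \<open>k \<le> l\<close> eq
proof (induction l rule: int_ge_induct)
  case (step i)
  have "W (i + 1) = W (i + 1 - 1)"
    using step.hyps by (intro step.prems) simp_all
  also have "\<dots> = W i" by simp
  also have "\<dots> = W k"
    by (rule step.IH) (rule step.prems; simp)
  finally show ?case .
qed simp

lemma weight_range:
  fixes W :: "int \<Rightarrow> (complex^'n) set"
  assumes W: "increasing_filtration W"
  shows "W (wt_max W) \<noteq> W (wt_max W - 1)" "W (wt_min W) \<noteq> W (wt_min W - 1)"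
    "W (wt_max W) = UNIV" "W (wt_min W - 1) = {0}" "wt_min W \<le> wt_max W"
proof -
  obtain l u where l: "W l = {0}" and u: "W u = UNIV"
    using W by (auto simp: increasing_filtration_def)
  have "W l \<noteq> W u"
  proof -
    have "axis undefined 1 \<notin> W l"
      by (auto simp: l axis_eq_0_iff)
    then show ?thesis using u by auto
  qed
  then have "\<not> u \<le> l"
    using increasing_filtration_mono [OF W, of u l] l u by auto
  define J where "J = {k. W k \<noteq> W (k - 1)}"
  have J: "J \<subseteq> {l<..u}"
  proof
    fix k assume k: "k \<in> J"
    have "l < k"
    proof (rule ccontr)
      assume "\<not> l < k"
      then have "W k \<subseteq> {0}" "W (k - 1) \<subseteq> {0}"
        unfolding l [symmetric] by (intro increasing_filtration_mono [OF W]; simp)+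
      moreover have "0 \<in> W k" "0 \<in> W (k - 1)"
        by (simp_all add: filtration_subspace_simps [OF W])
      ultimately have "W k = {0}" "W (k - 1) = {0}" by blast+
      then show False using k by (simp add: J_def)
    qed
    moreover have "k \<le> u"
    proof (rule ccontr)
      assume "\<not> k \<le> u"
      then have "UNIV \<subseteq> W k" "UNIV \<subseteq> W (k - 1)"
        unfolding u [symmetric] by (intro increasing_filtration_mono [OF W]; simp)+
      then have "W k = UNIV" "W (k - 1) = UNIV" by blast+
      then show False using k by (simp add: J_def)
    qed
    ultimately show "k \<in> {l<..u}" by simp
  qed
  then have fin: "finite J"
    by (rule finite_subset) simp
  have ne: "J \<noteq> {}"
  proof
    assume "J = {}"
    then have *: "W i = W (i - 1)" for i
      unfolding J_def by blast
    have "W u = W l"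
      by (rule filtration_no_jump [OF W *]) (use \<open>\<not> u \<le> l\<close> in linarith)
    then show False using \<open>W l \<noteq> W u\<close> by simp
  qed
  have MJ: "wt_max W = Max J" "wt_min W = Min J"
    by (simp_all only: wt_max_def wt_min_def J_def)
  have max: "wt_max W \<in> J" and min: "wt_min W \<in> J"
    unfolding MJ by (rule Max_in [OF fin ne], rule Min_in [OF fin ne])
  then show "W (wt_max W) \<noteq> W (wt_max W - 1)" "W (wt_min W) \<noteq> W (wt_min W - 1)"
    unfolding J_def by blast+
  have le_max: "k \<le> wt_max W" and ge_min: "wt_min W \<le> k" if "k \<in> J" for k
    unfolding MJ using Max_ge [OF fin that] Min_le [OF fin that] by simp_all
  show "wt_min W \<le> wt_max W"
    by (rule le_max [OF min])
  have "W u = W (wt_max W)"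
  proof (rule filtration_no_jump [OF W])
    show "wt_max W \<le> u" using J max by auto
    show "W i = W (i - 1)" if "wt_max W < i" for i
      using le_max [of i] that unfolding J_def by fastforce
  qed
  then show "W (wt_max W) = UNIV" by (simp add: u)
  have "W (wt_min W - 1) = W l"
  proof (rule filtration_no_jump [OF W])
    show "l \<le> wt_min W - 1" using J min by auto
    show "W i = W (i - 1)" if "i \<le> wt_min W - 1" for i
      using ge_min [of i] that unfolding J_def by fastforce
  qed
  then show "W (wt_min W - 1) = {0}" by (simp add: l)
qed


section \<open>Splittings of a filtration with even weights\<close>

text \<open>\<open>P b\<close> is a projection onto \<open>W\<^sub>2\<^sub>b\<close>, and the kernels of the \<open>P b\<close> decrease with \<open>b\<close>; the
  differences \<open>P b - P (b - 1)\<close> are then the projections to the summands of a direct sum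
  decomposition which splits \<open>W\<close>.\<close>

definition splitting ::
  "(int \<Rightarrow> (complex^'n) set) \<Rightarrow> int \<Rightarrow> int \<Rightarrow> (int \<Rightarrow> complex^'n^'n) \<Rightarrow> bool" where
  "splitting W c a P \<longleftrightarrow>
     increasing_filtration W \<and> (\<forall>k. odd k \<longrightarrow> W k = W (k - 1)) \<and>
     W (2 * a) = UNIV \<and> W (2 * c - 1) = {0} \<and> c \<le> a \<and>
     (\<forall>b v. P b *v v \<in> W (2 * b)) \<and> (\<forall>b. \<forall>v\<in>W (2 * b). P b *v v = v) \<and>
     (\<forall>b b'. b \<le> b' \<longrightarrow> P b ** P b' = P b)"

definition summand :: "(int \<Rightarrow> complex^'n^'n) \<Rightarrow> int \<Rightarrow> complex^'n^'n" where
  "summand P b = P b - P (b - 1)"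

definition gr_iso ::
  "int \<Rightarrow> int \<Rightarrow> (int \<Rightarrow> complex^'n^'n) \<Rightarrow> (int \<Rightarrow> complex^'n^'n) \<Rightarrow> complex^'n^'n" where
  "gr_iso c a P P' = (\<Sum>b=c..a. summand P' b ** summand P b)"

context
  fixes W :: "int \<Rightarrow> (complex^'n) set" and c a :: int and P :: "int \<Rightarrow> complex^'n^'n"
  assumes spl: "splitting W c a P"
begin

lemma spl_W: "increasing_filtration W"
  using spl by (simp add: splitting_def)

lemma spl_range: "P b *v v \<in> W (2 * b)" and spl_id: "v \<in> W (2 * b) \<Longrightarrow> P b *v v = v"
  and spl_mult_le: "b \<le> b' \<Longrightarrow> P b ** P b' = P b" and spl_ca: "c \<le> a"
  and spl_odd: "odd k \<Longrightarrow> W k = W (k - 1)"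
  and spl_W_top: "W (2 * a) = UNIV" and spl_W_bot: "W (2 * c - 1) = {0}"
  using spl unfolding splitting_def by blast+

lemma spl_even: "W k = W (2 * (k div 2))"
proof (cases "even k")
  case False
  then have "k - 1 = 2 * (k div 2)"
    by presburger
  then show ?thesis using spl_odd [OF False] by simp
qed auto

lemma spl_mult_ge: "b \<le> b' \<Longrightarrow> P b' ** P b = P b"
proof -
  assume "b \<le> b'"
  then have "W (2 * b) \<subseteq> W (2 * b')"
    by (intro increasing_filtration_mono [OF spl_W]) simp
  then have "P b' *v (P b *v v) = P b *v v" for v
    using spl_range by (intro spl_id) blast
  then show ?thesis
    by (simp add: matrix_eq flip: matrix_vector_mul_assoc)
qed

lemma spl_top: "a \<le> b \<Longrightarrow> P b = mat 1"
proof -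
  assume "a \<le> b"
  then have "UNIV \<subseteq> W (2 * b)"
    unfolding spl_W_top [symmetric] by (intro increasing_filtration_mono [OF spl_W]) simp
  then have "P b *v v = v" for v
    by (intro spl_id) blast
  then show ?thesis
    by (simp add: matrix_eq)
qed

lemma spl_bot: "b < c \<Longrightarrow> P b = 0"
proof -
  assume "b < c"
  then have "W (2 * b) \<subseteq> {0}"
    unfolding spl_W_bot [symmetric] by (intro increasing_filtration_mono [OF spl_W]) simp
  then have "P b *v v = 0" for v
    using spl_range [of b v] by blast
  then show ?thesis
    by (simp add: matrix_eq)
qed

lemma summand_mult: "summand P b ** summand P b' = (if b = b' then summand P b else 0)"
proof -
  have *: "summand P b ** summand P b'
      = P b ** P b' - P b ** P (b' - 1) - (P (b - 1) ** P b' - P (b - 1) ** P (b' - 1))"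
    by (simp only: summand_def mm.diff_left mm.diff_right) (simp add: algebra_simps)
  consider "b = b'" | "b < b'" | "b' < b" by linarith
  then show ?thesis
  proof cases
    case 1
    then show ?thesis
      unfolding * using spl_mult_le [of "b - 1" b] spl_mult_ge [of "b - 1" b] spl_mult_le [of b b]
        spl_mult_le [of "b - 1" "b - 1"] by (simp add: summand_def)
  next
    case 2
    then show ?thesis
      unfolding * using spl_mult_le [of b b'] spl_mult_le [of b "b' - 1"] spl_mult_le [of "b - 1" b']
        spl_mult_le [of "b - 1" "b' - 1"] by simp
  next
    case 3
    then show ?thesis
      unfolding * using spl_mult_ge [of b' b] spl_mult_ge [of "b' - 1" b] spl_mult_ge [of b' "b - 1"]
        spl_mult_ge [of "b' - 1" "b - 1"] by simp
  qed
qed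

lemma summand_outside: "b < c \<or> a < b \<Longrightarrow> summand P b = 0"
  by (auto simp: summand_def spl_bot spl_top)

lemma summand_range: "summand P b *v v \<in> W (2 * b)"
  using spl_range [of b v] spl_range [of "b - 1" v]
    increasing_filtration_mono [OF spl_W, of "2 * (b - 1)" "2 * b"]
  by (auto simp: summand_def mv.diff_left intro!: filtration_subspace_simps [OF spl_W])

lemma summand_kills: "v \<in> W k \<Longrightarrow> k < 2 * b \<Longrightarrow> summand P b *v v = 0"
proof -
  assume v: "v \<in> W k" and k: "k < 2 * b"
  have "v \<in> W (2 * b)" "v \<in> W (2 * (b - 1))"
  proof -
    have "W k \<subseteq> W (2 * b)" "W (2 * (k div 2)) \<subseteq> W (2 * (b - 1))"
      using k by (intro increasing_filtration_mono [OF spl_W]; presburger)+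
    then show "v \<in> W (2 * b)" "v \<in> W (2 * (b - 1))"
      using v spl_even [of k] by blast+
  qed
  then show ?thesis
    by (simp add: summand_def mv.diff_left spl_id)
qed

lemma sum_summand: "c - 1 \<le> k \<Longrightarrow> (\<Sum>b=c..k. summand P b) = P k"
proof (induction k rule: int_ge_induct)
  case base
  then show ?case by (simp add: spl_bot)
next
  case (step i)
  then have "{c..i + 1} = insert (i + 1) {c..i}" by auto
  then show ?case
    using step by (simp add: summand_def)
qed

lemma sum_summand_one: "(\<Sum>b=c..a. summand P b) = mat 1"
  using sum_summand [of a] spl_ca by (simp add: spl_top)

lemma W_decomposition:
  assumes "v \<in> W k" shows "v = (\<Sum>b\<in>{b. c \<le> b \<and> 2 * b \<le> k}. summand P b *v v)"
proof (cases "c \<le> k div 2")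
  case True
  have "{b. c \<le> b \<and> 2 * b \<le> k} = {c..k div 2}" by auto
  moreover have "P (k div 2) *v v = v"
    using assms spl_even [of k] by (intro spl_id) auto
  ultimately show ?thesis
    using True sum_summand [of "k div 2"] by (simp flip: mv.sum_left)
next
  case False
  then have *: "{b. c \<le> b \<and> 2 * b \<le> k} = {}" and "W k \<subseteq> W (2 * c - 1)"
    by (auto simp: not_le intro: increasing_filtration_mono [OF spl_W, THEN subsetD, rotated])
  then have "v = 0" using assms spl_W_bot by auto
  then show ?thesis by (simp add: *)
qed

lemma eq_on_summands:
  assumes "\<And>b. X ** summand P b = Y ** summand P b" shows "X = Y"
proof -
  have "X = (\<Sum>b=c..a. X ** summand P b)"
    by (simp flip: mm.sum_right add: sum_summand_one)
  also have "\<dots> = Y"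
    by (simp only: assms) (simp flip: mm.sum_right add: sum_summand_one)
  finally show ?thesis .
qed

lemma lowers_from_summands:
  assumes "\<And>b v. X *v (summand P b *v v) \<in> W (2 * b - 1)"
  shows "lowers W X"
  unfolding lowers_def
proof (intro allI ballI)
  fix k v assume "v \<in> W k"
  have "X *v v = (\<Sum>b\<in>{b. c \<le> b \<and> 2 * b \<le> k}. X *v (summand P b *v v))"
    using arg_cong [OF W_decomposition [OF \<open>v \<in> W k\<close>], of "(*v) X"] by (simp only: mv.sum_right)
  also have "\<dots> \<in> W (k - 1)"
  proof (intro vec.subspace_sum increasing_filtration_subspace spl_W)
    fix b assume "b \<in> {b. c \<le> b \<and> 2 * b \<le> k}"
    then have "W (2 * b - 1) \<subseteq> W (k - 1)"
      by (intro increasing_filtration_mono [OF spl_W]) simp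
    then show "X *v (summand P b *v v) \<in> W (k - 1)"
      using assms by blast
  qed
  finally show "X *v v \<in> W (k - 1)" .
qed

lemma splitting_gr_iso_self: "gr_iso c a P P = mat 1"
  by (simp add: gr_iso_def summand_mult sum_summand_one)

end

text \<open>Two splittings are related by a unique operator inducing the identity on the graded pieces.\<close>

lemma gr_iso_intertwines:
  assumes "splitting W c a P" "splitting W c a P'"
  shows gr_iso_summand: "gr_iso c a P P' ** summand P b = summand P' b ** summand P b"
    and "gr_iso c a P P' ** summand P b = summand P' b ** gr_iso c a P P'"
proof -
  show L: "gr_iso c a P P' ** summand P b = summand P' b ** summand P b"
  proof (cases "b \<in> {c..a}")
    case True
    have "gr_iso c a P P' ** summand P b = (\<Sum>b'=c..a. if b' = b then summand P' b ** summand P b else 0)"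
      unfolding gr_iso_def mm.sum_left
      by (intro sum.cong [OF refl])
        (auto simp: summand_mult [OF assms(1)] mm.zero_right simp flip: matrix_mul_assoc)
    then show ?thesis using True by simp
  next
    case False
    then have "summand P b = 0" by (intro summand_outside [OF assms(1)]) auto
    then show ?thesis by (simp add: mm.zero_right)
  qed
  have R: "summand P' b ** gr_iso c a P P' = summand P' b ** summand P b"
  proof (cases "b \<in> {c..a}")
    case True
    have "summand P' b ** gr_iso c a P P' = (\<Sum>b'=c..a. if b = b' then summand P' b ** summand P b else 0)"
      unfolding gr_iso_def mm.sum_right
      by (intro sum.cong [OF refl])
        (auto simp: summand_mult [OF assms(2)] mm.zero_left matrix_mul_assoc)
    then show ?thesis using True by simp
  next
    case False
    then have "summand P' b = 0" by (intro summand_outside [OF assms(2)]) auto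
    then show ?thesis by (simp add: mm.zero_left)
  qed
  show "gr_iso c a P P' ** summand P b = summand P' b ** gr_iso c a P P'"
    using L R by simp
qed

lemma gr_iso_lowers:
  assumes P: "splitting W c a P" and P': "splitting W c a P'"
  shows "lowers W (gr_iso c a P P' - mat 1)"
proof (rule lowers_from_summands [OF P])
  fix b v
  define w where "w = summand P b *v v"
  have w: "w \<in> W (2 * b)" "summand P b *v w = w"
    by (simp_all add: w_def summand_range [OF P] matrix_vector_mul_assoc summand_mult [OF P])
  have "gr_iso c a P P' *v w = summand P' b *v w"
  proof (cases "b \<in> {c..a}")
    case True
    have "gr_iso c a P P' *v w = (\<Sum>b'=c..a. if b' = b then summand P' b *v w else 0)"
      unfolding gr_iso_def mv.sum_left
    proof (intro sum.cong [OF refl])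
      fix b' show "summand P' b' ** summand P b' *v w = (if b' = b then summand P' b *v w else 0)"
        using w(2) by (auto simp: w_def matrix_vector_mul_assoc summand_mult [OF P] mm.zero_right
          mv.zero_left simp flip: matrix_mul_assoc)
    qed
    then show ?thesis using True by simp
  next
    case False
    then have "summand P b = 0" by (intro summand_outside [OF P]) auto
    then show ?thesis by (simp add: w_def mv.zero_left)
  qed
  then have "(gr_iso c a P P' - mat 1) *v w = - (P' (b - 1) *v w)"
    by (simp add: mv.diff_left summand_def spl_id [OF P' w(1)])
  also have "\<dots> \<in> W (2 * (b - 1))"
    by (intro filtration_subspace_simps [OF spl_W [OF P]] spl_range [OF P'])
  also have "\<dots> \<subseteq> W (2 * b - 1)"
    by (intro increasing_filtration_mono [OF spl_W [OF P]]) simp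
  finally show "(gr_iso c a P P' - mat 1) *v (summand P b *v v) \<in> W (2 * b - 1)"
    by (simp add: w_def)
qed

lemma gr_iso_unique:
  assumes P: "splitting W c a P" and P': "splitting W c a P'"
    and G: "\<And>b. G ** summand P b = summand P' b ** G" "lowers W (G - mat 1)"
  shows "G = gr_iso c a P P'"
proof (rule eq_on_summands [OF P])
  have *: "X ** summand P b = summand P' b ** summand P b"
    if X: "X ** summand P b = summand P' b ** X" "lowers W (X - mat 1)" for X b
  proof -
    have "summand P' b *v ((X - mat 1) *v (summand P b *v v)) = 0" for v
      using X(2) summand_range [OF P, of b v]
      by (intro summand_kills [OF P', of _ "2 * b - 1"]) (auto simp: lowers_def)
    then have "summand P' b ** (X - mat 1) ** summand P b = 0"
      by (simp add: matrix_eq mv.zero_left flip: matrix_vector_mul_assoc)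
    moreover have "summand P' b ** X ** summand P b = X ** summand P b"
      by (simp add: X(1) [symmetric] summand_mult [OF P] flip: matrix_mul_assoc)
    ultimately show ?thesis
      by (simp add: mat_distribs matrix_mul_assoc)
  qed
  show "G ** summand P b = gr_iso c a P P' ** summand P b" for b
    using * [OF G] * [OF gr_iso_intertwines(2) [OF P P'] gr_iso_lowers [OF P P']] by simp
qed

lemma unipotent_mult:
  assumes W: "increasing_filtration W" and "lowers W (A - mat 1)" "lowers W (B - mat 1)"
  shows "lowers W (A ** B - mat 1)"
proof -
  define X Y where "X = A - mat 1" "Y = B - mat 1"
  have "A ** B - mat 1 = X ** Y + X + Y"
    by (simp add: X_Y_def mat_distribs)
  moreover have "lowers W X" "lowers W Y"
    using assms by (simp_all add: X_Y_def)
  ultimately show ?thesis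
    by (simp add: lowers_closed lowers_mult lowers_preserves W)
qed

lemma gr_iso_inverse:
  assumes P: "splitting W c a P" and P': "splitting W c a P'"
  shows "gr_iso c a P' P ** gr_iso c a P P' = mat 1"
proof -
  have "gr_iso c a P' P ** gr_iso c a P P' = gr_iso c a P P"
  proof (rule gr_iso_unique [OF P P])
    show "gr_iso c a P' P ** gr_iso c a P P' ** summand P b
        = summand P b ** (gr_iso c a P' P ** gr_iso c a P P')" for b
      by (simp add: gr_iso_intertwines(2) [OF P P'] flip: matrix_mul_assoc)
        (simp add: gr_iso_intertwines(2) [OF P' P] matrix_mul_assoc)
    show "lowers W (gr_iso c a P' P ** gr_iso c a P P' - mat 1)"
      by (intro unipotent_mult spl_W [OF P] gr_iso_lowers P P')
  qed
  then show ?thesis by (simp add: splitting_gr_iso_self [OF P])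
qed

lemma conj_summand: "conj_mat (summand P b) = summand (\<lambda>b. conj_mat (P b)) b"
  by (simp add: summand_def conj_mat_diff)

lemma splitting_conj:
  assumes P: "splitting W c a P" and real: "\<And>k v. v \<in> W k \<Longrightarrow> conj_vec v \<in> W k"
  shows "splitting W c a (\<lambda>b. conj_mat (P b))"
proof -
  have *: "conj_mat (P b) *v v = conj_vec (P b *v conj_vec v)" for b v
    by (simp add: conj_mat_vec)
  have "conj_vec (P b *v conj_vec v) = v" if "v \<in> W (2 * b)" for b v
    using spl_id [OF P, of "conj_vec v" b] real [OF that] by simp
  then show ?thesis
    using P real unfolding splitting_def * by (auto simp flip: conj_mat_mult)
qed

lemma splitting_transport:
  assumes P: "splitting W c a P"
    and g: "preserves W g" "preserves W h" "g ** h = mat 1" "h ** g = mat 1"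
  shows "splitting W c a (\<lambda>b. g ** P b ** h)"
proof -
  have *: "g ** P b ** h ** (g ** P b' ** h) = g ** P b ** (h ** g) ** (P b' ** h)" for b b'
    by (simp only: matrix_mul_assoc)
  have "g ** P b ** h ** (g ** P b' ** h) = g ** P b ** h" if "b \<le> b'" for b b'
    unfolding * g(4) using spl_mult_le [OF P that] by (simp flip: matrix_mul_assoc) (simp add: matrix_mul_assoc)
  moreover have "(g ** P b ** h) *v v = v" if "v \<in> W (2 * b)" for b v
  proof -
    have "h *v v \<in> W (2 * b)"
      using g(2) that by (auto simp: preserves_def)
    then have "(g ** P b ** h) *v v = g *v (h *v v)"
      by (simp add: spl_id [OF P] flip: matrix_vector_mul_assoc)
    then show ?thesis by (simp add: matrix_vector_mul_assoc g(3))
  qed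
  moreover have "(g ** P b ** h) *v v \<in> W (2 * b)" for b v
    using g(1) spl_range [OF P] by (simp add: preserves_def flip: matrix_vector_mul_assoc)
  ultimately show ?thesis
    using P unfolding splitting_def by blast
qed



section \<open>The height of a splitting\<close>

text \<open>Let \<open>Y\<close> be the grading defined by the splitting. The equation \<open>conj Y = Ad (exp (-2\<i>\<delta>)) Y\<close> says that
  \<open>exp (-2\<i>\<delta>)\<close> carries the splitting to its complex conjugate; being the identity on the graded pieces,
  it is the operator \<open>gr_iso\<close>, and \<open>\<delta>\<close> is \<open>\<i>/2\<close> times its logarithm.\<close>

definition deligne_log :: "nat \<Rightarrow> int \<Rightarrow> int \<Rightarrow> (int \<Rightarrow> complex^'n^'n) \<Rightarrow> complex^'n^'n" where
  "deligne_log m c a P = scale_mat (\<i> / 2) (mat_log m (gr_iso c a P (\<lambda>b. conj_mat (P b))))"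

text \<open>The component of \<open>\<delta>\<close> from the top graded piece to the bottom one. Applied to a generator of the
  former it gives the height times a generator of the latter.\<close>

definition height_vec ::
  "nat \<Rightarrow> int \<Rightarrow> int \<Rightarrow> (int \<Rightarrow> complex^'n^'n) \<Rightarrow> complex^'n \<Rightarrow> complex^'n" where
  "height_vec m c a P v = P c *v (deligne_log m c a P *v (summand P a *v v))"

lemma summand_transport: "summand (\<lambda>b. g ** P b ** h) b = g ** summand P b ** h"
  by (simp add: summand_def mat_distribs)

lemma height_vec_equivariant:
  assumes inv: "g ** h = mat 1" "h ** g = mat 1" and real: "conj_mat g = g" "conj_mat h = h"
  shows "height_vec m c a (\<lambda>b. g ** P b ** h) (g *v v) = g *v height_vec m c a P v"
proof -
  define T where "T = gr_iso c a P (\<lambda>b. conj_mat (P b))"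
  have cancel: "g ** X ** h ** (g ** Y ** h) = g ** (X ** Y) ** h" for X Y
  proof -
    have "g ** X ** h ** (g ** Y ** h) = g ** X ** (h ** g) ** Y ** h"
      by (simp only: matrix_mul_assoc)
    then show ?thesis by (simp add: inv matrix_mul_assoc)
  qed
  have "gr_iso c a (\<lambda>b. g ** P b ** h) (\<lambda>b. conj_mat (g ** P b ** h)) = g ** T ** h"
    unfolding T_def gr_iso_def conj_mat_mult real summand_transport cancel
    by (simp add: mm.sum_left mm.sum_right)
  moreover have "mat_log m (g ** T ** h) = g ** mat_log m T ** h"
  proof -
    have "g ** T = (g ** T ** h) ** g"
      by (simp add: inv flip: matrix_mul_assoc)
    from mat_log_intertwine [OF this, of m]
    have "g ** mat_log m T ** h = mat_log m (g ** T ** h) ** (g ** h)"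
      by (simp add: matrix_mul_assoc)
    then show ?thesis by (simp add: inv)
  qed
  ultimately have log: "deligne_log m c a (\<lambda>b. g ** P b ** h) = g ** deligne_log m c a P ** h"
    by (simp add: deligne_log_def T_def scale_mat_mult_left scale_mat_mult_right)
  have "(g ** P c ** h) ** ((g ** deligne_log m c a P ** h) ** ((g ** summand P a ** h) ** g))
      = g ** (P c ** (deligne_log m c a P ** summand P a))"
    unfolding cancel by (simp add: cancel inv matrix_mul_assoc [symmetric])
      (simp add: inv matrix_mul_assoc)
  then show ?thesis
    unfolding height_vec_def log summand_transport by (simp add: matrix_vector_mul_assoc)
qed

context
  fixes W :: "int \<Rightarrow> (complex^'n) set" and c a :: int and P :: "int \<Rightarrow> complex^'n^'n" and m :: nat
  assumes spl: "splitting W c a P"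
    and real: "\<And>k v. v \<in> W k \<Longrightarrow> conj_vec v \<in> W k"
    and nil: "\<And>X. lowers W X \<Longrightarrow> mat_pow X m = 0"
begin

abbreviation (input) "P' \<equiv> \<lambda>b. conj_mat (P b)"
abbreviation (input) "g \<equiv> gr_iso c a P P'"
abbreviation (input) "\<delta> \<equiv> deligne_log m c a P"

lemmas spl' = splitting_conj [OF spl real]
lemmas incr = spl_W [OF spl]

lemma g_lowers: "lowers W (g - mat 1)"
  by (rule gr_iso_lowers [OF spl spl'])

lemma deligne_log_lowers: "lowers W \<delta>"
  unfolding deligne_log_def by (intro lowers_closed lowers_log incr g_lowers)

lemma deligne_log_eq: "mat_log m g = scale_mat (- 2 * \<i>) \<delta>"
  by (simp add: deligne_log_def scale_mat_scale)

lemma exp_deligne_log: "mat_exp (scale_mat (- 2 * \<i>) \<delta>) = g"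
  unfolding deligne_log_eq [symmetric] by (intro mat_exp_log nil g_lowers)

lemma conj_gr_iso: "conj_mat g = gr_iso c a P' P"
  by (simp add: gr_iso_def conj_mat_sum conj_mat_mult conj_summand)

lemma exp_minus_deligne_log: "mat_exp (scale_mat (2 * \<i>) \<delta>) = conj_mat g"
proof -
  have *: "scale_mat (2 * \<i>) \<delta> = - scale_mat (- 2 * \<i>) \<delta>"
    by (simp add: sm.minus_left)
  have "mat_pow (scale_mat (- 2 * \<i>) \<delta>) m = 0"
    by (intro nil lowers_closed incr deligne_log_lowers)
  from mat_exp_minus(1) [OF this] have "conj_mat g ** g ** mat_exp (scale_mat (2 * \<i>) \<delta>) = conj_mat g"
    unfolding exp_deligne_log * by (simp flip: matrix_mul_assoc)
  then show ?thesis
    by (simp add: conj_gr_iso gr_iso_inverse [OF spl spl'])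
qed

text \<open>The conjugate of \<open>g\<close> is its inverse, so conjugation changes the sign of the logarithm of \<open>g\<close>; it also
  changes the sign of the factor \<open>\<i>/2\<close>.\<close>

lemma deligne_log_real: "conj_mat \<delta> = \<delta>"
proof -
  have "conj_mat \<delta> = scale_mat (- (\<i> / 2)) (mat_log m (conj_mat g))"
    by (simp add: deligne_log_def conj_mat_scale conj_mat_log)
  also have "mat_log m (conj_mat g) = scale_mat (2 * \<i>) \<delta>"
    unfolding exp_minus_deligne_log [symmetric]
    by (intro mat_log_exp nil lowers_closed incr deligne_log_lowers)
  finally show ?thesis
    by (simp add: scale_mat_scale)
qed

lemma deligne_log_commutes: "g ** \<delta> = \<delta> ** g"
  using mat_log_intertwine [of g g g m]
  by (simp add: deligne_log_def scale_mat_mult_left scale_mat_mult_right)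

lemma spl_P_bot: "P c = summand P c"
  by (simp add: summand_def spl_bot [OF spl])

lemma unipotent_fixes_bottom: "lowers W (T - mat 1) \<Longrightarrow> v \<in> W (2 * c) \<Longrightarrow> T *v v = v"
proof -
  assume "lowers W (T - mat 1)" "v \<in> W (2 * c)"
  then have "(T - mat 1) *v v \<in> W (2 * c - 1)" unfolding lowers_def by blast
  then show ?thesis
    by (simp add: spl_W_bot [OF spl] mv.diff_left)
qed

lemma summand_top_unipotent: "lowers W (T - mat 1) \<Longrightarrow> summand P a *v (T *v v) = summand P a *v v"
proof -
  assume "lowers W (T - mat 1)"
  moreover have "v \<in> W (2 * a)" by (simp add: spl_W_top [OF spl])
  ultimately have "(T - mat 1) *v v \<in> W (2 * a - 1)" unfolding lowers_def by blast
  then have "summand P a *v ((T - mat 1) *v v) = 0"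
    by (rule summand_kills [OF spl]) simp
  then show ?thesis
    by (simp add: mv.diff_left mv.diff_right)
qed

lemma height_vec_bottom: "height_vec m c a P v \<in> W (2 * c)"
  by (simp add: height_vec_def spl_range [OF spl])

lemma height_vec_coset: "v - w \<in> W (2 * a - 1) \<Longrightarrow> height_vec m c a P v = height_vec m c a P w"
  using summand_kills [OF spl, of "v - w" "2 * a - 1" a] by (simp add: height_vec_def mv.diff_right)

lemma height_vec_real:
  assumes "conj_vec v = v" shows "conj_vec (height_vec m c a P v) = height_vec m c a P v"
proof -
  have L: "conj_mat (P c) ** g = g ** P c"
    using gr_iso_intertwines(2) [OF spl spl', of c] by (simp add: spl_P_bot conj_summand)
  have R: "conj_mat (summand P a) ** g = g ** summand P a"
    using gr_iso_intertwines(2) [OF spl spl', of a] by (simp add: conj_summand)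
  have "conj_mat (summand P a) *v v = conj_mat (summand P a) *v (g *v v)"
  proof -
    have "v \<in> W (2 * a)" by (simp add: spl_W_top [OF spl])
    then have "(g - mat 1) *v v \<in> W (2 * a - 1)" using g_lowers unfolding lowers_def by blast
    from summand_kills [OF spl' this, of a] have "conj_mat (summand P a) *v ((g - mat 1) *v v) = 0"
      by (simp add: conj_summand)
    then show ?thesis by (simp add: mv.diff_left mv.diff_right)
  qed
  also have "\<dots> = g *v (summand P a *v v)"
    by (simp add: matrix_vector_mul_assoc R)
  finally have "conj_vec (height_vec m c a P v) = conj_mat (P c) *v (\<delta> *v (g *v (summand P a *v v)))"
    by (simp add: height_vec_def conj_mat_vec assms deligne_log_real)
  also have "\<dots> = conj_mat (P c) *v (g *v (\<delta> *v (summand P a *v v)))"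
    by (simp add: matrix_vector_mul_assoc matrix_mul_assoc)
      (simp add: deligne_log_commutes flip: matrix_mul_assoc)
  also have "\<dots> = g *v height_vec m c a P v"
    by (simp add: matrix_vector_mul_assoc height_vec_def matrix_mul_assoc L)
  also have "\<dots> = height_vec m c a P v"
    by (intro unipotent_fixes_bottom g_lowers height_vec_bottom)
  finally show ?thesis .
qed

text \<open>Twisting the splitting by \<open>exp (u N)\<close> replaces \<open>g\<close> by \<open>exp (conj u N) g exp (- u N)\<close>. As \<open>N\<close> shifts
  the splitting and its conjugate by one step, it commutes with \<open>g\<close>, so that \<open>\<delta>\<close> becomes
  \<open>\<delta> + Im(u) N\<close>. Since \<open>c + 2 \<le> a\<close>, the operator \<open>N\<close> has no component from the top graded piece
  to the bottom one.\<close>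

lemma height_vec_nilpotent_orbit:
  assumes N: "lowers W N" "conj_mat N = N"
    and shift: "\<And>b. N ** summand P b = summand P (b - 1) ** N"
    and long: "c + 2 \<le> a"
  shows "height_vec m c a (\<lambda>b. mat_exp (scale_mat u N) ** P b ** mat_exp (- scale_mat u N)) v
    = height_vec m c a P v"
proof -
  define E E' where "E = mat_exp (scale_mat u N)" and "E' = mat_exp (- scale_mat u N)"
  define Q where "Q = (\<lambda>b. E ** P b ** E')"
  define C C' where "C = conj_mat E" and "C' = conj_mat E'"
  have low: "lowers W (scale_mat u N)" "lowers W (- scale_mat u N)"
    "lowers W (scale_mat (cnj u) N)" "lowers W (- scale_mat (cnj u) N)"
    by (intro lowers_closed incr N)+
  note nils = low [THEN nil]
  have EE: "E ** E' = mat 1" "E' ** E = mat 1"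
    unfolding E_def E'_def by (rule mat_exp_minus [OF nils(1)])+
  have C: "C = mat_exp (scale_mat (cnj u) N)" "C' = mat_exp (- scale_mat (cnj u) N)"
    unfolding C_def C'_def E_def E'_def
    by (simp_all add: conj_mat_exp [OF nils(1)] conj_mat_exp [OF nils(2)] conj_mat_scale conj_mat_minus N)
  have CC: "C ** C' = mat 1" "C' ** C = mat 1"
    unfolding C by (rule mat_exp_minus [OF nils(3)])+
  have uni: "lowers W (E - mat 1)" "lowers W (E' - mat 1)" "lowers W (C - mat 1)"
    unfolding C unfolding E_def E'_def
    by (rule lowers_exp [OF incr low(1) nils(1)], rule lowers_exp [OF incr low(2) nils(2)],
        rule lowers_exp [OF incr low(3) nils(3)])
  have pres: "preserves W E" "preserves W E'"
    unfolding E_def E'_def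
    by (rule preserves_exp [OF incr low(1) nils(1)], rule preserves_exp [OF incr low(2) nils(2)])
  have splQ: "splitting W c a Q"
    unfolding Q_def by (intro splitting_transport spl pres EE)
  have sumQ: "summand Q b = E ** summand P b ** E'" for b
    by (simp add: Q_def summand_transport)
  have shift': "N ** summand P' b = summand P' (b - 1) ** N" for b
    using arg_cong [OF shift [of b], of conj_mat] by (simp add: conj_mat_mult conj_summand N)
  have Ng: "N ** g = g ** N"
  proof (rule eq_on_summands [OF spl])
    fix b
    have "N ** g ** summand P b = N ** summand P' b ** summand P b"
      by (simp add: gr_iso_summand [OF spl spl'] flip: matrix_mul_assoc)
    also have "\<dots> = summand P' (b - 1) ** (N ** summand P b)"
      by (simp add: shift' matrix_mul_assoc)
    also have "\<dots> = summand P' (b - 1) ** summand P (b - 1) ** N"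
      by (simp add: shift matrix_mul_assoc)
    also have "\<dots> = g ** (summand P (b - 1) ** N)"
      by (simp add: gr_iso_summand [OF spl spl'] matrix_mul_assoc)
    also have "\<dots> = g ** N ** summand P b"
      by (simp add: matrix_mul_assoc flip: shift)
    finally show "N ** g ** summand P b = g ** N ** summand P b" .
  qed
  define L where "L = mat_log m g"
  have NL: "N ** L = L ** N"
    unfolding L_def by (rule mat_log_intertwine [OF Ng])
  have L: "lowers W L" "mat_exp L = g"
    unfolding L_def by (intro lowers_log incr g_lowers mat_exp_log nil)+
  have N\<delta>: "N ** \<delta> = \<delta> ** N"
    using NL by (simp add: deligne_log_def L_def scale_mat_mult_left scale_mat_mult_right)
  define D where "D = \<delta> + scale_mat (\<i> / 2 * (cnj u - u)) N"
  have gQ: "gr_iso c a Q (\<lambda>b. conj_mat (Q b)) = C ** g ** E'"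
  proof (rule gr_iso_unique [OF splQ splitting_conj [OF splQ real], symmetric])
    fix b
    have cQ: "summand (\<lambda>b. conj_mat (Q b)) b = C ** summand P' b ** C'"
      unfolding conj_summand [symmetric] sumQ C_def C'_def by (simp add: conj_mat_mult conj_summand)
    have "C ** g ** E' ** summand Q b = C ** g ** (E' ** E) ** summand P b ** E'"
      by (simp add: sumQ matrix_mul_assoc)
    also have "\<dots> = C ** (g ** summand P b) ** E'"
      by (simp add: EE matrix_mul_assoc)
    also have "\<dots> = C ** summand P' b ** (C' ** C) ** g ** E'"
      by (simp add: CC matrix_mul_assoc gr_iso_intertwines(2) [OF spl spl'])
    also have "\<dots> = summand (\<lambda>b. conj_mat (Q b)) b ** (C ** g ** E')"
      by (simp add: cQ matrix_mul_assoc)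
    finally show "C ** g ** E' ** summand Q b = summand (\<lambda>b. conj_mat (Q b)) b ** (C ** g ** E')" .
  next
    show "lowers W (C ** g ** E' - mat 1)"
      by (intro unipotent_mult incr uni g_lowers)
  qed
  have "C ** g ** E' = mat_exp (L + scale_mat (cnj u - u) N)"
  proof -
    have "mat_exp (scale_mat (cnj u) N + L) = C ** g"
      unfolding C L(2) [symmetric] using NL
      by (intro mat_exp_add [OF _ nils(3) nil [OF L(1)]])
        (simp add: scale_mat_mult_left scale_mat_mult_right)
    moreover have "mat_exp ((scale_mat (cnj u) N + L) + - scale_mat u N)
        = mat_exp (scale_mat (cnj u) N + L) ** E'"
      unfolding E'_def using NL
      by (intro mat_exp_add [OF _ nil [OF lowers_closed(2) [OF incr low(3) L(1)]] nils(2)])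
        (simp add: mat_distribs scale_mat_mult_left scale_mat_mult_right scale_mat_scale mult.commute
            sm.add_right sm.minus_right)
    ultimately show ?thesis
      by (simp add: sm.diff_left algebra_simps)
  qed
  moreover have "mat_log m (mat_exp (L + scale_mat (cnj u - u) N)) = L + scale_mat (cnj u - u) N"
    by (intro mat_log_exp nil incr L N lowers_closed)
  ultimately have logQ: "deligne_log m c a Q = D"
    by (simp add: deligne_log_def gQ D_def L_def sm.add_right scale_mat_scale)
  have "D ** E = E ** D"
  proof -
    have ND: "N ** D = D ** N"
      by (simp add: D_def mat_distribs N\<delta> scale_mat_mult_left scale_mat_mult_right)
    show ?thesis unfolding E_def
      by (rule mat_exp_intertwine [OF _ nils(1) nils(1)])
        (simp add: scale_mat_mult_left scale_mat_mult_right ND)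
  qed
  then have DE: "E' ** D ** E = D"
    by (simp flip: matrix_mul_assoc) (simp add: EE matrix_mul_assoc)
  have bot: "P c ** N ** summand P a = 0"
  proof -
    have "P c ** N ** summand P a = (summand P c ** summand P (a - 1)) ** N"
      by (simp add: spl_P_bot shift flip: matrix_mul_assoc)
    then show ?thesis
      using long by (simp add: summand_mult [OF spl])
  qed
  have "height_vec m c a Q v = (E ** P c ** (E' ** D ** E) ** summand P a ** E') *v v"
    unfolding height_vec_def logQ sumQ by (simp add: Q_def matrix_vector_mul_assoc matrix_mul_assoc)
  also have "\<dots> = E *v ((P c ** D ** summand P a) *v (E' *v v))"
    unfolding DE by (simp add: matrix_vector_mul_assoc matrix_mul_assoc)
  also have "P c ** D ** summand P a = P c ** \<delta> ** summand P a"
    by (simp add: D_def mat_distribs scale_mat_mult_left scale_mat_mult_right bot sm.zero_right)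
  also have "(P c ** \<delta> ** summand P a) *v (E' *v v) = height_vec m c a P v"
    by (simp add: height_vec_def summand_top_unipotent uni flip: matrix_vector_mul_assoc)
  also have "E *v \<dots> = \<dots>"
    by (intro unipotent_fixes_bottom uni height_vec_bottom)
  finally show ?thesis
    unfolding Q_def E_def E'_def .
qed

end

hide_const (open) g \<delta> P'


section \<open>Projections\<close>

definition is_proj :: "(complex^'n) set \<Rightarrow> (complex^'n) set \<Rightarrow> complex^'n^'n \<Rightarrow> bool" where
  "is_proj E W P \<longleftrightarrow> (\<forall>v. P *v v \<in> W \<and> v - P *v v \<in> E) \<and> (\<forall>w\<in>W. P *v w = w) \<and> (\<forall>v\<in>E. P *v v = 0)"

lemma is_projD:
  assumes "is_proj E W P"
  shows "P *v v \<in> W" "v - P *v v \<in> E" "w \<in> W \<Longrightarrow> P *v w = w" "e \<in> E \<Longrightarrow> P *v e = 0"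
  using assms by (auto simp: is_proj_def)

lemma is_proj_unique:
  assumes P: "is_proj E W P" and Q: "is_proj E W Q" shows "P = Q"
proof -
  have "P *v v = Q *v v" for v
  proof -
    have "P *v (v - Q *v v) = 0" "P *v (Q *v v) = Q *v v"
      using is_projD [OF P] is_projD [OF Q] by blast+
    then show ?thesis by (simp add: mv.diff_right)
  qed
  then show ?thesis by (simp add: matrix_eq)
qed

lemma is_proj_kernel:
  assumes P: "is_proj E W P" shows "P *v v = 0 \<longleftrightarrow> v \<in> E"
  using is_projD(2,4) [OF P, of v] by auto

lemma complement_unique:
  assumes "vec.subspace E" "vec.subspace W" "E \<inter> W = {0}"
    and "w \<in> W" "v - w \<in> E" "w' \<in> W" "v - w' \<in> E"
  shows "w = w'"
proof -
  have "w - w' \<in> W"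
    using assms(2,4,6) by (rule vec.subspace_diff)
  moreover have "(v - w') - (v - w) \<in> E"
    using assms(1,7,5) by (rule vec.subspace_diff)
  then have "w - w' \<in> E" by simp
  ultimately have "w - w' \<in> {0}" using assms(3) by blast
  then show ?thesis by simp
qed

lemma is_proj_exists:
  assumes E: "vec.subspace E" and W: "vec.subspace W" and "E \<inter> W = {0}"
    and ex: "\<And>v. \<exists>e\<in>E. v - e \<in> W"
  shows "\<exists>P. is_proj E W P"
proof -
  have "\<exists>w. w \<in> W \<and> v - w \<in> E" for v
    using ex [of v] by (metis diff_diff_eq2 add_diff_cancel_left')
  then obtain q where q: "\<And>v. q v \<in> W \<and> v - q v \<in> E" by metis
  have eq: "q v = w" if "w \<in> W" "v - w \<in> E" for v w
    using complement_unique [OF E W assms(3), of "q v" v w] q that by blast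
  have "Vector_Spaces.linear (*s) (*s) q"
  proof (unfold_locales)
    fix u v
    have "(u - q u) + (v - q v) \<in> E"
      using q by (intro vec.subspace_add [OF E]) auto
    then show "q (u + v) = q u + q v"
      using q by (intro eq vec.subspace_add [OF W]) (auto simp: algebra_simps)
  next
    fix r v
    have "r *s (v - q v) \<in> E"
      using q by (intro vec.subspace_scale [OF E]) auto
    then show "q (r *s v) = r *s q v"
      using q by (intro eq vec.subspace_scale [OF W]) (auto simp: vec.scale_right_diff_distrib)
  qed
  then have "matrix q *v v = q v" for v
    by (rule matrix_works)
  moreover have "q w = w" if "w \<in> W" for w
    using that by (intro eq) (simp_all add: vec.subspace_0 [OF E])
  moreover have "q v = 0" if "v \<in> E" for v
    using that by (intro eq) (simp_all add: vec.subspace_0 [OF W])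
  ultimately have "is_proj E W (matrix q)"
    using q by (simp add: is_proj_def)
  then show ?thesis by blast
qed

lemma is_proj_transport:
  assumes P: "is_proj E W P" and gh: "h ** g = mat 1" "g ** h = mat 1"
  shows "is_proj ((*v) g ` E) ((*v) g ` W) (g ** P ** h)"
  unfolding is_proj_def
proof (intro conjI allI ballI)
  fix v
  have v: "v = g *v (h *v v)" by (simp add: matrix_vector_mul_assoc gh)
  have Pv: "(g ** P ** h) *v v = g *v (P *v (h *v v))"
    by (simp add: matrix_vector_mul_assoc matrix_mul_assoc)
  show "(g ** P ** h) *v v \<in> (*v) g ` W"
    unfolding Pv using is_projD(1) [OF P] by blast
  have "v - (g ** P ** h) *v v = g *v (h *v v - P *v (h *v v))"
    unfolding Pv by (simp add: mv.diff_right flip: v)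
  then show "v - (g ** P ** h) *v v \<in> (*v) g ` E"
    using is_projD(2) [OF P] by (metis imageI)
next
  fix w assume "w \<in> (*v) g ` W"
  then obtain w' where w: "w' \<in> W" "w = g *v w'" by blast
  have "(g ** P ** h) *v w = g *v (P *v ((h ** g) *v w'))"
    by (simp add: w matrix_vector_mul_assoc matrix_mul_assoc)
  then show "(g ** P ** h) *v w = w"
    using is_projD(3) [OF P w(1)] by (simp add: gh w)
next
  fix w assume "w \<in> (*v) g ` E"
  then obtain w' where w: "w' \<in> E" "w = g *v w'" by blast
  have "(g ** P ** h) *v w = g *v (P *v ((h ** g) *v w'))"
    by (simp add: w matrix_vector_mul_assoc matrix_mul_assoc)
  then show "(g ** P ** h) *v w = 0"
    using is_projD(4) [OF P w(1)] by (simp add: gh)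
qed


section \<open>Hodge--Tate structures\<close>

text \<open>The conditions on \<open>F\<close> say that \<open>F\<^sup>p\<close> is complementary to \<open>W\<^sub>2\<^sub>p\<^sub>-\<^sub>2\<close>. They characterize Hodge--Tate
  structures, up to the rationality of \<open>W\<close>, and unlike the decomposition into types they are easily
  carried over to limits.\<close>

definition ht_pair :: "(int \<Rightarrow> (complex^'n) set) \<Rightarrow> (int \<Rightarrow> (complex^'n) set) \<Rightarrow> bool" where
  "ht_pair F W \<longleftrightarrow>
     increasing_filtration W \<and> (\<forall>k. \<forall>v\<in>W k. conj_vec v \<in> W k) \<and> (\<forall>k. odd k \<longrightarrow> W k = W (k - 1)) \<and>
     (\<forall>p. vec.subspace (F p)) \<and> antimono F \<and>
     (\<forall>p. F p \<inter> W (2 * p - 2) = {0}) \<and> (\<forall>p v. \<exists>f\<in>F p. v - f \<in> W (2 * p - 2))"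

definition hodge_proj ::
  "(int \<Rightarrow> (complex^'n) set) \<Rightarrow> (int \<Rightarrow> (complex^'n) set) \<Rightarrow> (int \<Rightarrow> complex^'n^'n) \<Rightarrow> bool" where
  "hodge_proj F W P \<longleftrightarrow> (\<forall>b. is_proj (F (b + 1)) (W (2 * b)) (P b))"

abbreviation lo :: "(int \<Rightarrow> (complex^'n) set) \<Rightarrow> int" where "lo W \<equiv> wt_min W div 2"
abbreviation hi :: "(int \<Rightarrow> (complex^'n) set) \<Rightarrow> int" where "hi W \<equiv> wt_max W div 2"

lemma ht_pairD:
  assumes "ht_pair F W"
  shows "increasing_filtration W" "v \<in> W k \<Longrightarrow> conj_vec v \<in> W k" "odd k \<Longrightarrow> W k = W (k - 1)"
    "vec.subspace (F p)" "p \<le> q \<Longrightarrow> F q \<subseteq> F p" "F p \<inter> W (2 * p - 2) = {0}"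
    "\<exists>f\<in>F p. v - f \<in> W (2 * p - 2)"
  using assms unfolding ht_pair_def antimono_def by (blast+)

lemma ht_pair_hodge_proj:
  assumes "ht_pair F W" shows "\<exists>P. hodge_proj F W P"
proof -
  have "\<exists>P. is_proj (F (b + 1)) (W (2 * b)) P" for b
    using ht_pairD(6,7) [OF assms, of "b + 1"]
    by (intro is_proj_exists ht_pairD(4) [OF assms] increasing_filtration_subspace ht_pairD(1) [OF assms])
      simp_all
  then show ?thesis
    unfolding hodge_proj_def by metis
qed

lemma weight_range_even:
  assumes W: "increasing_filtration W" and odd: "\<And>k. odd k \<Longrightarrow> W k = W (k - 1)"
  shows "2 * hi W = wt_max W" "2 * lo W = wt_min W" "lo W \<le> hi W"
    "W (2 * hi W) = UNIV" "W (2 * lo W - 1) = {0}"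
proof -
  have "even (wt_max W)" "even (wt_min W)"
    using odd weight_range(1,2) [OF W] by blast+
  then show *: "2 * hi W = wt_max W" "2 * lo W = wt_min W" by auto
  show "lo W \<le> hi W"
    using weight_range(5) [OF W] by (rule zdiv_mono1) simp
  show "W (2 * hi W) = UNIV" "W (2 * lo W - 1) = {0}"
    unfolding * by (rule weight_range [OF W])+
qed

text \<open>The kernels \<open>F\<^sup>b\<^sup>+\<^sup>1\<close> decrease as \<open>b\<close> grows. The summands of the splitting are the spaces
  \<open>F\<^sup>b \<inter> W\<^sub>2\<^sub>b\<close>.\<close>

lemma hodge_proj_splitting:
  assumes ht: "ht_pair F W" and P: "hodge_proj F W P"
  shows "splitting W (lo W) (hi W) P"
proof -
  note W = ht_pairD(1,3) [OF ht]
  have Pb: "is_proj (F (b + 1)) (W (2 * b)) (P b)" for b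
    using P by (simp add: hodge_proj_def)
  have "P b ** P b' = P b" if "b \<le> b'" for b b'
  proof -
    have "P b *v (v - P b' *v v) = 0" for v
      using is_projD(2) [OF Pb, of v b'] ht_pairD(5) [OF ht, of "b + 1" "b' + 1"] that
      by (intro is_projD(4) [OF Pb]) auto
    then show ?thesis
      by (simp add: matrix_eq mv.diff_right flip: matrix_vector_mul_assoc)
  qed
  then show ?thesis
    unfolding splitting_def using W is_projD(1,3) [OF Pb] weight_range_even [OF W] by blast
qed

lemma hodge_proj_filtration:
  assumes ht: "ht_pair F W" and P: "hodge_proj F W P"
  shows "v \<in> F p \<longleftrightarrow> P (p - 1) *v v = 0"
proof -
  have "is_proj (F p) (W (2 * (p - 1))) (P (p - 1))"
    using P unfolding hodge_proj_def by (metis diff_add_cancel)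
  then show ?thesis by (simp add: is_proj_kernel)
qed

lemma A_points_conj: "v \<in> A_points A \<Longrightarrow> conj_vec v = v"
proof -
  assume v: "v \<in> A_points A"
  have "cnj (v $ i) = v $ i" for i
  proof -
    obtain r where "v $ i = complex_of_real r" using v by (auto simp: A_points_def)
    then show ?thesis by simp
  qed
  then show ?thesis by (simp add: conj_vec_def vec_eq_iff)
qed

lemma conj_vec_span_real:
  assumes "W = vec.span (W \<inter> A_points A)" "v \<in> W" shows "conj_vec v \<in> W"
proof -
  have sub: "vec.subspace W"
    using assms(1) vec.subspace_span by metis
  have "v \<in> vec.span (W \<inter> A_points A)" using assms by simp
  then show ?thesis
  proof (induction rule: vec.span_induct_alt)
    case base
    then show ?case by (simp add: conj_vec_0 vec.subspace_0 [OF sub])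
  next
    case (step r x y)
    then have "cnj r *s x + conj_vec y \<in> W"
      by (intro vec.subspace_add [OF sub] vec.subspace_scale [OF sub]) auto
    then show ?case
      using step by (simp add: conj_vec_add conj_vec_scale A_points_conj [of x A])
  qed
qed

lemma sum_sets_absorb:
  assumes "vec.subspace E" "vec.subspace E'" "E' \<subseteq> E"
  shows "sum_sets E E' = E" "sum_sets E' E = E"
proof -
  have v: "v = v + 0" "v = 0 + v" for v :: "complex^'n" by simp_all
  have 0: "0 \<in> E'" using assms(2) by (rule vec.subspace_0)
  have "u + v \<in> E" "v + u \<in> E" if "u \<in> E" "v \<in> E'" for u v
    using vec.subspace_add [OF assms(1)] that assms(3) by auto
  then show "sum_sets E E' = E" "sum_sets E' E = E"
    unfolding sum_sets_def using v 0 by blast+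
qed

text \<open>As \<open>Gr\<^sub>2\<^sub>q\<close> is purely of type \<open>(q, q)\<close>, the filtration induced by \<open>F\<^sup>p\<close> on it is everything for
  \<open>p \<le> q\<close> and zero otherwise.\<close>

lemma mhs_ht_pair:
  assumes mhs: "is_mhs A F W" and ht: "hodge_tate F W"
  shows "ht_pair F W"
proof -
  note mhs' = mhs [unfolded is_mhs_def decreasing_filtration_def]
  note F = mhs' [THEN conjunct1] and incr = mhs' [THEN conjunct2, THEN conjunct1]
  note span = mhs' [THEN conjunct2, THEN conjunct2, THEN conjunct1, THEN spec]
  note opp = mhs' [THEN conjunct2, THEN conjunct2, THEN conjunct2, THEN spec, THEN spec, THEN conjunct1]
  have odd: "odd k \<Longrightarrow> W k = W (k - 1)" for k
    using ht unfolding hodge_tate_def by blast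
  have off: "p \<noteq> q \<Longrightarrow> hodge_comp F W p q = W (p + q - 1)" for p q
    using ht unfolding hodge_tate_def by blast
  have real: "conj_vec v \<in> W k" if "v \<in> W k" for v k
    using conj_vec_span_real [OF span that] .
  have conj: "conj_vec ` W k = W k" for k
    using real by (auto intro!: image_eqI [of _ conj_vec "conj_vec x" for x])
  have subF: "vec.subspace (F p)" for p
    using increasing_filtration_subspace [OF F, of "- p"] by simp
  have decr: "F q \<subseteq> F p" if "p \<le> q" for p q
    using increasing_filtration_mono [OF F, of "- q" "- p"] that by simp
  have subW: "vec.subspace (W k)" for k
    by (rule increasing_filtration_subspace [OF incr])
  have mono: "W k \<subseteq> W l" if "k \<le> l" for k l
    by (rule increasing_filtration_mono [OF incr that])
  have gr_sub: "W (k - 1) \<subseteq> F_gr F W p k" "F_gr F W p k \<subseteq> W k" for p k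
  proof -
    have "w = 0 + w" for w :: "complex^'n" by simp
    moreover have "0 \<in> F p \<inter> W k" using subF subW by (simp add: vec.subspace_0)
    ultimately show "W (k - 1) \<subseteq> F_gr F W p k" unfolding F_gr_def sum_sets_def by blast
    show "F_gr F W p k \<subseteq> W k"
      unfolding F_gr_def sum_sets_def using mono [of "k - 1" k] by (auto intro!: vec.subspace_add [OF subW])
  qed
  have absorb: "sum_sets (W (k - 1)) X = X" if "W (k - 1) \<subseteq> X" "vec.subspace X" for X k
    using sum_sets_absorb [OF that(2) subW that(1)] by simp
  have gr_subspace: "vec.subspace (F_gr F W p k)" for p k
  proof -
    have "F_gr F W p k = {x + y | x y. x \<in> F p \<inter> W k \<and> y \<in> W (k - 1)}"
      by (simp add: F_gr_def sum_sets_def)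
    also have "vec.subspace \<dots>"
      by (intro vec.subspace_sums vec.subspace_inter subF subW)
    finally show ?thesis .
  qed
  have conj_subspace: "vec.subspace (conj_vec ` X)" if X: "vec.subspace X" for X :: "(complex^'n) set"
    unfolding vec.subspace_def
  proof (intro conjI allI ballI)
    show "0 \<in> conj_vec ` X"
      using vec.subspace_0 [OF X] conj_vec_0 by (metis imageI)
    show "x + y \<in> conj_vec ` X" if "x \<in> conj_vec ` X" "y \<in> conj_vec ` X" for x y
      using that vec.subspace_add [OF X] by (auto simp flip: conj_vec_add)
    show "c *s x \<in> conj_vec ` X" if "x \<in> conj_vec ` X" for c x
    proof -
      from that obtain y where "y \<in> X" "x = conj_vec y" by blast
      then have "c *s x = conj_vec (cnj c *s y)" "cnj c *s y \<in> X"
        using vec.subspace_scale [OF X] by (simp_all add: conj_vec_scale)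
      then show ?thesis by blast
    qed
  qed
  \<comment> \<open>A graded piece of weight \<open>k\<close> with \<open>F\<^sup>p\<^sup>+\<^sup>1 = 0\<close> has \<open>conj F\<^sup>k\<^sup>-\<^sup>p\<close> equal to the whole piece, so
     that \<open>F\<^sup>p\<close> is the component of type \<open>(p, k - p)\<close>.\<close>
  have low: "F_gr F W p k = W (k - 1)" if "k < 2 * p" for p k
  proof -
    obtain q0 where q0: "F (- q0) = {0}"
      using F by (auto simp: increasing_filtration_def)
    define n where "n = nat (max (- q0) p - p)"
    have "F (p + int n) \<subseteq> {0}"
      unfolding q0 [symmetric] n_def by (intro decr) simp
    then show ?thesis using that
    proof (induction n arbitrary: p)
      case 0
      then have "F p \<inter> W k = {0}"
        using subF [of p] subW [of k] by (auto simp: vec.subspace_0)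
      then show ?case
        by (simp add: F_gr_def sum_sets_def)
    next
      case (Suc n)
      have "F_gr F W (p + 1) k = W (k - 1)"
        using Suc.prems by (intro Suc.IH) (simp_all add: algebra_simps)
      then have "conj_vec ` F_gr F W (k - p) k = W k"
        using opp [of "p + 1" k] absorb [OF _ conj_subspace [OF gr_subspace], of k "k - p" k]
          image_mono [OF gr_sub(1) [of k "k - p"], of conj_vec] conj
        by simp
      moreover have "hodge_comp F W p (k - p) = W (k - 1)"
        using off [of p "k - p"] Suc.prems by simp
      ultimately have "F_gr F W p k \<inter> W k = W (k - 1)"
        by (simp add: hodge_comp_def)
      then show ?case using gr_sub(2) [of p k] by blast
    qed
  qed
  have high: "F_gr F W p k = W k" if "2 * p \<le> k" for p k
  proof -
    have "F_gr F W (k + 1 - p) k = W (k - 1)"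
      using that by (intro low) simp
    then have *: "conj_vec ` F_gr F W p k = W k"
      using opp [of "k + 1 - p" k] absorb [OF _ conj_subspace [OF gr_subspace], of k p k]
        image_mono [OF gr_sub(1) [of k p], of conj_vec] conj
      by simp
    have "conj_vec ` conj_vec ` F_gr F W p k = W k" unfolding * by (rule conj)
    then show ?thesis by (simp add: image_image)
  qed
  obtain l u where l: "W l = {0}" and u: "W u = UNIV"
    using incr by (auto simp: increasing_filtration_def)
  have int: "F p \<inter> W (2 * p - 2) \<subseteq> {0}" for p
  proof -
    have "F p \<inter> W k \<subseteq> {0}" if "k \<le> 2 * p - 2" for k
    proof -
      have "F p \<inter> W k \<subseteq> W (k - int n)" for n
      proof (induction n)
        case (Suc n)
        show ?case
        proof
          fix v assume v: "v \<in> F p \<inter> W k"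
          then have "v \<in> F p \<inter> W (k - int n)" using Suc by blast
          moreover have "v = v + 0" by simp
          moreover have "0 \<in> W (k - int n - 1)" by (rule vec.subspace_0 [OF subW])
          ultimately have "v \<in> F_gr F W p (k - int n)"
            unfolding F_gr_def sum_sets_def by blast
          moreover have "F_gr F W p (k - int n) = W (k - int n - 1)"
            using that by (intro low) simp
          ultimately have "v \<in> W (k - int n - 1)" by simp
          then show "v \<in> W (k - int (Suc n))"
            by (simp add: algebra_simps)
        qed
      qed simp
      then have *: "F p \<inter> W k \<subseteq> W (k - int (nat (k - l)))" .
      show ?thesis
      proof (cases "l \<le> k")
        case True
        then show ?thesis using * by (simp add: l)
      next
        case False
        then show ?thesis using mono [of k l] l by auto
      qed
    qed
    then show ?thesis by blast
  qed
  have dec: "\<exists>f\<in>F p. v - f \<in> W (2 * p - 2)" for p v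
  proof -
    have "\<exists>f\<in>F p. v - f \<in> W (2 * p - 2)" if "v \<in> W (2 * p - 2 + int n)" for n v
      using that
    proof (induction n arbitrary: v)
      case 0
      then show ?case using vec.subspace_0 [OF subF] by (intro bexI [of _ 0]) simp_all
    next
      case (Suc n)
      define k where "k = 2 * p - 2 + int (Suc n)"
      have k1: "k - 1 = 2 * p - 2 + int n" by (simp add: k_def)
      have "\<exists>f\<in>F p. v - f \<in> W (k - 1)"
      proof (cases "odd k")
        case True
        then show ?thesis
          using Suc.prems odd [of k] vec.subspace_0 [OF subF, of p]
          by (intro bexI [of _ 0]) (simp_all add: k_def)
      next
        case False
        then have "2 * p \<le> k" unfolding k_def by presburger
        then have "v \<in> F_gr F W p k"
          using high Suc.prems by (simp add: k_def)
        then obtain f w where "f \<in> F p" "w \<in> W (k - 1)" "v = f + w"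
          unfolding F_gr_def sum_sets_def by blast
        then show ?thesis by (intro bexI [of _ f]) simp_all
      qed
      then obtain f where f: "f \<in> F p" "v - f \<in> W (k - 1)" by blast
      from Suc.IH [of "v - f"] f(2) obtain f' where f': "f' \<in> F p" "v - f - f' \<in> W (2 * p - 2)"
        unfolding k1 by blast
      have "f + f' \<in> F p" using f(1) f'(1) by (rule vec.subspace_add [OF subF])
      then show ?case
        using f'(2) by (intro bexI [of _ "f + f'"]) (simp_all add: algebra_simps)
    qed
    moreover have "UNIV \<subseteq> W (2 * p - 2 + int (nat (u - (2 * p - 2))))"
      unfolding u [symmetric] by (rule mono) simp
    ultimately show ?thesis by blast
  qed
  have "F p \<inter> W (2 * p - 2) = {0}" for p
    using int [of p] vec.subspace_0 [OF subF] vec.subspace_0 [OF subW] by blast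
  then show ?thesis
    unfolding ht_pair_def antimono_def using incr real odd subF decr dec by blast
qed

text \<open>The filtration induced by \<open>F\<^sup>p\<close> on \<open>Gr\<^sub>2\<^sub>q\<close> is everything for \<open>p \<le> q\<close> and zero for \<open>p > q\<close>.\<close>

lemma ht_pair_mhs:
  assumes ht: "ht_pair F W" and span: "\<And>k. W k = vec.span (W k \<inter> A_points A)"
  shows "is_mhs A F W" "hodge_tate F W"
proof -
  note incr = ht_pairD(1) [OF ht] and real = ht_pairD(2) [OF ht] and odd = ht_pairD(3) [OF ht]
    and subF = ht_pairD(4) [OF ht] and decr = ht_pairD(5) [OF ht]
  have subW: "vec.subspace (W k)" for k
    by (rule increasing_filtration_subspace [OF incr])
  have mono: "W k \<subseteq> W l" if "k \<le> l" for k l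
    by (rule increasing_filtration_mono [OF incr that])
  have conj: "conj_vec ` W k = W k" for k
    using real by (auto intro!: image_eqI [of _ conj_vec "conj_vec x" for x])
  have gr: "F_gr F W p k = (if 2 * p \<le> k then W k else W (k - 1))" for p k
  proof -
    have sub: "W (k - 1) \<subseteq> F_gr F W p k" "F_gr F W p k \<subseteq> W k"
    proof -
      have "w = 0 + w" for w :: "complex^'n" by simp
      moreover have "0 \<in> F p \<inter> W k" using subF subW by (simp add: vec.subspace_0)
      ultimately show "W (k - 1) \<subseteq> F_gr F W p k" unfolding F_gr_def sum_sets_def by blast
      show "F_gr F W p k \<subseteq> W k"
        unfolding F_gr_def sum_sets_def using mono [of "k - 1" k] by (auto intro!: vec.subspace_add [OF subW])
    qed
    show ?thesis
    proof (cases "odd k")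
      case True
      then show ?thesis using sub odd [OF True] by auto
    next
      case even: False
      show ?thesis
      proof (cases "2 * p \<le> k")
        case True
        have "W k \<subseteq> F_gr F W p k"
        proof
          fix v assume v: "v \<in> W k"
          obtain q where q: "k = 2 * q" using even by blast
          obtain f where f: "f \<in> F q" "v - f \<in> W (k - 2)"
            using ht_pairD(7) [OF ht, of q v] q by auto
          then have f': "f \<in> F p" "v - f \<in> W (k - 1)"
            using decr [of p q] mono [of "k - 2" "k - 1"] True q by auto
          have "v - (v - f) \<in> W k"
            by (rule vec.subspace_diff [OF subW v]) (use f'(2) mono [of "k - 1" k] in auto)
          then have "f \<in> F p \<inter> W k" using f' by simp
          moreover have "v = f + (v - f)" by simp
          ultimately show "v \<in> F_gr F W p k"
            unfolding F_gr_def sum_sets_def using f'(2) by blast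
        qed
        then show ?thesis using True sub by auto
      next
        case False
        have "F p \<inter> W k \<subseteq> {0}"
          using ht_pairD(6) [OF ht, of p] mono [of k "2 * p - 2"] False even by fastforce
        then have "F_gr F W p k \<subseteq> W (k - 1)"
          unfolding F_gr_def sum_sets_def by auto
        then show ?thesis using False sub by auto
      qed
    qed
  qed
  have conj_gr: "conj_vec ` F_gr F W p k = F_gr F W p k" for p k
    by (simp add: gr conj)
  have sums: "sum_sets (W k) (W l) = W (max k l)" for k l
    using sum_sets_absorb [OF subW subW mono] by (cases "k \<le> l") (auto simp: max_def)
  obtain l u where l: "W l = {0}" and u: "W u = UNIV"
    using incr by (auto simp: increasing_filtration_def)
  have Fu: "F (max 0 u + 1) \<subseteq> {0}"
  proof -
    have "UNIV \<subseteq> W (2 * (max 0 u + 1) - 2)"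
      unfolding u [symmetric] by (rule mono) simp
    then show ?thesis
      using ht_pairD(6) [OF ht, of "max 0 u + 1"] by blast
  qed
  have Fl: "F (min 0 l) = UNIV"
  proof -
    have "W (2 * min 0 l - 2) \<subseteq> {0}"
      unfolding l [symmetric] by (rule mono) simp
    then have "v \<in> F (min 0 l)" for v
      using ht_pairD(7) [OF ht, of "min 0 l" v] by fastforce
    then show ?thesis by blast
  qed
  have "F (max 0 u + 1) = {0}"
    using Fu vec.subspace_0 [OF subF] by blast
  then have "\<exists>k. F (- k) = {0}" by (metis minus_minus)
  moreover have "\<exists>k. F (- k) = UNIV" using Fl by (intro exI [of _ "- min 0 l"]) simp
  moreover have "mono (\<lambda>k. F (- k))"
    by (intro monoI decr) simp
  ultimately have "decreasing_filtration F"
    unfolding decreasing_filtration_def increasing_filtration_def using subF by blast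
  moreover have "sum_sets (F_gr F W p k) (conj_vec ` F_gr F W (k + 1 - p) k) = W k \<and>
        F_gr F W p k \<inter> conj_vec ` F_gr F W (k + 1 - p) k = W (k - 1)" for p k
  proof (cases "odd k")
    case True
    then show ?thesis
      unfolding conj_gr gr using odd [OF True] by (simp add: sums conj)
  next
    case False
    then have "2 * (k + 1 - p) \<le> k \<longleftrightarrow> \<not> 2 * p \<le> k" by presburger
    then show ?thesis
      unfolding conj_gr gr using mono [of "k - 1" k] by (auto simp: sums conj)
  qed
  ultimately show "is_mhs A F W"
    unfolding is_mhs_def using incr span by blast
  have "hodge_comp F W p q = W (p + q - 1)" if "p \<noteq> q" for p q
    unfolding hodge_comp_def gr using conj that mono [of "p + q - 1" "p + q"] by auto
  then show "hodge_tate F W"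
    unfolding hodge_tate_def using odd by blast
qed


section \<open>The Deligne bigrading and the height of a Hodge--Tate structure\<close>

lemma span_UN_sum:
  assumes sub: "\<And>i. vec.subspace (I i)" and v: "v \<in> vec.span (\<Union>i\<in>A. I i)"
  shows "\<exists>J c. finite J \<and> J \<subseteq> A \<and> (\<forall>i. c i \<in> I i) \<and> (\<forall>i. i \<notin> J \<longrightarrow> c i = 0) \<and> v = sum c J"
  using v
proof (induction rule: vec.span_induct_alt)
  case base
  show ?case
    by (intro exI [of _ "{}"] exI [of _ "\<lambda>_. 0"]) (simp add: vec.subspace_0 [OF sub])
next
  case (step r x y)
  then obtain J c where J: "finite J" "J \<subseteq> A" "\<forall>i. c i \<in> I i" "\<forall>i. i \<notin> J \<longrightarrow> c i = 0" "y = sum c J"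
    by blast
  obtain i where i: "i \<in> A" "x \<in> I i" using step by blast
  define d where "d = c(i := r *s x + c i)"
  have "\<forall>j. d j \<in> I j"
    using J(3) i by (auto simp: d_def intro!: vec.subspace_add [OF sub] vec.subspace_scale [OF sub])
  moreover have "sum d (insert i J) = r *s x + y"
  proof -
    have "y = sum c (insert i J)"
      using J by (simp add: sum.insert_if)
    then show ?thesis
      using J(1) by (simp add: d_def sum.insert_remove add.assoc)
  qed
  ultimately show ?case
    using J(1,2,4) i by (intro exI [of _ "insert i J"] exI [of _ d]) (auto simp: d_def)
qed

lemma bigrading_Int:
  assumes I: "bigrading I" and A: "v \<in> vec.span (\<Union>i\<in>A. I i)" and B: "v \<in> vec.span (\<Union>i\<in>B. I i)"
  shows "v \<in> vec.span (\<Union>i\<in>A \<inter> B. I i)"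
proof -
  have sub: "vec.subspace (I i)" for i
    using I unfolding bigrading_def by blast
  obtain J c where J: "finite J" "J \<subseteq> A" "\<forall>i. c i \<in> I i" "\<forall>i. i \<notin> J \<longrightarrow> c i = 0" "v = sum c J"
    using span_UN_sum [OF sub A] by blast
  obtain J' d where J': "finite J'" "J' \<subseteq> B" "\<forall>i. d i \<in> I i" "\<forall>i. i \<notin> J' \<longrightarrow> d i = 0" "v = sum d J'"
    using span_UN_sum [OF sub B] by blast
  have "v = sum c (J \<union> J')" "v = sum d (J \<union> J')"
    unfolding J(5) by (rule sum.mono_neutral_left, use J J' in auto)
      (unfold J(5) [symmetric] J'(5), rule sum.mono_neutral_left, use J J' in auto)
  then have "(\<Sum>i\<in>J \<union> J'. c i - d i) = 0"
    by (simp add: sum_subtractf)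
  moreover have "\<forall>i\<in>J \<union> J'. c i - d i \<in> I i"
    using J(3) J'(3) by (auto intro: vec.subspace_diff [OF sub])
  ultimately have *: "\<forall>i\<in>J \<union> J'. c i - d i = 0"
    using I J(1) J'(1) unfolding bigrading_def by (metis (no_types, lifting) finite_UnI)
  have "v = sum c (J \<inter> J')"
    unfolding J(5) by (rule sum.mono_neutral_right) (use J J' * in auto)
  also have "\<dots> \<in> vec.span (\<Union>i\<in>A \<inter> B. I i)"
    using J(2,3) J'(2) by (intro vec.span_sum vec.span_base) blast
  finally show ?thesis .
qed

definition ht_bigrading :: "(int \<Rightarrow> complex^'n^'n) \<Rightarrow> int \<times> int \<Rightarrow> (complex^'n) set" where
  "ht_bigrading P = (\<lambda>(p, q). if p = q then {v. summand P p *v v = v} else {0})"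

lemma ht_bigrading_diag [simp]: "v \<in> ht_bigrading P (p, p) \<longleftrightarrow> summand P p *v v = v"
  by (simp add: ht_bigrading_def)

lemma ht_bigrading_off: "p \<noteq> q \<Longrightarrow> ht_bigrading P (p, q) = {0}"
  by (simp add: ht_bigrading_def)

lemma ht_bigrading_subspace: "vec.subspace (ht_bigrading P j)"
  by (cases j) (auto simp: ht_bigrading_def vec.subspace_def mv.add_right matrix_mult_scale_vec)

definition weight_op :: "int \<Rightarrow> int \<Rightarrow> (int \<Rightarrow> complex^'n^'n) \<Rightarrow> complex^'n^'n" where
  "weight_op c a P = (\<Sum>b=c..a. scale_mat (of_int (2 * b)) (summand P b))"

context
  fixes F W :: "int \<Rightarrow> (complex^'n) set" and P :: "int \<Rightarrow> complex^'n^'n"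
  assumes ht: "ht_pair F W" and P: "hodge_proj F W P"
begin

abbreviation (input) "c \<equiv> lo W"
abbreviation (input) "a \<equiv> hi W"
abbreviation (input) "I \<equiv> ht_bigrading P"

lemmas spl = hodge_proj_splitting [OF ht P]
lemmas ht_incr = ht_pairD(1) [OF ht]

lemma summand_in_bigrading: "summand P b *v v \<in> I (b, b)"
  by (simp add: matrix_vector_mul_assoc summand_mult [OF spl])

lemma summand_on_bigrading: "v \<in> I (b, b) \<Longrightarrow> summand P b' *v v = (if b' = b then v else 0)"
  by (simp, metis matrix_vector_mul_assoc summand_mult [OF spl] matrix_vector_mult_0)

lemma ht_bigrading_inter: "I (b, b) = F b \<inter> W (2 * b)"
proof -
  have "summand P b *v v = v \<longleftrightarrow> v \<in> F b \<and> v \<in> W (2 * b)" for v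
  proof
    assume v: "summand P b *v v = v"
    have "P (b - 1) ** summand P b = 0"
      using spl_mult_le [OF spl, of "b - 1" b] spl_mult_le [OF spl, of "b - 1" "b - 1"]
      by (simp add: summand_def mm.diff_right)
    then have "P (b - 1) *v v = 0"
      using v by (metis matrix_vector_mul_assoc matrix_vector_mult_0)
    then show "v \<in> F b \<and> v \<in> W (2 * b)"
      using summand_range [OF spl, of b v] v by (simp add: hodge_proj_filtration [OF ht P])
  next
    assume "v \<in> F b \<and> v \<in> W (2 * b)"
    then show "summand P b *v v = v"
      by (simp add: hodge_proj_filtration [OF ht P] summand_def mv.diff_left spl_id [OF spl])
  qed
  then show ?thesis by (intro set_eqI) (simp only: ht_bigrading_diag Int_iff)
qed

lemma sum_summand_vec: "v = (\<Sum>b=c..a. summand P b *v v)"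
  by (simp add: sum_summand_one [OF spl] flip: mv.sum_left)

lemma summands_in_span:
  "(\<And>b. b \<in> B \<Longrightarrow> (b, b) \<in> A) \<Longrightarrow> (\<Sum>b\<in>B. summand P b *v v) \<in> vec.span (\<Union>i\<in>A. I i)"
  using summand_in_bigrading by (intro vec.span_sum vec.span_base) blast

lemma ht_bigrading_bigrading: "bigrading I"
  unfolding bigrading_def
proof (intro conjI allI impI ballI)
  show "vec.subspace (I j)" for j by (rule ht_bigrading_subspace)
  have "v \<in> vec.span (\<Union>j\<in>UNIV. I j)" for v
    by (subst sum_summand_vec) (rule summands_in_span, simp)
  then show "vec.span (\<Union>j. I j) = UNIV" by auto
  fix J f j assume J: "finite J \<and> (\<forall>j\<in>J. f j \<in> I j) \<and> sum f J = 0" "j \<in> J"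
  obtain b b' where j: "j = (b, b')" by fastforce
  show "f j = 0"
  proof (cases "b = b'")
    case False
    then show ?thesis using J j ht_bigrading_off by fastforce
  next
    case True
    have "summand P b *v f i = (if i = j then f j else 0)" if "i \<in> J" for i
    proof -
      obtain d d' where i: "i = (d, d')" by fastforce
      have fi: "f i \<in> I (d, d')" using J that i by auto
      show ?thesis
        using summand_on_bigrading [of "f i" d b] fi i j True ht_bigrading_off [of d d' P]
        by (cases "d = d'") auto
    qed
    then have "summand P b *v sum f J = (\<Sum>i\<in>J. if i = j then f j else 0)"
      by (simp add: mv.sum_right)
    then show ?thesis using J by (simp add: mv.zero_right)
  qed
qed

lemma W_span: "W k = vec.span (\<Union>i\<in>A. I i)"
  if "\<And>p q. (p, q) \<in> A \<Longrightarrow> p = q \<Longrightarrow> 2 * p \<le> k" "\<And>p. 2 * p \<le> k \<Longrightarrow> (p, p) \<in> A"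
proof
  show "W k \<subseteq> vec.span (\<Union>i\<in>A. I i)"
  proof
    fix v assume "v \<in> W k"
    then show "v \<in> vec.span (\<Union>i\<in>A. I i)"
      by (subst W_decomposition [OF spl]) (auto intro!: summands_in_span that)
  qed
  show "vec.span (\<Union>i\<in>A. I i) \<subseteq> W k"
  proof (rule vec.span_minimal [OF _ increasing_filtration_subspace [OF ht_incr]])
    have "I (p, q) \<subseteq> W k" if "(p, q) \<in> A" for p q
    proof (cases "p = q")
      case True
      then have "W (2 * p) \<subseteq> W k"
        using that \<open>\<And>p q. (p, q) \<in> A \<Longrightarrow> p = q \<Longrightarrow> 2 * p \<le> k\<close> by (intro increasing_filtration_mono [OF ht_incr]) auto
      then show ?thesis using True by (auto simp only: ht_bigrading_inter)
    next
      case False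
      then show ?thesis by (simp add: ht_bigrading_off filtration_subspace_simps [OF ht_incr])
    qed
    then show "(\<Union>i\<in>A. I i) \<subseteq> W k" by auto
  qed
qed

text \<open>Both \<open>I (b, b)\<close> and its conjugate are complements of \<open>W\<^sub>2\<^sub>b\<^sub>-\<^sub>2\<close> in \<open>W\<^sub>2\<^sub>b\<close>, which gives the condition on
  complex conjugation.\<close>

lemma ht_bigrading_deligne: "is_deligne_bigrading F W I"
  unfolding is_deligne_bigrading_def
proof (intro conjI allI)
  show "bigrading I" by (rule ht_bigrading_bigrading)
  fix p
  have eq: "(\<Union>(\<alpha>, \<beta>)\<in>A. I (\<alpha>, \<beta>)) = (\<Union>i\<in>A. I i)" for A by auto
  show "F p = vec.span (\<Union>(\<alpha>, \<beta>)\<in>{(\<alpha>, \<beta>). p \<le> \<alpha>}. I (\<alpha>, \<beta>))"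
    unfolding eq
  proof
    show "F p \<subseteq> vec.span (\<Union>i\<in>{(\<alpha>, \<beta>). p \<le> \<alpha>}. I i)"
    proof
      fix v assume "v \<in> F p"
      then have Pv: "P (p - 1) *v v = 0" by (simp add: hodge_proj_filtration [OF ht P])
      have "summand P b *v v = 0" if "b < p" for b
      proof -
        have "P b ** P (p - 1) = P b" "P (b - 1) ** P (p - 1) = P (b - 1)"
          using that by (intro spl_mult_le [OF spl]; simp)+
        then have "P b *v v = P b *v (P (p - 1) *v v)" "P (b - 1) *v v = P (b - 1) *v (P (p - 1) *v v)"
          by (simp_all add: matrix_vector_mul_assoc)
        then show ?thesis by (simp add: Pv summand_def mv.diff_left)
      qed
      then have "v = (\<Sum>b\<in>{c..a} \<inter> {p..}. summand P b *v v)"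
        by (subst sum_summand_vec, intro sum.mono_neutral_right) auto
      also have "\<dots> \<in> vec.span (\<Union>i\<in>{(\<alpha>, \<beta>). p \<le> \<alpha>}. I i)"
        by (rule summands_in_span) auto
      finally show "v \<in> vec.span (\<Union>i\<in>{(\<alpha>, \<beta>). p \<le> \<alpha>}. I i)" .
    qed
    show "vec.span (\<Union>i\<in>{(\<alpha>, \<beta>). p \<le> \<alpha>}. I i) \<subseteq> F p"
    proof (rule vec.span_minimal [OF _ ht_pairD(4) [OF ht]])
      have "I (x, y) \<subseteq> F p" if "p \<le> x" for x y
      proof (cases "x = y")
        case True
        then show ?thesis using ht_pairD(5) [OF ht that] by (auto simp only: ht_bigrading_inter)
      next
        case False
        then show ?thesis by (simp add: ht_bigrading_off vec.subspace_0 [OF ht_pairD(4) [OF ht]])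
      qed
      then show "(\<Union>i\<in>{(\<alpha>, \<beta>). p \<le> \<alpha>}. I i) \<subseteq> F p" by auto
    qed
  qed
  show "W p = vec.span (\<Union>(\<alpha>, \<beta>)\<in>{(\<alpha>, \<beta>). \<alpha> + \<beta> \<le> p}. I (\<alpha>, \<beta>))"
    unfolding eq by (rule W_span) auto
  fix q
  define R where "R = vec.span (\<Union>i\<in>{(\<beta>, \<alpha>). \<beta> < q \<and> \<alpha> < p}. I i)"
  have "sum_sets (conj_vec ` I (p, q)) R = sum_sets (I (q, p)) R"
  proof (cases "p = q")
    case False
    then show ?thesis by (simp add: ht_bigrading_off conj_vec_0)
  next
    case True
    have R: "R = W (2 * p - 2)"
      unfolding R_def True by (rule W_span [symmetric]) auto
    have WR: "W (2 * p - 2) \<subseteq> W (2 * p)"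
      by (rule increasing_filtration_mono [OF ht_incr]) simp
    have dec: "v = summand P p *v v + P (p - 1) *v v" "P (p - 1) *v v \<in> R" if "v \<in> W (2 * p)" for v
      using that spl_range [OF spl, of "p - 1" v]
      by (simp_all add: summand_def mv.diff_left spl_id [OF spl] R algebra_simps)
    have "sum_sets (I (p, p)) R = W (2 * p)"
    proof
      show "sum_sets (I (p, p)) R \<subseteq> W (2 * p)"
        using WR unfolding sum_sets_def ht_bigrading_inter R
        by (auto intro!: filtration_subspace_simps [OF ht_incr])
      show "W (2 * p) \<subseteq> sum_sets (I (p, p)) R"
        using dec summand_in_bigrading unfolding sum_sets_def by blast
    qed
    moreover have "sum_sets (conj_vec ` I (p, p)) R = W (2 * p)"
    proof
      show "sum_sets (conj_vec ` I (p, p)) R \<subseteq> W (2 * p)"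
        using WR ht_pairD(2) [OF ht] unfolding sum_sets_def ht_bigrading_inter R
        by (auto intro!: filtration_subspace_simps [OF ht_incr])
      show "W (2 * p) \<subseteq> sum_sets (conj_vec ` I (p, p)) R"
      proof
        fix v assume "v \<in> W (2 * p)"
        then have v: "conj_vec v \<in> W (2 * p)" by (rule ht_pairD(2) [OF ht])
        have "v = conj_vec (conj_vec v)" by simp
        also have "\<dots> = conj_vec (summand P p *v conj_vec v) + conj_vec (P (p - 1) *v conj_vec v)"
          by (subst dec(1) [OF v]) (simp add: conj_vec_add)
        finally show "v \<in> sum_sets (conj_vec ` I (p, p)) R"
          using summand_in_bigrading dec(2) [OF v] ht_pairD(2) [OF ht] unfolding sum_sets_def R by blast
      qed
    qed
    ultimately show ?thesis using True by simp
  qed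
  then show "let R = vec.span (\<Union>(\<beta>, \<alpha>)\<in>{(\<beta>, \<alpha>). \<beta> < q \<and> \<alpha> < p}. I (\<beta>, \<alpha>))
       in sum_sets (conj_vec ` I (p, q)) R = sum_sets (I (q, p)) R"
    by (simp add: R_def eq Let_def)
qed

text \<open>A component of type \<open>(p, q)\<close> with \<open>p > q\<close> is contained in \<open>F\<^sup>p \<inter> W\<^sub>2\<^sub>p\<^sub>-\<^sub>2 = 0\<close>. If \<open>p < q\<close> it vanishes because
  the whole space is \<open>F\<^sup>p\<^sup>+\<^sup>1 + W\<^sub>2\<^sub>p\<close>, which is a sum of other components.\<close>

lemma deligne_bigrading_unique:
  assumes I': "is_deligne_bigrading F W I'" shows "I' = I"
proof -
  have eq: "(\<Union>(\<alpha>, \<beta>)\<in>A. I' (\<alpha>, \<beta>)) = (\<Union>i\<in>A. I' i)" for A by auto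
  have big: "bigrading I'"
    and F: "\<And>p. F p = vec.span (\<Union>i\<in>{(\<alpha>, \<beta>). p \<le> \<alpha>}. I' i)"
    and W: "\<And>k. W k = vec.span (\<Union>i\<in>{(\<alpha>, \<beta>). \<alpha> + \<beta> \<le> k}. I' i)"
    using I' [unfolded is_deligne_bigrading_def eq, THEN conjunct1]
      I' [unfolded is_deligne_bigrading_def eq, THEN conjunct2, THEN conjunct1, THEN spec]
      I' [unfolded is_deligne_bigrading_def eq, THEN conjunct2, THEN conjunct2, THEN conjunct1, THEN spec] .
  have sub: "vec.subspace (I' j)" for j
    using big unfolding bigrading_def by blast
  have off: "I' (p, q) = {0}" if "p \<noteq> q" for p q
  proof -
    have "v = 0" if v: "v \<in> I' (p, q)" for v
    proof (cases "q < p")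
      case True
      have "v \<in> F p" unfolding F using v by (intro vec.span_base) auto
      moreover have "v \<in> W (p + q)" unfolding W using v by (intro vec.span_base) auto
      then have "v \<in> W (2 * p - 1)"
        using increasing_filtration_mono [OF ht_incr, of "p + q" "2 * p - 1"] True by auto
      then have "v \<in> W (2 * p - 2)"
        using ht_pairD(3) [OF ht, of "2 * p - 1"] by simp
      ultimately show ?thesis using ht_pairD(6) [OF ht, of p] by blast
    next
      case False
      then have "p < q" using \<open>p \<noteq> q\<close> by simp
      obtain f where f: "f \<in> F (p + 1)" "v - f \<in> W (2 * p)"
        using ht_pairD(7) [OF ht, of "p + 1" v] by auto
      let ?A = "{(\<alpha>, \<beta>). p + 1 \<le> \<alpha>} \<union> {(\<alpha>, \<beta>). \<alpha> + \<beta> \<le> 2 * p}"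
      have "f \<in> vec.span (\<Union>i\<in>?A. I' i)" "v - f \<in> vec.span (\<Union>i\<in>?A. I' i)"
        using f unfolding F W by (auto elim!: vec.span_mono [THEN subsetD, rotated])
      then have "f + (v - f) \<in> vec.span (\<Union>i\<in>?A. I' i)"
        by (rule vec.span_add)
      moreover have "v \<in> vec.span (\<Union>i\<in>{(p, q)}. I' i)"
        using v by (intro vec.span_base) simp
      ultimately have "v \<in> vec.span (\<Union>i\<in>{(p, q)} \<inter> ?A. I' i)"
        by (intro bigrading_Int [OF big]) simp_all
      moreover have "{(p, q)} \<inter> ?A = {}" using \<open>p < q\<close> by auto
      ultimately show ?thesis by simp
    qed
    then show ?thesis using vec.subspace_0 [OF sub] by blast
  qed
  have "I' (p, p) = F p \<inter> W (2 * p)" for p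
  proof
    show "I' (p, p) \<subseteq> F p \<inter> W (2 * p)"
      unfolding F W by (intro subsetI IntI vec.span_base UN_I [of "(p, p)"]) auto
    show "F p \<inter> W (2 * p) \<subseteq> I' (p, p)"
    proof
      fix v assume "v \<in> F p \<inter> W (2 * p)"
      then have "v \<in> vec.span (\<Union>i\<in>{(\<alpha>, \<beta>). p \<le> \<alpha>} \<inter> {(\<alpha>, \<beta>). \<alpha> + \<beta> \<le> 2 * p}. I' i)"
        unfolding F W by (intro bigrading_Int [OF big]) auto
      also have "\<dots> \<subseteq> I' (p, p)"
      proof (rule vec.span_minimal [OF _ sub])
        have "I' (x, y) \<subseteq> I' (p, p)" if "p \<le> x" "x + y \<le> 2 * p" for x y
          using that off [of x y] vec.subspace_0 [OF sub] by (cases "x = y") auto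
        then show "(\<Union>i\<in>{(\<alpha>, \<beta>). p \<le> \<alpha>} \<inter> {(\<alpha>, \<beta>). \<alpha> + \<beta> \<le> 2 * p}. I' i) \<subseteq> I' (p, p)" by auto
      qed
      finally show "v \<in> I' (p, p)" .
    qed
  qed
  then have "I' (p, q) = I (p, q)" for p q
    using off by (cases "p = q") (simp_all only: ht_bigrading_inter ht_bigrading_off not_False_eq_True)
  then show ?thesis by (intro ext) (metis surj_pair)
qed

lemma deligne_bigrading_eq: "deligne_bigrading F W = I"
  unfolding deligne_bigrading_def
  by (rule the_equality [where P = "is_deligne_bigrading F W", OF ht_bigrading_deligne deligne_bigrading_unique])

lemma grading_op_eq: "grading_op I = weight_op c a P"
  unfolding grading_op_def
proof (rule the_equality)
  show "\<forall>p q. \<forall>v\<in>I (p, q). weight_op c a P *v v = of_int (p + q) *s v"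
  proof (intro allI ballI)
    fix p q v assume v: "v \<in> I (p, q)"
    show "weight_op c a P *v v = of_int (p + q) *s v"
    proof (cases "p = q")
      case False
      then show ?thesis using v by (simp add: ht_bigrading_off)
    next
      case True
      have "weight_op c a P *v v = (\<Sum>b=c..a. if b = p then of_int (2 * p) *s v else 0)"
        unfolding weight_op_def mv.sum_left scale_mat_vec
        using summand_on_bigrading [of v p] v True by (intro sum.cong) auto
      also have "\<dots> = of_int (2 * p) *s v"
        using summand_outside [OF spl, of p] v True by (auto simp: not_le)
      finally show ?thesis by (simp add: True)
    qed
  qed
  fix Y assume Y: "\<forall>p q. \<forall>v\<in>I (p, q). Y *v v = of_int (p + q) *s v"
  have "Y *v (summand P b *v v) = weight_op c a P *v (summand P b *v v)" for b v
  proof -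
    have "Y *v (summand P b *v v) = of_int (b + b) *s (summand P b *v v)"
      using Y summand_in_bigrading by blast
    also have "\<dots> = weight_op c a P *v (summand P b *v v)"
      using \<open>\<forall>p q. \<forall>v\<in>I (p, q). weight_op c a P *v v = of_int (p + q) *s v\<close> summand_in_bigrading
      by metis
    finally show ?thesis .
  qed
  then have "Y ** summand P b = weight_op c a P ** summand P b" for b
    by (simp add: matrix_eq flip: matrix_vector_mul_assoc)
  then show "Y = weight_op c a P"
    by (rule eq_on_summands [OF spl])
qed

text \<open>The bigrading is concentrated on the diagonal, and so is the one of the endomorphisms. The condition
  of negative bidegree thus says that the operator lowers the weight.\<close>

lemma gl_component_eq:
  "gl_component I X (k, k) = (\<Sum>b=c..a. summand P (b + k) ** X ** summand P b)"
    (is "_ = ?C k")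
  and Lambda_iff: "X \<in> Lambda I \<longleftrightarrow> lowers W X"
proof -
  define C where "C X = (\<lambda>(k, l). if k = l then (\<Sum>b=c..a. summand P (b + k) ** X ** summand P b) else 0)"
    for X :: "complex^'n^'n"
  have C_piece: "C X j \<in> gl_piece I j" for X j
  proof -
    obtain k l where j: "j = (k, l)" by fastforce
    have "C X (k, l) *v v \<in> I (k + p, l + q)" if v: "v \<in> I (p, q)" for p q v
    proof (cases "k = l \<and> p = q")
      case True
      have "C X (k, l) *v v = (\<Sum>b=c..a. summand P (b + k) *v (X *v (summand P b *v v)))"
        using True by (simp add: C_def mv.sum_left flip: matrix_vector_mul_assoc)
      also have "\<dots> = (\<Sum>b=c..a. if b = p then summand P (p + k) *v (X *v v) else 0)"
        by (intro sum.cong refl)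
          (use True v summand_on_bigrading [of v p] in \<open>auto simp: mv.zero_right\<close>)
      also have "\<dots> \<in> I (k + p, k + p)"
        using summand_in_bigrading [of "p + k" "X *v v"]
        by (auto simp: add.commute mv.zero_right)
      finally show ?thesis using True by simp
    next
      case False
      then have "C X (k, l) *v v = 0"
        using v by (cases "k = l") (auto simp: C_def ht_bigrading_off mv.zero_right mv.zero_left)
      then show ?thesis using vec.subspace_0 [OF ht_bigrading_subspace] by simp
    qed
    then show ?thesis by (simp add: j gl_piece_def)
  qed
  have C_supp: "{j. C X j \<noteq> 0} \<subseteq> (\<lambda>k. (k, k)) ` {c - a..a - c}" for X
  proof
    fix j assume "j \<in> {j. C X j \<noteq> 0}"
    then obtain k where j: "j = (k, k)" "C X (k, k) \<noteq> 0"
      by (cases j) (auto simp: C_def split: if_splits)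
    then obtain b where "b \<in> {c..a}" "summand P (b + k) ** X ** summand P b \<noteq> 0"
      by (auto simp: C_def elim: sum.not_neutral_contains_not_neutral)
    moreover from this have "\<not> (b + k < c \<or> a < b + k)"
      using summand_outside [OF spl, of "b + k"] by (auto simp: mm.zero_left)
    ultimately show "j \<in> (\<lambda>k. (k, k)) ` {c - a..a - c}" using j by auto
  qed
  then have C_fin: "finite {j. C X j \<noteq> 0}" for X
    by (rule finite_subset) simp
  have C_sum: "X = sum (C X) {j. C X j \<noteq> 0}" for X
  proof -
    have 1: "(\<Sum>k=c-a..a-c. summand P (b + k)) = mat 1" if "b \<in> {c..a}" for b
    proof -
      have "(\<Sum>k=c-a..a-c. summand P (b + k)) = (\<Sum>b'=b+(c-a)..b+(a-c). summand P b')"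
        by (rule sum.reindex_bij_witness [of _ "\<lambda>b'. b' - b" "\<lambda>k. b + k"]) auto
      also have "\<dots> = (\<Sum>b'=c..a. summand P b')"
        using that summand_outside [OF spl] by (intro sum.mono_neutral_right) auto
      finally show ?thesis by (simp add: sum_summand_one [OF spl])
    qed
    have "sum (C X) {j. C X j \<noteq> 0} = sum (C X) ((\<lambda>k. (k, k)) ` {c - a..a - c})"
      by (rule sum.mono_neutral_left) (use C_supp in auto)
    also have "\<dots> = (\<Sum>k=c-a..a-c. \<Sum>b=c..a. summand P (b + k) ** X ** summand P b)"
      by (subst sum.reindex) (auto simp: inj_on_def C_def)
    also have "\<dots> = (\<Sum>b=c..a. (\<Sum>k=c-a..a-c. summand P (b + k)) ** X ** summand P b)"
      by (subst sum.swap) (simp add: mm.sum_left)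
    also have "\<dots> = (\<Sum>b=c..a. X ** summand P b)"
      by (intro sum.cong) (simp_all add: 1)
    also have "\<dots> = X"
      by (simp add: sum_summand_one [OF spl] flip: mm.sum_right)
    finally show ?thesis ..
  qed
  have uniq: "f = C X" if f: "\<And>j. f j \<in> gl_piece I j" "finite {j. f j \<noteq> 0}" "X = sum f {j. f j \<noteq> 0}" for f X
  proof (rule ext)
    fix j :: "int \<times> int"
    obtain k l where j: "j = (k, l)" by fastforce
    have piece: "f (k, l) *v (summand P b *v v) \<in> I (k + b, l + b)" for b v k l
      using f(1) [of "(k, l)"] summand_in_bigrading [of b v] unfolding gl_piece_def by blast
    have off: "f (k, l) ** summand P b = 0" if "k \<noteq> l" for k l b
      using piece [of k l b] that by (simp add: matrix_eq ht_bigrading_off flip: matrix_vector_mul_assoc)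
    have diag: "summand P (b + k) ** X ** summand P b = f (k, k) ** summand P b" for b k
    proof -
      have "summand P (b + k) ** f i ** summand P b = (if i = (k, k) then f (k, k) ** summand P b else 0)" for i
      proof -
        obtain x y where i: "i = (x, y)" by fastforce
        show ?thesis
        proof (cases "x = y")
          case True
          have "summand P (b + k) *v (f (x, x) *v (summand P b *v v))
              = (if x = k then f (x, x) *v (summand P b *v v) else 0)" for v
            using summand_on_bigrading [of "f (x, x) *v (summand P b *v v)" "x + b" "b + k"]
              piece [of x x b v] by auto
          then show ?thesis
            using True i by (auto simp: matrix_eq simp flip: matrix_vector_mul_assoc)
        next
          case False
          then show ?thesis
            using i by (auto simp: off mm.zero_right simp flip: matrix_mul_assoc)
        qed
      qed
      then have "summand P (b + k) ** X ** summand P b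
          = (\<Sum>i\<in>{j. f j \<noteq> 0}. if i = (k, k) then f (k, k) ** summand P b else 0)"
        by (subst f(3)) (simp add: mm.sum_left mm.sum_right)
      also have "\<dots> = f (k, k) ** summand P b"
        using f(2) by (auto simp: mm.zero_left)
      finally show ?thesis .
    qed
    show "f j = C X j"
    proof (cases "k = l")
      case True
      have "C X (k, k) = (\<Sum>b=c..a. f (k, k) ** summand P b)"
        by (simp add: C_def diag)
      also have "\<dots> = f (k, k)"
        by (simp add: sum_summand_one [OF spl] flip: mm.sum_right)
      finally show ?thesis using True j by simp
    next
      case False
      have "f j = (\<Sum>b=c..a. f j ** summand P b)"
        by (simp add: sum_summand_one [OF spl] flip: mm.sum_right)
      then show ?thesis using False j by (simp add: off C_def)
    qed
  qed
  have comp: "gl_component I X = C X"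
    unfolding gl_component_def by (rule the_equality) (use C_piece C_fin C_sum uniq in blast)+
  then show "gl_component I X (k, k) = ?C k"
    by (simp add: C_def)
  show "X \<in> Lambda I \<longleftrightarrow> lowers W X"
  proof
    assume "X \<in> Lambda I"
    then obtain f J where J: "X = sum f J" "J \<subseteq> {(p, q). p < 0 \<and> q < 0}" "\<forall>j\<in>J. f j \<in> gl_piece I j"
      unfolding Lambda_def by blast
    have "lowers W (f j)" if "j \<in> J" for j
    proof (rule lowers_from_summands [OF spl])
      fix b v
      obtain x y where j: "j = (x, y)" "x < 0" "y < 0" using J(2) \<open>j \<in> J\<close> by blast
      have "f j *v (summand P b *v v) \<in> I (x + b, y + b)"
        using J(3) that j summand_in_bigrading [of b v] unfolding gl_piece_def by blast
      also have "I (x + b, y + b) \<subseteq> W (2 * b - 1)"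
      proof (cases "x = y")
        case True
        have "W (2 * (x + b)) \<subseteq> W (2 * b - 1)"
          using j by (intro increasing_filtration_mono [OF ht_incr]) simp
        then show ?thesis using True by (auto simp only: ht_bigrading_inter)
      next
        case False
        then show ?thesis by (simp add: ht_bigrading_off filtration_subspace_simps [OF ht_incr])
      qed
      finally show "f j *v (summand P b *v v) \<in> W (2 * b - 1)" .
    qed
    then show "lowers W X" unfolding J(1) by (rule lowers_sum [OF ht_incr])
  next
    assume X: "lowers W X"
    have "C X (k, k) = 0" if "0 \<le> k" for k
    proof -
      have "summand P (b + k) *v (X *v (summand P b *v v)) = 0" for b v
        using X summand_range [OF spl, of b v] that
        by (intro summand_kills [OF spl, of _ "2 * b - 1"]) (auto simp: lowers_def)
      then have "summand P (b + k) ** X ** summand P b = 0" for b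
        by (simp add: matrix_eq mv.zero_left flip: matrix_vector_mul_assoc)
      then show ?thesis by (simp add: C_def)
    qed
    then have pos: "k < 0" if "C X (k, k) \<noteq> 0" for k
      using that by (meson not_le)
    have "{j. C X j \<noteq> 0} \<subseteq> {(p, q). p < 0 \<and> q < 0}"
    proof
      fix j assume j: "j \<in> {j. C X j \<noteq> 0}"
      then obtain k where "j = (k, k)" using C_supp [of X] by blast
      then show "j \<in> {(p, q). p < 0 \<and> q < 0}" using pos [of k] j by simp
    qed
    then show "X \<in> Lambda I"
      unfolding Lambda_def using C_sum [of X] C_fin [of X] C_piece [of X] by blast
  qed
qed

context
  fixes m :: nat
  assumes nil: "\<And>X. lowers W X \<Longrightarrow> mat_pow X m = 0"
begin

abbreviation (input) "Pbar \<equiv> \<lambda>b. conj_mat (P b)"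
abbreviation (input) "\<gamma> \<equiv> gr_iso c a P Pbar"
abbreviation (input) "\<Delta> \<equiv> deligne_log m c a P"

lemma real: "v \<in> W k \<Longrightarrow> conj_vec v \<in> W k"
  by (rule ht_pairD(2) [OF ht])

lemmas ht_spl' = splitting_conj [OF spl real]

lemma conj_weight_op: "conj_mat (weight_op c a P) = weight_op c a Pbar"
  by (simp add: weight_op_def conj_mat_sum conj_mat_scale conj_summand)

lemma weight_op_summand:
  assumes "splitting W c a Q"
  shows "weight_op c a Q ** summand Q b = scale_mat (of_int (2 * b)) (summand Q b)"
    "summand Q b ** weight_op c a Q = scale_mat (of_int (2 * b)) (summand Q b)"
proof -
  have "weight_op c a Q ** summand Q b
      = (\<Sum>b'=c..a. if b' = b then scale_mat (of_int (2 * b)) (summand Q b) else 0)"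
    unfolding weight_op_def mm.sum_left scale_mat_mult_left
    by (intro sum.cong) (auto simp: summand_mult [OF assms] sm.zero_right)
  also have "\<dots> = scale_mat (of_int (2 * b)) (summand Q b)"
    using summand_outside [OF assms, of b] by (auto simp: not_le sm.zero_right)
  finally show "weight_op c a Q ** summand Q b = scale_mat (of_int (2 * b)) (summand Q b)" .
  have "summand Q b ** weight_op c a Q
      = (\<Sum>b'=c..a. if b' = b then scale_mat (of_int (2 * b)) (summand Q b) else 0)"
    unfolding weight_op_def mm.sum_right scale_mat_mult_right
    by (intro sum.cong) (auto simp: summand_mult [OF assms] sm.zero_right)
  also have "\<dots> = scale_mat (of_int (2 * b)) (summand Q b)"
    using summand_outside [OF assms, of b] by (auto simp: not_le sm.zero_right)
  finally show "summand Q b ** weight_op c a Q = scale_mat (of_int (2 * b)) (summand Q b)" .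
qed

lemma deligne_splitting_eq: "deligne_splitting F W = \<Delta>"
proof -
  let ?Y = "weight_op c a P"
  have "(THE \<Delta>. \<Delta> \<in> Lambda I \<and> conj_mat \<Delta> = \<Delta> \<and>
      conj_mat ?Y = mat_exp (scale_mat (- 2 * \<i>) \<Delta>) ** ?Y ** mat_exp (scale_mat (2 * \<i>) \<Delta>)) = \<Delta>"
  proof (rule the_equality)
    have "\<gamma> ** ?Y = conj_mat ?Y ** \<gamma>"
    proof (rule eq_on_summands [OF spl])
      fix b
      have "\<gamma> ** ?Y ** summand P b = scale_mat (of_int (2 * b)) (\<gamma> ** summand P b)"
        by (simp add: weight_op_summand [OF spl] scale_mat_mult_right flip: matrix_mul_assoc)
      also have "\<dots> = scale_mat (of_int (2 * b)) (summand Pbar b) ** \<gamma>"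
        by (simp add: gr_iso_intertwines(2) [OF spl ht_spl'] scale_mat_mult_left)
      also have "\<dots> = conj_mat ?Y ** (summand Pbar b ** \<gamma>)"
        by (simp add: conj_weight_op weight_op_summand [OF ht_spl'] matrix_mul_assoc)
      also have "\<dots> = conj_mat ?Y ** \<gamma> ** summand P b"
        by (simp add: gr_iso_intertwines(2) [OF spl ht_spl'] flip: matrix_mul_assoc)
      finally show "\<gamma> ** ?Y ** summand P b = conj_mat ?Y ** \<gamma> ** summand P b" .
    qed
    moreover have "\<gamma> ** conj_mat \<gamma> = mat 1"
      using gr_iso_inverse [OF ht_spl' spl] by (simp add: conj_gr_iso [OF spl real nil])
    ultimately have "\<gamma> ** ?Y ** conj_mat \<gamma> = conj_mat ?Y"
      by (simp flip: matrix_mul_assoc)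
    then show "\<Delta> \<in> Lambda I \<and> conj_mat \<Delta> = \<Delta> \<and>
        conj_mat ?Y = mat_exp (scale_mat (- 2 * \<i>) \<Delta>) ** ?Y ** mat_exp (scale_mat (2 * \<i>) \<Delta>)"
      unfolding Lambda_iff
      using exp_deligne_log [OF spl real nil] exp_minus_deligne_log [OF spl real nil] deligne_log_lowers [OF spl real nil] deligne_log_real [OF spl real nil] by simp
  next
    fix d assume d: "d \<in> Lambda I \<and> conj_mat d = d \<and>
      conj_mat ?Y = mat_exp (scale_mat (- 2 * \<i>) d) ** ?Y ** mat_exp (scale_mat (2 * \<i>) d)"
    define X where "X = scale_mat (- 2 * \<i>) d"
    have X: "lowers W X"
      using d unfolding X_def Lambda_iff by (intro lowers_closed ht_incr) simp
    define G where "G = mat_exp X"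
    have "scale_mat (2 * \<i>) d = - X"
      by (simp add: X_def sm.minus_left)
    then have "conj_mat ?Y = G ** ?Y ** mat_exp (- X)"
      using d by (simp add: X_def G_def)
    then have YG: "conj_mat ?Y ** G = G ** ?Y"
      using mat_exp_minus(2) [OF nil [OF X]] by (simp add: G_def flip: matrix_mul_assoc)
    have G_low: "lowers W (G - mat 1)"
      unfolding G_def by (rule lowers_exp [OF ht_incr X nil [OF X]])
    have "G ** summand P b = summand Pbar b ** G" for b
    proof -
      \<comment> \<open>\<open>G\<close> maps eigenvectors of \<open>Y\<close> to eigenvectors of its conjugate with the same eigenvalue.\<close>
      have zero: "summand Pbar b' ** G ** summand P b = 0" if "b' \<noteq> b" for b b'
      proof -
        have "scale_mat (of_int (2 * b')) (summand Pbar b' ** G ** summand P b)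
            = summand Pbar b' ** (conj_mat ?Y ** G) ** summand P b"
          by (simp add: conj_weight_op matrix_mul_assoc weight_op_summand [OF ht_spl'] scale_mat_mult_left)
        also have "\<dots> = scale_mat (of_int (2 * b)) (summand Pbar b' ** G ** summand P b)"
          unfolding YG
          by (simp add: weight_op_summand [OF spl] scale_mat_mult_right flip: matrix_mul_assoc)
        finally have "scale_mat (of_int (2 * b') - of_int (2 * b)) (summand Pbar b' ** G ** summand P b) = 0"
          by (simp add: sm.diff_left)
        moreover have "of_int (2 * b') - of_int (2 * b) \<noteq> (0 :: complex)"
          using that by simp
        ultimately show ?thesis
          by (metis scale_mat_scale sm.zero_right scale_mat_1 left_inverse)
      qed
      have "G ** summand P b = summand Pbar b ** G ** summand P b"
      proof -
        have "G ** summand P b = (\<Sum>b'=c..a. summand Pbar b') ** G ** summand P b"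
          by (simp add: sum_summand_one [OF ht_spl'])
        also have "\<dots> = (\<Sum>b'=c..a. if b' = b then summand Pbar b ** G ** summand P b else 0)"
          unfolding mm.sum_left by (intro sum.cong) (auto simp: zero)
        also have "\<dots> = summand Pbar b ** G ** summand P b"
          using summand_outside [OF ht_spl', of b] by (auto simp: not_le mm.zero_left)
        finally show ?thesis .
      qed
      moreover have "summand Pbar b ** G = summand Pbar b ** G ** summand P b"
      proof -
        have "summand Pbar b ** G = summand Pbar b ** G ** (\<Sum>b'=c..a. summand P b')"
          by (simp add: sum_summand_one [OF spl])
        also have "\<dots> = (\<Sum>b'=c..a. if b' = b then summand Pbar b ** G ** summand P b else 0)"
          unfolding mm.sum_right by (intro sum.cong) (auto simp: zero)
        also have "\<dots> = summand Pbar b ** G ** summand P b"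
          using summand_outside [OF ht_spl', of b] by (auto simp: not_le mm.zero_left)
        finally show ?thesis .
      qed
      ultimately show ?thesis by simp
    qed
    then have "G = \<gamma>"
      by (intro gr_iso_unique [OF spl ht_spl' _ G_low])
    then have "mat_log m \<gamma> = X"
      using mat_log_exp(1) [OF nil [OF X]] by (simp add: G_def)
    then show "d = \<Delta>"
      by (simp add: deligne_log_def X_def scale_mat_scale)
  qed
  then show ?thesis
    unfolding deligne_splitting_def deligne_bigrading_eq grading_op_eq Let_def .
qed

text \<open>The element of \<open>I (a, a)\<close> lifting \<open>one\<close> is \<open>summand P a *v one\<close>. That the resulting multiple of
  \<open>one_dual\<close> is real follows from \<open>height_vec_real\<close>.\<close>

lemma height_eq:
  assumes one: "conj_vec one = one"
    and dual: "conj_vec one_dual = one_dual" "one_dual \<noteq> 0" "W (2 * c) \<subseteq> vec.span {one_dual}"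
  shows "complex_of_real (height F W one one_dual) *s one_dual = height_vec m c a P one"
proof -
  have W: "2 * a = wt_max W" "2 * c = wt_min W"
    using weight_range_even(1,2) [OF ht_pairD(1,3) [OF ht]] by blast+
  have len: "- (wt_length W div 2) = c - a"
  proof -
    have "wt_length W = 2 * (a - c)" using W by (simp add: wt_length_def)
    then show ?thesis by simp
  qed
  have W': "wt_max W - 1 = 2 * a - 1" using W by simp
  define h where "h = height_vec m c a P one"
  have "h \<in> vec.span {one_dual}"
    using height_vec_bottom [OF spl real nil] dual(3) unfolding h_def by blast
  then obtain x where x: "h = x *s one_dual"
    by (auto simp: vec.span_singleton)
  have "cnj x *s one_dual = x *s one_dual"
    using height_vec_real [OF spl real nil one] unfolding h_def [symmetric] x conj_vec_scale dual(1) .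
  then have "cnj x = x"
    using dual(2) by (simp add: vec.scale_right_imp_eq)
  then obtain r where r: "x = complex_of_real r"
    by (metis complex_cnj_cancel_iff complex_is_Real_iff Reals_cases Reals_cnj_iff)
  have comp: "gl_component I \<Delta> (c - a, c - a) *v (summand P a *v one) = h"
  proof -
    have "gl_component I \<Delta> (c - a, c - a) ** summand P a
        = (\<Sum>b=c..a. if b = a then summand P c ** \<Delta> ** summand P a else 0)"
      unfolding gl_component_eq mm.sum_left
      by (intro sum.cong)
        (auto simp: summand_mult [OF spl] mm.zero_right simp flip: matrix_mul_assoc)
    also have "\<dots> = P c ** \<Delta> ** summand P a"
      using spl_ca [OF spl] by (simp add: spl_P_bot [OF spl real nil])
    finally show ?thesis
      by (simp add: h_def height_vec_def matrix_vector_mul_assoc matrix_mul_assoc)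
  qed
  have e_unique: "e = summand P a *v one" if "e \<in> I (a, a)" "e - one \<in> W (2 * a - 1)" for e
    using summand_kills [OF spl that(2), of a] that(1) by (simp add: mv.diff_right)
  have e: "summand P a *v one - one \<in> W (2 * a - 1)"
  proof -
    have "summand P a *v one - one = - (P (a - 1) *v one)"
      by (simp add: summand_def mv.diff_left spl_top [OF spl])
    moreover have "P (a - 1) *v one \<in> W (2 * (a - 1))"
      by (rule spl_range [OF spl])
    moreover have "W (2 * (a - 1)) \<subseteq> W (2 * a - 1)"
      by (rule increasing_filtration_mono [OF ht_incr]) simp
    ultimately show ?thesis
      by (auto intro: filtration_subspace_simps [OF ht_incr])
  qed
  have "height F W one one_dual = r"
    unfolding height_def deligne_splitting_eq deligne_bigrading_eq Let_def len W'
  proof (rule the_equality)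
    show "\<exists>e\<in>I (a, a). e - one \<in> W (2 * a - 1) \<and>
        gl_component I \<Delta> (c - a, c - a) *v e = complex_of_real r *s one_dual"
      using e comp summand_in_bigrading [of a one] x r by (intro bexI [of _ "summand P a *v one"]) auto
    fix y assume "\<exists>e\<in>I (a, a). e - one \<in> W (2 * a - 1) \<and>
        gl_component I \<Delta> (c - a, c - a) *v e = complex_of_real y *s one_dual"
    then have "complex_of_real y *s one_dual = h"
      using e_unique comp by auto
    then show "y = r"
      using x r dual(2) by (metis of_real_eq_iff vec.scale_right_imp_eq)
  qed
  then show ?thesis
    using x r by (simp add: h_def)
qed

end

end

hide_const (open) c a I \<gamma> \<Delta> Pbar


section \<open>Holomorphic functions of several variables\<close>

definition hol_at :: "(complex^'r \<Rightarrow> complex) \<Rightarrow> complex^'r \<Rightarrow> bool" where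
  "hol_at f x \<longleftrightarrow> (\<exists>f'. (f has_derivative f') (at x) \<and> (\<forall>c h. f' (c *s h) = c * f' h))"

definition upd :: "complex^'r \<Rightarrow> 'r \<Rightarrow> complex \<Rightarrow> complex^'r" where
  "upd s j t = (\<chi> i. if i = j then t else s $ i)"

lemma upd_nth: "upd s j t $ i = (if i = j then t else s $ i)"
  by (simp add: upd_def)

lemma upd_same [simp]: "upd s j (s $ j) = s"
  by (simp add: upd_def vec_eq_iff)

lemma upd_diff: "upd s j t - upd s j t' = axis j (t - t')"
  by (simp add: upd_def axis_def vec_eq_iff)

lemma norm_upd_diff_le: "norm (upd s j t - upd s' j t) \<le> norm (s - s')"
  by (rule norm_le_componentwise_cart) (simp add: upd_nth)

lemma axis_scale: "c *s axis j d = axis j (c * d :: complex)"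
  by (simp add: axis_def vec_eq_iff)

lemma norm_axis: "norm (axis j (t :: complex)) = norm t"
  by (simp add: norm_axis_1 axis_def norm_vec_def L2_set_def if_distrib [of "\<lambda>x. (norm x)\<^sup>2"] cong: if_cong)

lemma bounded_linear_axis: "bounded_linear (axis j :: complex \<Rightarrow> complex^'r)"
  unfolding linear_conv_bounded_linear [symmetric]
  by (auto intro!: linearI simp: axis_def vec_eq_iff)

lemma upd_has_derivative: "((\<lambda>t. upd s j t) has_derivative axis j) (at t)"
proof -
  have *: "(\<lambda>t. upd s j t) = (\<lambda>t. upd s j 0 + axis j t)"
    by (auto simp: upd_def axis_def vec_eq_iff)
  have "((\<lambda>t. upd s j 0 + axis j t) has_derivative (\<lambda>h. 0 + axis j h)) (at t)"
    by (intro has_derivative_add has_derivative_const bounded_linear_imp_has_derivative bounded_linear_axis)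
  then show ?thesis by (subst *) simp
qed

lemma continuous_on_upd [continuous_intros]: "continuous_on X (\<lambda>t. upd s j t)"
  by (rule has_derivative_continuous_on, rule has_derivative_at_withinI, rule upd_has_derivative)

lemma hol_at_const [simp]: "hol_at (\<lambda>_. c) x"
  unfolding hol_at_def by (intro exI [of _ "\<lambda>_. 0"]) auto

lemma hol_at_nth [simp]: "hol_at (\<lambda>s. s $ j) x"
  unfolding hol_at_def
  by (intro exI [of _ "\<lambda>h. h $ j"]) (auto intro: bounded_linear.has_derivative bounded_linear_vec_nth)

lemma hol_at_add: "hol_at f x \<Longrightarrow> hol_at g x \<Longrightarrow> hol_at (\<lambda>s. f s + g s) x"
  unfolding hol_at_def
  by (elim exE conjE, rule_tac x = "\<lambda>h. f' h + f'a h" in exI)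
    (auto intro!: has_derivative_add simp: distrib_left)

lemma hol_at_minus: "hol_at f x \<Longrightarrow> hol_at (\<lambda>s. - f s) x"
  unfolding hol_at_def
  by (elim exE conjE, rule_tac x = "\<lambda>h. - f' h" in exI) (auto intro!: has_derivative_minus)

lemma hol_at_diff: "hol_at f x \<Longrightarrow> hol_at g x \<Longrightarrow> hol_at (\<lambda>s. f s - g s) x"
  using hol_at_add [OF _ hol_at_minus] by fastforce

lemma hol_at_mult: "hol_at f x \<Longrightarrow> hol_at g x \<Longrightarrow> hol_at (\<lambda>s. f s * g s) x"
  unfolding hol_at_def
  by (elim exE conjE, rule_tac x = "\<lambda>h. f x * f'a h + f' h * g x" in exI)
    (intro conjI has_derivative_mult; auto simp: algebra_simps)

lemma hol_at_sum: "(\<And>i. i \<in> I \<Longrightarrow> hol_at (f i) x) \<Longrightarrow> hol_at (\<lambda>s. \<Sum>i\<in>I. f i s) x"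
  by (induction I rule: infinite_finite_induct) (auto intro: hol_at_add)

lemma hol_at_cong: "\<forall>\<^sub>F y in nhds x. f y = g y \<Longrightarrow> hol_at f x \<Longrightarrow> hol_at g x"
  unfolding hol_at_def eventually_nhds
  by (metis has_derivative_transform_within_open)

lemma hol_at_compose:
  assumes "(g has_field_derivative D) (at (f x))" "hol_at f x"
  shows "hol_at (\<lambda>s. g (f s)) x"
proof -
  obtain f' where f': "(f has_derivative f') (at x)" "\<forall>c h. f' (c *s h) = c * f' h"
    using assms(2) by (auto simp: hol_at_def)
  have "((\<lambda>s. g (f s)) has_derivative (\<lambda>h. D * f' h)) (at x)"
    using has_derivative_compose [OF f'(1) assms(1) [unfolded has_field_derivative_def]] .
  then show ?thesis
    unfolding hol_at_def using f'(2) by (intro exI [of _ "\<lambda>h. D * f' h"]) simp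
qed

lemma hol_at_isCont: "hol_at f x \<Longrightarrow> isCont f x"
  unfolding hol_at_def using has_derivative_continuous by blast

lemma hol_at_line:
  assumes "hol_at f (upd s j t)"
  shows "(\<lambda>t. f (upd s j t)) field_differentiable at t"
proof -
  obtain f' where f': "(f has_derivative f') (at (upd s j t))" "\<forall>c h. f' (c *s h) = c * f' h"
    using assms by (auto simp: hol_at_def)
  have "((\<lambda>t. f (upd s j t)) has_derivative (\<lambda>h. f' (axis j h))) (at t)"
    by (rule has_derivative_compose [OF upd_has_derivative f'(1)])
  moreover have "f' (axis j h) = f' (axis j 1) * h" for h
    using f'(2) [rule_format, of h "axis j 1"] by (simp add: axis_scale mult.commute)
  ultimately show ?thesis
    unfolding field_differentiable_def has_field_derivative_def by (metis (no_types, lifting) ext)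
qed

text \<open>The first factor need not be differentiable: its increment is multiplied by a function vanishing at
  the point. This serves to derive the holomorphy of the projections from their continuity.\<close>

lemma hol_at_mult_vanishing:
  assumes u: "isCont u x" and v: "hol_at v x" "v x = 0"
  shows "hol_at (\<lambda>s. u s * v s) x"
proof -
  obtain v' where v': "(v has_derivative v') (at x)" "\<forall>c h. v' (c *s h) = c * v' h"
    using v by (auto simp: hol_at_def)
  have "((\<lambda>s. (u s - u x) * v s) has_derivative (\<lambda>_. 0)) (at x)"
    unfolding has_derivative_at_alt
  proof (intro conjI allI impI)
    fix e :: real assume "0 < e"
    obtain B where B: "0 < B" "\<And>h. norm (v' h) \<le> B * norm h"
      using bounded_linear.pos_bounded [OF has_derivative_bounded_linear [OF v'(1)]]
      by (metis mult.commute)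
    obtain d1 where d1: "0 < d1" "\<And>y. norm (y - x) < d1 \<Longrightarrow> norm (v y - v x - v' (y - x)) \<le> 1 * norm (y - x)"
      using v'(1) unfolding has_derivative_at_alt by (meson zero_less_one)
    have "0 < e / (B + 1)" using \<open>0 < e\<close> B by simp
    then obtain d2 where d2: "0 < d2" "\<And>y. norm (y - x) < d2 \<Longrightarrow> norm (u y - u x) < e / (B + 1)"
      using u unfolding continuous_at_eps_delta dist_norm by metis
    show "\<exists>d>0. \<forall>y. norm (y - x) < d \<longrightarrow>
        norm ((u y - u x) * v y - (u x - u x) * v x - 0) \<le> e * norm (y - x)"
    proof (intro exI [of _ "min d1 d2"] conjI allI impI)
      fix y assume y: "norm (y - x) < min d1 d2"
      have "norm (v y) \<le> norm (v y - v x - v' (y - x)) + norm (v' (y - x))"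
        using norm_triangle_ineq [of "v y - v x - v' (y - x)" "v' (y - x)"] v(2) by simp
      also have "\<dots> \<le> (B + 1) * norm (y - x)"
        using d1(2) [of y] y B(2) [of "y - x"] by (simp add: algebra_simps)
      finally have "norm (u y - u x) * norm (v y) \<le> e / (B + 1) * ((B + 1) * norm (y - x))"
        using d2(2) [of y] y B(1) \<open>0 < e\<close> by (intro mult_mono) auto
      then show "norm ((u y - u x) * v y - (u x - u x) * v x - 0) \<le> e * norm (y - x)"
        using B(1) by (simp add: norm_mult)
    qed (use d1 d2 in auto)
  qed simp
  then have "hol_at (\<lambda>s. (u s - u x) * v s) x"
    unfolding hol_at_def by (intro exI [of _ "\<lambda>_. 0"]) simp
  from hol_at_add [OF this hol_at_mult [OF hol_at_const [of "u x"] v(1)]] show ?thesis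
    by (simp add: algebra_simps)
qed

lemma holo_on_iff: "holo_on f X \<longleftrightarrow> (\<forall>x\<in>X. \<forall>i. hol_at (\<lambda>s. f s $ i) x)"
proof (intro iffI ballI allI)
  fix x i assume "holo_on f X" "x \<in> X"
  then obtain L :: "complex^'a^'b" where "(f has_derivative (\<lambda>h. L *v h)) (at x)"
    by (auto simp: holo_on_def)
  then have "((\<lambda>s. f s $ i) has_derivative (\<lambda>h. (L *v h) $ i)) (at x)"
    by (rule bounded_linear.has_derivative [OF bounded_linear_vec_nth])
  then show "hol_at (\<lambda>s. f s $ i) x"
    unfolding hol_at_def
    by (intro exI [of _ "\<lambda>h. (L *v h) $ i"])
      (auto simp: matrix_vector_mult_def sum_distrib_left mult_ac)
next
  assume hol: "\<forall>x\<in>X. \<forall>i. hol_at (\<lambda>s. f s $ i) x"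
  show "holo_on f X"
    unfolding holo_on_def
  proof
    fix x assume "x \<in> X"
    then obtain f' where f': "\<And>i. ((\<lambda>s. f s $ i) has_derivative f' i) (at x)"
        "\<And>i c h. f' i (c *s h) = c * f' i h"
      using hol unfolding hol_at_def by metis
    have "((\<lambda>s. \<Sum>i\<in>UNIV. axis i (f s $ i)) has_derivative (\<lambda>h. \<Sum>i\<in>UNIV. axis i (f' i h))) (at x)"
      by (intro has_derivative_sum bounded_linear.has_derivative [OF bounded_linear_axis] f')
    moreover have "(\<Sum>i\<in>UNIV. axis i (v $ i)) = v" for v :: "complex^'b"
      by (simp add: vec_eq_iff axis_def)
    moreover have "(\<Sum>i\<in>UNIV. axis i (f' i h)) = (\<chi> i j. f' i (axis j 1)) *v h" for h
    proof -
      have "f' i h = (\<Sum>j\<in>UNIV. f' i (axis j 1) * h $ j)" for i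
      proof -
        interpret bounded_linear "f' i" by (rule has_derivative_bounded_linear [OF f'(1)])
        have "f' i h = f' i (\<Sum>j\<in>UNIV. h $ j *s axis j 1)"
          by (simp add: basis_expansion)
        also have "\<dots> = (\<Sum>j\<in>UNIV. f' i (axis j 1) * h $ j)"
          by (simp add: sum f'(2) mult.commute)
        finally show ?thesis .
      qed
      then show ?thesis
        by (simp add: vec_eq_iff axis_def matrix_vector_mult_def)
    qed
    ultimately show "\<exists>L :: complex^'a^'b. (f has_derivative (\<lambda>h. L *v h)) (at x)"
      by (intro exI [of _ "\<chi> i j. f' i (axis j 1)"]) simp
  qed
qed

lemma hol_at_compose_holo:
  assumes "hol_at f (g x)" "holo_on g X" "x \<in> X"
  shows "hol_at (\<lambda>s. f (g s)) x"
proof -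
  obtain f' where f': "(f has_derivative f') (at (g x))" "\<forall>c h. f' (c *s h) = c * f' h"
    using assms(1) by (auto simp: hol_at_def)
  obtain L where L: "(g has_derivative (\<lambda>h. L *v h)) (at x)"
    using assms(2,3) by (auto simp: holo_on_def)
  have "((\<lambda>s. f (g s)) has_derivative (\<lambda>h. f' (L *v h))) (at x)"
    by (rule has_derivative_compose [OF L f'(1)])
  then show ?thesis
    unfolding hol_at_def using f'(2)
    by (intro exI [of _ "\<lambda>h. f' (L *v h)"]) (simp add: matrix_mult_scale_vec matrix_vector_mult_def
        sum_distrib_left mult_ac vec_eq_iff vector_scalar_mult_def flip: f'(2))
qed


section \<open>Extension across coordinate hyperplanes\<close>

text \<open>The derivative is bounded on the smaller disk by Cauchy's inequality.\<close>

lemma holomorphic_lipschitz: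
  assumes f: "f holomorphic_on S" and S: "cball a R \<subseteq> S" and r: "0 < r" "r < R"
    and B: "\<And>t. norm (t - a) = R \<Longrightarrow> norm (f t) \<le> B"
    and x: "norm (x - a) \<le> r" and y: "norm (y - a) \<le> r"
  shows "norm (f x - f y) \<le> B / (R - r) * norm (x - y)"
proof (rule field_differentiable_bound [where S = "cball a r" and f = f and f' = "deriv f"])
  have fR: "f holomorphic_on cball a R"
    using f S by (rule holomorphic_on_subset)
  have bound: "norm (f t) \<le> B" if "norm (t - a) \<le> R" for t
  proof (rule maximum_modulus_frontier [where S = "cball a R" and f = f and \<xi> = t])
    show "f holomorphic_on interior (cball a R)"
      by (rule holomorphic_on_subset [OF fR interior_subset])
    show "continuous_on (closure (cball a R)) f"
      using fR by (simp add: holomorphic_on_imp_continuous_on)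
    show "norm (f z) \<le> B" if "z \<in> frontier (cball a R)" for z
      using that r by (intro B) (simp add: frontier_cball dist_norm norm_minus_commute)
    show "t \<in> cball a R" using that by (simp add: dist_norm norm_minus_commute)
  qed simp
  show "norm (deriv f z) \<le> B / (R - r)" if z: "z \<in> cball a r" for z
  proof -
    have sub: "cball z (R - r) \<subseteq> cball a R"
    proof
      fix w assume "w \<in> cball z (R - r)"
      then show "w \<in> cball a R"
        using z dist_triangle [of a w z] by simp
    qed
    have "norm ((deriv ^^ 1) f z) \<le> fact 1 * B / (R - r) ^ 1"
    proof (rule Cauchy_inequality)
      have "ball z (R - r) \<subseteq> cball a R"
        using sub ball_subset_cball by blast
      then show "f holomorphic_on ball z (R - r)"
        by (rule holomorphic_on_subset [OF fR])
      show "continuous_on (cball z (R - r)) f"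
        using holomorphic_on_imp_continuous_on [OF fR] sub by (rule continuous_on_subset)
      show "norm (f w) \<le> B" if "norm (z - w) = R - r" for w
      proof -
        have "w \<in> cball a R" using subsetD [OF sub, of w] that by (simp add: dist_norm)
        then show ?thesis by (intro bound) (simp add: dist_norm norm_minus_commute)
      qed
    qed (use r in simp)
    then show ?thesis by simp
  qed
  show "(f has_field_derivative deriv f z) (at z within cball a r)" if "z \<in> cball a r" for z
  proof -
    have "f field_differentiable at z"
      using that r by (intro holomorphic_on_imp_differentiable_at [OF holomorphic_on_subset [OF fR ball_subset_cball]])
        auto
    then show ?thesis
      by (simp add: field_differentiable_derivI has_field_derivative_at_within)
  qed
  show "x \<in> cball a r" "y \<in> cball a r" using x y by (simp_all add: dist_norm norm_minus_commute)
qed simp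

lemma polydisk_upd: "s \<in> polydisk \<Longrightarrow> norm t < 1 \<Longrightarrow> upd s j t \<in> polydisk"
  by (simp add: polydisk_def upd_nth)

lemma open_polydisk: "open (polydisk :: (complex^'r) set)"
proof -
  have *: "polydisk = (\<Inter>j\<in>UNIV. {s :: complex^'r. cmod (s $ j) < 1})"
    by (auto simp: polydisk_def)
  moreover have "open {s :: complex^'r. cmod (s $ j) < 1}" for j
    by (intro open_Collect_less continuous_intros)
  ultimately show ?thesis unfolding * by (intro open_INT ballI) auto
qed

lemma polydisk_radius:
  assumes "s \<in> (polydisk :: (complex^'r) set)" "c < 1"
  shows "\<exists>\<rho>. c \<le> \<rho> \<and> 0 < \<rho> \<and> \<rho> < 1 \<and> (\<forall>i. cmod (s $ i) \<le> \<rho>)"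
proof -
  define M where "M = Max (insert (max c (1/2)) (range (\<lambda>i. cmod (s $ i))))"
  have "M < 1"
    using assms by (auto simp: M_def polydisk_def)
  moreover have "x \<le> M" if "x \<in> insert (max c (1/2)) (range (\<lambda>i. cmod (s $ i)))" for x
    unfolding M_def by (rule Max_ge [OF _ that]) simp
  ultimately show ?thesis
  proof (intro exI [of _ M] conjI allI)
    have "max c (1/2) \<le> M"
      using \<open>\<And>x. x \<in> insert (max c (1/2)) (range (\<lambda>i. cmod (s $ i))) \<Longrightarrow> x \<le> M\<close> by blast
    then show "c \<le> M" "0 < M" by auto
  qed auto
qed

lemma compact_polydisk_box:
  "compact {s :: complex^'r. \<forall>i. if i \<in> K then cmod (s $ i) = \<rho> else cmod (s $ i) \<le> \<rho>}"
proof -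
  have "{s :: complex^'r. \<forall>i. if i \<in> K then cmod (s $ i) = \<rho> else cmod (s $ i) \<le> \<rho>}
      = (\<Inter>i. if i \<in> K then {s. cmod (s $ i) = \<rho>} else {s. cmod (s $ i) \<le> \<rho>})"
    by (auto split: if_splits)
  moreover have "closed {s :: complex^'r. cmod (s $ i) = \<rho>}" "closed {s :: complex^'r. cmod (s $ i) \<le> \<rho>}" for i
    by (intro closed_Collect_eq closed_Collect_le continuous_intros)+
  ultimately have "closed {s :: complex^'r. \<forall>i. if i \<in> K then cmod (s $ i) = \<rho> else cmod (s $ i) \<le> \<rho>}"
    by auto
  moreover have "bounded {s :: complex^'r. \<forall>i. if i \<in> K then cmod (s $ i) = \<rho> else cmod (s $ i) \<le> \<rho>}"
  proof (rule boundedI)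
    fix s :: "complex^'r" assume "s \<in> {s. \<forall>i. if i \<in> K then cmod (s $ i) = \<rho> else cmod (s $ i) \<le> \<rho>}"
    then have "cmod (s $ i) \<le> \<rho>" for i
      by (smt (verit, ccfv_SIG) mem_Collect_eq)
    then have "(\<Sum>i\<in>UNIV. cmod (s $ i)) \<le> (\<Sum>i\<in>(UNIV :: 'r set). \<rho>)"
      by (rule sum_mono)
    then show "norm s \<le> (\<Sum>i\<in>(UNIV :: 'r set). \<rho>)"
      using L2_set_le_sum [of UNIV "\<lambda>i. cmod (s $ i)"] by (simp add: norm_vec_def)
  qed
  ultimately show ?thesis
    by (simp add: compact_eq_bounded_closed)
qed

text \<open>A continuous function which is holomorphic in each variable is differentiable: along a chain
  of points which differ in one coordinate, the difference of two slices is uniformly small.\<close>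

lemma osgood:
  fixes g :: "complex^'r \<Rightarrow> complex"
  assumes cont: "continuous_on polydisk g"
    and sep: "\<And>s j. s \<in> polydisk \<Longrightarrow> (\<lambda>t. g (upd s j t)) holomorphic_on ball 0 1"
    and x: "x \<in> polydisk"
  shows "hol_at g x"
proof -
  obtain \<rho> where \<rho>: "0 < \<rho>" "\<rho> < 1" "\<And>i. cmod (x $ i) \<le> \<rho>"
    using polydisk_radius [OF x, of 0] by auto
  define r where "r = (1 - \<rho>) / 3"
  have r: "0 < r" "\<rho> + 2 * r < 1" using \<rho> by (auto simp: r_def field_simps)
  define Q where "Q = {s :: complex^'r. \<forall>i. if i \<in> {} then cmod (s $ i) = \<rho> + 2 * r else cmod (s $ i) \<le> \<rho> + 2 * r}"
  have Q: "s \<in> Q \<longleftrightarrow> (\<forall>i. cmod (s $ i) \<le> \<rho> + 2 * r)" for s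
    by (simp add: Q_def)
  have "Q \<subseteq> polydisk"
    using r(2) by (auto simp: Q polydisk_def intro: le_less_trans [OF _ r(2)])
  then have unif: "uniformly_continuous_on Q g"
    unfolding Q_def by (intro compact_uniformly_continuous compact_polydisk_box continuous_on_subset [OF cont])
  define c where "c j = deriv (\<lambda>t. g (upd x j t)) (x $ j)" for j
  define mv where "mv J h = (\<chi> i. if i \<in> J then x $ i + h $ i else x $ i)" for J and h :: "complex^'r"
  have mv_near: "norm (mv J h - x) \<le> norm h" for J h
    by (rule norm_le_componentwise_cart) (simp add: mv_def)
  have "((\<lambda>h. g (mv J h)) has_derivative (\<lambda>h. \<Sum>j\<in>J. c j * h $ j)) (at 0)" if "finite J" for J
    using that
  proof (induction J)
    case empty
    have "(\<lambda>h. g (mv {} h)) = (\<lambda>h. g x)" by (simp add: mv_def)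
    then show ?case by simp
  next
    case (insert j J)
    have ball: "cball (x $ j) (2 * r) \<subseteq> ball 0 1"
    proof
      fix t assume "t \<in> cball (x $ j) (2 * r)"
      then show "t \<in> ball 0 1"
        using \<rho>(3) [of j] r norm_triangle_sub [of t "x $ j"] by (simp add: dist_norm norm_minus_commute)
    qed
    define \<phi> where "\<phi> t = g (upd x j t)" for t
    define R where "R h = (g (upd (mv J h) j (x $ j + h $ j)) - \<phi> (x $ j + h $ j)) - (g (mv J h) - \<phi> (x $ j))" for h
    have upd_mv: "upd (mv J h) j (x $ j + h $ j) = mv (insert j J) h" "upd (mv J h) j (x $ j) = mv J h" for h
      using insert.hyps by (auto simp: upd_def mv_def vec_eq_iff)
    have "(\<phi> has_field_derivative c j) (at (x $ j))"
      unfolding c_def \<phi>_def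
      using sep [OF x, of j] x by (intro holomorphic_derivI [where S = "ball 0 1"]) (auto simp: polydisk_def)
    then have "((\<lambda>h. \<phi> (x $ j + h $ j)) has_derivative (\<lambda>h. c j * h $ j)) (at 0)"
      unfolding has_field_derivative_def
      by (intro has_derivative_compose [where f = "\<lambda>h. x $ j + h $ j" and g = \<phi>])
        (auto intro!: derivative_eq_intros bounded_linear.has_derivative [OF bounded_linear_vec_nth])
    moreover have "(R has_derivative (\<lambda>h. 0)) (at 0)"
      unfolding has_derivative_at_alt
    proof (intro conjI allI impI)
      fix e :: real assume "0 < e"
      then obtain d where d: "0 < d" "\<And>s s'. s \<in> Q \<Longrightarrow> s' \<in> Q \<Longrightarrow> dist s' s < d \<Longrightarrow> dist (g s') (g s) < e * r"
        using unif r unfolding uniformly_continuous_on_def by (metis mult_pos_pos)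
      show "\<exists>d>0. \<forall>h. norm (h - 0) < d \<longrightarrow> norm (R h - R 0 - 0) \<le> e * norm (h - 0)"
      proof (intro exI [of _ "min d r"] conjI allI impI)
        fix h :: "complex^'r" assume h: "norm (h - 0) < min d r"
        have hj: "norm (h $ i) \<le> norm h" for i by (rule Finite_Cartesian_Product.norm_nth_le)
        define y where "y = mv J h"
        have y: "norm (y $ i) \<le> \<rho> + r" for i
          using \<rho>(3) [of i] hj [of i] h r norm_triangle_ineq [of "x $ i" "h $ i"] by (auto simp: y_def mv_def)
        then have yp: "y \<in> polydisk"
          using r by (auto simp: polydisk_def intro: le_less_trans [of _ "\<rho> + r"])
        define \<chi>' where "\<chi>' t = g (upd y j t) - \<phi> t" for t
        have small: "norm (\<chi>' t) \<le> e * r" if "norm (t - x $ j) = 2 * r" for t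
        proof -
          have "norm t \<le> \<rho> + 2 * r"
            using \<rho>(3) [of j] that norm_triangle_sub [of t "x $ j"] by simp
          then have "upd y j t \<in> Q" "upd x j t \<in> Q"
            using y \<rho> r by (auto simp: Q upd_nth intro: order_trans [of _ \<rho>] order_trans [of _ "\<rho> + r"])
          moreover have "dist (upd y j t) (upd x j t) < d"
            using norm_upd_diff_le [of y j t x] mv_near [of J h] h by (simp add: dist_norm y_def)
          ultimately show ?thesis
            using d(2) [of "upd x j t" "upd y j t"] by (simp add: \<chi>'_def \<phi>_def dist_norm)
        qed
        have "norm (\<chi>' (x $ j + h $ j) - \<chi>' (x $ j)) \<le> e * r / (2 * r - r) * norm ((x $ j + h $ j) - x $ j)"
        proof (rule holomorphic_lipschitz [OF _ ball _ _ small])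
          show "\<chi>' holomorphic_on ball 0 1"
            unfolding \<chi>'_def \<phi>_def by (intro holomorphic_intros sep x yp)
        qed (use r h hj [of j] in auto)
        also have "\<dots> \<le> e * norm h"
          using r hj [of j] \<open>0 < e\<close> by simp
        also have "\<chi>' (x $ j + h $ j) - \<chi>' (x $ j) = R h"
          by (simp add: \<chi>'_def R_def y_def upd_mv)
        finally have "norm (R h) \<le> e * norm h" .
        moreover have "R 0 = 0"
        proof -
          have "mv J 0 = x" by (simp add: mv_def vec_eq_iff)
          then show ?thesis by (simp add: R_def \<phi>_def)
        qed
        ultimately show "norm (R h - R 0 - 0) \<le> e * norm (h - 0)" by simp
      qed (use d r in auto)
    qed simp
    ultimately have "((\<lambda>h. g (mv J h) + (\<phi> (x $ j + h $ j) - \<phi> (x $ j)) + R h) has_derivative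
        (\<lambda>h. (\<Sum>j\<in>J. c j * h $ j) + (c j * h $ j - 0) + 0)) (at 0)"
      using insert.IH by (intro has_derivative_add has_derivative_diff has_derivative_const)
    moreover have "(\<lambda>h. g (mv J h) + (\<phi> (x $ j + h $ j) - \<phi> (x $ j)) + R h) = (\<lambda>h. g (mv (insert j J) h))"
      by (auto simp: R_def upd_mv)
    ultimately show ?case
      using insert.hyps by (simp add: add.commute)
  qed
  from this [of UNIV] have "((\<lambda>h. g (x + h)) has_derivative (\<lambda>h. \<Sum>j\<in>UNIV. c j * h $ j)) (at 0)"
    by (simp add: mv_def plus_vec_def)
  then have "((\<lambda>h. g (x + h)) has_derivative (\<lambda>h. \<Sum>j\<in>UNIV. c j * h $ j)) (at (x - x))"
    by simp
  moreover have "((\<lambda>y. y - x) has_derivative (\<lambda>h. h)) (at x)"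
    by (auto intro!: derivative_eq_intros)
  ultimately have "((\<lambda>y. g (x + (y - x))) has_derivative (\<lambda>h. \<Sum>j\<in>UNIV. c j * h $ j)) (at x)"
    by (rule has_derivative_compose [where f = "\<lambda>y. y - x" and g = "\<lambda>h. g (x + h)", rotated])
  then have "(g has_derivative (\<lambda>h. \<Sum>j\<in>UNIV. c j * h $ j)) (at x)" by simp
  then show ?thesis
    unfolding hol_at_def
    by (intro exI [of _ "\<lambda>h. \<Sum>j\<in>UNIV. c j * h $ j"]) (auto simp: sum_distrib_left mult_ac)
qed


lemma norm_le_l1: "norm (s :: complex^'r) \<le> (\<Sum>i\<in>UNIV. cmod (s $ i))"
  by (simp add: norm_vec_def L2_set_le_sum)

lemma sum_norm_le: "(\<Sum>i\<in>UNIV. cmod (s $ i)) \<le> CARD('r) * norm (s :: complex^'r)"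
  using sum_bounded_above [of UNIV "\<lambda>i. cmod (s $ i)" "norm s"]
  by (simp add: Finite_Cartesian_Product.norm_nth_le)

definition off_hyperplanes :: "'r set \<Rightarrow> (complex^'r) set" where
  "off_hyperplanes K = {s \<in> polydisk. \<forall>j\<in>K. s $ j \<noteq> 0}"

lemma off_hyperplanes_polydisk: "s \<in> off_hyperplanes K \<Longrightarrow> s \<in> polydisk"
  by (simp add: off_hyperplanes_def)

lemma off_hyperplanes_upd:
  "s \<in> off_hyperplanes K \<Longrightarrow> norm t < 1 \<Longrightarrow> (j \<in> K \<Longrightarrow> t \<noteq> 0) \<Longrightarrow> upd s j t \<in> off_hyperplanes K"
  by (auto simp: off_hyperplanes_def polydisk_upd upd_nth)

lemma open_off_hyperplanes: "open (off_hyperplanes K :: (complex^'r) set)"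
proof -
  have *: "off_hyperplanes K = polydisk \<inter> (\<Inter>j\<in>K. {s :: complex^'r. s $ j \<noteq> 0})"
    by (auto simp: off_hyperplanes_def)
  have "open {s :: complex^'r. s $ j \<noteq> 0}" for j
    by (intro open_Collect_neq continuous_intros)
  then show ?thesis
    unfolding * by (intro open_Int open_polydisk open_INT ballI) auto
qed

text \<open>Points off the hyperplanes which approximate \<open>s\<close>. The shift of \<open>n\<close> keeps the new coordinates in the
  disk of radius \<open>1/2\<close>.\<close>

definition pert :: "'r set \<Rightarrow> complex^'r \<Rightarrow> nat \<Rightarrow> complex^'r" where
  "pert K s n = (\<chi> j. if j \<in> K \<and> s $ j = 0 then of_real (1 / real (n + 2)) else s $ j)"

lemma pert_off_hyperplanes: "s \<in> polydisk \<Longrightarrow> pert K s n \<in> off_hyperplanes K"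
  by (auto simp: off_hyperplanes_def polydisk_def pert_def norm_divide field_simps
      simp del: of_real_divide)

lemma pert_bounded: "(\<And>i. cmod (s $ i) \<le> \<rho>) \<Longrightarrow> 1/2 \<le> \<rho> \<Longrightarrow> cmod (pert K s n $ i) \<le> \<rho>"
proof -
  assume "\<And>i. cmod (s $ i) \<le> \<rho>" "1/2 \<le> \<rho>"
  moreover have "cmod (of_real (1 / real (n + 2))) \<le> 1 / 2"
    unfolding norm_of_real by (simp add: field_simps)
  ultimately show ?thesis
    by (auto simp: pert_def simp del: of_real_divide norm_of_real intro: order_trans)
qed

lemma pert_id: "s \<in> off_hyperplanes K \<Longrightarrow> pert K s n = s"
  by (auto simp: pert_def off_hyperplanes_def vec_eq_iff)

lemma pert_tendsto: "(\<lambda>n. pert K s n) \<longlonglongrightarrow> s"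
proof (rule vec_tendstoI)
  fix i
  have "(\<lambda>n. 1 / real (n + 2)) \<longlonglongrightarrow> 0"
    using LIMSEQ_ignore_initial_segment [OF lim_const_over_n [of "1 :: real"], of 2] by simp
  then have "(\<lambda>n. complex_of_real (1 / real (n + 2))) \<longlonglongrightarrow> of_real 0"
    by (rule tendsto_of_real)
  then show "(\<lambda>n. pert K s n $ i) \<longlonglongrightarrow> s $ i"
    by (cases "i \<in> K \<and> s $ i = 0") (auto simp: pert_def simp del: of_real_divide)
qed

context
  fixes f :: "complex^'r \<Rightarrow> complex" and K :: "'r set"
  assumes hol: "\<And>s. s \<in> off_hyperplanes K \<Longrightarrow> hol_at f s"
    and bdd: "\<And>s j. s \<in> off_hyperplanes K \<Longrightarrow> j \<in> K \<Longrightarrow>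
      \<exists>B. \<forall>\<^sub>F t in at 0. cmod (f (upd s j t)) \<le> B"
begin

text \<open>Riemann's theorem on removable singularities, on the disk in direction \<open>j\<close> through \<open>s\<close>.\<close>

lemma slice_extension:
  assumes s: "s \<in> off_hyperplanes K"
  shows "\<exists>\<phi>. \<phi> holomorphic_on ball 0 1 \<and>
    (\<forall>t\<in>ball 0 1. (j \<in> K \<longrightarrow> t \<noteq> 0) \<longrightarrow> \<phi> t = f (upd s j t))"
proof -
  have diff: "(\<lambda>t. f (upd s j t)) field_differentiable at t within X" if "norm t < 1" "j \<in> K \<Longrightarrow> t \<noteq> 0" for t X
    by (rule field_differentiable_at_within, rule hol_at_line, rule hol, rule off_hyperplanes_upd [OF s])
      (use that in auto)
  show ?thesis
  proof (cases "j \<in> K")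
    case False
    have "(\<lambda>t. f (upd s j t)) holomorphic_on ball 0 1"
      unfolding holomorphic_on_def using False diff by simp
    then show ?thesis by blast
  next
    case True
    have "(\<lambda>t. f (upd s j t)) holomorphic_on ball 0 1 - {0}"
      unfolding holomorphic_on_def using diff by simp
    then have "\<exists>g. g holomorphic_on ball 0 1 \<and> (\<forall>z\<in>ball 0 1 - {0}. g z = f (upd s j z))"
      using holomorphic_on_extend_bounded [of "\<lambda>t. f (upd s j t)" "ball 0 1" 0] bdd [OF s True] by auto
    then show ?thesis using True by auto
  qed
qed

text \<open>By the maximum principle in one variable after the other, \<open>f\<close> is bounded by its values on
  the part of the polydisk where the coordinates in \<open>K\<close> have maximal modulus.\<close>

lemma bounded_off_hyperplanes:
  assumes \<rho>: "0 < \<rho>" "\<rho> < 1"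
  shows "\<exists>M. \<forall>s\<in>off_hyperplanes K. (\<forall>i. cmod (s $ i) \<le> \<rho>) \<longrightarrow> cmod (f s) \<le> M"
proof -
  define T where "T = {s :: complex^'r. \<forall>i. if i \<in> K then cmod (s $ i) = \<rho> else cmod (s $ i) \<le> \<rho>}"
  have T: "T \<subseteq> off_hyperplanes K"
  proof
    fix s assume s: "s \<in> T"
    then have "cmod (s $ i) \<le> \<rho>" for i
      unfolding T_def by (cases "i \<in> K") (auto dest: spec [of _ i])
    moreover have "s $ i \<noteq> 0" if "i \<in> K" for i
      using s that \<rho> unfolding T_def by (auto dest: spec [of _ i])
    ultimately show "s \<in> off_hyperplanes K"
      using \<rho> by (auto simp: off_hyperplanes_def polydisk_def intro: le_less_trans)
  qed
  have "continuous_on T f"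
    using T by (intro continuous_at_imp_continuous_on ballI hol_at_isCont hol) blast
  then have "compact (f ` T)"
    unfolding T_def by (rule compact_continuous_image [OF _ compact_polydisk_box])
  then obtain M where "\<forall>x\<in>f ` T. cmod x \<le> M"
    by (metis compact_imp_bounded bounded_iff)
  then have M: "cmod (f s) \<le> M" if "s \<in> T" for s
    using that by blast
  have "cmod (f s) \<le> M"
    if "finite J" "J \<subseteq> K" "s \<in> off_hyperplanes K" "\<forall>i. cmod (s $ i) \<le> \<rho>" "\<forall>j\<in>K - J. cmod (s $ j) = \<rho>"
    for J s
    using that
  proof (induction J arbitrary: s)
    case empty
    then show ?case by (intro M) (simp add: T_def)
  next
    case (insert j J)
    obtain \<phi> where \<phi>: "\<phi> holomorphic_on ball 0 1"
        "\<And>t. t \<in> ball 0 1 \<Longrightarrow> t \<noteq> 0 \<Longrightarrow> \<phi> t = f (upd s j t)"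
      using slice_extension [OF insert.prems(2), of j] by blast
    have \<phi>\<rho>: "\<phi> holomorphic_on cball 0 \<rho>"
      by (rule holomorphic_on_subset [OF \<phi>(1)]) (use \<rho> in auto)
    have "norm (\<phi> (s $ j)) \<le> M"
    proof (rule maximum_modulus_frontier [where S = "cball 0 \<rho>" and f = \<phi> and \<xi> = "s $ j"])
      show "\<phi> holomorphic_on interior (cball 0 \<rho>)"
        by (rule holomorphic_on_subset [OF \<phi>\<rho> interior_subset])
      show "continuous_on (closure (cball 0 \<rho>)) \<phi>"
        using \<phi>\<rho> by (simp add: holomorphic_on_imp_continuous_on)
      show "norm (\<phi> t) \<le> M" if "t \<in> frontier (cball 0 \<rho>)" for t
      proof -
        have t: "cmod t = \<rho>" using that \<rho> by (simp add: frontier_cball)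
        then have "\<phi> t = f (upd s j t)" using \<rho> by (intro \<phi>) auto
        also have "cmod \<dots> \<le> M"
          using insert.prems t \<rho>
          by (intro insert.IH off_hyperplanes_upd) (auto simp: upd_nth)
        finally show ?thesis .
      qed
      show "s $ j \<in> cball 0 \<rho>" using insert.prems by simp
    qed simp
    moreover have "\<phi> (s $ j) = f s"
    proof -
      have "s $ j \<noteq> 0" "cmod (s $ j) < 1"
        using insert.prems by (auto simp: off_hyperplanes_def polydisk_def)
      then show ?thesis using \<phi>(2) [of "s $ j"] by simp
    qed
    ultimately show ?case by simp
  qed
  from this [of K] show ?thesis by auto
qed

text \<open>The slices are uniformly Lipschitz since they are uniformly bounded on a larger polydisk. Two points
  are connected by changing one coordinate after the other.\<close>

lemma lipschitz_off_hyperplanes: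
  assumes \<rho>: "0 < \<rho>" "\<rho> < 1"
  shows "\<exists>L\<ge>0. \<forall>s\<in>off_hyperplanes K. \<forall>s'\<in>off_hyperplanes K.
    (\<forall>i. cmod (s $ i) \<le> \<rho>) \<longrightarrow> (\<forall>i. cmod (s' $ i) \<le> \<rho>) \<longrightarrow> cmod (f s - f s') \<le> L * norm (s - s')"
proof -
  define \<sigma> where "\<sigma> = (1 + \<rho>) / 2"
  have \<sigma>: "\<rho> < \<sigma>" "\<sigma> < 1" "0 < \<sigma>" using \<rho> by (auto simp: \<sigma>_def)
  obtain M where M: "\<And>s. s \<in> off_hyperplanes K \<Longrightarrow> (\<And>i. cmod (s $ i) \<le> \<sigma>) \<Longrightarrow> cmod (f s) \<le> M"
    using bounded_off_hyperplanes [OF \<sigma>(3,2)] by blast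
  define L where "L = \<bar>M\<bar> / (\<sigma> - \<rho>)"
  have L: "0 \<le> L" using \<sigma> by (simp add: L_def)
  have step: "cmod (f s - f (upd s j t)) \<le> L * cmod (s $ j - t)"
    if s: "s \<in> off_hyperplanes K" "\<forall>i. cmod (s $ i) \<le> \<rho>" and t: "cmod t \<le> \<rho>" "j \<in> K \<Longrightarrow> t \<noteq> 0" for s j t
  proof -
    obtain \<phi> where \<phi>: "\<phi> holomorphic_on ball 0 1"
        "\<And>t. t \<in> ball 0 1 \<Longrightarrow> (j \<in> K \<longrightarrow> t \<noteq> 0) \<Longrightarrow> \<phi> t = f (upd s j t)"
      using slice_extension [OF s(1), of j] by blast
    have "cmod (\<phi> (s $ j) - \<phi> t) \<le> \<bar>M\<bar> / (\<sigma> - \<rho>) * cmod (s $ j - t)"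
    proof (rule holomorphic_lipschitz [OF \<phi>(1)])
      show "cball 0 \<sigma> \<subseteq> ball (0 :: complex) 1" using \<sigma> by auto
      show "cmod (\<phi> w) \<le> \<bar>M\<bar>" if "cmod (w - 0) = \<sigma>" for w
      proof -
        have "\<phi> w = f (upd s j w)" using that \<sigma> by (intro \<phi>) auto
        moreover have "cmod (f (upd s j w)) \<le> M"
          using s that \<sigma> by (intro M off_hyperplanes_upd) (auto simp: upd_nth intro: order_trans [of _ \<rho>])
        ultimately show ?thesis by simp
      qed
    qed (use \<sigma> \<rho> s t in auto)
    moreover have "\<phi> (s $ j) = f s"
      using \<phi>(2) [of "s $ j"] s by (auto simp: off_hyperplanes_def polydisk_def)
    moreover have "\<phi> t = f (upd s j t)"
      using t \<rho> by (intro \<phi>) auto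
    ultimately show ?thesis by (simp add: L_def)
  qed
  have tele: "cmod (f s - f s') \<le> L * (\<Sum>j\<in>J. cmod (s $ j - s' $ j))"
    if "finite J" "s \<in> off_hyperplanes K" "\<forall>i. cmod (s $ i) \<le> \<rho>" "s' \<in> off_hyperplanes K"
      "\<forall>i. cmod (s' $ i) \<le> \<rho>" "\<forall>i. i \<notin> J \<longrightarrow> s $ i = s' $ i" for J s s'
    using that
  proof (induction J arbitrary: s)
    case empty
    then have "s = s'" by (simp add: vec_eq_iff)
    then show ?case by simp
  next
    case (insert j J)
    define s2 where "s2 = upd s j (s' $ j)"
    have nz: "j \<in> K \<Longrightarrow> s' $ j \<noteq> 0" using insert.prems by (auto simp: off_hyperplanes_def)
    have "cmod (f s - f s2) \<le> L * cmod (s $ j - s' $ j)"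
      unfolding s2_def using insert.prems nz by (intro step) auto
    moreover have "cmod (f s2 - f s') \<le> L * (\<Sum>i\<in>J. cmod (s2 $ i - s' $ i))"
      using insert.prems nz \<rho>
      by (intro insert.IH) (auto simp: s2_def upd_nth intro!: off_hyperplanes_upd intro: le_less_trans)
    moreover have "(\<Sum>i\<in>J. cmod (s2 $ i - s' $ i)) = (\<Sum>i\<in>J. cmod (s $ i - s' $ i))"
      using insert.hyps by (intro sum.cong) (auto simp: s2_def upd_nth)
    ultimately have "cmod (f s - f s2) + cmod (f s2 - f s') \<le> L * (\<Sum>i\<in>insert j J. cmod (s $ i - s' $ i))"
      using insert.hyps by (simp add: distrib_left)
    then show ?case
      using norm_triangle_ineq [of "f s - f s2" "f s2 - f s'"] by simp
  qed
  have "cmod (f s - f s') \<le> L * CARD('r) * norm (s - s')"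
    if "s \<in> off_hyperplanes K" "\<forall>i. cmod (s $ i) \<le> \<rho>" "s' \<in> off_hyperplanes K" "\<forall>i. cmod (s' $ i) \<le> \<rho>" for s s'
  proof -
    have "cmod (f s - f s') \<le> L * (\<Sum>j\<in>UNIV. cmod ((s - s') $ j))"
      using tele [of UNIV s s'] that by simp
    also have "\<dots> \<le> L * (CARD('r) * norm (s - s'))"
      by (intro mult_left_mono sum_norm_le L)
    finally show ?thesis by (simp add: mult.assoc)
  qed
  then show ?thesis using L by (intro exI [of _ "L * CARD('r)"]) simp
qed

text \<open>The function extends by continuity, since it is Lipschitz near every point, and the extension
  is holomorphic in each variable as a locally uniform limit of its perturbations.\<close>

lemma extension_across_hyperplanes:
  obtains g where "\<And>s. s \<in> off_hyperplanes K \<Longrightarrow> g s = f s"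
    and "\<And>s. s \<in> polydisk \<Longrightarrow> hol_at g s"
    and "\<And>\<rho>. \<rho> < 1 \<Longrightarrow> \<exists>L\<ge>0. \<forall>s s'. (\<forall>i. cmod (s $ i) \<le> \<rho>) \<longrightarrow> (\<forall>i. cmod (s' $ i) \<le> \<rho>) \<longrightarrow>
        cmod (g s - g s') \<le> L * norm (s - s')"
proof -
  define g where "g s = lim (\<lambda>n. f (pert K s n))" for s
  have lim: "(\<lambda>n. f (pert K s n)) \<longlonglongrightarrow> g s" if s: "s \<in> polydisk" for s
  proof -
    obtain \<rho> where \<rho>: "1/2 \<le> \<rho>" "0 < \<rho>" "\<rho> < 1" "\<forall>i. cmod (s $ i) \<le> \<rho>"
      using polydisk_radius [OF s, of "1/2"] by auto
    obtain L where L: "0 \<le> L" "\<And>s s'. s \<in> off_hyperplanes K \<Longrightarrow> s' \<in> off_hyperplanes K \<Longrightarrow>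
        \<forall>i. cmod (s $ i) \<le> \<rho> \<Longrightarrow> \<forall>i. cmod (s' $ i) \<le> \<rho> \<Longrightarrow> cmod (f s - f s') \<le> L * norm (s - s')"
      using lipschitz_off_hyperplanes [OF \<rho>(2,3)] by blast
    have "Cauchy (\<lambda>n. f (pert K s n))"
    proof (rule metric_CauchyI)
      fix e :: real assume "0 < e"
      then have "0 < e / (L + 1)" using L by simp
      then obtain n0 where n0: "\<And>m n. m \<ge> n0 \<Longrightarrow> n \<ge> n0 \<Longrightarrow> dist (pert K s m) (pert K s n) < e / (L + 1)"
        using LIMSEQ_imp_Cauchy [OF pert_tendsto [of K s]] unfolding Cauchy_def by metis
      show "\<exists>M. \<forall>m\<ge>M. \<forall>n\<ge>M. dist (f (pert K s m)) (f (pert K s n)) < e"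
      proof (intro exI [of _ n0] allI impI)
        fix m n assume "n0 \<le> m" "n0 \<le> n"
        have "dist (f (pert K s m)) (f (pert K s n)) \<le> L * dist (pert K s m) (pert K s n)"
          unfolding dist_norm
          using \<rho> s by (intro L pert_off_hyperplanes allI pert_bounded) auto
        also have "\<dots> \<le> (L + 1) * dist (pert K s m) (pert K s n)"
          by (intro mult_right_mono) auto
        also have "\<dots> < e"
          using n0 [OF \<open>n0 \<le> m\<close> \<open>n0 \<le> n\<close>] L by (simp add: field_simps)
        finally show "dist (f (pert K s m)) (f (pert K s n)) < e" .
      qed
    qed
    then show ?thesis
      unfolding g_def by (simp add: Cauchy_convergent_iff convergent_LIMSEQ_iff)
  qed
  have g_eq: "g s = f s" if "s \<in> off_hyperplanes K" for s
    by (simp add: g_def pert_id [OF that])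
  have in_polydisk: "s \<in> polydisk" if "\<forall>i. cmod (s $ i) \<le> \<rho>" "\<rho> < 1" for s :: "complex^'r" and \<rho>
    using that by (auto simp: polydisk_def intro: le_less_trans)
  have lip: "\<exists>L\<ge>0. \<forall>s s'. (\<forall>i. cmod (s $ i) \<le> \<rho>) \<longrightarrow> (\<forall>i. cmod (s' $ i) \<le> \<rho>) \<longrightarrow>
        cmod (g s - g s') \<le> L * norm (s - s')" if "\<rho> < 1" for \<rho>
  proof -
    define \<sigma> where "\<sigma> = max (1/2) \<rho>"
    have \<sigma>: "0 < \<sigma>" "\<sigma> < 1" "1/2 \<le> \<sigma>" "\<rho> \<le> \<sigma>" using that by (auto simp: \<sigma>_def)
    obtain L where L: "0 \<le> L" "\<And>s s'. s \<in> off_hyperplanes K \<Longrightarrow> s' \<in> off_hyperplanes K \<Longrightarrow>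
        \<forall>i. cmod (s $ i) \<le> \<sigma> \<Longrightarrow> \<forall>i. cmod (s' $ i) \<le> \<sigma> \<Longrightarrow> cmod (f s - f s') \<le> L * norm (s - s')"
      using lipschitz_off_hyperplanes [OF \<sigma>(1,2)] by blast
    have "cmod (g s - g s') \<le> L * norm (s - s')"
      if s: "\<forall>i. cmod (s $ i) \<le> \<rho>" and s': "\<forall>i. cmod (s' $ i) \<le> \<rho>" for s s'
    proof (rule tendsto_le [OF sequentially_bot])
      have sp: "s \<in> polydisk" "s' \<in> polydisk" using s s' \<open>\<rho> < 1\<close> in_polydisk by blast+
      show "(\<lambda>n. cmod (f (pert K s n) - f (pert K s' n))) \<longlonglongrightarrow> cmod (g s - g s')"
        by (intro tendsto_intros lim sp)
      show "(\<lambda>n. L * norm (pert K s n - pert K s' n)) \<longlonglongrightarrow> L * norm (s - s')"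
        by (intro tendsto_intros pert_tendsto)
      have ss: "cmod (s $ i) \<le> \<sigma>" "cmod (s' $ i) \<le> \<sigma>" for i
        using s s' \<sigma>(4) by (auto intro: order_trans)
      show "\<forall>\<^sub>F n in sequentially. cmod (f (pert K s n) - f (pert K s' n)) \<le> L * norm (pert K s n - pert K s' n)"
        using ss \<sigma>(3) sp by (intro always_eventually allI L pert_off_hyperplanes pert_bounded)
    qed
    then show ?thesis using L(1) by blast
  qed
  have cont: "continuous_on polydisk g"
  proof (rule continuous_at_imp_continuous_on, rule ballI)
    fix s :: "complex^'r" assume s: "s \<in> polydisk"
    obtain \<rho> where \<rho>: "0 < \<rho>" "\<rho> < 1" "\<forall>i. cmod (s $ i) \<le> \<rho>"
      using polydisk_radius [OF s, of 0] by auto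
    define \<sigma> where "\<sigma> = (1 + \<rho>) / 2"
    have \<sigma>: "\<rho> < \<sigma>" "\<sigma> < 1" using \<rho> by (auto simp: \<sigma>_def)
    obtain L where L: "0 \<le> L" "\<And>s s'. \<forall>i. cmod (s $ i) \<le> \<sigma> \<Longrightarrow> \<forall>i. cmod (s' $ i) \<le> \<sigma> \<Longrightarrow>
        cmod (g s - g s') \<le> L * norm (s - s')"
      using lip [OF \<sigma>(2)] by blast
    show "isCont g s"
      unfolding isCont_def
    proof (rule tendsto_dist_iff [THEN iffD2], rule Lim_null_comparison)
      have "\<forall>\<^sub>F y in at s. dist y s < \<sigma> - \<rho>"
        using \<sigma> by (intro eventually_at_ball [where A = UNIV, THEN eventually_mono]) (auto simp: dist_commute)
      then show "\<forall>\<^sub>F y in at s. norm (dist (g y) (g s)) \<le> L * norm (y - s)"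
      proof eventually_elim
        case (elim y)
        have "cmod (y $ i) \<le> \<sigma>" for i
          using elim \<rho>(3) [rule_format, of i] Finite_Cartesian_Product.norm_nth_le [of "y - s" i]
            norm_triangle_sub [of "y $ i" "s $ i"]
          by (simp add: dist_norm)
        moreover have "cmod (s $ i) \<le> \<sigma>" for i
          using \<rho>(3) \<sigma>(1) by (meson less_imp_le order_trans)
        ultimately show ?case using L(2) [of y s] by (simp add: dist_norm)
      qed
      have "((\<lambda>y. L * norm (y - s)) \<longlongrightarrow> L * norm (s - s)) (at s)"
        by (intro tendsto_intros)
      then show "((\<lambda>y. L * norm (y - s)) \<longlongrightarrow> 0) (at s)" by simp
    qed
  qed
  have slice_cont: "continuous_on (ball 0 1) (\<lambda>t. g (upd s j t))" if "s \<in> polydisk" for s j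
    by (rule continuous_on_compose2 [OF cont continuous_on_upd]) (use that in \<open>auto intro: polydisk_upd\<close>)
  have generic: "(\<lambda>t. g (upd s j t)) holomorphic_on ball 0 1" if s: "s \<in> off_hyperplanes K" for s j
  proof (rule no_isolated_singularity [where K = "{0}"])
    obtain \<phi> where \<phi>: "\<phi> holomorphic_on ball 0 1"
        "\<And>t. t \<in> ball 0 1 \<Longrightarrow> t \<noteq> 0 \<Longrightarrow> \<phi> t = f (upd s j t)"
      using slice_extension [OF s, of j] by blast
    have "\<phi> holomorphic_on ball 0 1 - {0}"
      using \<phi>(1) by (rule holomorphic_on_subset) auto
    then show "(\<lambda>t. g (upd s j t)) holomorphic_on ball 0 1 - {0}"
      by (rule holomorphic_transform) (use \<phi>(2) s in \<open>auto simp: g_eq off_hyperplanes_upd\<close>)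
  qed (use slice_cont off_hyperplanes_polydisk [OF s] in auto)
  have sep: "(\<lambda>t. g (upd s j t)) holomorphic_on ball 0 1" if s: "s \<in> polydisk" for s j
  proof (rule holomorphic_uniform_sequence [where f = "\<lambda>n t. g (upd (pert K s n) j t)"])
    show "(\<lambda>t. g (upd (pert K s n) j t)) holomorphic_on ball 0 1" for n
      by (intro generic pert_off_hyperplanes s)
    fix x :: complex assume x: "x \<in> ball 0 1"
    define d where "d = (1 - cmod x) / 2"
    have d: "0 < d" "cmod x + d < 1" using x by (auto simp: d_def field_simps)
    obtain \<rho> where \<rho>: "max (1/2) (cmod x + d) \<le> \<rho>" "\<rho> < 1" "\<And>i. cmod (s $ i) \<le> \<rho>"
      using polydisk_radius [OF s, of "max (1/2) (cmod x + d)"] d by auto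
    obtain L where L: "0 \<le> L" "\<And>s s'. \<forall>i. cmod (s $ i) \<le> \<rho> \<Longrightarrow> \<forall>i. cmod (s' $ i) \<le> \<rho> \<Longrightarrow>
        cmod (g s - g s') \<le> L * norm (s - s')"
      using lip [OF \<rho>(2)] by blast
    have sub: "cmod t \<le> cmod x + d" if "t \<in> cball x d" for t
      using that norm_triangle_sub [of t x] by (simp add: dist_norm norm_minus_commute)
    have "uniform_limit (cball x d) (\<lambda>n t. g (upd (pert K s n) j t)) (\<lambda>t. g (upd s j t)) sequentially"
      unfolding uniform_limit_iff
    proof (intro allI impI)
      fix e :: real assume "0 < e"
      then have "0 < e / (L + 1)" using L by simp
      then have "\<forall>\<^sub>F n in sequentially. dist (pert K s n) s < e / (L + 1)"
        using pert_tendsto [of K s] by (simp add: tendstoD)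
      then show "\<forall>\<^sub>F n in sequentially. \<forall>t\<in>cball x d. dist (g (upd (pert K s n) j t)) (g (upd s j t)) < e"
      proof eventually_elim
        case (elim n)
        show ?case
        proof
          fix t assume t: "t \<in> cball x d"
          have "cmod (upd (pert K s n) j t $ i) \<le> \<rho>" "cmod (upd s j t $ i) \<le> \<rho>" for i
            using sub [OF t] \<rho> pert_bounded [of s \<rho> K n i] by (auto simp: upd_nth)
          then have "dist (g (upd (pert K s n) j t)) (g (upd s j t)) \<le> L * norm (upd (pert K s n) j t - upd s j t)"
            unfolding dist_norm by (intro L) auto
          also have "\<dots> \<le> (L + 1) * dist (pert K s n) s"
            unfolding dist_norm using L(1) by (intro mult_mono norm_upd_diff_le) auto
          also have "\<dots> < e"
            using elim L(1) by (simp add: field_simps)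
          finally show "dist (g (upd (pert K s n) j t)) (g (upd s j t)) < e" .
        qed
      qed
    qed
    moreover have "cball x d \<subseteq> ball 0 1"
      using sub d by (force simp: subset_iff)
    ultimately show "\<exists>d>0. cball x d \<subseteq> ball 0 1 \<and>
        uniform_limit (cball x d) (\<lambda>n t. g (upd (pert K s n) j t)) (\<lambda>t. g (upd s j t)) sequentially"
      using d by blast
  qed simp
  show thesis
    by (rule that [OF g_eq osgood [OF cont sep] lip])
qed

end


section \<open>Projections along varying subspaces\<close>

lemma span_image_sum:
  assumes "v \<in> vec.span (f ` I)" "finite I"
  shows "\<exists>c. v = (\<Sum>i\<in>I. c i *s f i)"
  using assms(1)
proof (induction rule: vec.span_induct_alt)
  case base
  show ?case by (intro exI [of _ "\<lambda>_. 0"]) simp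
next
  case (step r x y)
  then obtain c i where i: "i \<in> I" "x = f i" and c: "y = (\<Sum>i\<in>I. c i *s f i)" by blast
  have "(\<Sum>k\<in>I. (c(i := r + c i)) k *s f k) = (\<Sum>k\<in>I. c k *s f k + (if k = i then r *s f i else 0))"
    by (intro sum.cong) (auto simp: vec.scale_left_distrib)
  also have "\<dots> = r *s x + y"
    using i c assms(2) by (simp add: sum.distrib)
  finally show ?case by metis
qed

text \<open>A frame of the bundle \<open>E\<close> near \<open>y0\<close> provides a matrix \<open>G y\<close> that is the identity on \<open>W\<close> and
  moves the fibre at \<open>y0\<close> to that at \<open>y\<close>. The projections satisfy \<open>P y = P y0 + P y (1 - G y)\<close>, from
  which their regularity at \<open>y0\<close> is read off.\<close>

lemma proj_frame:
  fixes b :: "nat \<Rightarrow> 'a \<Rightarrow> complex^'n" and d :: nat and P :: "'a \<Rightarrow> complex^'n^'n"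
  assumes P0: "is_proj (E y0) W (P y0)" and span: "E y0 \<subseteq> vec.span ((\<lambda>i. b i y0) ` {..<d})"
  shows "\<exists>c :: 'n \<Rightarrow> nat \<Rightarrow> complex. let G = (\<lambda>y. \<chi> r k. P y0 $ r $ k + (\<Sum>i<d. c k i * b i y $ r)) in
    G y0 = mat 1 \<and>
    (\<forall>y. is_proj (E y) W (P y) \<and> (\<forall>i<d. b i y \<in> E y) \<longrightarrow> P y = P y0 + P y ** (mat 1 - G y))"
proof -
  have "\<exists>c. axis k 1 - P y0 *v axis k 1 = (\<Sum>i<d. c i *s b i y0)" for k
    using is_projD(2) [OF P0, of "axis k 1"] span by (intro span_image_sum) auto
  then obtain c where c: "\<And>k. axis k 1 - P y0 *v axis k 1 = (\<Sum>i<d. c k i *s b i y0)" by metis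
  define G where "G = (\<lambda>y. \<chi> r k. P y0 $ r $ k + (\<Sum>i<d. c k i * b i y $ r))"
  have col: "(P y0 *v axis k 1) $ r = P y0 $ r $ k" for k r
    by (simp add: matrix_vector_mult_def axis_def if_distrib [of "(*) _"] cong: if_cong)
  have "G y0 = mat 1"
  proof -
    have "(\<Sum>i<d. c k i * b i y0 $ r) = axis k 1 $ r - P y0 $ r $ k" for k r
      using arg_cong [OF c [of k], of "\<lambda>v. v $ r"] by (simp add: col)
    then show ?thesis by (auto simp: G_def vec_eq_iff mat_def axis_def)
  qed
  moreover have "P y = P y0 + P y ** (mat 1 - G y)"
    if y: "is_proj (E y) W (P y)" "\<forall>i<d. b i y \<in> E y" for y
  proof -
    have "P y ** G y = P y0"
    proof -
      have "(P y ** G y) $ r $ k = P y0 $ r $ k" for r k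
      proof -
        have "(P y ** G y) $ r $ k = (P y *v (P y0 *v axis k 1 + (\<Sum>i<d. c k i *s b i y))) $ r"
          by (simp add: matrix_matrix_mult_def matrix_vector_mult_def [of "P y"] G_def col)
        also have "P y *v (P y0 *v axis k 1 + (\<Sum>i<d. c k i *s b i y)) = P y0 *v axis k 1"
          using is_projD(3) [OF y(1) is_projD(1) [OF P0]] is_projD(4) [OF y(1)] y(2)
          by (simp add: mv.add_right mv.sum_right matrix_mult_scale_vec)
        finally show ?thesis by (simp add: col)
      qed
      then show ?thesis by (simp add: vec_eq_iff)
    qed
    then show ?thesis by (simp add: mat_distribs)
  qed
  ultimately show ?thesis
    unfolding Let_def G_def by blast
qed

lemma proj_tendsto:
  fixes b :: "nat \<Rightarrow> 'a::topological_space \<Rightarrow> complex^'n" and P :: "'a \<Rightarrow> complex^'n^'n"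
  assumes P0: "is_proj (E y0) W (P y0)" and span: "E y0 \<subseteq> vec.span ((\<lambda>i. b i y0) ` {..<d})"
    and ev: "\<forall>\<^sub>F y in at y0. is_proj (E y) W (P y) \<and> (\<forall>i<d. b i y \<in> E y)"
    and b: "\<And>i. i < d \<Longrightarrow> (b i \<longlongrightarrow> b i y0) (at y0)"
  shows "(P \<longlongrightarrow> P y0) (at y0)"
proof -
  obtain c :: "'n \<Rightarrow> nat \<Rightarrow> complex" and G :: "'a \<Rightarrow> complex^'n^'n" where
    G_def: "G = (\<lambda>y. \<chi> r k. P y0 $ r $ k + (\<Sum>i<d. c k i * b i y $ r))"
    and G0: "G y0 = mat 1"
    and G: "\<And>y. is_proj (E y) W (P y) \<and> (\<forall>i<d. b i y \<in> E y) \<Longrightarrow> P y = P y0 + P y ** (mat 1 - G y)"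
    using proj_frame [where E = E and W = W and P = P and b = b and ?y0.0 = y0 and d = d, OF P0 span]
    unfolding Let_def by blast
  have "(G \<longlongrightarrow> G y0) (at y0)"
    unfolding G_def by (intro vec_tendstoI) (auto intro!: tendsto_intros b)
  then have "((\<lambda>y. mat 1 - G y) \<longlongrightarrow> mat 1 - G y0) (at y0)"
    by (intro tendsto_intros)
  then have lim: "((\<lambda>y. mat 1 - G y) \<longlongrightarrow> 0) (at y0)"
    by (simp add: G0)
  obtain C where C: "0 < C" "\<And>(A :: complex^'n^'n) (B :: complex^'n^'n). norm (A ** B) \<le> norm A * norm B * C"
    using mm.pos_bounded by blast
  have "\<forall>\<^sub>F y in at y0. norm (mat 1 - G y) < 1 / (2 * C)"
    using tendstoD [OF lim, of "1 / (2 * C)"] C by (simp add: dist_norm)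
  with ev have "\<forall>\<^sub>F y in at y0. norm (P y - P y0) \<le> 2 * norm (P y0) * C * norm (mat 1 - G y)"
  proof eventually_elim
    case (elim y)
    have eq: "P y = P y0 + P y ** (mat 1 - G y)" using G elim by blast
    then have diff: "norm (P y - P y0) \<le> norm (P y) * norm (mat 1 - G y) * C"
      using C(2) [of "P y" "mat 1 - G y"] by (metis add_diff_cancel_left')
    have "norm (mat 1 - G y) * C \<le> 1 / 2"
      using elim C(1) by (simp add: field_simps)
    then have "norm (P y) * (norm (mat 1 - G y) * C) \<le> norm (P y) * (1 / 2)"
      by (rule mult_left_mono) simp
    then have "norm (P y - P y0) \<le> norm (P y) / 2"
      using diff by (simp add: mult.assoc)
    then have "norm (P y) \<le> 2 * norm (P y0)"
      using norm_triangle_sub [of "P y" "P y0"] by simp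
    then have "norm (P y) * norm (mat 1 - G y) * C \<le> 2 * norm (P y0) * norm (mat 1 - G y) * C"
      using C by (intro mult_right_mono) auto
    then show ?case using diff by (simp add: mult_ac)
  qed
  moreover
  have "((\<lambda>y. 2 * norm (P y0) * C * norm (mat 1 - G y)) \<longlongrightarrow> 2 * norm (P y0) * C * norm (0 :: complex^'n^'n)) (at y0)"
    by (intro tendsto_intros lim)
  then have "((\<lambda>y. 2 * norm (P y0) * C * norm (mat 1 - G y)) \<longlongrightarrow> 0) (at y0)"
    by simp
  ultimately have "((\<lambda>y. P y - P y0) \<longlongrightarrow> 0) (at y0)"
    by (rule Lim_null_comparison)
  then show ?thesis by (simp add: LIM_zero_iff)
qed

lemma proj_hol_at:
  fixes b :: "nat \<Rightarrow> complex^'r \<Rightarrow> complex^'n" and P :: "complex^'r \<Rightarrow> complex^'n^'n"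
  assumes ev: "\<forall>\<^sub>F y in nhds y0. is_proj (E y) W (P y) \<and> (\<forall>i<d. b i y \<in> E y)"
    and span: "E y0 \<subseteq> vec.span ((\<lambda>i. b i y0) ` {..<d})"
    and b: "\<And>i r. i < d \<Longrightarrow> hol_at (\<lambda>y. b i y $ r) y0"
  shows "hol_at (\<lambda>y. P y $ r $ k) y0"
proof -
  have P0: "is_proj (E y0) W (P y0)"
    using eventually_nhds_x_imp_x [OF ev] by simp
  obtain c :: "'n \<Rightarrow> nat \<Rightarrow> complex" and G :: "complex^'r \<Rightarrow> complex^'n^'n" where
    G_def: "G = (\<lambda>y. \<chi> r k. P y0 $ r $ k + (\<Sum>i<d. c k i * b i y $ r))"
    and G0: "G y0 = mat 1"
    and G: "\<And>y. is_proj (E y) W (P y) \<and> (\<forall>i<d. b i y \<in> E y) \<Longrightarrow> P y = P y0 + P y ** (mat 1 - G y)"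
    using proj_frame [where E = E and W = W and P = P and b = b and ?y0.0 = y0 and d = d, OF P0 span]
    unfolding Let_def by blast
  have "(b i \<longlongrightarrow> b i y0) (at y0)" if "i < d" for i
    using hol_at_isCont [OF b [OF that]] by (intro vec_tendstoI) (simp add: isCont_def)
  then have "(P \<longlongrightarrow> P y0) (at y0)"
    by (intro proj_tendsto [where E = E and W = W and P = P and b = b and ?y0.0 = y0 and d = d, OF P0 span]) (use ev in \<open>auto simp: eventually_at_filter elim: eventually_mono\<close>)
  then have cont: "isCont (\<lambda>y. P y $ r $ k) y0" for r k
    unfolding isCont_def by (intro tendsto_vec_nth)
  have "hol_at (\<lambda>y. (mat 1 - G y) $ i $ k) y0" for i
    unfolding G_def by (auto intro!: hol_at_diff hol_at_add hol_at_sum hol_at_mult b)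
  then have "hol_at (\<lambda>y. P y0 $ r $ k + (\<Sum>i\<in>UNIV. P y $ r $ i * (mat 1 - G y) $ i $ k)) y0"
    by (intro hol_at_add hol_at_sum hol_at_mult_vanishing cont) (auto simp: G0)
  then show ?thesis
  proof (rule hol_at_cong [rotated])
    show "\<forall>\<^sub>F y in nhds y0. P y0 $ r $ k + (\<Sum>i\<in>UNIV. P y $ r $ i * (mat 1 - G y) $ i $ k) = P y $ r $ k"
      using ev
    proof eventually_elim
      case (elim y)
      have "P y $ r $ k = (P y0 + P y ** (mat 1 - G y)) $ r $ k"
        using G [OF elim] by simp
      then show ?case by (simp add: matrix_matrix_mult_def)
    qed
  qed
qed


section \<open>Lipschitz families of polynomial growth\<close>

text \<open>Families of functions of a logarithmic parameter \<open>u\<close> which depend on \<open>s\<close> in a Lipschitz way, with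
  constants of polynomial growth in \<open>u\<close>. They are closed under bilinear operations, and a factor
  vanishing with \<open>s\<close> outweighs their growth when \<open>u\<close> is of the size of \<open>log |s|\<close>.\<close>

definition plip ::
  "'a::metric_space set \<Rightarrow> ('a \<Rightarrow> 'b::real_normed_vector \<Rightarrow> 'c::real_normed_vector) \<Rightarrow> bool" where
  "plip B f \<longleftrightarrow> (\<exists>C d. 0 \<le> C \<and> (\<forall>s\<in>B. \<forall>s'\<in>B. \<forall>u. norm (f s u) \<le> C * (1 + norm u) ^ d \<and>
     norm (f s u - f s' u) \<le> C * (1 + norm u) ^ d * dist s s'))"

lemma plipE:
  assumes "plip B f"
  obtains C d where "0 \<le> C" "\<And>s u. s \<in> B \<Longrightarrow> norm (f s u) \<le> C * (1 + norm u) ^ d"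
    "\<And>s s' u. s \<in> B \<Longrightarrow> s' \<in> B \<Longrightarrow> norm (f s u - f s' u) \<le> C * (1 + norm u) ^ d * dist s s'"
  using assms unfolding plip_def by blast

lemma plip_const [intro]: "plip B (\<lambda>s u. c)"
  unfolding plip_def by (intro exI [of _ "norm c"] exI [of _ 0]) auto

lemma plip_param:
  assumes "bounded_linear h" shows "plip B (\<lambda>s u. h u)"
proof -
  obtain K where K: "0 < K" "\<And>u. norm (h u) \<le> norm u * K"
    using bounded_linear.pos_bounded [OF assms] by blast
  have "norm (h u) \<le> K * (1 + norm u) ^ 1" for u
    using K(2) [of u] K(1) by (simp add: algebra_simps)
  then show ?thesis
    unfolding plip_def using K(1) by (intro exI [of _ K] exI [of _ 1]) auto
qed

lemma plip_base:
  assumes "\<And>s. s \<in> B \<Longrightarrow> norm (g s) \<le> M"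
    and "\<And>s s'. s \<in> B \<Longrightarrow> s' \<in> B \<Longrightarrow> norm (g s - g s') \<le> L * dist s s'"
  shows "plip B (\<lambda>s u. g s)"
proof -
  have "norm (g s - g s') \<le> max 0 (max M L) * dist s s'" if "s \<in> B" "s' \<in> B" for s s'
  proof -
    have "L * dist s s' \<le> max 0 (max M L) * dist s s'"
      by (intro mult_right_mono) auto
    then show ?thesis using assms(2) [OF that] by linarith
  qed
  then show ?thesis
    unfolding plip_def using assms(1)
    by (intro exI [of _ "max 0 (max M L)"] exI [of _ 0]) (auto simp: le_max_iff_disj)
qed

lemma plip_bilinear:
  assumes bl: "bounded_bilinear bl" and f: "plip B f" and g: "plip B g"
  shows "plip B (\<lambda>s u. bl (f s u) (g s u))"
proof -
  interpret bounded_bilinear bl by fact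
  obtain K where K: "0 < K" "\<And>a b. norm (bl a b) \<le> norm a * norm b * K"
    using pos_bounded by blast
  obtain C d where f: "0 \<le> C" "\<And>s u. s \<in> B \<Longrightarrow> norm (f s u) \<le> C * (1 + norm u) ^ d"
    "\<And>s s' u. s \<in> B \<Longrightarrow> s' \<in> B \<Longrightarrow> norm (f s u - f s' u) \<le> C * (1 + norm u) ^ d * dist s s'"
    using f by (rule plipE) blast
  obtain C' d' where g: "0 \<le> C'" "\<And>s u. s \<in> B \<Longrightarrow> norm (g s u) \<le> C' * (1 + norm u) ^ d'"
    "\<And>s s' u. s \<in> B \<Longrightarrow> s' \<in> B \<Longrightarrow> norm (g s u - g s' u) \<le> C' * (1 + norm u) ^ d' * dist s s'"
    using g by (rule plipE) blast
  define D where "D = 2 * C * C' * K"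
  have D: "0 \<le> D" using f(1) g(1) K(1) by (simp add: D_def)
  have 1: "norm (bl (f s u) (g s u)) \<le> D * (1 + norm u) ^ (d + d')" if "s \<in> B" for s u
  proof -
    have "norm (bl (f s u) (g s u)) \<le> (C * (1 + norm u) ^ d) * (C' * (1 + norm u) ^ d') * K"
      by (intro order_trans [OF K(2)] mult_right_mono mult_mono f g that)
        (use f(1) K(1) in auto)
    also have "\<dots> = D / 2 * (1 + norm u) ^ (d + d')"
      by (simp add: D_def power_add)
    also have "\<dots> \<le> D * (1 + norm u) ^ (d + d')"
      using D by (intro mult_right_mono) auto
    finally show ?thesis .
  qed
  have 2: "norm (bl (f s u) (g s u) - bl (f s' u) (g s' u)) \<le> D * (1 + norm u) ^ (d + d') * dist s s'"
    if "s \<in> B" "s' \<in> B" for s s' u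
  proof -
    have "norm (bl (f s u - f s' u) (g s u))
        \<le> (C * (1 + norm u) ^ d * dist s s') * (C' * (1 + norm u) ^ d') * K"
      by (intro order_trans [OF K(2)] mult_right_mono mult_mono f g that)
        (use f(1) K(1) in auto)
    moreover have "norm (bl (f s' u) (g s u - g s' u))
        \<le> (C * (1 + norm u) ^ d) * (C' * (1 + norm u) ^ d' * dist s s') * K"
      by (intro order_trans [OF K(2)] mult_right_mono mult_mono f g that)
        (use f(1) K(1) in auto)
    moreover have "bl (f s u) (g s u) - bl (f s' u) (g s' u)
        = bl (f s u - f s' u) (g s u) + bl (f s' u) (g s u - g s' u)"
      by (simp add: diff_left diff_right)
    ultimately have "norm (bl (f s u) (g s u) - bl (f s' u) (g s' u))
        \<le> (C * (1 + norm u) ^ d * dist s s') * (C' * (1 + norm u) ^ d') * K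
          + (C * (1 + norm u) ^ d) * (C' * (1 + norm u) ^ d' * dist s s') * K"
      by (simp only:) (rule norm_triangle_mono)
    also have "\<dots> = D * (1 + norm u) ^ (d + d') * dist s s'"
      by (simp add: D_def power_add algebra_simps)
    finally show ?thesis .
  qed
  show ?thesis
    unfolding plip_def using D 1 2 by blast
qed

lemma plip_linear: "bounded_linear h \<Longrightarrow> plip B f \<Longrightarrow> plip B (\<lambda>s u. h (f s u))"
proof -
  assume h: "bounded_linear h" and f: "plip B f"
  have "bounded_bilinear (\<lambda>(r :: real) x. r *\<^sub>R h x)"
    by (rule bounded_bilinear.comp [OF bounded_bilinear_scaleR bounded_linear_ident h])
  from plip_bilinear [OF this plip_const [of B 1] f] show ?thesis by simp
qed

lemma plip_add:
  assumes f: "plip B f" and g: "plip B g" shows "plip B (\<lambda>s u. f s u + g s u)"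
proof -
  obtain C d where f: "0 \<le> C" "\<And>s u. s \<in> B \<Longrightarrow> norm (f s u) \<le> C * (1 + norm u) ^ d"
    "\<And>s s' u. s \<in> B \<Longrightarrow> s' \<in> B \<Longrightarrow> norm (f s u - f s' u) \<le> C * (1 + norm u) ^ d * dist s s'"
    using f by (rule plipE) blast
  obtain C' d' where g: "0 \<le> C'" "\<And>s u. s \<in> B \<Longrightarrow> norm (g s u) \<le> C' * (1 + norm u) ^ d'"
    "\<And>s s' u. s \<in> B \<Longrightarrow> s' \<in> B \<Longrightarrow> norm (g s u - g s' u) \<le> C' * (1 + norm u) ^ d' * dist s s'"
    using g by (rule plipE) blast
  have pow: "C * (1 + norm u) ^ d + C' * (1 + norm u) ^ d' \<le> (C + C') * (1 + norm u) ^ (d + d')" for u :: 'b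
  proof -
    have "(1 + norm u) ^ d \<le> (1 + norm u) ^ (d + d')" "(1 + norm u) ^ d' \<le> (1 + norm u) ^ (d + d')"
      by (intro power_increasing; simp)+
    then show ?thesis
      using f(1) g(1) by (simp add: distrib_right add_mono mult_left_mono)
  qed
  show ?thesis
    unfolding plip_def
  proof (intro exI [of _ "C + C'"] exI [of _ "d + d'"] conjI ballI allI)
    fix s s' :: 'a and u :: 'b assume s: "s \<in> B" "s' \<in> B"
    show "norm (f s u + g s u) \<le> (C + C') * (1 + norm u) ^ (d + d')"
      using norm_triangle_ineq [of "f s u" "g s u"] f(2) [OF s(1), of u] g(2) [OF s(1), of u] pow [of u]
      by linarith
    have "norm (f s u + g s u - (f s' u + g s' u)) \<le> norm (f s u - f s' u) + norm (g s u - g s' u)"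
      using norm_triangle_ineq [of "f s u - f s' u" "g s u - g s' u"] by (simp add: algebra_simps)
    also have "\<dots> \<le> (C * (1 + norm u) ^ d + C' * (1 + norm u) ^ d') * dist s s'"
      using f(3) [OF s, of u] g(3) [OF s, of u] by (simp add: distrib_right)
    also have "\<dots> \<le> (C + C') * (1 + norm u) ^ (d + d') * dist s s'"
      by (intro mult_right_mono pow) simp
    finally show "norm (f s u + g s u - (f s' u + g s' u)) \<le> (C + C') * (1 + norm u) ^ (d + d') * dist s s'" .
  qed (use f(1) g(1) in auto)
qed

lemma plip_diff: "plip B f \<Longrightarrow> plip B g \<Longrightarrow> plip B (\<lambda>s u. f s u - g s u)"
  using plip_add [OF _ plip_linear [OF bounded_linear_minus [OF bounded_linear_ident]], of B f g] by simp

lemma plip_sum: "(\<And>i. i \<in> I \<Longrightarrow> plip B (f i)) \<Longrightarrow> plip B (\<lambda>s u. \<Sum>i\<in>I. f i s u)"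
  by (induction I rule: infinite_finite_induct) (auto intro: plip_add)

lemma plip_mat_pow: "plip B f \<Longrightarrow> plip B (\<lambda>s u. mat_pow (f s u) k)"
  by (induction k) (auto simp: mat_pow_Suc intro: plip_bilinear [OF bounded_bilinear_matrix_mult])

lemma plip_mat_log: "plip B f \<Longrightarrow> plip B (\<lambda>s u. mat_log m (f s u))"
  unfolding mat_log_def
  by (intro plip_sum plip_linear [OF bounded_linear_scaleR_right] plip_mat_pow plip_diff plip_const)

lemma plip_height_vec:
  assumes "\<And>b. plip B (\<lambda>s u. P s u b)"
  shows "plip B (\<lambda>s u. height_vec m c a (P s u) v)"
  unfolding height_vec_def deligne_log_def gr_iso_def summand_def
  by (intro plip_bilinear [OF bounded_bilinear_matrix_vector_mult] plip_const assms plip_diff plip_mat_log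
      plip_linear [OF bounded_bilinear.bounded_linear_right [OF bounded_bilinear_scale_mat]] plip_sum
      plip_bilinear [OF bounded_bilinear_matrix_mult] plip_linear [OF bounded_linear_conj_mat])

lemma log_growth:
  assumes "0 \<le> R"
  shows "\<exists>D\<ge>0. \<forall>x. 0 < x \<longrightarrow> x \<le> 1 \<longrightarrow> (1 + R * (1 + ln (1 / x))) ^ d * x \<le> D * sqrt x"
proof -
  define e :: real where "e = 1 / (2 * real (Suc d))"
  have e: "0 < e" "e * real d \<le> 1 / 2" by (auto simp: e_def field_simps)
  define A where "A = 1 + R * (1 + 1 / e)"
  have A: "1 \<le> A" using assms e by (simp add: A_def)
  have "(1 + R * (1 + ln (1 / x))) ^ d * x \<le> A ^ d * sqrt x" if x: "0 < x" "x \<le> 1" for x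
  proof -
    define y where "y = (1 / x) powr e"
    have y: "1 \<le> y" using x e by (simp add: y_def ge_one_powr_ge_zero)
    have "ln (1 / x) \<le> y / e"
      unfolding y_def using x e by (intro ln_powr_bound) auto
    then have "R * (1 + ln (1 / x)) \<le> R * (y + y / e)"
      using y assms by (intro mult_left_mono) auto
    then have "1 + R * (1 + ln (1 / x)) \<le> A * y"
      using y by (simp add: A_def algebra_simps)
    moreover have "0 \<le> 1 + R * (1 + ln (1 / x))"
      using x assms by (intro add_nonneg_nonneg mult_nonneg_nonneg) auto
    ultimately have "(1 + R * (1 + ln (1 / x))) ^ d \<le> (A * y) ^ d"
      by (intro power_mono)
    also have "\<dots> = A ^ d * y ^ d" by (simp add: power_mult_distrib)
    also have "y ^ d \<le> (1 / x) powr (1 / 2)"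
    proof -
      have "y ^ d = (1 / x) powr (e * real d)"
        using x by (simp add: y_def powr_powr flip: powr_realpow)
      also have "\<dots> \<le> (1 / x) powr (1 / 2)"
        using x e by (intro powr_mono) auto
      finally show ?thesis .
    qed
    finally have "(1 + R * (1 + ln (1 / x))) ^ d * x \<le> A ^ d * (1 / x) powr (1 / 2) * x"
      using x A by (simp add: mult_left_mono mult_right_mono)
    also have "\<dots> = A ^ d * ((1 / x) powr (1 / 2) * x)"
      by (simp only: mult.assoc)
    also have "(1 / x) powr (1 / 2) * x = sqrt x"
      using x by (simp add: powr_half_sqrt real_sqrt_divide field_simps)
    finally show ?thesis .
  qed
  then show ?thesis using A by (intro exI [of _ "A ^ d"]) auto
qed

text \<open>The logarithmic parameters \<open>u\<^sub>j\<close> may be arbitrarily large compared with the other coordinates of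
  \<open>s\<close>, so they are removed in the order of increasing \<open>|s\<^sub>j|\<close>: replacing the smallest coordinate by 0
  costs a power of the logarithm of that coordinate times the coordinate itself, and once it is 0 the
  value does not depend on the corresponding parameter.\<close>

lemma logarithmic_limit:
  fixes H :: "complex^'r \<Rightarrow> complex^'r \<Rightarrow> 'c::real_normed_vector" and K :: "'r set" and \<rho> :: real
  defines "B \<equiv> {s. \<forall>i. cmod (s $ i) \<le> \<rho>}"
  assumes \<rho>: "0 < \<rho>" "\<rho> \<le> 1" and H: "plip B H"
    and indep: "\<And>s u j. s \<in> B \<Longrightarrow> j \<in> K \<Longrightarrow> s $ j = 0 \<Longrightarrow> H s u = H s (upd u j 0)"
    and s: "(s \<longlongrightarrow> 0) F"
    and u: "\<forall>\<^sub>F x in F. (\<forall>j\<in>K. s x $ j \<noteq> 0 \<and> cmod (u x $ j) \<le> 1 + ln (1 / cmod (s x $ j))) \<and>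
      (\<forall>j. j \<notin> K \<longrightarrow> u x $ j = 0)"
  shows "((\<lambda>x. H (s x) (u x)) \<longlongrightarrow> H 0 0) F"
proof -
  obtain C d where C: "0 \<le> C"
    "\<And>s s' u. s \<in> B \<Longrightarrow> s' \<in> B \<Longrightarrow> norm (H s u - H s' u) \<le> C * (1 + norm u) ^ d * dist s s'"
    using H by (rule plipE) blast
  obtain D where D: "0 \<le> D"
    "\<And>x. 0 < x \<Longrightarrow> x \<le> 1 \<Longrightarrow> (1 + CARD('r) * (1 + ln (1 / x))) ^ d * x \<le> D * sqrt x"
    using log_growth [of "CARD('r)" d] by auto
  define zero where "zero J s = (\<chi> i. if i \<in> J then 0 else s $ i)" for J and s :: "complex^'r"
  have key: "norm (H s u - H (zero J s) 0) \<le> card J * (C * D) * sqrt (norm s)"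
    if "finite J" "J \<subseteq> K" "s \<in> B" "\<forall>j\<in>J. s $ j \<noteq> 0 \<and> cmod (u $ j) \<le> 1 + ln (1 / cmod (s $ j))"
      "\<forall>j\<in>K - J. s $ j = 0" "\<forall>j. j \<notin> J \<longrightarrow> u $ j = 0" for J s u
    using that
  proof (induction "card J" arbitrary: J s u)
    case 0
    then have "J = {}" by simp
    moreover have "u = 0" using 0 \<open>J = {}\<close> by (simp add: vec_eq_iff)
    ultimately show ?case by (simp add: zero_def)
  next
    case (Suc n)
    then have "J \<noteq> {}" by auto
    obtain j where j: "j \<in> J" "\<And>i. i \<in> J \<Longrightarrow> cmod (s $ j) \<le> cmod (s $ i)"
      using arg_min_if_finite(1) [OF \<open>finite J\<close> \<open>J \<noteq> {}\<close>, of "\<lambda>i. cmod (s $ i)"]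
        arg_min_least [OF \<open>finite J\<close> \<open>J \<noteq> {}\<close>, of _ "\<lambda>i. cmod (s $ i)"] by metis
    define x where "x = cmod (s $ j)"
    have x: "0 < x" "x \<le> 1" "x \<le> norm s"
      using j(1) Suc.prems \<rho> Finite_Cartesian_Product.norm_nth_le [of s j]
      by (auto simp: x_def B_def intro: order_trans)
    have uj: "cmod (u $ i) \<le> 1 + ln (1 / x)" for i
    proof (cases "i \<in> J")
      case True
      then have "cmod (u $ i) \<le> 1 + ln (1 / cmod (s $ i))" "x \<le> cmod (s $ i)"
        using Suc.prems j(2) by (auto simp: x_def)
      moreover have "ln (1 / cmod (s $ i)) \<le> ln (1 / x)"
        using x \<open>x \<le> cmod (s $ i)\<close> by (intro ln_mono frac_le) auto
      ultimately show ?thesis by linarith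
    next
      case False
      then show ?thesis using Suc.prems x by simp
    qed
    have "norm u \<le> CARD('r) * (1 + ln (1 / x))"
      using sum_bounded_above [of UNIV "\<lambda>i. cmod (u $ i)" "1 + ln (1 / x)"] uj norm_le_l1 [of u] by simp
    then have pow: "(1 + norm u) ^ d \<le> (1 + CARD('r) * (1 + ln (1 / x))) ^ d"
      by (intro power_mono) auto
    define s' where "s' = upd s j 0"
    define u' where "u' = upd u j 0"
    have s': "s' \<in> B" using Suc.prems(3) \<rho> by (auto simp: B_def s'_def upd_nth)
    have "s - s' = axis j (s $ j - 0)"
      unfolding s'_def using upd_diff [of s j "s $ j" 0] by simp
    then have dist: "dist s s' = x"
      by (simp add: dist_norm x_def norm_axis)
    have "norm (H s u - H s' u) \<le> C * (1 + norm u) ^ d * x"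
      using C(2) [OF Suc.prems(3) s', of u] by (simp add: dist)
    also have "\<dots> \<le> C * ((1 + CARD('r) * (1 + ln (1 / x))) ^ d * x)"
      using C(1) pow x by (simp add: mult.assoc mult_left_mono mult_right_mono)
    also have "\<dots> \<le> C * (D * sqrt x)"
      by (intro mult_left_mono D x C)
    also have "\<dots> \<le> C * (D * sqrt (norm s))"
      using C(1) D(1) x by (intro mult_left_mono real_sqrt_le_mono) auto
    finally have 1: "norm (H s u - H s' u) \<le> C * D * sqrt (norm s)" by (simp add: mult.assoc)
    have eq: "H s' u = H s' u'"
      unfolding u'_def using s' j(1) Suc.prems by (intro indep) (auto simp: s'_def upd_nth)
    have card: "n = card (J - {j})" using Suc j(1) by simp
    have "norm (H s' u' - H (zero (J - {j}) s') 0) \<le> card (J - {j}) * (C * D) * sqrt (norm s')"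
      using Suc.prems s' by (intro Suc.hyps(1) card) (auto simp: s'_def u'_def upd_nth)
    moreover have "zero (J - {j}) s' = zero J s"
      using j(1) by (auto simp: zero_def s'_def upd_nth vec_eq_iff)
    moreover have "norm s' \<le> norm s"
      by (rule norm_le_componentwise_cart) (simp add: s'_def upd_nth)
    moreover have "real n * (C * D) * sqrt (norm s') \<le> real n * (C * D) * sqrt (norm s)"
      using C(1) D(1) \<open>norm s' \<le> norm s\<close> by (intro mult_left_mono real_sqrt_le_mono) auto
    ultimately have 2: "norm (H s' u' - H (zero J s) 0) \<le> real n * (C * D) * sqrt (norm s)"
      by (simp add: card)
    have "norm (H s u - H (zero J s) 0) \<le> norm (H s u - H s' u) + norm (H s' u' - H (zero J s) 0)"
      using norm_triangle_ineq [of "H s u - H s' u" "H s' u' - H (zero J s) 0"] by (simp add: eq)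
    also have "\<dots> \<le> real (Suc n) * (C * D) * sqrt (norm s)"
      using 1 2 by (simp add: algebra_simps)
    finally show ?case using Suc.hyps(2) by simp
  qed
  have bound: "norm (H s u - H 0 0) \<le> card K * (C * D) * sqrt (norm s) + C * norm s"
    if "s \<in> B" "(\<forall>j\<in>K. s $ j \<noteq> 0 \<and> cmod (u $ j) \<le> 1 + ln (1 / cmod (s $ j))) \<and>
      (\<forall>j. j \<notin> K \<longrightarrow> u $ j = 0)" for s u
  proof -
    have z: "norm (zero K s) \<le> norm s"
      by (rule norm_le_componentwise_cart) (simp add: zero_def)
    have zB: "zero K s \<in> B" "0 \<in> B"
      using that(1) \<rho> by (auto simp: B_def zero_def)
    have "norm (H (zero K s) 0 - H 0 0) \<le> C * dist (zero K s) 0"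
      using C(2) [OF zB, of 0] by simp
    also have "\<dots> \<le> C * norm s"
      using z C(1) by (simp add: mult_left_mono)
    finally have "norm (H (zero K s) 0 - H 0 0) \<le> C * norm s" .
    moreover have "norm (H s u - H (zero K s) 0) \<le> card K * (C * D) * sqrt (norm s)"
      using that by (intro key) auto
    ultimately show ?thesis
      using norm_triangle_ineq [of "H s u - H (zero K s) 0" "H (zero K s) 0 - H 0 0"] by simp
  qed
  have "\<forall>\<^sub>F x in F. s x \<in> B"
  proof -
    have "\<forall>\<^sub>F x in F. dist (s x) 0 < \<rho>" by (rule tendstoD [OF s \<rho>(1)])
    then show ?thesis
      by eventually_elim
        (auto simp: B_def intro: order_trans [OF Finite_Cartesian_Product.norm_nth_le])
  qed
  with u have "\<forall>\<^sub>F x in F. norm (H (s x) (u x) - H 0 0)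
      \<le> card K * (C * D) * sqrt (norm (s x)) + C * norm (s x)"
    by eventually_elim (rule bound)
  moreover
  have "((\<lambda>x. card K * (C * D) * sqrt (norm (s x)) + C * norm (s x)) \<longlongrightarrow>
      card K * (C * D) * sqrt (norm (0 :: complex^'r)) + C * norm (0 :: complex^'r)) F"
    by (intro tendsto_intros s)
  then have "((\<lambda>x. card K * (C * D) * sqrt (norm (s x)) + C * norm (s x)) \<longlongrightarrow> 0) F"
    by simp
  ultimately have "((\<lambda>x. H (s x) (u x) - H 0 0) \<longlongrightarrow> 0) F"
    by (rule Lim_null_comparison)
  then show ?thesis by (simp add: LIM_zero_iff)
qed


section \<open>Change of reference fibre\<close>

lemma coeff_ring_closed:
  assumes "coeff_ring A"
  shows "0 \<in> A" "x \<in> A \<Longrightarrow> y \<in> A \<Longrightarrow> x + y \<in> A" "x \<in> A \<Longrightarrow> y \<in> A \<Longrightarrow> x * y \<in> A"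
  using assms by (auto simp: coeff_ring_def)

lemma A_points_mult:
  assumes A: "coeff_ring A" and X: "X \<in> GL_A A" and v: "v \<in> A_points A"
  shows "X *v v \<in> A_points A"
  unfolding A_points_def
proof (intro CollectI allI)
  fix i
  obtain x where x: "\<And>j. X $ i $ j = complex_of_real (x j)" "\<And>j. x j \<in> A"
    using X unfolding GL_A_def image_iff mem_Collect_eq by metis
  obtain y where y: "\<And>j. v $ j = complex_of_real (y j)" "\<And>j. y j \<in> A"
    using v unfolding A_points_def image_iff mem_Collect_eq by metis
  have "(\<Sum>j\<in>J. x j * y j) \<in> A" if "finite J" for J
    using that by (induction J) (auto intro: coeff_ring_closed [OF A] x y)
  moreover have "(X *v v) $ i = complex_of_real (\<Sum>j\<in>UNIV. x j * y j)"
    by (simp add: matrix_vector_mult_def x y)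
  ultimately show "(X *v v) $ i \<in> complex_of_real ` A"
    by (simp only:) (rule imageI, simp)
qed

lemma GL_A_inverse:
  assumes "X \<in> GL_A A"
  obtains Y where "Y \<in> GL_A A" "X ** Y = mat 1" "Y ** X = mat 1"
proof -
  from assms obtain Y where Y: "\<forall>i j. Y $ i $ j \<in> complex_of_real ` A" "X ** Y = mat 1 \<and> Y ** X = mat 1"
    unfolding GL_A_def by blast
  then have "Y \<in> GL_A A"
    using assms unfolding GL_A_def by blast
  then show thesis using that Y(2) by blast
qed

lemma GL_A_real: "X \<in> GL_A A \<Longrightarrow> conj_mat X = X"
proof -
  assume X: "X \<in> GL_A A"
  have "cnj (X $ i $ j) = X $ i $ j" for i j
  proof -
    obtain r where "X $ i $ j = complex_of_real r" using X unfolding GL_A_def by blast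
    then show ?thesis by simp
  qed
  then show ?thesis by (simp add: conj_mat_def vec_eq_iff)
qed

context
  fixes g h :: "complex^'n^'n"
  assumes gh: "g ** h = mat 1" "h ** g = mat 1"
begin

lemma cancel_vec: "g *v (h *v v) = v" "h *v (g *v v) = v"
  by (simp_all add: matrix_vector_mul_assoc gh)

lemma mem_image_inverse: "v \<in> (*v) g ` S \<longleftrightarrow> h *v v \<in> S"
  by (metis cancel_vec image_iff)

lemma image_eq_iff: "(*v) g ` S = (*v) g ` S' \<longleftrightarrow> S = S'"
  by (intro inj_image_eq_iff injI) (metis cancel_vec(2))

lemma subspace_image: "vec.subspace S \<Longrightarrow> vec.subspace ((*v) g ` S)"
  unfolding vec.subspace_def
  by (auto simp: mem_image_inverse mv.add_right matrix_mult_scale_vec cancel_vec mv.zero_right)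

lemma increasing_filtration_image:
  assumes W: "increasing_filtration W" shows "increasing_filtration (\<lambda>k. (*v) g ` W k)"
proof -
  have "(*v) g ` {0} = {0}" by (simp add: mv.zero_right)
  moreover have "(*v) g ` UNIV = UNIV" by (metis UNIV_eq_I UNIV_I mem_image_inverse)
  moreover have "mono (\<lambda>k. (*v) g ` W k)"
    using increasing_filtration_mono [OF W] by (intro monoI image_mono)
  ultimately show ?thesis
    using W subspace_image unfolding increasing_filtration_def by metis
qed

lemma wt_image: "wt_max (\<lambda>k. (*v) g ` W k) = wt_max W" "wt_min (\<lambda>k. (*v) g ` W k) = wt_min W"
  by (simp_all add: wt_max_def wt_min_def image_eq_iff)

lemma ht_pair_image:
  assumes ht: "ht_pair F W" and real: "\<And>k v. v \<in> (*v) g ` W k \<Longrightarrow> conj_vec v \<in> (*v) g ` W k"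
  shows "ht_pair (\<lambda>p. (*v) g ` F p) (\<lambda>k. (*v) g ` W k)"
  unfolding ht_pair_def
proof (intro conjI allI ballI impI)
  show "increasing_filtration (\<lambda>k. (*v) g ` W k)"
    by (rule increasing_filtration_image [OF ht_pairD(1) [OF ht]])
  show "(*v) g ` W k = (*v) g ` W (k - 1)" if "odd k" for k
    using ht_pairD(3) [OF ht that] by simp
  show "vec.subspace ((*v) g ` F p)" for p
    by (rule subspace_image [OF ht_pairD(4) [OF ht]])
  show "antimono (\<lambda>p. (*v) g ` F p)"
    by (intro antimonoI image_mono ht_pairD(5) [OF ht])
  show "(*v) g ` F p \<inter> (*v) g ` W (2 * p - 2) = {0}" for p
  proof -
    have "(*v) g ` F p \<inter> (*v) g ` W (2 * p - 2) = (*v) g ` (F p \<inter> W (2 * p - 2))"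
      by (intro image_Int [symmetric] injI) (metis cancel_vec(2))
    then show ?thesis by (simp add: ht_pairD(6) [OF ht] mv.zero_right)
  qed
  show "\<exists>f\<in>(*v) g ` F p. v - f \<in> (*v) g ` W (2 * p - 2)" for p v
  proof -
    obtain f where "f \<in> F p" "h *v v - f \<in> W (2 * p - 2)"
      using ht_pairD(7) [OF ht] by blast
    then show ?thesis
      by (intro bexI [of _ "g *v f"]) (auto simp: mem_image_inverse mv.diff_right cancel_vec)
  qed
qed (rule real)

lemma dim_image_mat: "vec.dim ((*v) g ` S) = vec.dim S"
proof (rule antisym)
  show "vec.dim ((*v) g ` S) \<le> vec.dim S"
    by (rule vec.dim_image_le [OF matrix_vector_mul_linear_gen])
  have "vec.dim ((*v) h ` (*v) g ` S) \<le> vec.dim ((*v) g ` S)"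
    by (rule vec.dim_image_le [OF matrix_vector_mul_linear_gen])
  then show "vec.dim S \<le> vec.dim ((*v) g ` S)"
    by (simp add: image_image cancel_vec)
qed

lemma hodge_proj_image:
  assumes "hodge_proj F W P"
  shows "hodge_proj (\<lambda>p. (*v) g ` F p) (\<lambda>k. (*v) g ` W k) (\<lambda>b. g ** P b ** h)"
  using assms is_proj_transport [OF _ gh(2,1)] by (simp add: hodge_proj_def)

lemma lowers_image: "lowers (\<lambda>k. (*v) g ` W k) (g ** X ** h) \<longleftrightarrow> lowers W X"
  by (auto simp: lowers_def mem_image_inverse cancel_vec simp flip: matrix_vector_mul_assoc)

context
  fixes A :: "real set"
  assumes A: "coeff_ring A" and gA: "g \<in> GL_A A" and hA: "h \<in> GL_A A"
begin

lemma image_A_points: "(*v) g ` W \<inter> A_points A = (*v) g ` (W \<inter> A_points A)"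
proof -
  have "g *v x \<in> A_points A \<longleftrightarrow> x \<in> A_points A" for x
    using A_points_mult [OF A gA, of x] A_points_mult [OF A hA, of "g *v x"] by (auto simp: cancel_vec)
  then show ?thesis by blast
qed

lemma betti_generator_image:
  assumes "betti_generator A W k u"
  shows "betti_generator A (\<lambda>k. (*v) g ` W k) k (g *v u)"
proof -
  have distr: "g *v (complex_of_real x *s u + v) = complex_of_real x *s (g *v u) + g *v v" for x v
    by (simp add: mv.add_right matrix_mult_scale_vec)
  have eq: "(*v) g ` {complex_of_real x *s u + v | x v. x \<in> A \<and> v \<in> B}
      = {complex_of_real x *s (g *v u) + v | x v. x \<in> A \<and> v \<in> (*v) g ` B}" for B
  proof (intro equalityI subsetI)
    fix y assume "y \<in> (*v) g ` {complex_of_real x *s u + v | x v. x \<in> A \<and> v \<in> B}"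
    then obtain x v where "x \<in> A" "v \<in> B" "y = g *v (complex_of_real x *s u + v)" by blast
    then show "y \<in> {complex_of_real x *s (g *v u) + v | x v. x \<in> A \<and> v \<in> (*v) g ` B}"
      unfolding distr by blast
  next
    fix y assume "y \<in> {complex_of_real x *s (g *v u) + v | x v. x \<in> A \<and> v \<in> (*v) g ` B}"
    then obtain x v where "x \<in> A" "v \<in> B" "y = g *v (complex_of_real x *s u + v)"
      unfolding distr by blast
    then show "y \<in> (*v) g ` {complex_of_real x *s u + v | x v. x \<in> A \<and> v \<in> B}" by blast
  qed
  note betti = assms [unfolded betti_generator_def]
  have "(*v) g ` W k \<inter> A_points A = (*v) g ` (W k \<inter> A_points A)"
    by (rule image_A_points)
  also have "\<dots> = (*v) g ` {complex_of_real x *s u + v | x v. x \<in> A \<and> v \<in> W (k - 1) \<inter> A_points A}"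
    using betti [THEN conjunct2, THEN conjunct2] by (rule arg_cong)
  also have "\<dots> = {complex_of_real x *s (g *v u) + v | x v. x \<in> A \<and> v \<in> (*v) g ` W (k - 1) \<inter> A_points A}"
    unfolding eq image_A_points ..
  finally show ?thesis
    unfolding betti_generator_def dim_image_mat
    using betti [THEN conjunct1] imageI [OF betti [THEN conjunct2, THEN conjunct1], of "(*v) g"]
    by (intro conjI) (simp_all only: image_A_points)
qed

end

end


section \<open>Relative weight filtrations of operators lowering the weight\<close>

lemma sum_setsI: "u \<in> E \<Longrightarrow> v \<in> E' \<Longrightarrow> u + v \<in> sum_sets E E'"
  unfolding sum_sets_def by blast

lemma sum_setsE: "v \<in> sum_sets E E' \<Longrightarrow> (\<And>x y. v = x + y \<Longrightarrow> x \<in> E \<Longrightarrow> y \<in> E' \<Longrightarrow> Q) \<Longrightarrow> Q"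
  unfolding sum_sets_def by blast

text \<open>As odd graded pieces vanish, \<open>N\<close> maps \<open>W\<^sub>k\<close> to \<open>W\<^sub>k\<^sub>-\<^sub>2\<close>. The pieces \<open>Gr\<^sup>M\<^sub>m Gr\<^sup>W\<^sub>k\<close> with \<open>M = W\<close> and
  \<open>m \<noteq> k\<close> are zero, and there the isomorphisms required of \<open>N\<^sup>j\<close> are trivial.\<close>

lemma rel_weight_filtration_self:
  assumes W: "increasing_filtration W" and odd: "\<And>k. odd k \<Longrightarrow> W k = W (k - 1)" and N: "lowers W N"
  shows "rel_weight_filtration N W W"
proof -
  have sub: "vec.subspace (W k)" for k by (rule increasing_filtration_subspace [OF W])
  have mono: "W k \<subseteq> W l" if "k \<le> l" for k l by (rule increasing_filtration_mono [OF W that])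
  have even: "W (k - 1) = W (k - 2)" if "even k" for k
    using odd [of "k - 1"] that by simp
  have N2: "(*v) N ` W m \<subseteq> W (m - 2)" for m
  proof (cases "even m")
    case True
    then show ?thesis using N even [OF True] by (auto simp: lowers_def)
  next
    case False
    have "N *v v \<in> W (m - 2)" if "v \<in> W m" for v
    proof -
      have "v \<in> W (m - 1)" using that odd [of m] False by simp
      then have "N *v v \<in> W (m - 1 - 1)" using N unfolding lowers_def by blast
      then show ?thesis by (simp add: diff_diff_eq)
    qed
    then show ?thesis by blast
  qed
  have Int: "W m \<inter> W k = W (min m k)" for m k
    using mono [of m k] mono [of k m] by (cases "m \<le> k") (auto simp: min_def)
  have Sum: "sum_sets (W m) (W k) = W (max m k)" for m k
    using sum_sets_absorb [OF sub sub mono] by (cases "m \<le> k") (auto simp: max_def)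
  have pres: "(*v) N ` W k \<subseteq> W k" for k
    using lowers_preserves [OF W N] by (auto simp: preserves_def)
  have sums: "W (k - int j) = sum_sets ((*v) (mat_pow N j) ` W k) (W (k - int j))"
      if "1 \<le> j" for k j
  proof -
    have *: "mat_pow N i *v v \<in> W (k - int i)" if "v \<in> W k" for i v
    proof (induction i)
      case (Suc i)
      then have "N *v (mat_pow N i *v v) \<in> W (k - int i - 1)" using N unfolding lowers_def by blast
      then show ?case by (simp add: mat_pow_Suc diff_diff_eq add.commute flip: matrix_vector_mul_assoc)
    qed (use that in simp)
    show ?thesis
    proof
      show "W (k - int j) \<subseteq> sum_sets ((*v) (mat_pow N j) ` W k) (W (k - int j))"
      proof
        fix v assume "v \<in> W (k - int j)"
        then have "mat_pow N j *v 0 + v \<in> sum_sets ((*v) (mat_pow N j) ` W k) (W (k - int j))"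
          using vec.subspace_0 [OF sub, of k] by (intro sum_setsI imageI)
        then show "v \<in> sum_sets ((*v) (mat_pow N j) ` W k) (W (k - int j))"
          by (simp add: mv.zero_right)
      qed
      show "sum_sets ((*v) (mat_pow N j) ` W k) (W (k - int j)) \<subseteq> W (k - int j)"
        using * by (auto elim!: sum_setsE intro: vec.subspace_add [OF sub])
    qed
  qed
  show ?thesis
    unfolding rel_weight_filtration_def Let_def Int Sum
    using W pres N2 sums by (auto simp: min_def max_def)
qed

lemma rel_weight_filtration_unique:
  assumes W: "increasing_filtration W" and N: "lowers W N" and M: "rel_weight_filtration N W M"
  shows "M k = W k"
proof -
  have incr: "increasing_filtration M" and N2: "(*v) N ` M m \<subseteq> M (m - 2)" for m
    using M unfolding rel_weight_filtration_def by blast+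
  have gr: "\<And>v. v \<in> M (k + int j) \<inter> W k \<Longrightarrow>
        mat_pow N j *v v \<in> sum_sets (M (k - int j - 1) \<inter> W k) (M (k - int j) \<inter> W (k - 1)) \<Longrightarrow>
        v \<in> sum_sets (M (k + int j - 1) \<inter> W k) (M (k + int j) \<inter> W (k - 1))"
    "M (k - int j) \<inter> W k = sum_sets ((*v) (mat_pow N j) ` (M (k + int j) \<inter> W k))
        (sum_sets (M (k - int j - 1) \<inter> W k) (M (k - int j) \<inter> W (k - 1)))" if "1 \<le> j" for k j
    using M that unfolding rel_weight_filtration_def Let_def by blast+
  note subM = increasing_filtration_subspace [OF incr] and subW = increasing_filtration_subspace [OF W]
  have monoM: "M k \<subseteq> M l" if "k \<le> l" for k l by (rule increasing_filtration_mono [OF incr that])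
  have monoW: "W k \<subseteq> W l" if "k \<le> l" for k l by (rule increasing_filtration_mono [OF W that])
  have Npow: "mat_pow N j *v v \<in> M (k - int j) \<inter> W (k - 1)" if v: "v \<in> M (k + int j) \<inter> W k" and j: "1 \<le> j" for j k v
  proof -
    have "mat_pow N i *v v \<in> M (k + int j - 2 * int i)" for i
    proof (induction i)
      case (Suc i)
      then have "N *v (mat_pow N i *v v) \<in> M (k + int j - 2 * int i - 2)" using N2 by blast
      moreover have "k + int j - 2 * int i - 2 = k + int j - 2 * int (Suc i)" by simp
      ultimately show ?case by (simp add: mat_pow_Suc flip: matrix_vector_mul_assoc)
    qed (use v in simp)
    from this [of j] have "mat_pow N j *v v \<in> M (k - int j)" by simp
    moreover have "mat_pow N j *v v \<in> W (k - 1)"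
      using lowers_pow [OF W N, of j] j v unfolding lowers_def by auto
    ultimately show ?thesis by blast
  qed
  \<comment> \<open>The operator vanishes on the graded pieces of \<open>W\<close>, so \<open>M\<close> induces a filtration with a single
     jump, at \<open>k\<close>, on the piece of weight \<open>k\<close>.\<close>
  have jump: "v \<in> sum_sets (M (m - 1) \<inter> W k) (W (k - 1))" if v: "v \<in> M m \<inter> W k" and "m \<noteq> k" for v m k
  proof -
    define j where "j = nat \<bar>m - k\<bar>"
    have j: "1 \<le> j" using \<open>m \<noteq> k\<close> by (simp add: j_def)
    have "0 \<in> M (k - int j - 1) \<inter> W k" using vec.subspace_0 [OF subM] vec.subspace_0 [OF subW] by blast
    from sum_setsI [OF this Npow [OF _ j, of _ k]]
    have B: "mat_pow N j *v w \<in> sum_sets (M (k - int j - 1) \<inter> W k) (M (k - int j) \<inter> W (k - 1))"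
      if "w \<in> M (k + int j) \<inter> W k" for w using that by simp
    show ?thesis
    proof (cases "k < m")
      case True
      then have m: "m = k + int j" by (simp add: j_def)
      from gr(1) [OF j _ B] v m show ?thesis
        by (auto elim!: sum_setsE intro!: sum_setsI)
    next
      case False
      then have m: "m = k - int j" using \<open>m \<noteq> k\<close> by (simp add: j_def)
      then obtain x y where xy: "v = mat_pow N j *v x + y" "x \<in> M (k + int j) \<inter> W k"
          "y \<in> sum_sets (M (k - int j - 1) \<inter> W k) (M (k - int j) \<inter> W (k - 1))"
        using v gr(2) [OF j, of k] unfolding sum_sets_def by blast
      obtain y1 y2 where y: "y = y1 + y2" "y1 \<in> M (m - 1) \<inter> W k" "y2 \<in> W (k - 1)"
        using xy(3) m by (auto elim!: sum_setsE)
      have "v = y1 + (y2 + mat_pow N j *v x)" by (simp add: xy y)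
      moreover have "y2 + mat_pow N j *v x \<in> W (k - 1)"
        using y(3) Npow [OF xy(2) j] by (intro vec.subspace_add [OF subW]) auto
      ultimately show ?thesis using y(2) by (metis sum_setsI)
    qed
  qed
  obtain l u where l: "M l = {0}" and u: "M u = UNIV" using incr by (auto simp: increasing_filtration_def)
  obtain l' u' where l': "W l' = {0}" and u': "W u' = UNIV" using W by (auto simp: increasing_filtration_def)
  have below: "M m \<inter> W k \<subseteq> W (k - 1)" if "m < k" for m k
  proof (cases "l \<le> m")
    case False
    then have "M m \<subseteq> {0}" using monoM [of m l] l by auto
    then show ?thesis using vec.subspace_0 [OF subW] by auto
  next
    case True
    then show ?thesis using that
    proof (induction m rule: int_ge_induct)
      case base
      then show ?case using l vec.subspace_0 [OF subW] by auto
    next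
      case (step i)
      show ?case
      proof
        fix v assume "v \<in> M (i + 1) \<inter> W k"
        then have "v \<in> sum_sets (M (i + 1 - 1) \<inter> W k) (W (k - 1))"
          using step.prems by (intro jump) auto
        then obtain x y where "v = x + y" "x \<in> M i \<inter> W k" "y \<in> W (k - 1)"
          by (auto elim!: sum_setsE)
        then show "v \<in> W (k - 1)"
          using step by (auto intro!: vec.subspace_add [OF subW])
      qed
    qed
  qed
  have above: "W k \<subseteq> sum_sets (M m \<inter> W k) (W (k - 1))" if "k \<le> m" for m k
  proof -
    have all: "W k \<subseteq> sum_sets (M m \<inter> W k) (W (k - 1))" if "u \<le> m" for m
    proof
      fix v assume v: "v \<in> W k"
      have "UNIV \<subseteq> M m" using monoM [OF that] u by simp
      then have "v + 0 \<in> sum_sets (M m \<inter> W k) (W (k - 1))"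
        using v vec.subspace_0 [OF subW] by (intro sum_setsI) auto
      then show "v \<in> sum_sets (M m \<inter> W k) (W (k - 1))" by simp
    qed
    show ?thesis
    proof (cases "m \<le> u")
      case False
      then show ?thesis by (intro all) simp
    next
      case True
      then show ?thesis using that
      proof (induction m rule: int_le_induct)
        case base
        show ?case by (rule all) simp
      next
        case (step i)
        show ?case
        proof
          fix v assume "v \<in> W k"
          then have "v \<in> sum_sets (M i \<inter> W k) (W (k - 1))" using step by auto
          then obtain x y where xy: "v = x + y" "x \<in> M i \<inter> W k" "y \<in> W (k - 1)"
            by (auto elim!: sum_setsE)
          have "x \<in> sum_sets (M (i - 1) \<inter> W k) (W (k - 1))"
            using xy(2) step.prems by (intro jump) auto
          then obtain x' y' where xy': "x = x' + y'" "x' \<in> M (i - 1) \<inter> W k" "y' \<in> W (k - 1)"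
            by (auto elim!: sum_setsE)
          have "v = x' + (y' + y)" by (simp add: xy xy')
          then show "v \<in> sum_sets (M (i - 1) \<inter> W k) (W (k - 1))"
            using xy(3) xy'(2,3) by (auto intro!: sum_setsI vec.subspace_add [OF subW])
        qed
      qed
    qed
  qed
  have "W k \<subseteq> M k"
  proof (cases "l' \<le> k")
    case False
    then have "W k \<subseteq> {0}" using monoW [of k l'] l' by auto
    then show ?thesis using vec.subspace_0 [OF subM] by auto
  next
    case True
    then show ?thesis
    proof (induction k rule: int_ge_induct)
      case base
      then show ?case using l' vec.subspace_0 [OF subM] by auto
    next
      case (step i)
      show ?case
      proof
        fix v assume "v \<in> W (i + 1)"
        then obtain x y where "v = x + y" "x \<in> M (i + 1)" "y \<in> W i"
          using above [of "i + 1" "i + 1"] by (auto elim!: sum_setsE)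
        then show "v \<in> M (i + 1)"
          using step.IH monoM [of i "i + 1"] by (auto intro!: vec.subspace_add [OF subM])
      qed
    qed
  qed
  moreover have "M k \<subseteq> W k"
  proof -
    have "M k \<subseteq> W i" if "k \<le> i" for i
    proof (cases "i \<le> u'")
      case False
      then have "UNIV \<subseteq> W i" using monoW [of u' i] u' by auto
      then show ?thesis by blast
    next
      case True
      then show ?thesis using that
      proof (induction i rule: int_le_induct)
        case base
        then show ?case by (simp add: u')
      next
        case (step i)
        then show ?case using below [of k i] by auto
      qed
    qed
    then show ?thesis by simp
  qed
  ultimately show ?thesis by blast
qed

text \<open>Monodromy acts trivially on a graded piece carrying an invariant definite form: a vector \<open>u\<close>
  with \<open>w = (T - 1) u\<close> fixed by \<open>T\<close> satisfies \<open>\<beta>(u, w) = \<beta>(T u, T w) = \<beta>(u, w) + \<beta>(w, w)\<close>, up to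
  complex conjugation.\<close>

lemma unipotent_definite:
  fixes \<beta> :: "complex^'n \<Rightarrow> complex^'n \<Rightarrow> complex"
  assumes W: "increasing_filtration W" and real: "\<And>k v. v \<in> W k \<Longrightarrow> conj_vec v \<in> W k"
    and T: "preserves W T" "conj_mat T = T" "unipotent_mat T"
    and add: "\<And>u u' v. \<beta> (u + u') v = \<beta> u v + \<beta> u' v" "\<And>u v v'. \<beta> u (v + v') = \<beta> u v + \<beta> u v'"
    and kernel: "\<And>u v. u \<in> W (k - 1) \<Longrightarrow> v \<in> W k \<Longrightarrow> \<beta> u v = 0" "\<And>u v. u \<in> W k \<Longrightarrow> v \<in> W (k - 1) \<Longrightarrow> \<beta> u v = 0"
    and inv: "\<And>u v. u \<in> W k \<Longrightarrow> v \<in> W k \<Longrightarrow> \<beta> (T *v u) (T *v v) = \<beta> u v"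
    and definite: "\<And>u. u \<in> W k - W (k - 1) \<Longrightarrow> \<beta> u (conj_vec u) \<noteq> 0"
    and v: "v \<in> W k"
  shows "(T - mat 1) *v v \<in> W (k - 1)"
proof (rule ccontr)
  define X where "X = T - mat 1"
  note sub = increasing_filtration_subspace [OF W]
  assume "(T - mat 1) *v v \<notin> W (k - 1)"
  then have 1: "mat_pow X (Suc 0) *v v \<notin> W (k - 1)" by (simp add: X_def)
  have pres: "X *v x \<in> W k" if "x \<in> W k" for x
    using T(1) that by (auto simp: X_def preserves_def mv.diff_left intro: vec.subspace_diff [OF sub])
  have pow: "mat_pow X i *v v \<in> W k" for i
  proof (induction i)
    case (Suc i)
    then show ?case by (simp add: mat_pow_Suc pres flip: matrix_vector_mul_assoc)
  qed (simp add: v)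
  obtain m where "mat_pow X m = 0" using T(3) by (auto simp: unipotent_mat_def nilpotent_mat_def X_def)
  then have "mat_pow X m *v v \<in> W (k - 1)" by (simp add: vec.subspace_0 [OF sub])
  define i where "i = (LEAST i. mat_pow X i *v v \<in> W (k - 1))"
  have i: "mat_pow X i *v v \<in> W (k - 1)"
    unfolding i_def by (rule LeastI) fact
  have v0: "v \<notin> W (k - 1)"
  proof
    assume "v \<in> W (k - 1)"
    then have "X *v v \<in> W (k - 1)"
      using T(1) by (auto simp: X_def preserves_def mv.diff_left intro: vec.subspace_diff [OF sub])
    then show False using 1 by simp
  qed
  have "i \<noteq> 0" using i v0 by (metis mat_pow_0 matrix_vector_mul_lid)
  moreover have "i \<noteq> Suc 0" using i 1 by metis
  ultimately obtain l where l: "i = Suc (Suc l)" by (metis not0_implies_Suc)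
  define u where "u = mat_pow X l *v v"
  define w where "w = X *v u"
  have w: "w = mat_pow X (Suc l) *v v" by (simp add: w_def u_def mat_pow_Suc matrix_vector_mul_assoc)
  have uW: "u \<in> W k" and wW: "w \<in> W k" unfolding u_def w by (rule pow)+
  have wn: "w \<notin> W (k - 1)"
    unfolding w using not_less_Least [of "Suc l" "\<lambda>i. mat_pow X i *v v \<in> W (k - 1)"] l i_def by auto
  have Xw: "X *v w \<in> W (k - 1)"
    using i unfolding l w by (simp add: mat_pow_Suc matrix_vector_mul_assoc)
  have Tu: "T *v u = u + w" and Tw: "T *v w = w + X *v w"
    by (simp_all add: w_def X_def mv.diff_left mv.diff_right)
  have "\<beta> u (conj_vec w) = \<beta> (T *v u) (T *v conj_vec w)"
    using inv [OF uW real [OF wW]] by simp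
  also have "T *v conj_vec w = conj_vec (T *v w)" by (simp add: conj_mat_vec T(2))
  also have "\<dots> = conj_vec w + conj_vec (X *v w)" unfolding Tw by (rule conj_vec_add)
  also have "\<beta> (T *v u) (conj_vec w + conj_vec (X *v w)) = \<beta> u (conj_vec w) + \<beta> w (conj_vec w)"
    using kernel(2) [OF uW real [OF Xw]] kernel(2) [OF wW real [OF Xw]] by (simp add: Tu add)
  finally have "\<beta> w (conj_vec w) = 0" by simp
  then show False using definite [of w] wW wn by blast
qed

lemma bform_add: "bform Q (u + u') v = bform Q u v + bform Q u' v" "bform Q u (v + v') = bform Q u v + bform Q u v'"
  by (simp_all add: bform_def distrib_left distrib_right sum.distrib)


section \<open>The universal cover of the complement of a normal crossing divisor\<close>

lemma cover_map_off: "z \<in> cover_dom K \<Longrightarrow> cover_map K z \<in> off_hyperplanes K"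
proof -
  assume z: "z \<in> cover_dom K"
  have "cmod (cover_map K z $ j) < 1" for j
  proof -
    have "if j \<in> K then 0 < Im (z $ j) else cmod (z $ j) < 1"
      using z unfolding cover_dom_def by blast
    then show ?thesis by (cases "j \<in> K") (auto simp: cover_map_def)
  qed
  then show ?thesis by (auto simp: off_hyperplanes_def polydisk_def cover_map_def)
qed

text \<open>The principal branch of the logarithm has an argument of modulus at most \<open>\<pi>\<close>.\<close>

lemma cover_map_surj:
  assumes s: "s \<in> off_hyperplanes K"
  shows "\<exists>z\<in>cover_dom K. cover_map K z = s \<and> (\<forall>j\<in>K. cmod (z $ j) \<le> 1 + ln (1 / cmod (s $ j)))"
proof -
  define z where "z = (\<chi> j. if j \<in> K then Ln (s $ j) / (2 * of_real pi * \<i>) else s $ j)"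
  have s1: "cmod (s $ j) < 1" "j \<in> K \<Longrightarrow> s $ j \<noteq> 0" for j
    using s by (auto simp: off_hyperplanes_def polydisk_def)
  have ReIm: "Im (z $ j) = - ln (cmod (s $ j)) / (2 * pi)" "Re (z $ j) = Im (Ln (s $ j)) / (2 * pi)" if "j \<in> K" for j
  proof -
    have "z $ j = - \<i> * Ln (s $ j) / of_real (2 * pi)"
      using that by (simp add: z_def field_simps)
    then show "Im (z $ j) = - ln (cmod (s $ j)) / (2 * pi)" "Re (z $ j) = Im (Ln (s $ j)) / (2 * pi)"
      using s1(2) [OF that] by (simp_all add: Re_divide_of_real Im_divide_of_real)
  qed
  have ln: "ln (cmod (s $ j)) < 0" if "j \<in> K" for j
    using s1 that by (simp add: ln_less_zero)
  have "z \<in> cover_dom K"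
    unfolding cover_dom_def
  proof (intro CollectI allI)
    fix j show "if j \<in> K then 0 < Im (z $ j) else cmod (z $ j) < 1"
      using ln [of j] s1(1) [of j] by (auto simp: ReIm divide_neg_pos) (simp add: z_def)
  qed
  moreover have "cover_map K z = s"
    using s1(2) by (auto simp: cover_map_def z_def vec_eq_iff)
  moreover have "cmod (z $ j) \<le> 1 + ln (1 / cmod (s $ j))" if "j \<in> K" for j
  proof -
    have "\<bar>Re (z $ j)\<bar> \<le> 1"
      using mpi_less_Im_Ln [OF s1(2) [OF that]] Im_Ln_le_pi [OF s1(2) [OF that]]
      by (simp add: ReIm that abs_le_iff field_simps)
    moreover have "\<bar>Im (z $ j)\<bar> \<le> ln (1 / cmod (s $ j))"
    proof -
      have "- ln (cmod (s $ j)) / (2 * pi) \<le> - ln (cmod (s $ j)) / 1"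
        using ln [OF that] pi_gt3 by (intro divide_left_mono) auto
      moreover have "0 \<le> - ln (cmod (s $ j)) / (2 * pi)"
        using ln [OF that] pi_gt_zero by (intro divide_nonneg_pos) auto
      ultimately show ?thesis
        using s1(2) [OF that] by (simp add: ReIm [OF that] ln_div)
    qed
    ultimately show ?thesis using cmod_le [of "z $ j"] by linarith
  qed
  ultimately show ?thesis by blast
qed

lemma cover_dom_eq: "cover_dom K = (\<Inter>j. (\<lambda>z. z $ j) -` (if j \<in> K then {w. 0 < Im w} else ball 0 1))"
  by (auto simp: cover_dom_def split: if_splits)

lemma open_cover_dom: "open (cover_dom K :: (complex^'r) set)"
  unfolding cover_dom_eq
  by (intro open_INT ballI open_vimage) (auto intro: continuous_intros open_halfspace_Im_gt)

lemma connected_cover_dom: "connected (cover_dom K :: (complex^'r) set)"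
proof -
  have "convex (cover_dom K :: (complex^'r) set)"
    unfolding cover_dom_eq
    by (intro convex_INT convex_linear_vimage bounded_linear.linear bounded_linear_vec_nth)
      (auto simp: convex_halfspace_Im_gt)
  then show ?thesis by (rule convex_connected)
qed

lemma continuous_on_cover_map: "continuous_on X (cover_map K :: complex^'r \<Rightarrow> _)"
  unfolding cover_map_def
proof (rule continuous_on_vec_lambda)
  fix j show "continuous_on X (\<lambda>z :: complex^'r. if j \<in> K then exp (2 * of_real pi * \<i> * z $ j) else z $ j)"
    by (cases "j \<in> K") (auto intro!: continuous_intros)
qed

lemma cover_dom_upd: "z \<in> cover_dom K \<Longrightarrow> j \<in> K \<Longrightarrow> 0 < Im w \<Longrightarrow> upd z j w \<in> cover_dom K"
  by (auto simp: cover_dom_def upd_nth)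

lemma cover_map_upd: "j \<in> K \<Longrightarrow> cover_map K (upd z j w) = upd (cover_map K z) j (exp (2 * of_real pi * \<i> * w))"
  by (auto simp: cover_map_def upd_def vec_eq_iff)

lemma add_axis_upd: "z + axis j t = upd z j (z $ j + t)"
  by (auto simp: upd_def axis_def vec_eq_iff)

lemma cover_dom_shift: "z \<in> cover_dom K \<Longrightarrow> j \<in> K \<Longrightarrow> z + axis j (of_int n) \<in> cover_dom K"
  unfolding add_axis_upd by (rule cover_dom_upd) (auto simp: cover_dom_def)

lemma cover_map_shift: "j \<in> K \<Longrightarrow> cover_map K (z + axis j (of_int n)) = cover_map K z"
proof -
  assume "j \<in> K"
  have "exp (2 * of_real pi * \<i> * (z $ j + of_int n)) = exp (2 * of_real pi * \<i> * z $ j)"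
    by (subst exp_eq) (auto intro!: exI [of _ n] simp: algebra_simps)
  then show ?thesis
    unfolding add_axis_upd cover_map_upd [OF \<open>j \<in> K\<close>]
    using \<open>j \<in> K\<close> by (auto simp: upd_def cover_map_def vec_eq_iff)
qed

text \<open>A function on the cover is a function on the complement of the divisor if it is invariant under
  the generators of the deck transformation group.\<close>

lemma cover_periodic:
  assumes per: "\<And>z j. z \<in> cover_dom K \<Longrightarrow> j \<in> K \<Longrightarrow> f (z + axis j 1) = f z"
    and z: "z \<in> cover_dom K" "z' \<in> cover_dom K" and eq: "cover_map K z = cover_map K z'"
  shows "f z = f z'"
proof -
  have nat: "f (z + axis j (of_nat n)) = f z" if "z \<in> cover_dom K" "j \<in> K" for z j n
  proof (induction n)
    case 0
    then show ?case by (simp add: axis_def vec_eq_iff zero_vec_def [symmetric] add.right_neutral plus_vec_def)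
  next
    case (Suc n)
    have "z + axis j (of_nat (Suc n)) = (z + axis j (of_int (int n))) + axis j 1"
      by (auto simp: axis_def vec_eq_iff)
    also have "f \<dots> = f (z + axis j (of_int (int n)))"
      using that by (intro per cover_dom_shift)
    also have "\<dots> = f z" using Suc by simp
    finally show ?case .
  qed
  have int: "f (z + axis j (of_int n)) = f z" if "z \<in> cover_dom K" "j \<in> K" for z j n
  proof (cases "0 \<le> n")
    case True
    then show ?thesis using nat [OF that, of "nat n"] by simp
  next
    case False
    have "f (z + axis j (of_int n) + axis j (of_nat (nat (- n)))) = f (z + axis j (of_int n))"
      using nat [OF cover_dom_shift [OF that, of n] that(2), of "nat (- n)"] .
    moreover have "z + axis j (of_int n) + axis j (of_nat (nat (- n))) = z"
      using False by (auto simp: axis_def vec_eq_iff)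
    ultimately show ?thesis by (simp only:)
  qed
  have "f z = f z'" if "finite J" "J \<subseteq> K" "z \<in> cover_dom K" "cover_map K z = cover_map K z'"
      "\<forall>j. j \<notin> J \<longrightarrow> z $ j = z' $ j" for J z
    using that
  proof (induction J arbitrary: z)
    case empty
    then have "z = z'" by (simp add: vec_eq_iff)
    then show ?case by simp
  next
    case (insert j J)
    have "cover_map K z $ j = cover_map K z' $ j" using insert.prems by simp
    then have "exp (2 * of_real pi * \<i> * z' $ j) = exp (2 * of_real pi * \<i> * z $ j)"
      using insert.prems by (simp add: cover_map_def)
    then obtain n :: int where "2 * of_real pi * \<i> * z' $ j = 2 * of_real pi * \<i> * z $ j + (of_int (2 * n) * pi) * \<i>"
      unfolding exp_eq by blast
    then have "(2 * of_real pi * \<i>) * (z' $ j - (z $ j + of_int n)) = 0"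
      by (simp add: algebra_simps)
    then have n: "z' $ j = z $ j + of_int n" by simp
    define y where "y = z + axis j (of_int n)"
    have "f y = f z'"
    proof (rule insert.IH)
      show "y \<in> cover_dom K" "cover_map K y = cover_map K z'"
        using insert.prems by (simp_all add: y_def cover_dom_shift cover_map_shift)
      show "\<forall>i. i \<notin> J \<longrightarrow> y $ i = z' $ i"
        using insert.prems n by (auto simp: y_def axis_def)
    qed (use insert.prems in auto)
    then show ?case
      using int [of z j n] insert.prems by (simp add: y_def)
  qed
  moreover have "z $ j = z' $ j" if "j \<notin> K" for j
    using arg_cong [OF eq, of "\<lambda>s. s $ j"] that by (simp add: cover_map_def)
  ultimately show ?thesis
    using z eq by (metis finite subset_refl)
qed


section \<open>Flat frames\<close>

lemma GL_A_matrix_inv: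
  assumes "X \<in> GL_A A" shows "matrix_inv X ** X = mat 1" "X ** matrix_inv X = mat 1"
proof -
  have "\<exists>Y. X ** Y = mat 1 \<and> Y ** X = mat 1"
    using assms unfolding GL_A_def by blast
  then have "X ** matrix_inv X = mat 1 \<and> matrix_inv X ** X = mat 1"
    unfolding matrix_inv_def by (rule someI_ex)
  then show "matrix_inv X ** X = mat 1" "X ** matrix_inv X = mat 1"
    by blast+
qed

text \<open>Two flat frames of a local system differ by a locally constant matrix.\<close>

lemma flat_frame_local:
  assumes V: "local_system A S V" and \<Psi>: "flat_frame A V X \<gamma> \<Psi>"
    and cont: "continuous_on X \<gamma>" and S: "\<gamma> ` X \<subseteq> S" and x: "x \<in> X"
  obtains U \<phi> M M' where "(U, \<phi>) \<in> frames V" "\<gamma> x \<in> U" "open U" "U \<subseteq> S" "M ** M' = mat 1" "M' ** M = mat 1"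
    "\<Psi> x = M ** \<phi> (\<gamma> x)" "\<forall>\<^sub>F y in at x within X. \<gamma> y \<in> U \<and> \<Psi> y = M ** \<phi> (\<gamma> y)"
proof -
  obtain U \<phi> where U: "(U, \<phi>) \<in> frames V" "\<gamma> x \<in> U"
    using V S x unfolding local_system_def by blast
  have oU: "open U" "U \<subseteq> S" and \<phi>: "\<And>y. y \<in> U \<Longrightarrow> \<phi> y \<in> GL_A A"
    using V U(1) unfolding local_system_def flat_frame_def by blast+
  define M where "M = \<Psi> x ** matrix_inv (\<phi> (\<gamma> x))"
  define M' where "M' = \<phi> (\<gamma> x) ** matrix_inv (\<Psi> x)"
  have \<Psi>x: "\<Psi> x \<in> GL_A A" using \<Psi> x by (simp add: flat_frame_def)
  note invs = GL_A_matrix_inv [OF \<phi> [OF U(2)]] GL_A_matrix_inv [OF \<Psi>x]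
  have "M ** M' = \<Psi> x ** (matrix_inv (\<phi> (\<gamma> x)) ** \<phi> (\<gamma> x)) ** matrix_inv (\<Psi> x)"
    "M' ** M = \<phi> (\<gamma> x) ** (matrix_inv (\<Psi> x) ** \<Psi> x) ** matrix_inv (\<phi> (\<gamma> x))"
    "M ** \<phi> (\<gamma> x) = \<Psi> x ** (matrix_inv (\<phi> (\<gamma> x)) ** \<phi> (\<gamma> x))"
    by (simp_all only: M_def M'_def matrix_mul_assoc)
  then have M: "M ** M' = mat 1" "M' ** M = mat 1" "\<Psi> x = M ** \<phi> (\<gamma> x)"
    by (simp_all add: invs)
  have "(\<gamma> \<longlongrightarrow> \<gamma> x) (at x within X)"
    using cont x by (simp add: continuous_on_def)
  then have evU: "\<forall>\<^sub>F y in at x within X. \<gamma> y \<in> U"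
    using oU(1) U(2) by (rule topological_tendstoD)
  have "\<forall>\<^sub>F y in at x within {y \<in> X. \<gamma> y \<in> U}. \<Psi> y ** matrix_inv (\<phi> (\<gamma> y)) = M"
    using \<Psi> U x unfolding flat_frame_def locally_constant_on_def M_def by fastforce
  then have "\<forall>\<^sub>F y in at x within X. \<gamma> y \<in> U \<longrightarrow> \<Psi> y ** matrix_inv (\<phi> (\<gamma> y)) = M"
    unfolding eventually_at_filter by (rule eventually_mono) auto
  with evU have "\<forall>\<^sub>F y in at x within X. \<gamma> y \<in> U \<and> \<Psi> y = M ** \<phi> (\<gamma> y)"
  proof eventually_elim
    case (elim y)
    then have "M ** \<phi> (\<gamma> y) = \<Psi> y ** (matrix_inv (\<phi> (\<gamma> y)) ** \<phi> (\<gamma> y))"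
      by (simp add: matrix_mul_assoc)
    then show ?case using elim GL_A_matrix_inv [OF \<phi>, of "\<gamma> y"] by simp
  qed
  then show thesis
    by (rule that [OF U oU M])
qed

text \<open>\<open>R x M\<close> stands for a structure on the fibre at \<open>x\<close> transported to the reference fibre by \<open>M\<close>, such as
  the weight filtration, the polarization or a section; \<open>act\<close> is the action of a change of reference
  fibre. A flat structure becomes constant on a connected space.\<close>

lemma flat_frame_const:
  assumes V: "local_system A S V" and \<Psi>: "flat_frame A V X \<gamma> \<Psi>"
    and cont: "continuous_on X \<gamma>" and S: "\<gamma> ` X \<subseteq> S" and conn: "connected X"
    and act: "\<And>C M x. R x (C ** M) = act C (R x M)"
    and loc: "\<And>U \<phi>. (U, \<phi>) \<in> frames V \<Longrightarrow> locally_constant_on U (\<lambda>x. R x (\<phi> x))"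
    and x: "x \<in> X" "y \<in> X"
  shows "R (\<gamma> x) (\<Psi> x) = R (\<gamma> y) (\<Psi> y)"
proof (rule connected_local_const [where f = "\<lambda>x. R (\<gamma> x) (\<Psi> x)", OF conn x], rule ballI)
  fix x assume x: "x \<in> X"
  obtain U \<phi> M M' where U: "(U, \<phi>) \<in> frames V" "\<gamma> x \<in> U" "open U"
    and M: "\<Psi> x = M ** \<phi> (\<gamma> x)" "\<forall>\<^sub>F y in at x within X. \<gamma> y \<in> U \<and> \<Psi> y = M ** \<phi> (\<gamma> y)"
    by (rule flat_frame_local [OF V \<Psi> cont S x]) blast
  have "\<forall>\<^sub>F y' in at (\<gamma> x) within U. R y' (\<phi> y') = R (\<gamma> x) (\<phi> (\<gamma> x))"
    using loc [OF U(1)] U(2) unfolding locally_constant_on_def by blast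
  then have "\<forall>\<^sub>F y' in nhds (\<gamma> x). y' \<in> U \<longrightarrow> R y' (\<phi> y') = R (\<gamma> x) (\<phi> (\<gamma> x))"
    unfolding eventually_at_filter by (rule eventually_mono) auto
  moreover have "(\<gamma> \<longlongrightarrow> \<gamma> x) (at x within X)"
    using cont x by (simp add: continuous_on_def)
  ultimately have "\<forall>\<^sub>F y in at x within X. \<gamma> y \<in> U \<longrightarrow> R (\<gamma> y) (\<phi> (\<gamma> y)) = R (\<gamma> x) (\<phi> (\<gamma> x))"
    by (rule eventually_compose_filterlim)
  with M(2) show "\<forall>\<^sub>F y in at x within X. R (\<gamma> x) (\<Psi> x) = R (\<gamma> y) (\<Psi> y)"
    by eventually_elim (simp add: M(1) act)
qed

lemma holo_chartD:
  assumes "holo_chart atlas P \<psi>"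
  shows "open P" "open (\<psi> ` P)" "continuous_on P \<psi>" "continuous_on (\<psi> ` P) (inv_into P \<psi>)"
    "x \<in> P \<Longrightarrow> inv_into P \<psi> (\<psi> x) = x"
    "(U, \<psi>') \<in> atlas \<Longrightarrow> holo_on (\<lambda>s. \<psi>' (inv_into P \<psi> s)) (\<psi> ` (P \<inter> U))"
    "(U, \<psi>') \<in> atlas \<Longrightarrow> holo_on (\<lambda>s. \<psi> (inv_into U \<psi>' s)) (\<psi>' ` (P \<inter> U))"
proof -
  note c = assms [unfolded holo_chart_def homeomorphism_def]
  show "open P" using c by (elim conjE)
  show "open (\<psi> ` P)" using c by (elim conjE)
  show "continuous_on P \<psi>" using c by (elim conjE)
  show "continuous_on (\<psi> ` P) (inv_into P \<psi>)" using c by (elim conjE)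
  have inv: "\<forall>x\<in>P. inv_into P \<psi> (\<psi> x) = x"
    using c by (elim conjE)
  show "inv_into P \<psi> (\<psi> x) = x" if "x \<in> P"
    using inv that by (rule bspec)
  have "\<forall>(U', \<psi>') \<in> atlas. holo_on (\<lambda>s. \<psi>' (inv_into P \<psi> s)) (\<psi> ` (P \<inter> U')) \<and>
      holo_on (\<lambda>s. \<psi> (inv_into U' \<psi>' s)) (\<psi>' ` (P \<inter> U'))"
    using c by (elim conjE)
  from bspec [OF this, of "(U, \<psi>')"]
  show "holo_on (\<lambda>s. \<psi>' (inv_into P \<psi> s)) (\<psi> ` (P \<inter> U))"
      "holo_on (\<lambda>s. \<psi> (inv_into U \<psi>' s)) (\<psi>' ` (P \<inter> U))" if "(U, \<psi>') \<in> atlas"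
    using that by simp_all
qed

lemma holo_chart_open_image:
  assumes c: "holo_chart atlas P \<psi>" and "open X"
  shows "open (\<psi> ` (P \<inter> X))"
proof -
  have "\<psi> ` (P \<inter> X) = \<psi> ` P \<inter> inv_into P \<psi> -` X"
    using holo_chartD(5) [OF c] by (auto intro!: rev_image_eqI)
  also have "open \<dots>"
    using holo_chartD(2,4) [OF c] \<open>open X\<close> by (metis continuous_on_open_vimage inf_commute)
  finally show ?thesis .
qed

lemma mfd_holo_on_chart:
  assumes mfd: "complex_manifold atlas" and c: "holo_chart atlas P \<psi>" and X: "open X"
    and f: "mfd_holo_on atlas f X" and x: "x \<in> P \<inter> X"
  shows "hol_at (\<lambda>s. f (inv_into P \<psi> s) $ i) (\<psi> x)"
proof -
  note mfd' = mfd [unfolded complex_manifold_def]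
  have "x \<in> (\<Union>(U, \<psi>) \<in> atlas. U)"
    unfolding mfd' [THEN conjunct2] ..
  then obtain U \<psi>' where U: "(U, \<psi>') \<in> atlas" "x \<in> U" by blast
  have U': "holo_chart atlas U \<psi>'"
    using bspec [OF mfd' [THEN conjunct1] U(1)] by simp
  have "holo_on (\<lambda>s. f (inv_into U \<psi>' s)) (\<psi>' ` (X \<inter> U))"
    using f U(1) unfolding mfd_holo_on_def by blast
  then have "hol_at (\<lambda>s. f (inv_into U \<psi>' s) $ i) (\<psi>' x)"
    unfolding holo_on_iff using x U(2) by blast
  then have "hol_at (\<lambda>s. f (inv_into U \<psi>' s) $ i) (\<psi>' (inv_into P \<psi> (\<psi> x)))"
    using x by (simp add: holo_chartD(5) [OF c])
  then have "hol_at (\<lambda>s. f (inv_into U \<psi>' (\<psi>' (inv_into P \<psi> s))) $ i) (\<psi> x)"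
    by (rule hol_at_compose_holo [OF _ holo_chartD(6) [OF c U(1)]]) (use x U(2) in blast)
  then show ?thesis
  proof (rule hol_at_cong [rotated])
    have "open (\<psi> ` (P \<inter> U))"
      by (rule holo_chart_open_image [OF c holo_chartD(1) [OF U']])
    then have "\<forall>\<^sub>F s in nhds (\<psi> x). s \<in> \<psi> ` (P \<inter> U)"
      using x U(2) by (intro eventually_nhds_in_open) auto
    then show "\<forall>\<^sub>F s in nhds (\<psi> x). f (inv_into U \<psi>' (\<psi>' (inv_into P \<psi> s))) $ i = f (inv_into P \<psi> s) $ i"
      by eventually_elim (auto simp: holo_chartD(5) [OF c] holo_chartD(5) [OF U'])
  qed
qed


section \<open>The local system on the universal cover\<close>

lemma GL_A_matrix_inv_mem: "X \<in> GL_A A \<Longrightarrow> matrix_inv X \<in> GL_A A"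
proof -
  assume X: "X \<in> GL_A A"
  obtain Y where Y: "Y \<in> GL_A A" "X ** Y = mat 1" using GL_A_inverse [OF X] by metis
  have "matrix_inv X = matrix_inv X ** (X ** Y)" by (simp add: Y)
  also have "\<dots> = Y" by (simp add: matrix_mul_assoc GL_A_matrix_inv [OF X])
  finally show ?thesis using Y by simp
qed

lemma ht_pair_hodge_comp:
  assumes ht: "ht_pair F W" shows "W (2 * q) \<subseteq> hodge_comp F W q q"
proof -
  have sub: "W (2 * q) \<subseteq> F_gr F W q (2 * q)"
  proof
    fix v assume v: "v \<in> W (2 * q)"
    obtain f where f: "f \<in> F q" "v - f \<in> W (2 * q - 2)"
      using ht_pairD(7) [OF ht] by blast
    note W = ht_pairD(1) [OF ht]
    have w: "v - f \<in> W (2 * q - 1)" "v - f \<in> W (2 * q)"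
      using f(2) increasing_filtration_mono [OF W, of "2 * q - 2" "2 * q - 1"]
        increasing_filtration_mono [OF W, of "2 * q - 2" "2 * q"] by auto
    have "v - (v - f) \<in> W (2 * q)"
      by (rule vec.subspace_diff [OF increasing_filtration_subspace [OF W] v w(2)])
    then have "f + (v - f) \<in> F_gr F W q (2 * q)"
      unfolding F_gr_def using f(1) w(1) by (intro sum_setsI) auto
    then show "v \<in> F_gr F W q (2 * q)" by simp
  qed
  moreover have "W (2 * q) \<subseteq> conj_vec ` F_gr F W q (2 * q)"
  proof
    fix v assume "v \<in> W (2 * q)"
    then have "conj_vec v \<in> F_gr F W q (2 * q)" using sub ht_pairD(2) [OF ht] by blast
    then show "v \<in> conj_vec ` F_gr F W q (2 * q)" by (metis conj_vec_conj_vec imageI)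
  qed
  ultimately show ?thesis
    by (simp add: hodge_comp_def)
qed

locale degeneration =
  fixes A :: "real set"
    and atlas :: "('m::t2_space, 'r::finite) chart set"
    and D :: "'m set"
    and V :: "('m, 'n::finite) variation"
    and one one_dual :: "'m \<Rightarrow> complex^'n"
    and p :: 'm and P :: "'m set" and \<psi> :: "'m \<Rightarrow> complex^'r" and K :: "'r set"
    and \<Phi> :: "complex^'r \<Rightarrow> complex^'n^'n"
  assumes A: "coeff_ring A" and mfd: "complex_manifold atlas" and V: "gp_vmhs A atlas (- D) V"
    and ht: "\<And>s. s \<notin> D \<Longrightarrow> hodge_tate (hodge V s) (weight V s)"
    and ori: "oriented_variation A (- D) V one one_dual"
    and coords: "adapted_coords atlas D p P \<psi> K"
    and frame: "flat_frame A V (cover_dom K) (cover_pt P \<psi> K) \<Phi>"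
begin

abbreviation "c \<equiv> cover_pt P \<psi> K"

lemma ls: "local_system A (- D) V"
  using V by (simp only: gp_vmhs_def)

lemma mhs: "x \<notin> D \<Longrightarrow> is_mhs A (hodge V x) (weight V x)"
  using V [unfolded gp_vmhs_def, THEN conjunct2, THEN conjunct1] by blast

lemma polarization: "x \<notin> D \<Longrightarrow> graded_polarization A (hodge V x) (weight V x) (polar V x)"
  using V [unfolded gp_vmhs_def, THEN conjunct2, THEN conjunct2, THEN conjunct1] by blast

lemma frame_const:
  assumes "(U, \<phi>) \<in> frames V"
  shows "locally_constant_on U (\<lambda>x. (*v) (\<phi> x) ` weight V x k)"
    "locally_constant_on U (\<lambda>x. {(\<phi> x *v u, \<phi> x *v v, bform (polar V x k) u v) | u v.
        u \<in> weight V x k \<and> v \<in> weight V x k})"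
  using V [unfolded gp_vmhs_def, THEN conjunct2, THEN conjunct2, THEN conjunct2, THEN conjunct1] assms
  by auto

lemma frame_holo:
  "(U, \<phi>) \<in> frames V \<Longrightarrow> holo_subbundle (mfd_holo_on atlas) U (\<lambda>x. (*v) (\<phi> x) ` hodge V x q)"
  using V [unfolded gp_vmhs_def, THEN conjunct2, THEN conjunct2, THEN conjunct2, THEN conjunct2, THEN conjunct1]
  by auto

lemma griffiths: "griffiths_transversal atlas V"
  using V [unfolded gp_vmhs_def, THEN conjunct2, THEN conjunct2, THEN conjunct2, THEN conjunct2, THEN conjunct2] .

lemma chart: "holo_chart atlas P \<psi>" and pP: "p \<in> P" and psi_p: "\<psi> p = 0" and psi_P: "\<psi> ` P = polydisk"
  and D_P: "D \<inter> P = {x \<in> P. \<exists>j\<in>K. \<psi> x $ j = 0}"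
proof -
  note c = coords [unfolded adapted_coords_def]
  show "holo_chart atlas P \<psi>" using c by (elim conjE)
  show "p \<in> P" using c by (elim conjE)
  show "\<psi> p = 0" using c by (elim conjE)
  show "\<psi> ` P = polydisk" using c by (elim conjE)
  show "D \<inter> P = {x \<in> P. \<exists>j\<in>K. \<psi> x $ j = 0}" using c by (elim conjE)
qed

lemma psi_off: "x \<in> P \<Longrightarrow> \<psi> x \<in> off_hyperplanes K \<longleftrightarrow> x \<notin> D"
proof -
  assume x: "x \<in> P"
  then have "\<psi> x \<in> polydisk" using psi_P by blast
  moreover have "x \<in> D \<longleftrightarrow> x \<in> D \<inter> P" using x by simp
  ultimately show ?thesis unfolding D_P off_hyperplanes_def using x by blast
qed

lemma inv_psi: "s \<in> polydisk \<Longrightarrow> inv_into P \<psi> s \<in> P" "s \<in> polydisk \<Longrightarrow> \<psi> (inv_into P \<psi> s) = s"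
  using inv_into_into [of s \<psi> P] f_inv_into_f [of s \<psi> P] by (simp_all add: psi_P)

lemma inv_psi_psi: "x \<in> P \<Longrightarrow> inv_into P \<psi> (\<psi> x) = x"
  by (rule holo_chartD(5) [OF chart])

lemma inv_psi_off: "s \<in> off_hyperplanes K \<Longrightarrow> inv_into P \<psi> s \<notin> D"
  using psi_off inv_psi off_hyperplanes_polydisk by metis

lemma c_off:
  assumes "z \<in> cover_dom K" shows "c z \<in> P" "\<psi> (c z) = cover_map K z" "c z \<notin> D"
  using inv_psi [OF off_hyperplanes_polydisk [OF cover_map_off [OF assms]]]
    inv_psi_off [OF cover_map_off [OF assms]]
  by (simp_all add: cover_pt_def)

lemma c_cong: "cover_map K z = cover_map K z' \<Longrightarrow> c z = c z'"
  by (simp add: cover_pt_def)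

lemma c_cont: "continuous_on (cover_dom K) c"
  unfolding cover_pt_def
proof (rule continuous_on_compose2 [OF holo_chartD(4) [OF chart] continuous_on_cover_map])
  show "cover_map K ` cover_dom K \<subseteq> \<psi> ` P"
    using cover_map_off off_hyperplanes_polydisk by (auto simp: psi_P)
qed

lemma const:
  assumes "\<And>C M x. R x (C ** M) = act C (R x M)"
    and "\<And>U \<phi>. (U, \<phi>) \<in> frames V \<Longrightarrow> locally_constant_on U (\<lambda>x. R x (\<phi> x))"
    and "z \<in> cover_dom K" "z' \<in> cover_dom K"
  shows "R (c z) (\<Phi> z) = R (c z') (\<Phi> z')"
proof (rule flat_frame_const [where R = R and act = act, OF ls frame c_cont _ connected_cover_dom assms])
  show "c ` cover_dom K \<subseteq> - D" using c_off by blast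
qed

definition base :: "complex^'r" where
  "base = (\<chi> j. if j \<in> K then \<i> else 0)"

definition W :: "int \<Rightarrow> (complex^'n) set" where
  "W k = (*v) (\<Phi> base) ` weight V (c base) k"

lemma base: "base \<in> cover_dom K"
  by (auto simp: base_def cover_dom_def)

lemma W_eq: "z \<in> cover_dom K \<Longrightarrow> (*v) (\<Phi> z) ` weight V (c z) k = W k"
  unfolding W_def
  by (rule const [where R = "\<lambda>x M. (*v) M ` weight V x k" and act = "\<lambda>C S. (*v) C ` S"])
    (simp_all add: image_image matrix_vector_mul_assoc frame_const base)

lemma W_fun_eq: "z \<in> cover_dom K \<Longrightarrow> (\<lambda>k. (*v) (\<Phi> z) ` weight V (c z) k) = W"
  using W_eq by blast

lemma \<Phi>_GL: "z \<in> cover_dom K \<Longrightarrow> \<Phi> z \<in> GL_A A"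
  using frame by (simp add: flat_frame_def)

abbreviation "\<Phi>i z \<equiv> matrix_inv (\<Phi> z)"

lemma \<Phi>i:
  assumes "z \<in> cover_dom K"
  shows "\<Phi> z ** \<Phi>i z = mat 1" "\<Phi>i z ** \<Phi> z = mat 1" "\<Phi>i z \<in> GL_A A"
    "conj_mat (\<Phi> z) = \<Phi> z" "conj_mat (\<Phi>i z) = \<Phi>i z"
  using GL_A_matrix_inv [OF \<Phi>_GL [OF assms]] GL_A_matrix_inv_mem [OF \<Phi>_GL [OF assms]]
    GL_A_real [OF \<Phi>_GL [OF assms]] GL_A_real [OF GL_A_matrix_inv_mem [OF \<Phi>_GL [OF assms]]]
  by blast+

lemma ht_fibre: "x \<notin> D \<Longrightarrow> ht_pair (hodge V x) (weight V x)"
  by (rule mhs_ht_pair [OF mhs ht])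

lemma W_incr: "increasing_filtration W"
  using increasing_filtration_image [OF \<Phi>i(1,2) [OF base] ht_pairD(1) [OF ht_fibre [OF c_off(3) [OF base]]]]
  by (simp add: W_fun_eq [OF base])

lemma W_odd: "odd k \<Longrightarrow> W k = W (k - 1)"
  unfolding W_def by (simp add: ht_pairD(3) [OF ht_fibre [OF c_off(3) [OF base]]])

lemma W_span: "W k = vec.span (W k \<inter> A_points A)"
proof -
  have "weight V (c base) k = vec.span (weight V (c base) k \<inter> A_points A)"
    using mhs [OF c_off(3) [OF base], unfolded is_mhs_def, THEN conjunct2, THEN conjunct2, THEN conjunct1] by blast
  then have "W k = (*v) (\<Phi> base) ` vec.span (weight V (c base) k \<inter> A_points A)"
    unfolding W_def by (rule arg_cong)
  also have "\<dots> = vec.span ((*v) (\<Phi> base) ` (weight V (c base) k \<inter> A_points A))"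
    by (simp add: vec.span_image)
  also have "(*v) (\<Phi> base) ` (weight V (c base) k \<inter> A_points A) = W k \<inter> A_points A"
    unfolding W_def by (rule image_A_points [OF \<Phi>i(1,2) [OF base] A \<Phi>_GL [OF base] \<Phi>i(3) [OF base], symmetric])
  finally show ?thesis .
qed

lemma W_real: "v \<in> W k \<Longrightarrow> conj_vec v \<in> W k"
  by (rule conj_vec_span_real [OF W_span])

lemma W_wt: "z \<in> cover_dom K \<Longrightarrow> wt_max W = wt_max (weight V (c z))"
  "z \<in> cover_dom K \<Longrightarrow> wt_min W = wt_min (weight V (c z))"
  using wt_image [OF \<Phi>i(1,2), of z "weight V (c z)"] by (simp_all add: W_fun_eq)

lemma ht_image:
  assumes z: "z \<in> cover_dom K" and g: "g ** h = mat 1" "h ** g = mat 1"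
    and W: "\<And>k. (*v) g ` weight V (c z) k = W k"
  shows "ht_pair (\<lambda>p. (*v) g ` hodge V (c z) p) W"
  using ht_pair_image [OF g ht_fibre [OF c_off(3) [OF z]]] W_real by (simp add: W)

lemma fibre_oriented: "x \<notin> D \<Longrightarrow> oriented_mhs A (hodge V x) (weight V x) (one x) (one_dual x)"
  using ori by (simp add: oriented_variation_def)

lemma betti:
  assumes z: "z \<in> cover_dom K"
  shows "betti_generator A W (wt_max W) (\<Phi> z *v one (c z))"
    "betti_generator A W (wt_min W) (\<Phi> z *v one_dual (c z))"
proof -
  note o = fibre_oriented [OF c_off(3) [OF z], unfolded oriented_mhs_def, THEN conjunct2]
  note im = betti_generator_image [OF \<Phi>i(1,2) [OF z] A \<Phi>_GL [OF z] \<Phi>i(3) [OF z]]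
  show "betti_generator A W (wt_max W) (\<Phi> z *v one (c z))"
    using im [OF o [THEN conjunct1]] by (simp only: W_wt [OF z] W_fun_eq [OF z])
  show "betti_generator A W (wt_min W) (\<Phi> z *v one_dual (c z))"
    using im [OF o [THEN conjunct2]] by (simp only: W_wt [OF z] W_fun_eq [OF z])
qed

lemma one_coset:
  assumes z: "z \<in> cover_dom K" "z' \<in> cover_dom K"
  shows "\<Phi> z *v one (c z) - \<Phi> z' *v one (c z') \<in> W (wt_max W - 1)"
proof -
  define R where "R x M = (\<lambda>v. M *v (one x + v)) ` weight V x (wt_max (weight V x) - 1)" for x and M :: "complex^'n^'n"
  have "R (c z) (\<Phi> z) = R (c z') (\<Phi> z')"
  proof (rule const [where act = "\<lambda>C S. (*v) C ` S", OF _ _ z])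
    show "R x (C ** M) = (*v) C ` R x M" for x C M
      by (simp add: R_def image_image matrix_vector_mul_assoc)
    show "locally_constant_on U (\<lambda>x. R x (\<phi> x))" if "(U, \<phi>) \<in> frames V" for U \<phi>
      using ori that unfolding R_def oriented_variation_def flat_gr_section_def by auto
  qed
  moreover have "\<Phi> z *v one (c z) \<in> R (c z) (\<Phi> z)"
  proof -
    have "0 \<in> weight V (c z) (wt_max (weight V (c z)) - 1)"
      by (rule vec.subspace_0 [OF increasing_filtration_subspace [OF ht_pairD(1) [OF ht_fibre [OF c_off(3) [OF z(1)]]]]])
    then show ?thesis unfolding R_def by (intro image_eqI [of _ _ 0]) simp_all
  qed
  ultimately obtain v where v: "v \<in> weight V (c z') (wt_max W - 1)"
      "\<Phi> z *v one (c z) = \<Phi> z' *v (one (c z') + v)"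
    unfolding R_def W_wt(1) [OF z(2)] by blast
  then have "\<Phi> z *v one (c z) - \<Phi> z' *v one (c z') = \<Phi> z' *v v"
    by (simp add: mv.add_right)
  then show ?thesis
    using v(1) W_eq [OF z(2)] by blast
qed

lemma dual_const:
  assumes z: "z \<in> cover_dom K" "z' \<in> cover_dom K"
  shows "\<Phi> z *v one_dual (c z) = \<Phi> z' *v one_dual (c z')"
proof -
  define R where "R x M = (\<lambda>v. M *v (one_dual x + v)) ` weight V x (wt_min (weight V x) - 1)" for x and M :: "complex^'n^'n"
  have "R (c z) (\<Phi> z) = R (c z') (\<Phi> z')"
  proof (rule const [where act = "\<lambda>C S. (*v) C ` S", OF _ _ z])
    show "R x (C ** M) = (*v) C ` R x M" for x C M
      by (simp add: R_def image_image matrix_vector_mul_assoc)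
    show "locally_constant_on U (\<lambda>x. R x (\<phi> x))" if "(U, \<phi>) \<in> frames V" for U \<phi>
      using ori that unfolding R_def oriented_variation_def flat_gr_section_def by auto
  qed
  moreover have "R (c z) (\<Phi> z) = {\<Phi> z *v one_dual (c z)}" if "z \<in> cover_dom K" for z
    using weight_range(4) [OF ht_pairD(1) [OF ht_fibre [OF c_off(3) [OF that]]]] by (simp add: R_def)
  ultimately show ?thesis using z by simp
qed

lemma shift_axis: "z \<in> cover_dom K \<Longrightarrow> j \<in> K \<Longrightarrow> z + axis j 1 \<in> cover_dom K"
  "j \<in> K \<Longrightarrow> c (z + axis j 1) = c z"
proof -
  show "z \<in> cover_dom K \<Longrightarrow> j \<in> K \<Longrightarrow> z + axis j 1 \<in> cover_dom K"
    using cover_dom_shift [of z K j 1] by simp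
  show "j \<in> K \<Longrightarrow> c (z + axis j 1) = c z"
    by (rule c_cong) (use cover_map_shift [of j K z 1] in simp)
qed

text \<open>A flat structure which is compared with itself along a loop is invariant under monodromy. This applies
  to the polarization of \<open>Gr\<^sub>2\<^sub>q\<close>, which is definite, the whole piece being of type \<open>(q, q)\<close>.\<close>

lemma monodromy_lowers:
  assumes j: "j \<in> K" and T: "unipotent_mat T" "\<And>z. z \<in> cover_dom K \<Longrightarrow> \<Phi> (z + axis j 1) = T ** \<Phi> z"
  shows "lowers W (T - mat 1)" "conj_mat T = T"
proof -
  define z where "z = base + axis j 1"
  define x where "x = c base"
  have z: "z \<in> cover_dom K" and cz: "c z = x" using base j by (simp_all add: z_def x_def shift_axis)
  have xD: "x \<notin> D" unfolding x_def by (rule c_off(3) [OF base])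
  note htx = ht_fibre [OF xD] and \<Phi>b = \<Phi>i [OF base]
  have Tz: "\<Phi> z = T ** \<Phi> base" unfolding z_def by (rule T(2) [OF base])
  have "T = \<Phi> z ** \<Phi>i base" by (simp add: Tz \<Phi>b flip: matrix_mul_assoc)
  then show real: "conj_mat T = T" by (simp add: conj_mat_mult \<Phi>i [OF z] \<Phi>b)
  have mem: "v \<in> W k \<longleftrightarrow> \<Phi>i base *v v \<in> weight V x k" for v k
    unfolding W_def x_def by (rule mem_image_inverse [OF \<Phi>b(1,2)])
  have pres: "preserves W T"
    unfolding preserves_def
  proof (intro allI ballI)
    fix k v assume "v \<in> W k"
    then obtain w where w: "w \<in> weight V x k" "v = \<Phi> base *v w" unfolding W_def x_def by blast
    then have "T *v v = \<Phi> z *v w" by (simp add: Tz matrix_vector_mul_assoc)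
    then show "T *v v \<in> W k" using w(1) W_eq [OF z, of k] by (auto simp: cz)
  qed
  show "lowers W (T - mat 1)"
    unfolding lowers_def
  proof (intro allI ballI)
    fix k v assume v: "v \<in> W k"
    show "(T - mat 1) *v v \<in> W (k - 1)"
    proof (cases "odd k")
      case True
      have "T *v v - v \<in> W k"
        using pres v unfolding preserves_def
        by (intro vec.subspace_diff [OF increasing_filtration_subspace [OF W_incr]]) blast+
      then show ?thesis using W_odd [OF True] by (simp add: mv.diff_left)
    next
      case False
      then obtain q where q: "k = 2 * q" by blast
      define \<beta> where "\<beta> u v = bform (polar V x k) (\<Phi>i base *v u) (\<Phi>i base *v v)" for u v
      note pol = polarization [OF xD, unfolded graded_polarization_def, rule_format, of k]
      show ?thesis
      proof (rule unipotent_definite [where \<beta> = \<beta>, OF W_incr W_real pres real T(1) _ _ _ _ _ _ v])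
        show "\<beta> (u + u') v = \<beta> u v + \<beta> u' v" "\<beta> u (v + v') = \<beta> u v + \<beta> u v'" for u u' v v'
          by (simp_all add: \<beta>_def mv.add_right bform_add)
        show 1: "\<beta> u v = 0" if "u \<in> W (k - 1)" "v \<in> W k" for u v
          using pol that unfolding \<beta>_def mem by blast
        show "\<beta> u v = 0" if "u \<in> W k" "v \<in> W (k - 1)" for u v
        proof -
          have "v \<in> W k" using that(2) increasing_filtration_mono [OF W_incr, of "k - 1" k] by auto
          then have "\<beta> u v = (- 1) powi k * \<beta> v u"
            using pol that(1) unfolding \<beta>_def mem by blast
          then show ?thesis using 1 [OF that(2,1)] by simp
        qed
        show "\<beta> (T *v u) (T *v v) = \<beta> u v" if uv: "u \<in> W k" "v \<in> W k" for u v
        proof -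
          define R where "R y M = {(M *v u, M *v v, bform (polar V y k) u v) | u v.
              u \<in> weight V y k \<and> v \<in> weight V y k}" for y and M :: "complex^'n^'n"
          have "R (c z) (\<Phi> z) = R (c base) (\<Phi> base)"
          proof (rule const [where act = "\<lambda>C S. (\<lambda>(a, b, t). (C *v a, C *v b, t)) ` S", OF _ _ z base])
            show "R y (C ** M) = (\<lambda>(a, b, t). (C *v a, C *v b, t)) ` R y M" for y C M
              unfolding R_def
              by (auto simp: image_iff simp flip: matrix_vector_mul_assoc) blast+
            show "locally_constant_on U (\<lambda>y. R y (\<phi> y))" if "(U, \<phi>) \<in> frames V" for U \<phi>
              unfolding R_def by (rule frame_const(2) [OF that])
          qed
          moreover have "(T *v u, T *v v, \<beta> u v) \<in> R (c z) (\<Phi> z)"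
          proof -
            have "\<Phi> z *v (\<Phi>i base *v w) = T *v w" for w
              by (simp add: Tz matrix_vector_mul_assoc \<Phi>b flip: matrix_mul_assoc)
            then show ?thesis
              using uv unfolding R_def cz \<beta>_def mem
              by (intro CollectI exI [of _ "\<Phi>i base *v u"] exI [of _ "\<Phi>i base *v v"]) simp
          qed
          ultimately obtain u' v' where "T *v u = \<Phi> base *v u'" "T *v v = \<Phi> base *v v'"
              "\<beta> u v = bform (polar V x k) u' v'"
            unfolding R_def x_def by blast
          then show ?thesis
            by (simp add: \<beta>_def matrix_vector_mul_assoc \<Phi>b)
        qed
        show "\<beta> u (conj_vec u) \<noteq> 0" if u: "u \<in> W k - W (k - 1)" for u
        proof -
          have "\<Phi>i base *v u \<in> hodge_comp (hodge V x) (weight V x) q q - weight V x (k - 1)"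
            using u ht_pair_hodge_comp [OF htx, of q] mem [of u k] mem [of u "k - 1"] by (auto simp: q)
          moreover have "q + q = k" by (simp add: q)
          ultimately obtain r :: real where "r > 0"
              "\<i> powi (q - q) * bform (polar V x k) (\<Phi>i base *v u) (conj_vec (\<Phi>i base *v u)) = complex_of_real r"
            using pol by blast
          then show ?thesis
            by (simp add: \<beta>_def conj_mat_vec \<Phi>b)
        qed
      qed
    qed
  qed
qed

text \<open>A local section of the covering, compatible with a flat frame of the local system.\<close>

lemma local_lift:
  assumes z0: "z0 \<in> cover_dom K"
  obtains Ob zl U \<phi> M M' where "open Ob" "cover_map K z0 \<in> Ob" "Ob \<subseteq> off_hyperplanes K"
    "(U, \<phi>) \<in> frames V" "open U" "M ** M' = mat 1" "M' ** M = mat 1" "zl (cover_map K z0) = z0"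
    "\<And>s. s \<in> Ob \<Longrightarrow> zl s \<in> cover_dom K \<and> cover_map K (zl s) = s \<and> c (zl s) = inv_into P \<psi> s \<and>
      inv_into P \<psi> s \<in> U \<and> \<Phi> (zl s) = M ** \<phi> (inv_into P \<psi> s)"
    "\<And>s i. s \<in> Ob \<Longrightarrow> hol_at (\<lambda>s. zl s $ i) s"
    "\<And>j t. j \<in> K \<Longrightarrow> zl (upd (cover_map K z0) j t)
      = z0 + axis j (Ln (t / cover_map K z0 $ j) / (2 * of_real pi * \<i>))"
proof -
  define s0 where "s0 = cover_map K z0"
  have s0: "s0 \<in> off_hyperplanes K" unfolding s0_def by (rule cover_map_off [OF z0])
  then have s0K: "s0 $ j \<noteq> 0" if "j \<in> K" for j using that by (auto simp: off_hyperplanes_def)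
  define zl where "zl s = (\<chi> j. if j \<in> K then z0 $ j + Ln (s $ j / s0 $ j) / (2 * of_real pi * \<i>) else s $ j)" for s
  have zl0: "zl s0 = z0"
    using s0K by (auto simp: zl_def vec_eq_iff) (auto simp: s0_def cover_map_def)
  have cm: "cover_map K (zl s) = s" if "s \<in> off_hyperplanes K" for s
  proof -
    have "exp (2 * of_real pi * \<i> * (zl s $ j)) = s $ j" if j: "j \<in> K" for j
    proof -
      have sj: "s $ j \<noteq> 0" using \<open>s \<in> off_hyperplanes K\<close> j by (auto simp: off_hyperplanes_def)
      have "2 * of_real pi * \<i> * (zl s $ j) = 2 * of_real pi * \<i> * z0 $ j + Ln (s $ j / s0 $ j)"
        using j by (simp add: zl_def field_simps)
      then have "exp (2 * of_real pi * \<i> * (zl s $ j)) = exp (2 * of_real pi * \<i> * z0 $ j) * (s $ j / s0 $ j)"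
        using sj s0K [OF j] by (simp add: exp_add)
      also have "exp (2 * of_real pi * \<i> * z0 $ j) = s0 $ j"
        using j by (simp add: s0_def cover_map_def)
      finally show ?thesis using s0K [OF j] by simp
    qed
    then show ?thesis by (auto simp: cover_map_def vec_eq_iff zl_def)
  qed
  define O1 where "O1 = off_hyperplanes K \<inter> (\<Inter>j\<in>K. {s. cmod (s $ j / s0 $ j - 1) < 1})"
  have O1: "open O1" "s0 \<in> O1"
  proof -
    have "open {s :: complex^'r. cmod (s $ j / s0 $ j - 1) < 1}" if "j \<in> K" for j
      using s0K [OF that] by (intro open_Collect_less continuous_intros) auto
    then show "open O1"
      unfolding O1_def by (intro open_Int open_off_hyperplanes open_INT ballI) auto
    show "s0 \<in> O1" using s0 s0K by (auto simp: O1_def)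
  qed
  have hol: "hol_at (\<lambda>s. zl s $ j) s" if s: "s \<in> O1" for s j
  proof (cases "j \<in> K")
    case False
    then show ?thesis by (simp add: zl_def)
  next
    case True
    have "cmod (s $ j / s0 $ j - 1) < 1" using s True by (auto simp: O1_def)
    then have "0 < Re (s $ j / s0 $ j)"
      using abs_Re_le_cmod [of "s $ j / s0 $ j - 1"] by simp
    then have "s $ j / s0 $ j \<notin> \<real>\<^sub>\<le>\<^sub>0" by (auto simp: complex_nonpos_Reals_iff)
    then have "hol_at (\<lambda>s. Ln (s $ j / s0 $ j)) s"
      by (intro hol_at_compose [where g = Ln, OF has_field_derivative_Ln])
        (auto simp: divide_inverse intro!: hol_at_mult)
    then have "hol_at (\<lambda>s. z0 $ j + Ln (s $ j / s0 $ j) * (1 / (2 * of_real pi * \<i>))) s"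
      by (intro hol_at_add hol_at_mult) auto
    then show ?thesis using True by (simp add: zl_def)
  qed
  have zl_cont: "continuous_on O1 zl"
  proof (intro continuous_at_imp_continuous_on ballI)
    fix s assume "s \<in> O1"
    then show "isCont zl s"
      using hol_at_isCont [OF hol] unfolding isCont_def by (intro vec_tendstoI) auto
  qed
  have cD: "c ` cover_dom K \<subseteq> - D" using c_off by blast
  obtain U \<phi> M M' where U: "(U, \<phi>) \<in> frames V" "c z0 \<in> U" "open U" and M: "M ** M' = mat 1" "M' ** M = mat 1"
      "\<Phi> z0 = M ** \<phi> (c z0)" "\<forall>\<^sub>F y in at z0 within cover_dom K. c y \<in> U \<and> \<Phi> y = M ** \<phi> (c y)"
    by (rule flat_frame_local [OF ls frame c_cont cD z0]) blast
  have "\<forall>\<^sub>F y in nhds z0. y \<in> cover_dom K \<and> c y \<in> U \<and> \<Phi> y = M ** \<phi> (c y)"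
  proof -
    have "\<forall>\<^sub>F y in nhds z0. y \<in> cover_dom K"
      using z0 open_cover_dom by (rule eventually_nhds_in_open [rotated])
    moreover have "\<forall>\<^sub>F y in nhds z0. y \<noteq> z0 \<longrightarrow> y \<in> cover_dom K \<longrightarrow> c y \<in> U \<and> \<Phi> y = M ** \<phi> (c y)"
      using M(4) unfolding eventually_at_filter .
    ultimately show ?thesis
      by eventually_elim (use M(3) U(2) in metis)
  qed
  then obtain Oz where Oz: "open Oz" "z0 \<in> Oz"
      "\<And>y. y \<in> Oz \<Longrightarrow> y \<in> cover_dom K \<and> c y \<in> U \<and> \<Phi> y = M ** \<phi> (c y)"
    unfolding eventually_nhds by blast
  define Ob where "Ob = O1 \<inter> zl -` Oz"
  have "open Ob"
    unfolding Ob_def using zl_cont O1(1) Oz(1) by (metis continuous_on_open_vimage inf_commute)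
  moreover have "cover_map K z0 \<in> Ob"
    using O1(2) Oz(2) zl0 by (simp add: Ob_def s0_def)
  moreover have "Ob \<subseteq> off_hyperplanes K" by (auto simp: Ob_def O1_def)
  moreover have "zl s \<in> cover_dom K \<and> cover_map K (zl s) = s \<and> c (zl s) = inv_into P \<psi> s \<and>
      inv_into P \<psi> s \<in> U \<and> \<Phi> (zl s) = M ** \<phi> (inv_into P \<psi> s)" if "s \<in> Ob" for s
  proof -
    have s: "s \<in> off_hyperplanes K" "zl s \<in> Oz" using that by (auto simp: Ob_def O1_def)
    have "c (zl s) = inv_into P \<psi> s" by (simp add: cover_pt_def cm [OF s(1)])
    then show ?thesis using Oz(3) [OF s(2)] cm [OF s(1)] by auto
  qed
  moreover have "hol_at (\<lambda>s. zl s $ i) s" if "s \<in> Ob" for s i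
    using that by (intro hol) (simp add: Ob_def)
  moreover have "zl (upd (cover_map K z0) j t) = z0 + axis j (Ln (t / cover_map K z0 $ j) / (2 * of_real pi * \<i>))"
    if "j \<in> K" for j t
  proof -
    have "i \<notin> K \<Longrightarrow> s0 $ i = z0 $ i" "i \<in> K \<Longrightarrow> Ln (s0 $ i / s0 $ i) = 0" for i
      using s0K by (simp_all add: s0_def cover_map_def)
    then show ?thesis
      using that unfolding s0_def [symmetric] by (auto simp: zl_def vec_eq_iff upd_nth axis_def)
  qed
  ultimately show thesis
    using that [of Ob U \<phi> M M' zl] U M(1,2) zl0 unfolding s0_def by blast
qed

end


section \<open>The period map untwisted by the monodromy logarithms\<close>

definition hol_mat :: "(complex^'r \<Rightarrow> complex^'n^'n) \<Rightarrow> complex^'r \<Rightarrow> bool" where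
  "hol_mat F x \<longleftrightarrow> (\<forall>i k. hol_at (\<lambda>s. F s $ i $ k) x)"

lemma hol_mat_const: "hol_mat (\<lambda>s. X) x"
  by (simp add: hol_mat_def)

lemma hol_mat_mult: "hol_mat F x \<Longrightarrow> hol_mat G x \<Longrightarrow> hol_mat (\<lambda>s. F s ** G s) x"
  by (auto simp: hol_mat_def matrix_matrix_mult_def intro!: hol_at_sum hol_at_mult)

lemma hol_mat_diff: "hol_mat F x \<Longrightarrow> hol_mat G x \<Longrightarrow> hol_mat (\<lambda>s. F s - G s) x"
  by (auto simp: hol_mat_def intro!: hol_at_diff)

lemma hol_mat_sum: "(\<And>i. i \<in> I \<Longrightarrow> hol_mat (F i) x) \<Longrightarrow> hol_mat (\<lambda>s. \<Sum>i\<in>I. F i s) x"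
  by (auto simp: hol_mat_def intro!: hol_at_sum)

lemma hol_mat_scale: "hol_at f x \<Longrightarrow> hol_mat F x \<Longrightarrow> hol_mat (\<lambda>s. scale_mat (f s) (F s)) x"
  by (auto simp: hol_mat_def scale_mat_def intro!: hol_at_mult)

lemma hol_mat_pow: "hol_mat F x \<Longrightarrow> hol_mat (\<lambda>s. mat_pow (F s) k) x"
  by (induction k) (auto simp: mat_pow_Suc intro: hol_mat_mult hol_mat_const)

lemma hol_mat_exp:
  assumes "\<And>s. mat_pow (F s) m = 0" and "hol_mat F x" shows "hol_mat (\<lambda>s. mat_exp (F s)) x"
  unfolding mat_exp_nilpotent [OF assms(1)] scale_mat_of_real [symmetric]
  by (intro hol_mat_sum hol_mat_scale hol_mat_pow assms(2) hol_at_const)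

lemma hol_mat_vec: "hol_mat F x \<Longrightarrow> (\<And>i. hol_at (\<lambda>s. v s $ i) x) \<Longrightarrow> hol_at (\<lambda>s. (F s *v v s) $ i) x"
  by (auto simp: hol_mat_def matrix_vector_mult_def intro!: hol_at_sum hol_at_mult)

locale log_monodromy = degeneration A atlas D V one one_dual p P \<psi> K \<Phi>
  for A and atlas :: "('m::t2_space, 'r::finite) chart set" and D
    and V :: "('m, 'n::finite) variation" and one one_dual p P \<psi> K \<Phi> +
  fixes N :: "'r \<Rightarrow> complex^'n^'n"
  assumes adm: "admissible A atlas D V"
    and N_nilpotent: "\<And>j. j \<in> K \<Longrightarrow> nilpotent_mat (N j)"
    and N_monodromy: "\<And>z j. z \<in> cover_dom K \<Longrightarrow> j \<in> K \<Longrightarrow> \<Phi> (z + axis j 1) = mat_exp (N j) ** \<Phi> z"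
begin

definition m :: nat where "m = (SOME m. \<forall>X. lowers W X \<longrightarrow> mat_pow X m = 0)"

lemma nil: "lowers W X \<Longrightarrow> mat_pow X m = 0"
  unfolding m_def using someI_ex [OF lowers_uniformly_nilpotent [OF W_incr]] by blast

lemma N: assumes j: "j \<in> K" shows "lowers W (N j)" "conj_mat (N j) = N j"
proof -
  obtain l where l: "mat_pow (N j) l = 0" using N_nilpotent [OF j] by (auto simp: nilpotent_mat_def)
  have uni: "unipotent_mat (mat_exp (N j))"
    using mat_log_exp(2) [OF l] by (auto simp: unipotent_mat_def nilpotent_mat_def)
  note T = monodromy_lowers [OF j uni N_monodromy [OF _ j]]
  have eq: "N j = mat_log l (mat_exp (N j))" by (simp add: mat_log_exp(1) [OF l])
  show "lowers W (N j)" by (subst eq) (rule lowers_log [OF W_incr T(1)])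
  show "conj_mat (N j) = N j" by (subst (2) eq, subst eq) (simp add: conj_mat_log T(2))
qed

text \<open>The translations of the cover commute, so the monodromy matrices do, and the \<open>N\<^sub>j\<close> are their
  logarithms.\<close>

lemma N_commute: assumes ij: "i \<in> K" "j \<in> K" shows "N i ** N j = N j ** N i"
proof -
  let ?T = "\<lambda>j. mat_exp (N j)"
  note i = shift_axis(1) [OF base ij(1)] and j = shift_axis(1) [OF base ij(2)]
  have "?T j ** (?T i ** \<Phi> base) = ?T i ** (?T j ** \<Phi> base)"
  proof -
    have "?T j ** (?T i ** \<Phi> base) = \<Phi> (base + axis i 1 + axis j 1)"
      using N_monodromy [OF i ij(2)] N_monodromy [OF base ij(1)] by simp
    also have "base + axis i 1 + axis j 1 = base + axis j 1 + axis i 1" by (simp add: add_ac)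
    also have "\<Phi> \<dots> = ?T i ** (?T j ** \<Phi> base)"
      using N_monodromy [OF j ij(1)] N_monodromy [OF base ij(2)] by simp
    finally show ?thesis .
  qed
  then have "?T j ** ?T i ** (\<Phi> base ** \<Phi>i base) = ?T i ** ?T j ** (\<Phi> base ** \<Phi>i base)"
    by (simp add: matrix_mul_assoc)
  then have T: "?T i ** ?T j = ?T j ** ?T i" by (simp add: \<Phi>i [OF base])
  have log: "mat_log m (?T k) = N k" if "k \<in> K" for k
    by (rule mat_log_exp(1) [OF nil [OF N(1) [OF that]]])
  have "?T i ** N j = N j ** ?T i"
    using mat_log_intertwine [OF T, of m] by (simp add: log ij)
  then show ?thesis
    using mat_log_intertwine [of "N j" "?T i" "?T i" m] by (simp add: log ij)
qed

definition X :: "complex^'r \<Rightarrow> complex^'n^'n" where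
  "X u = (\<Sum>j\<in>K. scale_mat (u $ j) (N j))"

abbreviation "E u \<equiv> mat_exp (X u)"
abbreviation "Ei u \<equiv> mat_exp (- X u)"

lemma X_lowers: "lowers W (X u)" "lowers W (- X u)"
  unfolding X_def by (intro lowers_sum lowers_closed W_incr N; assumption)+

lemma X_N: "j \<in> K \<Longrightarrow> X u ** N j = N j ** X u"
  by (auto simp: X_def mm.sum_left mm.sum_right scale_mat_mult_left scale_mat_mult_right N_commute
      intro!: sum.cong)

lemma E_inverse: "E u ** Ei u = mat 1" "Ei u ** E u = mat 1"
  by (rule mat_exp_minus [OF nil [OF X_lowers(1)]])+

lemma E_image: "(*v) (E u) ` W k = W k" "(*v) (Ei u) ` W k = W k"
proof -
  have "preserves W (E u)" "preserves W (Ei u)"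
    using preserves_exp [OF W_incr X_lowers(1) nil [OF X_lowers(1)]]
      preserves_exp [OF W_incr X_lowers(2) nil [OF X_lowers(2)]] by blast+
  then have *: "E u *v v \<in> W k" "Ei u *v v \<in> W k" if "v \<in> W k" for v
    using that by (auto simp: preserves_def)
  have "v = E u *v (Ei u *v v)" "v = Ei u *v (E u *v v)" for v
    by (simp_all add: matrix_vector_mul_assoc E_inverse)
  then show "(*v) (E u) ` W k = W k" "(*v) (Ei u) ` W k = W k"
    using * by (blast intro: image_eqI)+
qed

lemma X_add_axis: "j \<in> K \<Longrightarrow> X (u + axis j t) = X u + scale_mat t (N j)"
proof -
  assume j: "j \<in> K"
  have "X (u + axis j t) = (\<Sum>i\<in>K. scale_mat (u $ i) (N i) + (if i = j then scale_mat t (N j) else 0))"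
    unfolding X_def by (intro sum.cong refl) (auto simp: axis_def sm.add_left sm.zero_left)
  then show ?thesis using j by (simp add: sum.distrib X_def)
qed

lemma E_add_axis:
  assumes j: "j \<in> K"
  shows "E (u + axis j t) = mat_exp (scale_mat t (N j)) ** E u" "E (u + axis j t) = E u ** mat_exp (scale_mat t (N j))"
    "Ei (u + axis j t) = Ei u ** mat_exp (- scale_mat t (N j))"
proof -
  have low: "lowers W (scale_mat t (N j))" "lowers W (- scale_mat t (N j))"
    by (intro lowers_closed W_incr N j)+
  note n = nil [OF low(1)] nil [OF low(2)] nil [OF X_lowers(1)] nil [OF X_lowers(2)]
  have comm: "X u ** scale_mat t (N j) = scale_mat t (N j) ** X u"
    by (simp add: scale_mat_mult_left scale_mat_mult_right X_N j)
  show "E (u + axis j t) = E u ** mat_exp (scale_mat t (N j))"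
    unfolding X_add_axis [OF j] by (rule mat_exp_add [OF comm n(3,1)])
  show "E (u + axis j t) = mat_exp (scale_mat t (N j)) ** E u"
    unfolding X_add_axis [OF j] by (subst add.commute) (rule mat_exp_add [OF comm [symmetric] n(1,3)])
  have "Ei (u + axis j t) = mat_exp (- X u + - scale_mat t (N j))"
    by (simp add: X_add_axis [OF j])
  also have "\<dots> = Ei u ** mat_exp (- scale_mat t (N j))"
    by (rule mat_exp_add [OF _ n(4,2)]) (simp add: mm.minus_left mm.minus_right comm)
  finally show "Ei (u + axis j t) = Ei u ** mat_exp (- scale_mat t (N j))" .
qed

text \<open>The trivialization \<open>\<Theta>\<close> is single-valued on the complement of the divisor, and so is the Hodge
  filtration \<open>Fs\<close> in this trivialization.\<close>

definition \<Theta> :: "complex^'r \<Rightarrow> complex^'n^'n" where "\<Theta> z = Ei z ** \<Phi> z"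
definition \<Theta>i :: "complex^'r \<Rightarrow> complex^'n^'n" where "\<Theta>i z = \<Phi>i z ** E z"

lemma \<Theta>_inverse:
  assumes z: "z \<in> cover_dom K" shows "\<Theta> z ** \<Theta>i z = mat 1" "\<Theta>i z ** \<Theta> z = mat 1"
proof -
  have "\<Theta> z ** \<Theta>i z = Ei z ** (\<Phi> z ** \<Phi>i z) ** E z" "\<Theta>i z ** \<Theta> z = \<Phi>i z ** (E z ** Ei z) ** \<Phi> z"
    by (simp_all only: \<Theta>_def \<Theta>i_def matrix_mul_assoc)
  then show "\<Theta> z ** \<Theta>i z = mat 1" "\<Theta>i z ** \<Theta> z = mat 1"
    by (simp_all add: \<Phi>i [OF z] E_inverse)
qed

lemma \<Theta>_periodic: "z \<in> cover_dom K \<Longrightarrow> z' \<in> cover_dom K \<Longrightarrow> cover_map K z = cover_map K z' \<Longrightarrow> \<Theta> z = \<Theta> z'"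
proof (rule cover_periodic [where f = \<Theta>])
  fix z j assume z: "z \<in> cover_dom K" and j: "j \<in> K"
  have low: "lowers W (scale_mat 1 (N j))" by (simp add: N j)
  have "\<Theta> (z + axis j 1) = Ei z ** (mat_exp (- scale_mat 1 (N j)) ** mat_exp (scale_mat 1 (N j))) ** \<Phi> z"
    by (simp add: \<Theta>_def E_add_axis(3) [OF j] N_monodromy [OF z j] matrix_mul_assoc)
  then show "\<Theta> (z + axis j 1) = \<Theta> z"
    by (simp only: mat_exp_minus(2) [OF nil [OF low]] matrix_mul_rid \<Theta>_def)
qed

lemma \<Theta>_W: "z \<in> cover_dom K \<Longrightarrow> (*v) (\<Theta> z) ` weight V (c z) k = W k"
proof -
  assume z: "z \<in> cover_dom K"
  have "(*v) (\<Theta> z) ` weight V (c z) k = (*v) (Ei z) ` (*v) (\<Phi> z) ` weight V (c z) k"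
    by (simp add: \<Theta>_def image_image matrix_vector_mul_assoc)
  then show ?thesis by (simp only: W_eq [OF z] E_image)
qed

definition zof :: "complex^'r \<Rightarrow> complex^'r" where
  "zof s = (SOME z. z \<in> cover_dom K \<and> cover_map K z = s)"

lemma zof: "s \<in> off_hyperplanes K \<Longrightarrow> zof s \<in> cover_dom K \<and> cover_map K (zof s) = s"
proof -
  assume "s \<in> off_hyperplanes K"
  then have "\<exists>z. z \<in> cover_dom K \<and> cover_map K z = s"
    using cover_map_surj by blast
  then show ?thesis unfolding zof_def by (rule someI_ex)
qed

definition Fs :: "complex^'r \<Rightarrow> int \<Rightarrow> (complex^'n) set" where
  "Fs s q = (*v) (\<Theta> (zof s)) ` hodge V (c (zof s)) q"

lemma Fs_eq: "z \<in> cover_dom K \<Longrightarrow> Fs (cover_map K z) q = (*v) (\<Theta> z) ` hodge V (c z) q"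
proof -
  assume z: "z \<in> cover_dom K"
  note zo = zof [OF cover_map_off [OF z]]
  have "\<Theta> (zof (cover_map K z)) = \<Theta> z" using zo z by (intro \<Theta>_periodic) auto
  moreover have "c (zof (cover_map K z)) = c z" using zo by (intro c_cong) auto
  ultimately show ?thesis by (simp add: Fs_def)
qed

lemma ht_Fs: "s \<in> off_hyperplanes K \<Longrightarrow> ht_pair (Fs s) W"
proof -
  assume s: "s \<in> off_hyperplanes K"
  note z = zof [OF s, THEN conjunct1]
  show ?thesis
    unfolding Fs_def by (rule ht_image [OF z \<Theta>_inverse [OF z] \<Theta>_W [OF z]])
qed

definition q :: "complex^'r \<Rightarrow> int \<Rightarrow> complex^'n^'n" where
  "q s = (SOME Q. hodge_proj (Fs s) W Q)"

lemma q: "s \<in> off_hyperplanes K \<Longrightarrow> hodge_proj (Fs s) W (q s)"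
  unfolding q_def using ht_pair_hodge_proj [OF ht_Fs] by (rule someI_ex)

lemma q_proj: "s \<in> off_hyperplanes K \<Longrightarrow> is_proj (Fs s (b + 1)) (W (2 * b)) (q s b)"
  using q by (simp add: hodge_proj_def)

lemma q_hol:
  assumes s0: "s0 \<in> off_hyperplanes K"
  shows "hol_mat (\<lambda>s. q s b) s0"
proof -
  obtain z0 where z0: "z0 \<in> cover_dom K" "cover_map K z0 = s0" using zof [OF s0] by blast
  obtain Ob zl U \<phi> M M' where lift: "open Ob" "cover_map K z0 \<in> Ob" "Ob \<subseteq> off_hyperplanes K"
    and U: "(U, \<phi>) \<in> frames V" "open U" "M ** M' = mat 1" "M' ** M = mat 1" "zl (cover_map K z0) = z0"
    and zl: "\<And>s. s \<in> Ob \<Longrightarrow> zl s \<in> cover_dom K \<and> cover_map K (zl s) = s \<and> c (zl s) = inv_into P \<psi> s \<and>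
      inv_into P \<psi> s \<in> U \<and> \<Phi> (zl s) = M ** \<phi> (inv_into P \<psi> s)"
    and zl_hol: "\<And>s i. s \<in> Ob \<Longrightarrow> hol_at (\<lambda>s. zl s $ i) s"
    and "\<And>j t. j \<in> K \<Longrightarrow> zl (upd (cover_map K z0) j t)
      = z0 + axis j (Ln (t / cover_map K z0 $ j) / (2 * of_real pi * \<i>))"
    by (rule local_lift [OF z0(1)]) blast
  note Ob = lift [unfolded z0(2)]
  define x0 where "x0 = inv_into P \<psi> s0"
  have x0: "x0 \<in> P" "\<psi> x0 = s0" "x0 \<in> U"
    using inv_psi [OF off_hyperplanes_polydisk [OF s0]] zl [OF Ob(2)] by (simp_all add: x0_def)
  obtain B :: "'m set" and d :: nat and \<beta> where B: "open B" "x0 \<in> B" "B \<subseteq> U"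
    and \<beta>: "\<forall>i<d. mfd_holo_on atlas (\<beta> i) B"
    and span: "\<forall>y\<in>B. vec.dim ((*v) (\<phi> y) ` hodge V y (b + 1)) = d \<and>
        (*v) (\<phi> y) ` hodge V y (b + 1) = vec.span ((\<lambda>i. \<beta> i y) ` {..<d})"
    using bspec [OF frame_holo [OF U(1), of "b + 1", unfolded holo_subbundle_def] x0(3)]
    by (elim exE conjE) (rule that)
  define G where "G s = Ei (zl s) ** M" for s
  define \<gamma> where "\<gamma> i s = G s *v \<beta> i (inv_into P \<psi> s)" for i s
  have Fs_span: "Fs s (b + 1) = vec.span ((\<lambda>i. \<gamma> i s) ` {..<d})" if s: "s \<in> Ob" "inv_into P \<psi> s \<in> B" for s
  proof -
    define y where "y = inv_into P \<psi> s"
    note z = zl [OF s(1)]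
    have "Fs s (b + 1) = (*v) (\<Theta> (zl s)) ` hodge V y (b + 1)"
      using Fs_eq [of "zl s" "b + 1"] z by (simp add: y_def)
    also have "\<Theta> (zl s) = G s ** \<phi> y"
      using z by (simp add: \<Theta>_def G_def y_def matrix_mul_assoc)
    also have "(*v) (G s ** \<phi> y) ` hodge V y (b + 1) = (*v) (G s) ` (*v) (\<phi> y) ` hodge V y (b + 1)"
      by (simp add: image_image matrix_vector_mul_assoc)
    also have "(*v) (\<phi> y) ` hodge V y (b + 1) = vec.span ((\<lambda>i. \<beta> i y) ` {..<d})"
      using span s(2) by (simp add: y_def)
    also have "(*v) (G s) ` vec.span ((\<lambda>i. \<beta> i y) ` {..<d}) = vec.span ((\<lambda>i. \<gamma> i s) ` {..<d})"
      by (simp add: \<gamma>_def y_def image_image flip: vec.span_image)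
    finally show ?thesis .
  qed
  have evB: "\<forall>\<^sub>F s in nhds s0. s \<in> Ob \<and> inv_into P \<psi> s \<in> B"
  proof -
    have "open (\<psi> ` (P \<inter> B))" by (rule holo_chart_open_image [OF chart B(1)])
    then have "\<forall>\<^sub>F s in nhds s0. s \<in> \<psi> ` (P \<inter> B)"
      using x0 B(2) by (intro eventually_nhds_in_open) blast+
    moreover have "\<forall>\<^sub>F s in nhds s0. s \<in> Ob"
      using Ob by (intro eventually_nhds_in_open)
    ultimately show ?thesis
      by eventually_elim (auto simp: inv_psi_psi)
  qed
  have G_hol: "hol_mat G s0"
    unfolding G_def
  proof (intro hol_mat_mult hol_mat_const hol_mat_exp [where m = m])
    show "mat_pow (- X (zl s)) m = 0" for s by (rule nil [OF X_lowers(2)])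
    have "hol_mat (\<lambda>s. 0 - (\<Sum>j\<in>K. scale_mat (zl s $ j) (N j))) s0"
      by (intro hol_mat_diff hol_mat_sum hol_mat_scale hol_mat_const zl_hol Ob)
    then show "hol_mat (\<lambda>s. - X (zl s)) s0" by (simp add: X_def)
  qed
  have \<gamma>_hol: "hol_at (\<lambda>s. \<gamma> i s $ r) s0" if "i < d" for i r
    unfolding \<gamma>_def
  proof (rule hol_mat_vec [OF G_hol])
    fix k
    show "hol_at (\<lambda>s. \<beta> i (inv_into P \<psi> s) $ k) s0"
      using mfd_holo_on_chart [OF mfd chart B(1), of "\<beta> i" x0 k] \<beta> that x0 B(2) by auto
  qed
  have "\<forall>\<^sub>F s in nhds s0. is_proj (Fs s (b + 1)) (W (2 * b)) (q s b) \<and> (\<forall>i<d. \<gamma> i s \<in> Fs s (b + 1))"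
    using evB
  proof eventually_elim
    case (elim s)
    have "is_proj (Fs s (b + 1)) (W (2 * b)) (q s b)" using elim Ob(3) by (intro q_proj) blast
    moreover have "\<gamma> i s \<in> Fs s (b + 1)" if "i < d" for i
      unfolding Fs_span [OF elim [THEN conjunct1] elim [THEN conjunct2]]
      using that by (intro vec.span_base) blast
    ultimately show ?case by blast
  qed
  moreover have "Fs s0 (b + 1) \<subseteq> vec.span ((\<lambda>i. \<gamma> i s0) ` {..<d})"
    using Fs_span [OF Ob(2)] B(2) by (simp add: x0_def)
  ultimately show ?thesis
    unfolding hol_mat_def
    by (intro allI proj_hol_at [where E = "\<lambda>s. Fs s (b + 1)" and W = "W (2 * b)" and b = \<gamma> and d = d]) (auto intro: \<gamma>_hol)
qed

text \<open>Along a disk transversal to a branch of the divisor, admissibility provides the extension of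
  the Hodge filtration to the centre, still complementary to the weight filtration because its
  intersection with \<open>W\<close> has constant rank. So the projections remain bounded.\<close>

lemma q_bounded:
  assumes s: "s \<in> off_hyperplanes K" and j: "j \<in> K"
  shows "\<exists>B. \<forall>\<^sub>F t in at 0. cmod (q (upd s j t) b $ i $ k) \<le> B"
proof -
  obtain z0 where z0: "z0 \<in> cover_dom K" "cover_map K z0 = s" using zof [OF s] by blast
  define f0 where "f0 t = inv_into P \<psi> (upd s j t)" for t
  define \<Phi>' where "\<Phi>' w = \<Phi> (upd z0 j w)" for w
  have off: "upd s j t \<in> off_hyperplanes K" if "t \<in> ball 0 1 - {0}" for t
    using that by (intro off_hyperplanes_upd [OF s]) auto
  have poly: "upd s j t \<in> polydisk" if "t \<in> ball 0 1" for t
    using that by (intro polydisk_upd off_hyperplanes_polydisk [OF s]) auto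
  have up: "upd z0 j w \<in> cover_dom K" if "w \<in> upper_half_plane" for w
    using that by (intro cover_dom_upd z0 j) (simp add: upper_half_plane_def)
  have cm: "cover_map K (upd z0 j w) = upd s j (exp (2 * of_real pi * \<i> * w))" for w
    by (simp add: cover_map_upd [OF j] z0)
  have pt: "disk_pt f0 = (\<lambda>w. c (upd z0 j w))"
    by (auto simp: disk_pt_def f0_def cover_pt_def cm)
  \<comment> \<open>The disk through \<open>s\<close> in direction \<open>j\<close>, centred on the divisor. Its monodromy is \<open>exp (N j)\<close>, and the
     trivialization \<open>exp (- w N j) \<Phi>\<close> differs from \<open>\<Theta>\<close> by the constant matrix \<open>C\<close> defined below.\<close>
  have test: "test_disk atlas D f0"
    unfolding test_disk_def
  proof (intro conjI ballI)
    show "continuous_on (ball 0 1) f0"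
      unfolding f0_def
      by (rule continuous_on_compose2 [OF holo_chartD(4) [OF chart] continuous_on_upd]) (use poly psi_P in auto)
    show "f0 t \<notin> D" if "t \<in> ball 0 1 - {0}" for t
      unfolding f0_def by (rule inv_psi_off [OF off [OF that]])
    fix ch assume ch: "ch \<in> atlas"
    obtain U \<psi>' where U: "ch = (U, \<psi>')" by fastforce
    have "(\<lambda>t. \<psi>' (f0 t) $ i) holomorphic_on {t \<in> ball 0 1. f0 t \<in> U}" for i
      unfolding holomorphic_on_def
    proof
      fix t assume t: "t \<in> {t \<in> ball 0 1. f0 t \<in> U}"
      have "upd s j t = \<psi> (f0 t)" "f0 t \<in> P \<inter> U"
        using inv_psi [OF poly, of t] t by (auto simp: f0_def)
      then have "upd s j t \<in> \<psi> ` (P \<inter> U)" by blast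
      then have "hol_at (\<lambda>s. \<psi>' (inv_into P \<psi> s) $ i) (upd s j t)"
        using holo_chartD(6) [OF chart ch [unfolded U]] unfolding holo_on_iff by blast
      from hol_at_line [OF this]
      show "(\<lambda>t. \<psi>' (f0 t) $ i) field_differentiable at t within {t \<in> ball 0 1. f0 t \<in> U}"
        unfolding f0_def by (rule field_differentiable_at_within)
    qed
    then show "case ch of (U, \<psi>') \<Rightarrow> disk_holo_on (\<lambda>t. \<psi>' (f0 t)) {t \<in> ball 0 1. f0 t \<in> U}"
      by (simp add: U disk_holo_on_def)
  qed
  have flat: "flat_frame A V upper_half_plane (disk_pt f0) \<Phi>'"
    unfolding flat_frame_def pt
  proof (intro conjI ballI)
    show "\<Phi>' w \<in> GL_A A" if "w \<in> upper_half_plane" for w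
      unfolding \<Phi>'_def by (rule \<Phi>_GL [OF up [OF that]])
    fix fr assume fr: "fr \<in> frames V"
    obtain U \<phi> where U: "fr = (U, \<phi>)" by fastforce
    have loc: "locally_constant_on {z \<in> cover_dom K. c z \<in> U} (\<lambda>z. \<Phi> z ** matrix_inv (\<phi> (c z)))"
      using frame fr U unfolding flat_frame_def by auto
    have "locally_constant_on {w \<in> upper_half_plane. c (upd z0 j w) \<in> U}
        (\<lambda>w. \<Phi>' w ** matrix_inv (\<phi> (c (upd z0 j w))))"
      unfolding locally_constant_on_def
    proof
      fix w assume w: "w \<in> {w \<in> upper_half_plane. c (upd z0 j w) \<in> U}"
      define Y where "Y = {z \<in> cover_dom K. c z \<in> U}"
      have wY: "upd z0 j w \<in> Y" using w up by (simp add: Y_def)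
      have "\<forall>\<^sub>F z in at (upd z0 j w) within Y. \<Phi> z ** matrix_inv (\<phi> (c z))
          = \<Phi> (upd z0 j w) ** matrix_inv (\<phi> (c (upd z0 j w)))"
        using loc wY unfolding locally_constant_on_def Y_def by blast
      then have "\<forall>\<^sub>F z in nhds (upd z0 j w). z \<in> Y \<longrightarrow> \<Phi> z ** matrix_inv (\<phi> (c z))
          = \<Phi> (upd z0 j w) ** matrix_inv (\<phi> (c (upd z0 j w)))"
        unfolding eventually_at_filter by (rule eventually_mono) auto
      moreover have "((\<lambda>w. upd z0 j w) \<longlongrightarrow> upd z0 j w) (at w within {w \<in> upper_half_plane. c (upd z0 j w) \<in> U})"
        using continuous_on_upd [of UNIV z0 j] by (auto simp: continuous_on_def intro: tendsto_within_subset)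
      ultimately have "\<forall>\<^sub>F y in at w within {w \<in> upper_half_plane. c (upd z0 j w) \<in> U}. upd z0 j y \<in> Y \<longrightarrow>
          \<Phi> (upd z0 j y) ** matrix_inv (\<phi> (c (upd z0 j y)))
          = \<Phi> (upd z0 j w) ** matrix_inv (\<phi> (c (upd z0 j w)))"
        by (rule eventually_compose_filterlim)
      then show "\<forall>\<^sub>F y in at w within {w \<in> upper_half_plane. c (upd z0 j w) \<in> U}.
          \<Phi>' y ** matrix_inv (\<phi> (c (upd z0 j y))) = \<Phi>' w ** matrix_inv (\<phi> (c (upd z0 j w)))"
        unfolding eventually_at_filter
        by (rule eventually_mono) (auto simp: Y_def up \<Phi>'_def)
    qed
    then show "case fr of (U, \<phi>) \<Rightarrow> locally_constant_on {w \<in> upper_half_plane. c (upd z0 j w) \<in> U}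
        (\<lambda>w. \<Phi>' w ** matrix_inv (\<phi> (c (upd z0 j w))))"
      by (simp add: U)
  qed
  have mon: "\<forall>z\<in>upper_half_plane. \<Phi>' (z + 1) = mat_exp (N j) ** \<Phi>' z"
  proof
    fix w assume w: "w \<in> upper_half_plane"
    have "upd z0 j (w + 1) = upd z0 j w + axis j 1"
      by (auto simp: upd_def axis_def vec_eq_iff)
    then show "\<Phi>' (w + 1) = mat_exp (N j) ** \<Phi>' w"
      unfolding \<Phi>'_def using N_monodromy [OF up [OF w] j] by simp
  qed
  have "\<i> \<in> upper_half_plane" by (simp add: upper_half_plane_def)
  moreover have "disk_admissible V f0 \<Phi>' (N j)"
    using adm test flat N_nilpotent [OF j] mon unfolding admissible_def by blast
  moreover have "(\<lambda>k. (*v) (\<Phi>' \<i>) ` weight V (disk_pt f0 \<i>) k) = W"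
    using W_fun_eq [OF up [OF \<open>\<i> \<in> upper_half_plane\<close>]] by (simp add: \<Phi>'_def pt)
  ultimately obtain Ft where
    F1: "\<And>z p. z \<in> upper_half_plane \<Longrightarrow> Ft (exp (2 * of_real pi * \<i> * z)) p
        = (*v) (mat_exp (scale_mat (- z) (N j)) ** \<Phi>' z) ` hodge V (disk_pt f0 z) p"
    and F2: "\<And>p. holo_subbundle disk_holo_on (ball 0 1) (\<lambda>t. Ft t p)"
    and F3: "\<And>p k. holo_subbundle disk_holo_on (ball 0 1) (\<lambda>t. Ft t p \<inter> W k)"
    unfolding disk_admissible_def Let_def by metis
  define C where "C = Ei (upd z0 j 0)"
  define C' where "C' = E (upd z0 j 0)"
  have CC: "C ** C' = mat 1" "C' ** C = mat 1" unfolding C_def C'_def by (rule E_inverse)+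
  have CW: "(*v) C ` W k = W k" "(*v) C' ` W k = W k" for k unfolding C_def C'_def by (rule E_image)+
  have Fs_Ft: "Fs (upd s j t) p = (*v) C ` Ft t p" if t: "t \<in> ball 0 1 - {0}" for t p
  proof -
    obtain z where z: "z \<in> cover_dom K" "cover_map K z = upd s j t"
      using cover_map_surj [OF off [OF t]] by blast
    define w where "w = z $ j"
    have w: "w \<in> upper_half_plane"
      using z(1) j unfolding cover_dom_def upper_half_plane_def w_def by (auto dest: spec [of _ j])
    have tw: "exp (2 * of_real pi * \<i> * w) = t"
      using arg_cong [OF z(2), of "\<lambda>v. v $ j"] j by (simp add: cover_map_def upd_nth w_def)
    have "Fs (upd s j t) p = (*v) (\<Theta> (upd z0 j w)) ` hodge V (disk_pt f0 w) p"
      using Fs_eq [OF up [OF w], of p] by (simp add: cm tw pt)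
    also have "\<Theta> (upd z0 j w) = C ** (mat_exp (scale_mat (- w) (N j)) ** \<Phi>' w)"
    proof -
      have "upd z0 j w = upd z0 j 0 + axis j w"
        by (auto simp: upd_def axis_def vec_eq_iff)
      then have "Ei (upd z0 j w) = C ** mat_exp (- scale_mat w (N j))"
        using E_add_axis(3) [OF j, of "upd z0 j 0" w] by (simp add: C_def)
      then show ?thesis
        by (simp add: \<Theta>_def \<Phi>'_def sm.minus_left matrix_mul_assoc)
    qed
    also have "(*v) (C ** (mat_exp (scale_mat (- w) (N j)) ** \<Phi>' w)) ` hodge V (disk_pt f0 w) p
        = (*v) C ` (*v) (mat_exp (scale_mat (- w) (N j)) ** \<Phi>' w) ` hodge V (disk_pt f0 w) p"
      by (simp add: image_image matrix_vector_mul_assoc)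
    also have "\<dots> = (*v) C ` Ft t p"
      using F1 [OF w, of p] by (simp add: tw)
    finally show ?thesis .
  qed
  have Ft_ht: "ht_pair (Ft t) W" if t: "t \<in> ball 0 1 - {0}" for t
  proof -
    have "ht_pair (\<lambda>p. (*v) C' ` Fs (upd s j t) p) (\<lambda>k. (*v) C' ` W k)"
      using W_real by (intro ht_pair_image [OF CC(2,1)] ht_Fs off t) (simp only: CW)
    moreover have "(*v) C' ` Fs (upd s j t) p = Ft t p" for p
      by (simp add: Fs_Ft [OF t] image_image matrix_vector_mul_assoc CC)
    ultimately show ?thesis by (simp add: CW)
  qed
  define Wb where "Wb = W (2 * b)"
  have Wb: "vec.subspace Wb" unfolding Wb_def by (rule increasing_filtration_subspace [OF W_incr])
  obtain N0 d0 \<beta> where N0: "open N0" "0 \<in> N0" "N0 \<subseteq> ball 0 1" "\<forall>i<d0. disk_holo_on (\<beta> i) N0"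
      "\<forall>y\<in>N0. vec.dim (Ft y (b + 1)) = d0 \<and> Ft y (b + 1) = vec.span ((\<lambda>i. \<beta> i y) ` {..<d0})"
  proof -
    have "(0 :: complex) \<in> ball 0 1" by simp
    from bspec [OF F2 [of "b + 1", unfolded holo_subbundle_def] this] that show thesis by blast
  qed
  obtain N1 d1 where N1: "open N1" "0 \<in> N1" "N1 \<subseteq> ball 0 1" "\<forall>y\<in>N1. vec.dim (Ft y (b + 1) \<inter> Wb) = d1"
  proof -
    have "(0 :: complex) \<in> ball 0 1" by simp
    from bspec [OF F3 [of "b + 1" "2 * b", unfolded holo_subbundle_def] this] that show thesis
      unfolding Wb_def by blast
  qed
  have sub: "vec.subspace (Ft y (b + 1))" if "y \<in> N0" for y
    using N0(5) that by (metis vec.subspace_span)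
  have "\<exists>Q. is_proj (Ft t (b + 1)) Wb Q" if "t \<in> N0" for t
  proof (cases "t = 0")
    case False
    then have t: "t \<in> ball 0 1 - {0}" using that N0(3) by blast
    then show ?thesis
      using ht_pair_hodge_proj [OF Ft_ht [OF t]] unfolding hodge_proj_def Wb_def by blast
  next
    case True
    obtain e where e: "0 < e" "ball 0 e \<subseteq> N0 \<inter> N1"
      using open_contains_ball N0(1,2) N1(1,2) by (metis IntI open_Int)
    define t1 :: complex where "t1 = of_real (e / 2)"
    have "t1 \<in> ball 0 e" "t1 \<noteq> 0" using e(1) by (simp_all add: t1_def)
    then have t1: "t1 \<in> N0" "t1 \<in> N1" "t1 \<in> ball 0 1 - {0}"
      using e(2) N0(3) by blast+
    note ht1 = Ft_ht [OF t1(3)]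
    have int1: "Ft t1 (b + 1) \<inter> Wb = {0}"
      using ht_pairD(6) [OF ht1, of "b + 1"] by (simp add: Wb_def)
    have sum1: "{x + y | x y. x \<in> Ft t1 (b + 1) \<and> y \<in> Wb} = UNIV"
    proof -
      have "v \<in> {x + y | x y. x \<in> Ft t1 (b + 1) \<and> y \<in> Wb}" for v
      proof -
        obtain f where f: "f \<in> Ft t1 (b + 1)" "v - f \<in> Wb"
          using ht_pairD(7) [OF ht1, of "b + 1" v] by (auto simp: Wb_def)
        moreover have "v = f + (v - f)" by simp
        ultimately show ?thesis by blast
      qed
      then show ?thesis by blast
    qed
    have "vec.dim (Ft 0 (b + 1) \<inter> Wb) = vec.dim (Ft t1 (b + 1) \<inter> Wb)"
      using N1(2,4) t1(2) by simp
    then have int0: "Ft 0 (b + 1) \<inter> Wb \<subseteq> {0}" by (simp add: int1)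
    then have int0': "Ft 0 (b + 1) \<inter> Wb = {0}"
      using vec.subspace_0 [OF sub [OF N0(2)]] vec.subspace_0 [OF Wb] by blast
    have "vec.dim (Ft 0 (b + 1)) = vec.dim (Ft t1 (b + 1))"
      using bspec [OF N0(5) N0(2)] bspec [OF N0(5) t1(1)] by metis
    then have "vec.dim (UNIV :: (complex^'n) set) \<le> vec.dim {x + y | x y. x \<in> Ft 0 (b + 1) \<and> y \<in> Wb}"
      using vec.dim_sums_Int [OF sub [OF N0(2)] Wb, unfolded int0']
        vec.dim_sums_Int [OF sub [OF t1(1)] Wb, unfolded int1 sum1] by linarith
    then have sum0: "{x + y | x y. x \<in> Ft 0 (b + 1) \<and> y \<in> Wb} = UNIV"
      by (rule vec.subspace_dim_equal [OF vec.subspace_sums [OF sub [OF N0(2)] Wb] vec.subspace_UNIV subset_UNIV])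
    have ex: "\<exists>f\<in>Ft 0 (b + 1). v - f \<in> Wb" for v
    proof -
      have "v \<in> {x + y | x y. x \<in> Ft 0 (b + 1) \<and> y \<in> Wb}" unfolding sum0 ..
      then obtain x y where "v = x + y" "x \<in> Ft 0 (b + 1)" "y \<in> Wb" by blast
      then show ?thesis by (intro bexI [of _ x]) simp_all
    qed
    show ?thesis
      unfolding True by (rule is_proj_exists [OF sub [OF N0(2)] Wb int0' ex])
  qed
  then obtain Pt where Pt: "\<And>t. t \<in> N0 \<Longrightarrow> is_proj (Ft t (b + 1)) Wb (Pt t)" by metis
  have evN0: "\<forall>\<^sub>F t in at 0. t \<in> N0 \<and> t \<noteq> 0"
    using eventually_nhds_in_open [OF N0(1,2)] unfolding eventually_at_filter by (rule eventually_mono) simp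
  have lim: "(Pt \<longlongrightarrow> Pt 0) (at 0)"
  proof (rule proj_tendsto [where E = "\<lambda>t. Ft t (b + 1)" and W = Wb and b = \<beta> and d = d0])
    show "is_proj (Ft 0 (b + 1)) Wb (Pt 0)" by (rule Pt [OF N0(2)])
    show "Ft 0 (b + 1) \<subseteq> vec.span ((\<lambda>i. \<beta> i 0) ` {..<d0})" using N0(2,5) by simp
    show "\<forall>\<^sub>F t in at 0. is_proj (Ft t (b + 1)) Wb (Pt t) \<and> (\<forall>i<d0. \<beta> i t \<in> Ft t (b + 1))"
      using evN0
    proof eventually_elim
      case (elim t)
      then show ?case using Pt N0(5) by (auto intro!: vec.span_base)
    qed
    show "(\<beta> i \<longlongrightarrow> \<beta> i 0) (at 0)" if "i < d0" for i
    proof (rule vec_tendstoI)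
      fix r
      have "(\<lambda>t. \<beta> i t $ r) holomorphic_on N0"
        using N0(4) that unfolding disk_holo_on_def by blast
      then have "continuous_on N0 (\<lambda>t. \<beta> i t $ r)" by (rule holomorphic_on_imp_continuous_on)
      then have "isCont (\<lambda>t. \<beta> i t $ r) 0"
        using N0(1,2) by (simp add: continuous_on_eq_continuous_at)
      then show "((\<lambda>t. \<beta> i t $ r) \<longlongrightarrow> \<beta> i 0 $ r) (at 0)" by (simp add: isCont_def)
    qed
  qed
  have q_Pt: "q (upd s j t) b = C ** Pt t ** C'" if t: "t \<in> N0" "t \<noteq> 0" for t
  proof -
    have tb: "t \<in> ball 0 1 - {0}" using t N0(3) by blast
    have "is_proj ((*v) C ` Ft t (b + 1)) ((*v) C ` Wb) (C ** Pt t ** C')"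
      by (rule is_proj_transport [OF Pt [OF t(1)] CC(2,1)])
    then have "is_proj (Fs (upd s j t) (b + 1)) (W (2 * b)) (C ** Pt t ** C')"
      by (simp add: Fs_Ft [OF tb] CW Wb_def)
    then show ?thesis
      by (rule is_proj_unique [OF q_proj [OF off [OF tb]]])
  qed
  have "((\<lambda>t. C ** Pt t ** C') \<longlongrightarrow> C ** Pt 0 ** C') (at 0)"
    by (intro mm.tendsto tendsto_const lim)
  then have "((\<lambda>t. norm ((C ** Pt t ** C') $ i $ k)) \<longlongrightarrow> norm ((C ** Pt 0 ** C') $ i $ k)) (at 0)"
    by (intro tendsto_intros)
  then have "\<forall>\<^sub>F t in at 0. norm ((C ** Pt t ** C') $ i $ k) < norm ((C ** Pt 0 ** C') $ i $ k) + 1"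
    by (rule order_tendstoD) simp
  with evN0 have "\<forall>\<^sub>F t in at 0. cmod (q (upd s j t) b $ i $ k) \<le> norm ((C ** Pt 0 ** C') $ i $ k) + 1"
    by eventually_elim (simp add: q_Pt less_imp_le)
  then show ?thesis by blast
qed

end


section \<open>The extended Hodge filtration\<close>

text \<open>The dimension of \<open>F\<^sup>p\<close> is the codimension of \<open>W\<^sub>2\<^sub>p\<^sub>-\<^sub>2\<close>.\<close>

lemma ht_pair_dim:
  assumes F: "ht_pair F W" and F': "ht_pair F' W"
  shows "vec.dim (F p) = vec.dim (F' p)"
proof -
  have "vec.dim (UNIV :: (complex^'a) set) = vec.dim (G p) + vec.dim (W (2 * p - 2))" if G: "ht_pair G W" for G
  proof -
    have "{x + y | x y. x \<in> G p \<and> y \<in> W (2 * p - 2)} = UNIV"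
    proof -
      have "v \<in> {x + y | x y. x \<in> G p \<and> y \<in> W (2 * p - 2)}" for v
      proof -
        obtain f where f: "f \<in> G p" "v - f \<in> W (2 * p - 2)" using ht_pairD(7) [OF G] by blast
        moreover have "v = f + (v - f)" by simp
        ultimately show ?thesis by blast
      qed
      then show ?thesis by blast
    qed
    then show ?thesis
      using vec.dim_sums_Int [OF ht_pairD(4) [OF G, of p]
          increasing_filtration_subspace [OF ht_pairD(1) [OF G], of "2 * p - 2"]]
      unfolding ht_pairD(6) [OF G] by simp
  qed
  from this [OF F] this [OF F'] show ?thesis by simp
qed

lemma hol_mat_isCont: "hol_mat F x \<Longrightarrow> isCont F x"
  unfolding hol_mat_def isCont_def
  by (intro vec_tendstoI) (use hol_at_isCont in \<open>auto simp: isCont_def\<close>)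

lemma norm_mat_le: "norm (X :: complex^'n^'m) \<le> (\<Sum>i\<in>UNIV. \<Sum>k\<in>UNIV. cmod (X $ i $ k))"
proof -
  have "norm X \<le> (\<Sum>i\<in>UNIV. norm (X $ i))"
    unfolding norm_vec_def [of X] by (rule L2_set_le_sum) simp
  also have "\<dots> \<le> (\<Sum>i\<in>UNIV. \<Sum>k\<in>UNIV. cmod (X $ i $ k))"
    by (intro sum_mono) (simp add: norm_vec_def L2_set_le_sum)
  finally show ?thesis .
qed

lemma extended_identity:
  fixes f g :: "complex^'r \<Rightarrow> 'c::t2_space"
  assumes "\<And>s. s \<in> off_hyperplanes K \<Longrightarrow> f s = g s" and f: "isCont f s" and g: "isCont g s" and s: "s \<in> polydisk"
  shows "f s = g s"
proof -
  have "(\<lambda>n. f (pert K s n)) \<longlonglongrightarrow> f s" "(\<lambda>n. g (pert K s n)) \<longlonglongrightarrow> g s"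
    by (rule isCont_tendsto_compose [OF f pert_tendsto] isCont_tendsto_compose [OF g pert_tendsto])+
  then show ?thesis
    using assms(1) [OF pert_off_hyperplanes [OF s]] LIMSEQ_unique by simp
qed

context log_monodromy begin

lemma q_extension:
  obtains Q where "\<And>s b. s \<in> off_hyperplanes K \<Longrightarrow> Q s b = q s b"
    "\<And>s b. s \<in> polydisk \<Longrightarrow> hol_mat (\<lambda>s. Q s b) s"
    "\<And>\<rho> b. \<rho> < 1 \<Longrightarrow> \<exists>L\<ge>0. \<forall>s s'. (\<forall>i. cmod (s $ i) \<le> \<rho>) \<longrightarrow> (\<forall>i. cmod (s' $ i) \<le> \<rho>) \<longrightarrow>
        norm (Q s b - Q s' b) \<le> L * norm (s - s')"
proof -
  define ext where "ext f g \<longleftrightarrow> (\<forall>s \<in> off_hyperplanes K. g s = f s) \<and> (\<forall>s \<in> polydisk. hol_at g s) \<and>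
      (\<forall>\<rho><1. \<exists>L\<ge>0. \<forall>s s'. (\<forall>i. cmod (s $ i) \<le> \<rho>) \<longrightarrow> (\<forall>i. cmod (s' $ i) \<le> \<rho>) \<longrightarrow>
        cmod (g s - g s') \<le> L * norm (s - s'))" for f g :: "complex^'r \<Rightarrow> complex"
  have "\<exists>g. ext (\<lambda>s. q s b $ i $ k) g" for b i k
  proof -
    have 1: "hol_at (\<lambda>s. q s b $ i $ k) s" if "s \<in> off_hyperplanes K" for s
      using q_hol [OF that, of b] by (simp add: hol_mat_def)
    show ?thesis
      by (rule extension_across_hyperplanes [OF 1 q_bounded]) (auto simp: ext_def)
  qed
  then obtain G where G: "\<And>b i k. ext (\<lambda>s. q s b $ i $ k) (G b i k)" by metis
  define Q where "Q s b = (\<chi> i k. G b i k s)" for s b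
  show thesis
  proof (rule that [of Q])
    show "Q s b = q s b" if "s \<in> off_hyperplanes K" for s b
      using G that by (simp add: ext_def Q_def vec_eq_iff)
    show "hol_mat (\<lambda>s. Q s b) s" if "s \<in> polydisk" for s b
      using G that by (simp add: ext_def Q_def hol_mat_def)
    fix \<rho> :: real and b assume \<rho>: "\<rho> < 1"
    have "\<exists>L\<ge>0. \<forall>s s'. (\<forall>i. cmod (s $ i) \<le> \<rho>) \<longrightarrow> (\<forall>i. cmod (s' $ i) \<le> \<rho>) \<longrightarrow>
        cmod (G b i k s - G b i k s') \<le> L * norm (s - s')" for i k
      using G [of b i k] \<rho> unfolding ext_def by blast
    then obtain L where L: "\<And>i k. L i k \<ge> 0" "\<And>i k s s'. (\<forall>i. cmod (s $ i) \<le> \<rho>) \<Longrightarrow> (\<forall>i. cmod (s' $ i) \<le> \<rho>) \<Longrightarrow>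
        cmod (G b i k s - G b i k s') \<le> L i k * norm (s - s')"
      by metis
    have "norm (Q s b - Q s' b) \<le> (\<Sum>i\<in>UNIV. \<Sum>k\<in>UNIV. L i k) * norm (s - s')"
      if "\<forall>i. cmod (s $ i) \<le> \<rho>" "\<forall>i. cmod (s' $ i) \<le> \<rho>" for s s'
    proof -
      have "norm (Q s b - Q s' b) \<le> (\<Sum>i\<in>UNIV. \<Sum>k\<in>UNIV. cmod (G b i k s - G b i k s'))"
        using norm_mat_le [of "Q s b - Q s' b"] by (simp add: Q_def)
      also have "\<dots> \<le> (\<Sum>i\<in>UNIV. \<Sum>k\<in>UNIV. L i k * norm (s - s'))"
        by (intro sum_mono L that)
      finally show ?thesis by (simp add: sum_distrib_right)
    qed
    then show "\<exists>L\<ge>0. \<forall>s s'. (\<forall>i. cmod (s $ i) \<le> \<rho>) \<longrightarrow> (\<forall>i. cmod (s' $ i) \<le> \<rho>) \<longrightarrow>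
        norm (Q s b - Q s' b) \<le> L * norm (s - s')"
      by (intro exI [of _ "\<Sum>i\<in>UNIV. \<Sum>k\<in>UNIV. L i k"] conjI sum_nonneg L) auto
  qed
qed

text \<open>The holomorphic extension of \<open>q\<close> to the polydisk. The Lipschitz bound says that its derivative is
  bounded near the divisor, which is needed both for transversality and for the estimate of the height.\<close>

definition qe :: "complex^'r \<Rightarrow> int \<Rightarrow> complex^'n^'n" where
  "qe = (SOME Q. (\<forall>s b. s \<in> off_hyperplanes K \<longrightarrow> Q s b = q s b) \<and>
    (\<forall>s b. s \<in> polydisk \<longrightarrow> hol_mat (\<lambda>s. Q s b) s) \<and>
    (\<forall>\<rho> b. \<rho> < 1 \<longrightarrow> (\<exists>L\<ge>0. \<forall>s s'. (\<forall>i. cmod (s $ i) \<le> \<rho>) \<longrightarrow> (\<forall>i. cmod (s' $ i) \<le> \<rho>) \<longrightarrow>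
        norm (Q s b - Q s' b) \<le> L * norm (s - s'))))"

lemma
  shows qe_eq: "s \<in> off_hyperplanes K \<Longrightarrow> qe s b = q s b"
    and qe_hol: "s \<in> polydisk \<Longrightarrow> hol_mat (\<lambda>s. qe s b) s"
    and qe_lip: "\<rho> < 1 \<Longrightarrow> \<exists>L\<ge>0. \<forall>s s'. (\<forall>i. cmod (s $ i) \<le> \<rho>) \<longrightarrow> (\<forall>i. cmod (s' $ i) \<le> \<rho>) \<longrightarrow>
        norm (qe s b - qe s' b) \<le> L * norm (s - s')"
proof -
  define R where "R Q \<longleftrightarrow> (\<forall>s b. s \<in> off_hyperplanes K \<longrightarrow> Q s b = q s b) \<and>
    (\<forall>s b. s \<in> polydisk \<longrightarrow> hol_mat (\<lambda>s. Q s b) s) \<and>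
    (\<forall>\<rho> b. \<rho> < 1 \<longrightarrow> (\<exists>L\<ge>0. \<forall>s s'. (\<forall>i. cmod (s $ i) \<le> \<rho>) \<longrightarrow> (\<forall>i. cmod (s' $ i) \<le> \<rho>) \<longrightarrow>
        norm (Q s b - Q s' b) \<le> L * norm (s - s')))" for Q
  have "\<exists>Q. R Q"
  proof (rule q_extension)
    fix Q :: "complex^'r \<Rightarrow> int \<Rightarrow> complex^'n^'n"
    assume "\<And>s b. s \<in> off_hyperplanes K \<Longrightarrow> Q s b = q s b" "\<And>s b. s \<in> polydisk \<Longrightarrow> hol_mat (\<lambda>s. Q s b) s"
      "\<And>\<rho> b. \<rho> < 1 \<Longrightarrow> \<exists>L\<ge>0. \<forall>s s'. (\<forall>i. cmod (s $ i) \<le> \<rho>) \<longrightarrow> (\<forall>i. cmod (s' $ i) \<le> \<rho>) \<longrightarrow>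
        norm (Q s b - Q s' b) \<le> L * norm (s - s')"
    then have "R Q" unfolding R_def by blast
    then show "\<exists>Q. R Q" by (rule exI [of R])
  qed
  then have R: "R (SOME Q. R Q)" by (rule someI_ex)
  have qe: "qe = (SOME Q. R Q)" unfolding qe_def R_def ..
  from R [folded qe, unfolded R_def]
  show "s \<in> off_hyperplanes K \<Longrightarrow> qe s b = q s b" "s \<in> polydisk \<Longrightarrow> hol_mat (\<lambda>s. qe s b) s"
    "\<rho> < 1 \<Longrightarrow> \<exists>L\<ge>0. \<forall>s s'. (\<forall>i. cmod (s $ i) \<le> \<rho>) \<longrightarrow> (\<forall>i. cmod (s' $ i) \<le> \<rho>) \<longrightarrow>
        norm (qe s b - qe s' b) \<le> L * norm (s - s')"
    by blast+
qed

lemma qe_isCont: "s \<in> polydisk \<Longrightarrow> isCont (\<lambda>s. qe s b) s"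
  by (rule hol_mat_isCont [OF qe_hol])

lemma qe_mult:
  assumes s: "s \<in> polydisk" and b: "b \<le> b'" shows "qe s b ** qe s b' = qe s b"
proof (rule extended_identity [where K = K])
  show "isCont (\<lambda>s. qe s b ** qe s b') s" "isCont (\<lambda>s. qe s b) s"
    by (intro mm.isCont qe_isCont s)+
  fix s assume s: "s \<in> off_hyperplanes K"
  show "qe s b ** qe s b' = qe s b"
    using hodge_proj_splitting [OF ht_Fs [OF s] q [OF s]] b unfolding splitting_def qe_eq [OF s] by blast
qed (rule s)

lemma qe_range:
  assumes s: "s \<in> polydisk" shows "qe s b *v v \<in> W (2 * b)" "v \<in> W (2 * b) \<Longrightarrow> qe s b *v v = v"
proof -
  \<comment> \<open>A projection onto \<open>W\<^sub>2\<^sub>b\<close> that does not vary with \<open>s\<close> turns the conditions on the range into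
     identities between matrices, which extend to the polydisk.\<close>
  define s0 where "s0 = cover_map K base"
  have s0: "s0 \<in> off_hyperplanes K" unfolding s0_def by (rule cover_map_off [OF base])
  note q0 = q_proj [OF s0, of b]
  have off: "qe s b ** q s0 b = q s0 b \<and> q s0 b ** qe s b = qe s b" if s: "s \<in> off_hyperplanes K" for s
  proof -
    note qs = q_proj [OF s, of b]
    show ?thesis
      using is_projD(1,3) [OF qs] is_projD(1,3) [OF q0]
      by (simp add: qe_eq [OF s] matrix_eq flip: matrix_vector_mul_assoc)
  qed
  have 1: "qe s b ** q s0 b = q s0 b"
    by (rule extended_identity [where K = K, OF _ mm.isCont [OF qe_isCont [OF s] continuous_const] continuous_const s])
      (use off in blast)
  have 2: "q s0 b ** qe s b = qe s b"
    by (rule extended_identity [where K = K, OF _ mm.isCont [OF continuous_const qe_isCont [OF s]] qe_isCont [OF s] s])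
      (use off in blast)
  have "qe s b *v v = q s0 b *v (qe s b *v v)" by (simp add: matrix_vector_mul_assoc 2)
  then show "qe s b *v v \<in> W (2 * b)" using is_projD(1) [OF q0] by metis
  assume "v \<in> W (2 * b)"
  then have "v = q s0 b *v v" using is_projD(3) [OF q0] by simp
  then show "qe s b *v v = v" by (metis 1 matrix_vector_mul_assoc)
qed

definition Fe :: "complex^'r \<Rightarrow> int \<Rightarrow> (complex^'n) set" where
  "Fe s e = {v. qe s (e - 1) *v v = 0}"

lemma Fe_diff: "s \<in> polydisk \<Longrightarrow> v - qe s (e - 1) *v v \<in> Fe s e"
  using qe_mult [of s "e - 1" "e - 1"]
  by (simp add: Fe_def mv.diff_right matrix_vector_mul_assoc)

lemma Fe_ht: assumes s: "s \<in> polydisk" shows "ht_pair (Fe s) W"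
  unfolding ht_pair_def
proof (intro conjI allI ballI impI)
  show "vec.subspace (Fe s e)" for e
    by (auto simp: vec.subspace_def Fe_def mv.add_right mv.zero_right matrix_mult_scale_vec)
  show "antimono (Fe s)"
  proof (rule antimonoI, rule subsetI)
    fix e e' :: int and v assume e: "e \<le> e'" and v: "v \<in> Fe s e'"
    have "qe s (e - 1) *v v = qe s (e - 1) *v (qe s (e' - 1) *v v)"
      using qe_mult [OF s, of "e - 1" "e' - 1"] e by (simp add: matrix_vector_mul_assoc)
    then show "v \<in> Fe s e" using v by (simp add: Fe_def mv.zero_right)
  qed
  show "Fe s e \<inter> W (2 * e - 2) = {0}" for e
  proof -
    have "v = 0" if "v \<in> Fe s e" "v \<in> W (2 * e - 2)" for v
      using qe_range(2) [OF s, of v "e - 1"] that by (simp add: Fe_def algebra_simps)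
    moreover have "0 \<in> W (2 * e - 2)" by (rule vec.subspace_0 [OF increasing_filtration_subspace [OF W_incr]])
    ultimately show ?thesis by (auto simp: Fe_def mv.zero_right)
  qed
  show "\<exists>f\<in>Fe s e. v - f \<in> W (2 * e - 2)" for e v
    using qe_range(1) [OF s, of "e - 1" v]
    by (intro bexI [OF _ Fe_diff [OF s, of v e]]) (simp add: algebra_simps)
qed (use W_incr W_real W_odd in blast)+

lemma Fe_proj: assumes s: "s \<in> polydisk" shows "hodge_proj (Fe s) W (qe s)"
  unfolding hodge_proj_def is_proj_def
  using qe_range [OF s] Fe_diff [OF s, of _ "b + 1" for b] by (auto simp: Fe_def)

lemma Fe_eq: "s \<in> off_hyperplanes K \<Longrightarrow> Fe s e = Fs s e"
  using hodge_proj_filtration [OF ht_Fs q] by (auto simp: Fe_def qe_eq)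

text \<open>Both \<open>F\<^sup>e\<close> at \<open>0\<close> and \<open>F\<^sup>e\<close> at \<open>s\<close> are complementary to \<open>W\<^sub>2\<^sub>e\<^sub>-\<^sub>2\<close>, so the projection with kernel
  \<open>W\<^sub>2\<^sub>e\<^sub>-\<^sub>2\<close> maps the first isomorphically onto the second. The image of a basis is a frame on the whole
  polydisk.\<close>

lemma Fe_frame:
  obtains d and \<beta> :: "nat \<Rightarrow> complex^'r \<Rightarrow> complex^'n"
  where "\<And>i. holo_on (\<beta> i) polydisk"
    "\<And>s. s \<in> polydisk \<Longrightarrow> vec.dim (Fe s e) = d \<and> Fe s e = vec.span ((\<lambda>i. \<beta> i s) ` {..<d})"
proof -
  have 0: "0 \<in> (polydisk :: (complex^'r) set)" by (simp add: polydisk_def)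
  obtain B where B: "B \<subseteq> Fe 0 e" "vec.independent B" "Fe 0 e \<subseteq> vec.span B" "card B = vec.dim (Fe 0 e)"
    using vec.basis_exists by metis
  have fin: "finite B" using B(2) by (rule vec.finiteI_independent)
  have span: "vec.span B = Fe 0 e"
    using B(1,3) by (intro antisym vec.span_minimal ht_pairD(4) [OF Fe_ht [OF 0]])
  obtain h where h: "bij_betw h {0..<card B} B" using ex_bij_betw_nat_finite [OF fin] by blast
  define R where "R s = mat 1 - qe s (e - 1)" for s
  have R: "R s *v v = v - qe s (e - 1) *v v" for s v by (simp add: R_def mv.diff_left)
  show thesis
  proof (rule that [of "\<lambda>i s. R s *v h i" "card B"])
    show "holo_on (\<lambda>s. R s *v h i) polydisk" for i
      unfolding holo_on_iff R_def
      by (intro ballI allI hol_mat_vec hol_mat_diff hol_mat_const qe_hol hol_at_const)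
    fix s :: "complex^'r" assume s: "s \<in> polydisk"
    have "vec.span ((\<lambda>i. R s *v h i) ` {..<card B}) = (*v) (R s) ` vec.span (h ` {..<card B})"
      by (simp add: image_image flip: vec.span_image)
    also have "h ` {..<card B} = B" using h by (simp add: bij_betw_def atLeast0LessThan)
    also have "(*v) (R s) ` vec.span B = Fe s e"
    proof (intro equalityI subsetI)
      fix v assume "v \<in> (*v) (R s) ` vec.span B"
      then show "v \<in> Fe s e" using Fe_diff [OF s] by (auto simp: R)
    next
      fix v assume v: "v \<in> Fe s e"
      obtain f where f: "f \<in> Fe 0 e" "v - f \<in> W (2 * e - 2)" using ht_pairD(7) [OF Fe_ht [OF 0]] by blast
      have "qe s (e - 1) *v (v - f) = v - f" using f(2) by (intro qe_range [OF s]) (simp add: algebra_simps)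
      then have "v = R s *v f" using v by (simp add: R Fe_def mv.diff_right algebra_simps)
      then show "v \<in> (*v) (R s) ` vec.span B" using f(1) span by blast
    qed
    finally show "vec.dim (Fe s e) = card B \<and> Fe s e = vec.span ((\<lambda>i. R s *v h i) ` {..<card B})"
      using ht_pair_dim [OF Fe_ht [OF s] Fe_ht [OF 0]] B(4) by simp
  qed
qed

lemma Fe_subbundle: "holo_subbundle holo_on polydisk (\<lambda>s. Fe s e)"
  unfolding holo_subbundle_def
  by (rule ballI, rule Fe_frame [of e]) (use open_polydisk in blast)

end


section \<open>Transversality along the divisor\<close>

text \<open>Transversality refers to the charts of the atlas; by the chain rule it holds in every
  holomorphic chart.\<close>

lemma griffiths_chart:
  fixes G :: "complex^'r \<Rightarrow> complex^'n" and V :: "('m::t2_space, 'n::finite) variation"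
  assumes gt: "griffiths_transversal atlas V" and mfd: "complex_manifold atlas" and c: "holo_chart atlas P \<psi>"
    and fr: "(U, \<phi>) \<in> frames V" and Ob: "open Ob" "Ob \<subseteq> \<psi> ` P" "\<And>s. s \<in> Ob \<Longrightarrow> inv_into P \<psi> s \<in> U"
    and hol: "\<And>s i. s \<in> Ob \<Longrightarrow> hol_at (\<lambda>s. G s $ i) s"
    and G: "\<And>s. s \<in> Ob \<Longrightarrow> G s \<in> (*v) (\<phi> (inv_into P \<psi> s)) ` hodge V (inv_into P \<psi> s) e"
    and s0: "s0 \<in> Ob" and D: "((\<lambda>t. G (upd s0 j t)) has_derivative G') (at (s0 $ j))"
  shows "G' h \<in> (*v) (\<phi> (inv_into P \<psi> s0)) ` hodge V (inv_into P \<psi> s0) (e - 1)"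
proof -
  define N where "N = P \<inter> \<psi> -` Ob"
  define \<beta> where "\<beta> x = G (\<psi> x)" for x
  define y where "y = inv_into P \<psi> s0"
  have y: "y \<in> P" "\<psi> y = s0"
    using s0 Ob(2) inv_into_into [of s0 \<psi> P] f_inv_into_f [of s0 \<psi> P] by (auto simp: y_def)
  have inv: "inv_into P \<psi> (\<psi> x) = x" if "x \<in> P" for x by (rule holo_chartD(5) [OF c that])
  have N: "open N" "y \<in> N" "N \<subseteq> U"
  proof -
    show "open N"
      unfolding N_def using holo_chartD(1,3) [OF c] Ob(1) by (metis continuous_on_open_vimage inf_commute)
    show "y \<in> N" using y s0 by (simp add: N_def)
    show "N \<subseteq> U" using Ob(3) inv by (force simp: N_def)
  qed
  have \<beta>: "mfd_holo_on atlas \<beta> N"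
    unfolding mfd_holo_on_def
  proof
    fix ch assume "ch \<in> atlas"
    moreover obtain U' \<psi>' where ch: "ch = (U', \<psi>')" by fastforce
    ultimately have U': "(U', \<psi>') \<in> atlas" by simp
    have c': "holo_chart atlas U' \<psi>'" using bspec [OF mfd [unfolded complex_manifold_def, THEN conjunct1] U'] by simp
    have "hol_at (\<lambda>s. \<beta> (inv_into U' \<psi>' s) $ i) s" if "s \<in> \<psi>' ` (N \<inter> U')" for s i
    proof -
      obtain x where x: "x \<in> N" "x \<in> U'" "s = \<psi>' x" using \<open>s \<in> \<psi>' ` (N \<inter> U')\<close> by blast
      then have "inv_into U' \<psi>' s = x" by (simp add: holo_chartD(5) [OF c'])
      then show ?thesis
        unfolding \<beta>_def using x
        by (intro hol_at_compose_holo [OF _ holo_chartD(7) [OF c U']] hol) (auto simp: N_def)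
    qed
    then show "case ch of (U, \<psi>) \<Rightarrow> holo_on (\<lambda>s. \<beta> (inv_into U \<psi> s)) (\<psi> ` (N \<inter> U))"
      by (simp add: ch holo_on_iff)
  qed
  have mem: "\<forall>x\<in>N. \<beta> x \<in> (*v) (\<phi> x) ` hodge V x e"
  proof
    fix x assume "x \<in> N"
    then show "\<beta> x \<in> (*v) (\<phi> x) ` hodge V x e"
      using G [of "\<psi> x"] inv [of x] by (simp add: N_def \<beta>_def)
  qed
  have "y \<in> (\<Union>(U, \<psi>) \<in> atlas. U)"
    unfolding mfd [unfolded complex_manifold_def, THEN conjunct2] ..
  then obtain U' \<psi>' where U': "(U', \<psi>') \<in> atlas" "y \<in> U'" by blast
  have c': "holo_chart atlas U' \<psi>'" using bspec [OF mfd [unfolded complex_manifold_def, THEN conjunct1] U'(1)] by simp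
  have "holo_on (\<lambda>s. \<beta> (inv_into U' \<psi>' s)) (\<psi>' ` (N \<inter> U'))"
    using bspec [OF \<beta> [unfolded mfd_holo_on_def] U'(1)] by simp
  then obtain L where L: "((\<lambda>s. \<beta> (inv_into U' \<psi>' s)) has_derivative (\<lambda>h. L *v h)) (at (\<psi>' y))"
    unfolding holo_on_def using N(2) U'(2) by blast
  have gr: "L *v h \<in> (*v) (\<phi> y) ` hodge V y (e - 1)" for h
  proof -
    have "\<forall>(U', \<psi>) \<in> atlas. \<forall>y \<in> N \<inter> U'. \<forall>L :: complex^'r^'n.
        ((\<lambda>s. \<beta> (inv_into U' \<psi> s)) has_derivative (\<lambda>h. L *v h)) (at (\<psi> y)) \<longrightarrow>
        (\<forall>h. L *v h \<in> (*v) (\<phi> y) ` hodge V y (e - 1))"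
      using bspec [OF gt [unfolded griffiths_transversal_def] fr, simplified, rule_format, of N \<beta> e] N \<beta> mem by blast
    from bspec [OF this U'(1)] show ?thesis using N(2) U'(2) L by blast
  qed
  obtain L' where L': "((\<lambda>s. \<psi>' (inv_into P \<psi> s)) has_derivative (\<lambda>h. L' *v h)) (at s0)"
    using holo_chartD(6) [OF c U'(1)] y U'(2) unfolding holo_on_def by blast
  have "((\<lambda>s. \<beta> (inv_into U' \<psi>' (\<psi>' (inv_into P \<psi> s)))) has_derivative (\<lambda>h. L *v (L' *v h))) (at s0)"
    using L by (intro has_derivative_compose [OF L']) (simp add: y_def)
  then have "(G has_derivative (\<lambda>h. L *v (L' *v h))) (at s0)"
  proof (rule has_derivative_transform_within_open)
    show "open (Ob \<inter> \<psi> ` (P \<inter> U'))" "s0 \<in> Ob \<inter> \<psi> ` (P \<inter> U')"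
      using y U'(2) s0 by (auto intro!: open_Int Ob holo_chart_open_image [OF c holo_chartD(1) [OF c']])
    show "\<beta> (inv_into U' \<psi>' (\<psi>' (inv_into P \<psi> s))) = G s" if "s \<in> Ob \<inter> \<psi> ` (P \<inter> U')" for s
      using that by (auto simp: inv holo_chartD(5) [OF c'] \<beta>_def)
  qed
  then have "((\<lambda>t. G (upd s0 j t)) has_derivative (\<lambda>h. L *v (L' *v axis j h))) (at (s0 $ j))"
    by (intro has_derivative_compose [where g = G and g' = "\<lambda>h. L *v (L' *v h)", OF upd_has_derivative]) simp
  from has_derivative_unique [OF D this] have "G' h = L *v (L' *v axis j h)" by (rule fun_cong)
  then show ?thesis using gr unfolding y_def by simp
qed

lemma has_derivative_lipschitz:
  assumes f: "(f has_derivative f') (at x)" and L: "\<forall>\<^sub>F y in nhds x. norm (f y - f x) \<le> L * norm (y - x)"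
  shows "norm (f' h) \<le> L * norm h"
proof (rule field_le_epsilon)
  interpret bounded_linear f' by (rule has_derivative_bounded_linear [OF f])
  fix e :: real assume e: "0 < e"
  define e' where "e' = e / (norm h + 1)"
  have e': "0 < e'" "e' * norm h \<le> e"
  proof -
    show "0 < e'" using e by (simp add: e'_def add_nonneg_pos)
    have "e' * norm h \<le> e' * (norm h + 1)" using \<open>0 < e'\<close> by (intro mult_left_mono) auto
    also have "\<dots> = e" using norm_ge_zero [of h] unfolding e'_def by (smt (verit) nonzero_eq_divide_eq)
    finally show "e' * norm h \<le> e" .
  qed
  obtain d where d: "0 < d" "\<And>y. norm (y - x) < d \<Longrightarrow> norm (f y - f x - f' (y - x)) \<le> e' * norm (y - x)"
    using f e' unfolding has_derivative_at_alt by blast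
  obtain d' where d': "0 < d'" "\<And>y. dist y x < d' \<Longrightarrow> norm (f y - f x) \<le> L * norm (y - x)"
    using L unfolding eventually_nhds_metric by blast
  define k where "k = norm h + 1"
  have k: "0 < k" using norm_ge_zero [of h] unfolding k_def by linarith
  define r where "r = min d d' / (2 * k)"
  have r: "0 < r" using d d' k by (simp add: r_def)
  have small: "norm (r *\<^sub>R h) < min d d'"
  proof -
    have "norm (r *\<^sub>R h) \<le> r * k" using r by (simp add: k_def)
    also have "\<dots> = min d d' / 2" using k by (simp add: r_def)
    also have "\<dots> < min d d'" using d(1) d'(1) by (simp add: min_def)
    finally show ?thesis .
  qed
  have "norm (f (x + r *\<^sub>R h) - f x - f' (r *\<^sub>R h)) \<le> e' * norm (r *\<^sub>R h)"
    using d(2) [of "x + r *\<^sub>R h"] small by simp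
  moreover have "norm (f (x + r *\<^sub>R h) - f x) \<le> L * norm (r *\<^sub>R h)"
    using d'(2) [of "x + r *\<^sub>R h"] small by (simp add: dist_norm)
  moreover have "norm (f' (r *\<^sub>R h)) \<le> norm (f (x + r *\<^sub>R h) - f x) + norm (f (x + r *\<^sub>R h) - f x - f' (r *\<^sub>R h))"
    using norm_triangle_ineq4 [of "f (x + r *\<^sub>R h) - f x" "f (x + r *\<^sub>R h) - f x - f' (r *\<^sub>R h)"] by simp
  ultimately have "norm (f' (r *\<^sub>R h)) \<le> (L + e') * norm (r *\<^sub>R h)"
    by (simp add: distrib_right)
  then have "r * norm (f' h) \<le> r * ((L + e') * norm h)" using r by (simp add: scaleR mult_ac)
  then have "norm (f' h) \<le> (L + e') * norm h" using r by simp
  also have "\<dots> \<le> L * norm h + e" using e'(2) by (simp add: distrib_right)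
  finally show "norm (f' h) \<le> L * norm h + e" .
qed

lemma mat_exp_has_derivative:
  assumes N: "mat_pow N m = 0" and \<tau>: "(\<tau> has_field_derivative \<tau>') (at t)" "\<tau> t = 0"
  shows "((\<lambda>t. mat_exp (scale_mat (\<tau> t) N)) has_derivative (\<lambda>h. scale_mat (h * \<tau>') N)) (at t)"
proof -
  have N2: "mat_pow N (m + 2) = 0" by (rule mat_pow_eq_0 [OF N]) simp
  define T where "T k x = scale_mat (x ^ k / fact k) (mat_pow N k)" for k x
  have exp: "mat_exp (scale_mat x N) = (\<Sum>k<m + 2. T k x)" for x
  proof -
    have "mat_pow (scale_mat x N) (m + 2) = 0" by (simp only: mat_pow_scale N2 sm.zero_right)
    from mat_exp_nilpotent [OF this] show ?thesis
      by (simp add: T_def mat_pow_scale scale_mat_scale flip: scale_mat_of_real)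
  qed
  have "((\<lambda>t. T k (\<tau> t)) has_derivative (\<lambda>h. if k = 1 then scale_mat (h * \<tau>') N else 0)) (at t)" for k
  proof -
    have "((\<lambda>t. \<tau> t ^ k / fact k) has_field_derivative (of_nat k * \<tau> t ^ (k - 1) * \<tau>' / fact k)) (at t)"
      by (auto intro!: derivative_eq_intros \<tau>(1))
    then have "((\<lambda>t. T k (\<tau> t)) has_derivative
        (\<lambda>h. scale_mat (of_nat k * \<tau> t ^ (k - 1) * \<tau>' / fact k * h) (mat_pow N k))) (at t)"
      unfolding T_def has_field_derivative_def by (rule bounded_linear.has_derivative [OF sm.bounded_linear_left])
    moreover have "scale_mat (of_nat k * \<tau> t ^ (k - 1) * \<tau>' / fact k * h) (mat_pow N k)
        = (if k = 1 then scale_mat (h * \<tau>') N else 0)" for h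
    proof (cases "k = 0 \<or> k = 1")
      case False
      then show ?thesis by (simp add: \<tau>(2) power_0_left sm.zero_left)
    qed (auto simp: sm.zero_left mult.commute)
    ultimately show ?thesis by simp
  qed
  then have "((\<lambda>t. \<Sum>k<m + 2. T k (\<tau> t)) has_derivative
      (\<lambda>h. \<Sum>k<m + 2. if k = 1 then scale_mat (h * \<tau>') N else 0)) (at t)"
    by (rule has_derivative_sum)
  moreover have "(\<Sum>k<m + 2. if k = 1 then Z else 0) = Z" for Z :: "complex^'a^'a"
    by (subst sum.delta) auto
  ultimately show ?thesis by (simp only: exp)
qed

context log_monodromy begin

text \<open>Let \<open>f(s) = v - P(s) v\<close>, a section of \<open>F\<^sup>b\<^sup>+\<^sup>1\<close> in the single-valued trivialization. In a flat frame
  it is \<open>exp (\<Sum> z\<^sub>j N\<^sub>j) f(s)\<close>, and as \<open>z\<^sub>j = log s\<^sub>j / 2\<pi>\<i>\<close> its derivative in direction \<open>s\<^sub>j\<close> is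
  \<open>exp (\<Sum> z\<^sub>j N\<^sub>j) (N\<^sub>j f / (2\<pi>\<i> s\<^sub>j) + \<partial>\<^sub>j f)\<close>. By transversality this lies in \<open>F\<^sup>b\<close>. Multiplication by
  \<open>s\<^sub>j\<close> leaves \<open>\<partial>\<^sub>j f\<close> with a factor which vanishes on the divisor.\<close>

lemma transversality_off:
  assumes s0: "s0 \<in> off_hyperplanes K" and j: "j \<in> K"
    and L: "\<forall>\<^sub>F t in nhds (s0 $ j). norm (qe (upd s0 j t) b *v v - qe s0 b *v v) \<le> L * norm (t - s0 $ j)"
  shows "\<exists>w. norm w \<le> 2 * pi * L \<and>
    qe s0 (b - 1) *v (N j *v (v - qe s0 b *v v)) = s0 $ j *s (qe s0 (b - 1) *v w)"
proof -
  obtain z0 where z0: "z0 \<in> cover_dom K" "cover_map K z0 = s0" using zof [OF s0] by blast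
  obtain Ob zl U \<phi> M M' where lift: "open Ob" "cover_map K z0 \<in> Ob" "Ob \<subseteq> off_hyperplanes K"
    and U: "(U, \<phi>) \<in> frames V" "open U" "M ** M' = mat 1" "M' ** M = mat 1" "zl (cover_map K z0) = z0"
    and zl: "\<And>s. s \<in> Ob \<Longrightarrow> zl s \<in> cover_dom K \<and> cover_map K (zl s) = s \<and> c (zl s) = inv_into P \<psi> s \<and>
      inv_into P \<psi> s \<in> U \<and> \<Phi> (zl s) = M ** \<phi> (inv_into P \<psi> s)"
    and zl_hol: "\<And>s i. s \<in> Ob \<Longrightarrow> hol_at (\<lambda>s. zl s $ i) s"
    and zl_upd: "\<And>j t. j \<in> K \<Longrightarrow> zl (upd (cover_map K z0) j t)
      = z0 + axis j (Ln (t / cover_map K z0 $ j) / (2 * of_real pi * \<i>))"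
    by (rule local_lift [OF z0(1)]) blast
  note Ob = lift [unfolded z0(2)]
  define t0 where "t0 = s0 $ j"
  have t0: "t0 \<noteq> 0" using s0 j by (auto simp: t0_def off_hyperplanes_def)
  have poly: "s \<in> polydisk" if "s \<in> Ob" for s using that Ob(3) off_hyperplanes_polydisk by blast
  define y0 where "y0 = inv_into P \<psi> s0"
  define f where "f t = v - qe (upd s0 j t) b *v v" for t
  define \<tau> where "\<tau> t = Ln (t / t0) / (2 * of_real pi * \<i>)" for t
  define \<tau>' where "\<tau>' = 1 / (2 * of_real pi * \<i> * t0)"
  define G where "G s = (M' ** E (zl s)) *v (v - qe s b *v v)" for s
  have Fs_mem: "v \<in> Fs s q \<longleftrightarrow> (M' ** E (zl s)) *v v \<in> (*v) (\<phi> (inv_into P \<psi> s)) ` hodge V (inv_into P \<psi> s) q"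
    if s: "s \<in> Ob" for s q v
  proof -
    define y where "y = inv_into P \<psi> s"
    note z = zl [OF s]
    have "Fs s q = (*v) (\<Theta> (zl s)) ` hodge V y q" using Fs_eq [of "zl s" q] z by (simp add: y_def)
    also have "\<Theta> (zl s) = (Ei (zl s) ** M) ** \<phi> y" using z by (simp add: \<Theta>_def y_def matrix_mul_assoc)
    also have "(*v) ((Ei (zl s) ** M) ** \<phi> y) ` hodge V y q = (*v) (Ei (zl s) ** M) ` (*v) (\<phi> y) ` hodge V y q"
      by (simp add: image_image matrix_vector_mul_assoc)
    finally have *: "Fs s q = (*v) (Ei (zl s) ** M) ` (*v) (\<phi> y) ` hodge V y q" .
    have "(Ei (zl s) ** M) ** (M' ** E (zl s)) = Ei (zl s) ** (M ** M') ** E (zl s)"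
      "(M' ** E (zl s)) ** (Ei (zl s) ** M) = M' ** (E (zl s) ** Ei (zl s)) ** M"
      by (simp_all only: matrix_mul_assoc)
    then have "(Ei (zl s) ** M) ** (M' ** E (zl s)) = mat 1" "(M' ** E (zl s)) ** (Ei (zl s) ** M) = mat 1"
      by (simp_all add: U E_inverse)
    from mem_image_inverse [OF this, of v "(*v) (\<phi> y) ` hodge V y q"] show ?thesis unfolding * y_def .
  qed
  have hol: "hol_at (\<lambda>s. G s $ i) s" if s: "s \<in> Ob" for s i
    unfolding G_def
  proof (rule hol_mat_vec)
    have "hol_mat (\<lambda>s. X (zl s)) s"
      unfolding X_def by (intro hol_mat_sum hol_mat_scale hol_mat_const zl_hol s)
    then show "hol_mat (\<lambda>s. M' ** E (zl s)) s"
      by (intro hol_mat_mult hol_mat_const hol_mat_exp [where m = m] nil [OF X_lowers(1)])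
    show "hol_at (\<lambda>s. (v - qe s b *v v) $ i) s" for i
      by (simp, intro hol_at_diff hol_at_const hol_mat_vec qe_hol poly s)
  qed
  have mem: "G s \<in> (*v) (\<phi> (inv_into P \<psi> s)) ` hodge V (inv_into P \<psi> s) (b + 1)" if s: "s \<in> Ob" for s
  proof -
    have "v - qe s b *v v \<in> Fs s (b + 1)"
      using Fe_diff [OF poly [OF s], of v "b + 1"] Fe_eq [of s "b + 1"] s Ob(3) by auto
    then show ?thesis unfolding G_def using Fs_mem [OF s] by blast
  qed
  obtain f' where f': "(f has_derivative f') (at t0)"
  proof -
    have "holo_on (\<lambda>s. v - qe s b *v v) polydisk"
      unfolding holo_on_iff
      by (intro ballI allI, simp, intro hol_at_diff hol_at_const hol_mat_vec qe_hol)
    then obtain L where "((\<lambda>s. v - qe s b *v v) has_derivative (\<lambda>h. L *v h)) (at s0)"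
      unfolding holo_on_def using poly [OF Ob(2)] by blast
    then have "((\<lambda>t. v - qe (upd s0 j t) b *v v) has_derivative (\<lambda>h. L *v axis j h)) (at t0)"
      by (intro has_derivative_compose [where g = "\<lambda>s. v - qe s b *v v" and g' = "\<lambda>h. L *v h", OF upd_has_derivative])
        (simp add: t0_def)
    then show thesis using that [of "\<lambda>h. L *v axis j h"] unfolding f_def [abs_def] by blast
  qed
  have \<tau>: "(\<tau> has_field_derivative \<tau>') (at t0)" "\<tau> t0 = 0"
    unfolding \<tau>_def \<tau>'_def using t0 by (auto intro!: derivative_eq_intros)
  have G_upd: "G (upd s0 j t) = (M' ** E z0) *v (mat_exp (scale_mat (\<tau> t) (N j)) *v f t)" for t
    using zl_upd [OF j, of t] by (simp add: z0(2) G_def f_def \<tau>_def t0_def E_add_axis(2) [OF j] matrix_vector_mul_assoc matrix_mul_assoc)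
  have exp0: "mat_exp (scale_mat (\<tau> t0) (N j)) = mat 1" by (simp add: \<tau>(2) sm.zero_left)
  have "((\<lambda>t. mat_exp (scale_mat (\<tau> t) (N j)) *v f t) has_derivative
      (\<lambda>h. mat_exp (scale_mat (\<tau> t0) (N j)) *v f' h + scale_mat (h * \<tau>') (N j) *v f t0)) (at t0)"
    by (rule mv.FDERIV [OF mat_exp_has_derivative [OF nil [OF N(1) [OF j]] \<tau>] f'])
  then have "((\<lambda>t. G (upd s0 j t)) has_derivative
      (\<lambda>h. (M' ** E z0) *v (f' h + scale_mat (h * \<tau>') (N j) *v f t0))) (at t0)"
    unfolding G_upd exp0 matrix_vector_mul_lid
    by (rule bounded_linear.has_derivative [OF mv.bounded_linear_right])
  from griffiths_chart [OF griffiths mfd chart U(1) Ob(1) _ _ hol mem Ob(2) this [unfolded t0_def], of 1]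
  have "(M' ** E (zl s0)) *v (f' 1 + \<tau>' *s (N j *v f t0)) \<in> (*v) (\<phi> y0) ` hodge V y0 b"
    using poly zl U(5) by (auto simp: psi_P z0(2) y0_def t0_def scale_mat_vec)
  then have "f' 1 + \<tau>' *s (N j *v f t0) \<in> Fe s0 b"
    unfolding Fe_eq [OF s0] Fs_mem [OF Ob(2)] y0_def .
  then have "\<tau>' *s (qe s0 (b - 1) *v (N j *v f t0)) = - (qe s0 (b - 1) *v f' 1)"
    by (simp add: Fe_def mv.add_right matrix_mult_scale_vec eq_neg_iff_add_eq_0 add.commute)
  from arg_cong [OF this, of "\<lambda>x. (2 * of_real pi * \<i> * t0) *s x"]
  have "qe s0 (b - 1) *v (N j *v f t0) = t0 *s (qe s0 (b - 1) *v ((- (2 * of_real pi * \<i>)) *s f' 1))"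
    using t0 by (simp add: \<tau>'_def matrix_mult_scale_vec vector_smult_assoc mv.minus_right vec.scale_minus_right mult_ac)
  moreover have "norm ((- (2 * of_real pi * \<i>)) *s f' 1) \<le> 2 * pi * L"
  proof -
    have "norm (f' 1) \<le> L * norm (1 :: complex)"
    proof (rule has_derivative_lipschitz [OF f'])
      show "\<forall>\<^sub>F y in nhds t0. norm (f y - f t0) \<le> L * norm (y - t0)"
        using L unfolding t0_def f_def by eventually_elim (simp add: norm_minus_commute)
    qed
    moreover have "norm (r *s x) = cmod r * norm x" for r and x :: "complex^'n"
      by (simp add: norm_vec_def L2_set_def norm_mult power_mult_distrib real_sqrt_mult flip: sum_distrib_left)
    ultimately show ?thesis by (simp add: norm_mult)
  qed
  ultimately show ?thesis
    by (intro exI [of _ "(- (2 * of_real pi * \<i>)) *s f' 1"]) (simp add: f_def t0_def)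
qed

text \<open>The error term of \<open>transversality_off\<close> disappears in the limit since the derivative of the
  projections is bounded. As \<open>N\<^sub>j\<close> also lowers \<open>W\<close>, it then respects the kernels and the images of the
  projections.\<close>

lemma transversality:
  assumes s: "s \<in> polydisk" and j: "j \<in> K" "s $ j = 0"
  shows "qe s (b - 1) ** N j = N j ** qe s b"
proof -
  obtain \<rho> where \<rho>: "1/2 \<le> \<rho>" "0 < \<rho>" "\<rho> < 1" "\<forall>i. cmod (s $ i) \<le> \<rho>"
    using polydisk_radius [OF s, of "1/2"] by auto
  define \<sigma> where "\<sigma> = (1 + \<rho>) / 2"
  have \<sigma>: "\<rho> < \<sigma>" "\<sigma> < 1" using \<rho> by (simp_all add: \<sigma>_def)
  obtain L where L: "0 \<le> L" "\<And>s s'. (\<forall>i. cmod (s $ i) \<le> \<sigma>) \<Longrightarrow> (\<forall>i. cmod (s' $ i) \<le> \<sigma>) \<Longrightarrow>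
        norm (qe s b - qe s' b) \<le> L * norm (s - s')"
    using qe_lip [OF \<sigma>(2), of b] by blast
  define sn where "sn n = pert K s n" for n
  have sn: "sn n \<in> off_hyperplanes K" "\<forall>i. cmod (sn n $ i) \<le> \<rho>" for n
    unfolding sn_def using \<rho> by (auto intro!: pert_off_hyperplanes [OF s] pert_bounded)
  have lim: "sn \<longlonglongrightarrow> s" unfolding sn_def by (rule pert_tendsto)
  have qlim: "(\<lambda>n. qe (sn n) b) \<longlonglongrightarrow> qe s b" for b
    by (rule isCont_tendsto_compose [OF qe_isCont [OF s] lim])
  obtain C where C: "0 < C" "\<And>(A :: complex^'n^'n) v. norm (A *v v) \<le> norm A * norm v * C"
    using mv.pos_bounded by blast
  have "qe s (b - 1) *v (N j *v (v - qe s b *v v)) = 0" for v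
  proof -
    define L' where "L' = L * norm v * C"
    have "\<exists>w. norm w \<le> 2 * pi * L' \<and>
      qe (sn n) (b - 1) *v (N j *v (v - qe (sn n) b *v v)) = sn n $ j *s (qe (sn n) (b - 1) *v w)" for n
    proof (rule transversality_off [OF sn(1) j(1)])
      have "\<forall>\<^sub>F t in nhds (sn n $ j). t \<in> ball 0 \<sigma>"
        using sn(2) [of n] \<sigma>(1) by (intro eventually_nhds_in_open) (auto intro: le_less_trans)
      then show "\<forall>\<^sub>F t in nhds (sn n $ j). norm (qe (upd (sn n) j t) b *v v - qe (sn n) b *v v) \<le> L' * norm (t - sn n $ j)"
      proof eventually_elim
        case (elim t)
        have "\<forall>i. cmod (sn n $ i) \<le> \<sigma>" using sn(2) [of n] \<sigma>(1) by (meson less_imp_le order_trans)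
        moreover from this have "\<forall>i. cmod (upd (sn n) j t $ i) \<le> \<sigma>" using elim by (auto simp: upd_nth)
        ultimately have "norm (qe (upd (sn n) j t) b - qe (sn n) b) \<le> L * norm (upd (sn n) j t - sn n)"
          by (intro L)
        also have "upd (sn n) j t - sn n = axis j (t - sn n $ j)"
          using upd_diff [of "sn n" j t "sn n $ j"] by simp
        finally have "norm (qe (upd (sn n) j t) b - qe (sn n) b) \<le> L * norm (t - sn n $ j)"
          by (simp add: norm_axis)
        then have "norm (qe (upd (sn n) j t) b - qe (sn n) b) * norm v * C \<le> L * norm (t - sn n $ j) * norm v * C"
          using C(1) by (intro mult_right_mono) auto
        with C(2) [of "qe (upd (sn n) j t) b - qe (sn n) b" v] show ?case
          by (simp add: L'_def mv.diff_left mult_ac)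
      qed
    qed
    then obtain w where w: "\<And>n. norm (w n) \<le> 2 * pi * L'"
        "\<And>n. qe (sn n) (b - 1) *v (N j *v (v - qe (sn n) b *v v)) = sn n $ j *s (qe (sn n) (b - 1) *v w n)"
      by metis
    have "(\<lambda>n. qe (sn n) (b - 1) *v (N j *v (v - qe (sn n) b *v v)))
        \<longlonglongrightarrow> qe s (b - 1) *v (N j *v (v - qe s b *v v))"
      by (intro mv.tendsto tendsto_diff tendsto_const qlim)
    moreover have "(\<lambda>n. sn n $ j *s (qe (sn n) (b - 1) *v w n)) \<longlonglongrightarrow> 0"
    proof -
      have "(\<lambda>n. scale_mat (sn n $ j) (qe (sn n) (b - 1))) \<longlonglongrightarrow> scale_mat (s $ j) (qe s (b - 1))"
        by (intro sm.tendsto qlim tendsto_vec_nth lim)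
      then have Z: "Zfun (\<lambda>n. scale_mat (sn n $ j) (qe (sn n) (b - 1))) sequentially"
        by (simp add: j(2) sm.zero_left tendsto_Zfun_iff)
      have "Bfun w sequentially" by (rule BfunI [of _ "2 * pi * L'"]) (simp add: w)
      from mv.Zfun_prod_Bfun [OF Z this] show ?thesis
        by (simp add: tendsto_Zfun_iff scale_mat_vec)
    qed
    ultimately show ?thesis unfolding w(2) by (rule LIMSEQ_unique)
  qed
  moreover have "qe s (b - 1) *v (N j *v (qe s b *v v)) = N j *v (qe s b *v v)" for v
  proof -
    have "N j *v (qe s b *v v) \<in> W (2 * b - 1)"
      using N(1) [OF j(1)] qe_range(1) [OF s] unfolding lowers_def by blast
    then have "N j *v (qe s b *v v) \<in> W (2 * (b - 1))"
      using W_odd [of "2 * b - 1"] by (simp add: algebra_simps)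
    then show ?thesis by (rule qe_range(2) [OF s])
  qed
  ultimately show ?thesis
    by (simp add: matrix_eq mv.diff_right flip: matrix_vector_mul_assoc)
qed

lemma transversality_summand:
  assumes s: "s \<in> polydisk" and j: "j \<in> K" "s $ j = 0"
  shows "N j ** summand (qe s) b = summand (qe s) (b - 1) ** N j"
  using transversality [OF assms, of b] transversality [OF assms, of "b - 1"]
  by (simp add: summand_def mat_distribs)

end


section \<open>The limit of the height\<close>

lemma betti_generator_bottom:
  assumes u: "betti_generator A W k u" and span: "W k = vec.span (W k \<inter> A_points A)" and bot: "W (k - 1) = {0}"
  shows "u \<noteq> 0" "W k \<subseteq> vec.span {u}"
proof -
  have pts: "W k \<inter> A_points A = {complex_of_real x *s u + v | x v. x \<in> A \<and> v \<in> W (k - 1) \<inter> A_points A}"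
    and dim: "vec.dim (W k) = Suc (vec.dim (W (k - 1)))"
    using u unfolding betti_generator_def by blast+
  have "W k \<inter> A_points A \<subseteq> vec.span {u}"
    unfolding pts bot by (auto intro: vec.span_scale vec.span_base)
  then show *: "W k \<subseteq> vec.span {u}"
    by (subst span) (intro vec.span_minimal vec.subspace_span)
  show "u \<noteq> 0"
  proof
    assume "u = 0"
    then have "W k \<subseteq> {0}" using * by (simp add: vec.span_insert_0)
    then have "vec.dim (W k) \<le> vec.dim {0 :: complex^'a}" by (rule vec.dim_subset)
    then show False using dim by simp
  qed
qed

context log_monodromy begin

lemma W_range: "2 * hi W = wt_max W" "2 * lo W = wt_min W"
  using weight_range_even(1,2) [OF W_incr] W_odd by blast+

definition splitting_at :: "complex^'r \<Rightarrow> complex^'r \<Rightarrow> int \<Rightarrow> complex^'n^'n" where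
  "splitting_at s u b = E u ** qe s b ** Ei u"

lemma E_ht: "s \<in> polydisk \<Longrightarrow> ht_pair (\<lambda>p. (*v) (E u) ` Fe s p) W"
  using ht_pair_image [OF E_inverse Fe_ht] W_real by (simp add: E_image)

lemma E_proj: "s \<in> polydisk \<Longrightarrow> hodge_proj (\<lambda>p. (*v) (E u) ` Fe s p) W (splitting_at s u)"
  using hodge_proj_image [OF E_inverse Fe_proj] by (simp add: E_image splitting_at_def [abs_def])

lemma splitting_at: "s \<in> polydisk \<Longrightarrow> splitting W (lo W) (hi W) (splitting_at s u)"
  by (rule hodge_proj_splitting [OF E_ht E_proj])

lemma splitting_at_zero: "splitting_at s 0 = qe s"
  by (auto simp: splitting_at_def X_def sm.zero_left)

text \<open>Where \<open>s\<^sub>j = 0\<close>, varying \<open>u\<^sub>j\<close> is a twist by \<open>exp (u\<^sub>j N\<^sub>j)\<close> with \<open>N\<^sub>j\<close> shifting the grading by one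
  step.\<close>

lemma height_vec_indep:
  assumes s: "s \<in> polydisk" and j: "j \<in> K" "s $ j = 0" and long: "lo W + 2 \<le> hi W"
  shows "height_vec m (lo W) (hi W) (splitting_at s u) v = height_vec m (lo W) (hi W) (splitting_at s (upd u j 0)) v"
proof -
  define u0 where "u0 = upd u j 0"
  define t where "t = u $ j"
  have u: "u = u0 + axis j t" by (auto simp: u0_def t_def upd_def axis_def vec_eq_iff)
  have S: "splitting_at s u = (\<lambda>b. mat_exp (scale_mat t (N j)) ** splitting_at s u0 b ** mat_exp (- scale_mat t (N j)))"
    unfolding u by (simp add: fun_eq_iff splitting_at_def E_add_axis(1,3) [OF j(1)] matrix_mul_assoc)
  have comm: "N j ** E u0 = E u0 ** N j" "N j ** Ei u0 = Ei u0 ** N j"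
    by (rule mat_exp_intertwine [OF _ nil [OF X_lowers(1)] nil [OF X_lowers(1)]]
        mat_exp_intertwine [OF _ nil [OF X_lowers(2)] nil [OF X_lowers(2)]];
      simp add: X_N [OF j(1)] mm.minus_left mm.minus_right)+
  have shift: "N j ** summand (splitting_at s u0) b = summand (splitting_at s u0) (b - 1) ** N j" for b
  proof -
    have sum: "summand (splitting_at s u0) b = E u0 ** summand (qe s) b ** Ei u0" for b
      unfolding splitting_at_def [abs_def] by (rule summand_transport)
    have "N j ** summand (splitting_at s u0) b = E u0 ** (N j ** summand (qe s) b) ** Ei u0"
      by (simp add: sum matrix_mul_assoc comm)
    also have "\<dots> = E u0 ** summand (qe s) (b - 1) ** (N j ** Ei u0)"
      by (simp add: transversality_summand [OF s j] matrix_mul_assoc)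
    also have "\<dots> = summand (splitting_at s u0) (b - 1) ** N j"
      by (simp add: sum comm matrix_mul_assoc)
    finally show ?thesis .
  qed
  show ?thesis
    unfolding S u0_def [symmetric]
    by (rule height_vec_nilpotent_orbit [OF splitting_at [OF s] W_real nil N [OF j(1)] shift long])
qed

lemma plip_splitting_at:
  assumes \<rho>: "\<rho> < 1" shows "plip {s. \<forall>i. cmod (s $ i) \<le> \<rho>} (\<lambda>s u. splitting_at s u b)"
proof -
  have bl: "bounded_linear X" "bounded_linear (\<lambda>u. - X u)"
  proof -
    show "bounded_linear X"
      unfolding X_def [abs_def]
      by (intro bounded_linear_sum bounded_linear_compose [OF sm.bounded_linear_left] bounded_linear_vec_nth)
    then show "bounded_linear (\<lambda>u. - X u)" by (rule bounded_linear_minus)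
  qed
  have exp: "plip B (\<lambda>s u. mat_exp (Y u))" if Y: "bounded_linear Y" "\<And>u. mat_pow (Y u) m = 0"
    for B :: "(complex^'r) set" and Y :: "complex^'r \<Rightarrow> complex^'n^'n"
    unfolding mat_exp_nilpotent [OF Y(2)]
    by (intro plip_sum plip_linear [OF bounded_linear_scaleR_right] plip_mat_pow plip_param Y)
  obtain L where L: "0 \<le> L" "\<And>s s'. (\<forall>i. cmod (s $ i) \<le> \<rho>) \<Longrightarrow> (\<forall>i. cmod (s' $ i) \<le> \<rho>) \<Longrightarrow>
        norm (qe s b - qe s' b) \<le> L * norm (s - s')"
    using qe_lip [OF \<rho>, of b] by blast
  have base: "plip {s. \<forall>i. cmod (s $ i) \<le> \<rho>} (\<lambda>s u. qe s b)"
  proof (rule plip_base)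
    fix s :: "complex^'r" assume s: "s \<in> {s. \<forall>i. cmod (s $ i) \<le> \<rho>}"
    have "0 \<le> \<rho>" using s by (metis mem_Collect_eq norm_ge_zero order_trans)
    then have "norm (qe s b - qe 0 b) \<le> L * norm (s - 0)" using s by (intro L) simp_all
    also have "\<dots> \<le> L * (CARD('r) * \<rho>)"
    proof (intro mult_left_mono L)
      have "norm s \<le> (\<Sum>i\<in>UNIV. cmod (s $ i))" by (rule norm_le_l1)
      also have "\<dots> \<le> (\<Sum>i\<in>(UNIV :: 'r set). \<rho>)" using s by (intro sum_mono) simp
      finally show "norm (s - 0) \<le> CARD('r) * \<rho>" by simp
    qed
    finally show "norm (qe s b) \<le> norm (qe 0 b) + L * (CARD('r) * \<rho>)"
      using norm_triangle_ineq2 [of "qe s b" "qe 0 b"] by linarith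
  next
    show "norm (qe s b - qe s' b) \<le> L * dist s s'"
      if "s \<in> {s. \<forall>i. cmod (s $ i) \<le> \<rho>}" "s' \<in> {s. \<forall>i. cmod (s $ i) \<le> \<rho>}" for s s'
      using L(2) that by (simp add: dist_norm)
  qed
  show ?thesis
    unfolding splitting_at_def
    by (intro plip_bilinear [OF bounded_bilinear_matrix_mult] base exp [OF bl(1) nil [OF X_lowers(1)]]
        exp [OF bl(2) nil [OF X_lowers(2)]])
qed

lemma generators:
  assumes z: "z \<in> cover_dom K"
  shows "conj_vec (\<Phi> z *v one (c z)) = \<Phi> z *v one (c z)"
    "conj_vec (\<Phi> z *v one_dual (c z)) = \<Phi> z *v one_dual (c z)" "\<Phi> z *v one_dual (c z) \<noteq> 0"
    "W (2 * lo W) \<subseteq> vec.span {\<Phi> z *v one_dual (c z)}"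
proof -
  note b = betti [OF z]
  show "conj_vec (\<Phi> z *v one (c z)) = \<Phi> z *v one (c z)"
    "conj_vec (\<Phi> z *v one_dual (c z)) = \<Phi> z *v one_dual (c z)"
    using b unfolding betti_generator_def by (blast intro: A_points_conj)+
  note bot = betti_generator_bottom [OF b(2) W_span weight_range(4) [OF W_incr]]
  show "\<Phi> z *v one_dual (c z) \<noteq> 0" by (rule bot)
  show "W (2 * lo W) \<subseteq> vec.span {\<Phi> z *v one_dual (c z)}"
    using bot(2) unfolding W_range(2) .
qed

text \<open>At a point of the cover above \<open>x\<close>, untwisting the period map and twisting it back gives the
  height of the fibre.\<close>

lemma height_fibre:
  assumes z: "z \<in> cover_dom K" and z1: "z1 \<in> cover_dom K" and u: "\<And>j. j \<in> K \<Longrightarrow> u $ j = z $ j"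
  defines "x \<equiv> c z"
  shows "complex_of_real (height (hodge V x) (weight V x) (one x) (one_dual x)) *s (\<Phi> z1 *v one_dual (c z1))
    = height_vec m (lo W) (hi W) (splitting_at (cover_map K z) u) (\<Phi> z1 *v one (c z1))"
proof -
  define s where "s = cover_map K z"
  have s: "s \<in> off_hyperplanes K" "s \<in> polydisk"
    unfolding s_def using cover_map_off [OF z] off_hyperplanes_polydisk by blast+
  have xD: "x \<notin> D" unfolding x_def by (rule c_off(3) [OF z])
  note htx = ht_fibre [OF xD] and g = \<Phi>i [OF z]
  obtain Q where Q: "hodge_proj (hodge V x) (weight V x) Q" using ht_pair_hodge_proj [OF htx] by blast
  define h where "h = height (hodge V x) (weight V x) (one x) (one_dual x)"
  note wt = W_wt [OF z, folded x_def, symmetric]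
  have Wx: "(\<lambda>k. (*v) (\<Phi> z) ` weight V x k) = W" using W_eq [OF z] by (simp add: x_def)
  have nilx: "mat_pow Y m = 0" if "lowers (weight V x) Y" for Y
  proof -
    have "mat_pow (\<Phi> z ** Y ** \<Phi>i z) m = 0"
      using nil lowers_image [OF g(1,2), of "weight V x" Y] that unfolding Wx by blast
    moreover have "\<Phi>i z ** (\<Phi> z ** Y ** \<Phi>i z) = Y ** \<Phi>i z"
      by (simp add: matrix_mul_assoc g)
    ultimately have "mat_pow Y m ** \<Phi>i z = 0"
      using mat_pow_intertwine by (metis mm.zero_right)
    then have "mat_pow Y m ** (\<Phi>i z ** \<Phi> z) = 0" by (simp add: matrix_mul_assoc mm.zero_left)
    then show ?thesis by (simp add: g)
  qed
  have o: "conj_vec (one x) = one x" "conj_vec (one_dual x) = one_dual x" "one_dual x \<noteq> 0"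
    "weight V x (2 * lo (weight V x)) \<subseteq> vec.span {one_dual x}"
  proof -
    note b = fibre_oriented [OF xD, unfolded oriented_mhs_def, THEN conjunct2]
    show "conj_vec (one x) = one x" "conj_vec (one_dual x) = one_dual x"
      using b unfolding betti_generator_def by (blast intro: A_points_conj)+
    have span: "weight V x k = vec.span (weight V x k \<inter> A_points A)" for k
      using mhs [OF xD, unfolded is_mhs_def, THEN conjunct2, THEN conjunct2, THEN conjunct1] by blast
    note bot = betti_generator_bottom [OF b [THEN conjunct2] span weight_range(4) [OF ht_pairD(1) [OF htx]]]
    have lo: "2 * lo (weight V x) = wt_min (weight V x)"
      using weight_range_even(2) [OF ht_pairD(1) [OF htx]] ht_pairD(3) [OF htx] by blast
    show "one_dual x \<noteq> 0" by (rule bot)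
    show "weight V x (2 * lo (weight V x)) \<subseteq> vec.span {one_dual x}"
      using bot(2) unfolding lo .
  qed
  have XE: "X u = X z" unfolding X_def by (intro sum.cong) (simp_all add: u)
  have proj: "(\<lambda>b. \<Phi> z ** Q b ** \<Phi>i z) = splitting_at s u"
  proof
    fix b
    have "(*v) (E z) ` Fe s e = (*v) (\<Phi> z) ` hodge V x e" for e
    proof -
      have "(*v) (E z) ` Fe s e = (*v) (E z ** \<Theta> z) ` hodge V x e"
        using Fs_eq [OF z, of e]
        by (simp add: Fe_eq [OF s(1) [unfolded s_def]] s_def x_def image_image matrix_vector_mul_assoc)
      also have "E z ** \<Theta> z = \<Phi> z" by (simp add: \<Theta>_def matrix_mul_assoc E_inverse)
      finally show ?thesis .
    qed
    then have "hodge_proj (\<lambda>e. (*v) (\<Phi> z) ` hodge V x e) W (splitting_at s u)"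
      using E_proj [OF s(2), of u] by (simp add: XE)
    moreover have "hodge_proj (\<lambda>e. (*v) (\<Phi> z) ` hodge V x e) W (\<lambda>b. \<Phi> z ** Q b ** \<Phi>i z)"
      using hodge_proj_image [OF g(1,2) Q] by (simp only: Wx)
    ultimately show "\<Phi> z ** Q b ** \<Phi>i z = splitting_at s u b"
      unfolding hodge_proj_def by (metis is_proj_unique)
  qed
  have "complex_of_real h *s one_dual x = height_vec m (lo W) (hi W) Q (one x)"
    using height_eq [OF htx Q nilx o] by (simp only: h_def wt)
  then have "complex_of_real h *s (\<Phi> z *v one_dual x)
      = height_vec m (lo W) (hi W) (splitting_at s u) (\<Phi> z *v one x)"
    using height_vec_equivariant [OF g(1,2,4,5), of m "lo W" "hi W" Q "one x"]
    by (simp add: proj matrix_mult_scale_vec [symmetric])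
  also have "\<Phi> z *v one_dual x = \<Phi> z1 *v one_dual (c z1)"
    unfolding x_def by (rule dual_const [OF z z1])
  also have "height_vec m (lo W) (hi W) (splitting_at s u) (\<Phi> z *v one x)
      = height_vec m (lo W) (hi W) (splitting_at s u) (\<Phi> z1 *v one (c z1))"
  proof (rule height_vec_coset [OF splitting_at [OF s(2)] W_real nil])
    show "\<Phi> z *v one x - \<Phi> z1 *v one (c z1) \<in> W (2 * hi W - 1)"
      using one_coset [OF z z1] unfolding x_def W_range(1) .
  qed
  finally show ?thesis unfolding h_def s_def .
qed

lemma polydisk_0: "0 \<in> polydisk"
  by (simp add: polydisk_def)

text \<open>Near \<open>p\<close> a point \<open>x\<close> of the complement has a logarithm \<open>z\<close> with \<open>|z\<^sub>j|\<close> at most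
  \<open>1 + log (1/|s\<^sub>j|)\<close>. So the height at \<open>x\<close> is a value of \<open>H\<close> to which \<open>logarithmic_limit\<close> applies, with
  the height of the limit as value at the origin.\<close>

theorem height_limit:
  assumes z1: "z1 \<in> cover_dom K" and long: "wt_length W \<ge> 4"
  shows "((\<lambda>x. height (hodge V x) (weight V x) (one x) (one_dual x)) \<longlongrightarrow>
    height (Fe 0) W (\<Phi> z1 *v one (c z1)) (\<Phi> z1 *v one_dual (c z1))) (at p within - D)"
proof -
  define v where "v = \<Phi> z1 *v one (c z1)"
  define d where "d = \<Phi> z1 *v one_dual (c z1)"
  define h where "h x = height (hodge V x) (weight V x) (one x) (one_dual x)" for x
  define H where "H s u = height_vec m (lo W) (hi W) (splitting_at s u) v" for s u
  note gen = generators [OF z1, folded v_def d_def]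
  have lohi: "lo W + 2 \<le> hi W"
    using long W_range unfolding wt_length_def by linarith
  obtain zx where zx: "\<And>x. x \<in> P - D \<Longrightarrow> zx x \<in> cover_dom K \<and> cover_map K (zx x) = \<psi> x \<and>
      (\<forall>j\<in>K. cmod (zx x $ j) \<le> 1 + ln (1 / cmod (\<psi> x $ j)))"
  proof -
    have "\<forall>x\<in>P - D. \<exists>z. z \<in> cover_dom K \<and> cover_map K z = \<psi> x \<and>
      (\<forall>j\<in>K. cmod (z $ j) \<le> 1 + ln (1 / cmod (\<psi> x $ j)))"
      using cover_map_surj psi_off by blast
    from bchoice [OF this] that show thesis by blast
  qed
  define u where "u x = (\<chi> j. if j \<in> K then zx x $ j else 0)" for x
  have ev: "\<forall>\<^sub>F x in at p within - D. x \<in> P - D"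
    unfolding eventually_at_topological using pP holo_chartD(1) [OF chart] by (intro exI [of _ P]) auto
  have Hh: "H (\<psi> x) (u x) = complex_of_real (h x) *s d" if x: "x \<in> P - D" for x
  proof -
    note z = zx [OF x]
    have "c (zx x) = x" using z x by (simp add: cover_pt_def inv_psi_psi)
    then show ?thesis
      using height_fibre [of "zx x" z1 "u x"] z z1 by (simp add: H_def h_def v_def d_def u_def)
  qed
  have H0: "H 0 0 = complex_of_real (height (Fe 0) W v d) *s d"
    using height_eq [OF Fe_ht [OF polydisk_0] Fe_proj [OF polydisk_0] nil gen]
    by (simp add: H_def splitting_at_zero)
  have "((\<lambda>x. H (\<psi> x) (u x)) \<longlongrightarrow> H 0 0) (at p within - D)"
  proof (rule logarithmic_limit [where \<rho> = "1/2" and K = K])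
    show "plip {s. \<forall>i. cmod (s $ i) \<le> 1 / 2} H"
      unfolding H_def by (intro plip_height_vec plip_splitting_at) simp
    show "H s u = H s (upd u j 0)" if "s \<in> {s. \<forall>i. cmod (s $ i) \<le> 1 / 2}" "j \<in> K" "s $ j = 0" for s u j
    proof -
      have "cmod (s $ i) < 1" for i using that(1) by (intro le_less_trans [of "cmod (s $ i)" "1/2" 1]) auto
      then have "s \<in> polydisk" by (simp add: polydisk_def)
      then show ?thesis unfolding H_def using that lohi by (intro height_vec_indep)
    qed
    have "isCont \<psi> p" using holo_chartD(1,3) [OF chart] pP by (simp add: continuous_on_eq_continuous_at)
    then show "(\<psi> \<longlongrightarrow> 0) (at p within - D)"
      using psi_p unfolding isCont_def by (metis tendsto_within_subset subset_UNIV)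
    show "\<forall>\<^sub>F x in at p within - D. (\<forall>j\<in>K. \<psi> x $ j \<noteq> 0 \<and> cmod (u x $ j) \<le> 1 + ln (1 / cmod (\<psi> x $ j))) \<and>
        (\<forall>j. j \<notin> K \<longrightarrow> u x $ j = 0)"
      using ev
    proof eventually_elim
      case (elim x)
      then have "\<psi> x \<in> off_hyperplanes K" using psi_off by blast
      then show ?case using zx [OF elim] by (auto simp: u_def off_hyperplanes_def)
    qed
  qed simp_all
  then have "((\<lambda>x. complex_of_real (h x) *s d) \<longlongrightarrow> complex_of_real (height (Fe 0) W v d) *s d) (at p within - D)"
    unfolding H0 by (rule Lim_transform_eventually) (use ev in eventually_elim, rule Hh)
  then have lim: "((\<lambda>x. complex_of_real (h x) * d $ i) \<longlongrightarrow> complex_of_real (height (Fe 0) W v d) * d $ i) (at p within - D)" for i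
    by (drule_tac tendsto_vec_nth [of _ _ _ i]) simp
  obtain i where i: "d $ i \<noteq> 0" using gen(3) by (auto simp: vec_eq_iff)
  have "((\<lambda>x. complex_of_real (h x) * d $ i / d $ i) \<longlongrightarrow>
      complex_of_real (height (Fe 0) W v d) * d $ i / d $ i) (at p within - D)"
    by (rule tendsto_divide [OF lim tendsto_const i])
  then show ?thesis
    using i by (simp add: tendsto_of_real_iff h_def v_def d_def)
qed

text \<open>An extension of the filtration by a subbundle is unique: the sections of a local frame are killed by
  the projections off the divisor, hence also at \<open>0\<close>, and the ranks agree.\<close>

lemma limit_filtration:
  assumes Ft: "\<And>z e. z \<in> cover_dom K \<Longrightarrow> Ft (cover_map K z) e = (*v) (Ei z ** \<Phi> z) ` hodge V (c z) e"
    and hol: "holo_subbundle holo_on polydisk (\<lambda>s. Ft s e)"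
  shows "Ft 0 e = Fe 0 e"
proof -
  have eq: "Ft s e = Fe s e" if s: "s \<in> off_hyperplanes K" for s
    using zof [OF s] Ft [of "zof s" e] Fs_eq [of "zof s" e] by (simp add: Fe_eq [OF s] \<Theta>_def)
  obtain N0 d \<beta> where N0: "open N0" "0 \<in> N0" "N0 \<subseteq> polydisk" "\<forall>i<(d::nat). holo_on (\<beta> i) N0"
    "\<forall>s\<in>N0. vec.dim (Ft s e) = d \<and> Ft s e = vec.span ((\<lambda>i. \<beta> i s) ` {..<d})"
    using bspec [OF hol [unfolded holo_subbundle_def] polydisk_0] by (elim exE conjE) (rule that)
  define sn :: "nat \<Rightarrow> complex^'r" where "sn n = pert K 0 n" for n
  have sn: "sn n \<in> off_hyperplanes K" for n unfolding sn_def by (rule pert_off_hyperplanes [OF polydisk_0])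
  have lim: "sn \<longlonglongrightarrow> 0" unfolding sn_def by (rule pert_tendsto)
  have ev: "\<forall>\<^sub>F n in sequentially. sn n \<in> N0" by (rule topological_tendstoD [OF lim N0(1,2)])
  have "qe 0 (e - 1) *v \<beta> i 0 = 0" if i: "i < d" for i
  proof -
    have "\<beta> i \<midarrow>0\<rightarrow> \<beta> i 0"
    proof (rule vec_tendstoI)
      fix r
      have "hol_at (\<lambda>s. \<beta> i s $ r) 0" using N0(2,4) i unfolding holo_on_iff by blast
      then show "(\<lambda>s. \<beta> i s $ r) \<midarrow>0\<rightarrow> \<beta> i 0 $ r" using hol_at_isCont isCont_def by blast
    qed
    then have "isCont (\<beta> i) 0" by (simp add: isCont_def)
    then have "(\<lambda>n. qe (sn n) (e - 1) *v \<beta> i (sn n)) \<longlonglongrightarrow> qe 0 (e - 1) *v \<beta> i 0"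
      by (intro mv.tendsto isCont_tendsto_compose [OF qe_isCont [OF polydisk_0] lim] isCont_tendsto_compose [OF _ lim])
    moreover have "\<forall>\<^sub>F n in sequentially. qe (sn n) (e - 1) *v \<beta> i (sn n) = 0"
      using ev
    proof eventually_elim
      case (elim n)
      have "\<beta> i (sn n) \<in> Ft (sn n) e" using N0(5) elim i by (auto intro!: vec.span_base)
      then show ?case by (simp add: eq [OF sn] Fe_def)
    qed
    ultimately show ?thesis by (rule LIMSEQ_unique [OF _ tendsto_eventually])
  qed
  then have "(\<lambda>i. \<beta> i 0) ` {..<d} \<subseteq> Fe 0 e" by (auto simp: Fe_def)
  moreover have sub: "vec.subspace (Fe 0 e)" by (rule ht_pairD(4) [OF Fe_ht [OF polydisk_0]])
  ultimately have "Ft 0 e \<subseteq> Fe 0 e" using N0(2,5) vec.span_minimal by metis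
  moreover obtain n where "sn n \<in> N0" using eventually_happens [OF ev] by auto
  then have "vec.dim (Fe 0 e) = vec.dim (Ft 0 e)"
    using ht_pair_dim [OF Fe_ht [OF polydisk_0] Fe_ht [OF off_hyperplanes_polydisk [OF sn]], of e n]
      N0(2,5) eq [OF sn] by metis
  moreover have "vec.subspace (Ft 0 e)" using N0(2,5) vec.subspace_span by metis
  ultimately show ?thesis using sub by (intro vec.subspace_dim_equal) simp_all
qed

lemma polydisk_filtration: "z \<in> cover_dom K \<Longrightarrow> Fe (cover_map K z) e = (*v) (Ei z ** \<Phi> z) ` hodge V (c z) e"
  by (simp add: Fe_eq cover_map_off Fs_eq \<Theta>_def)

lemma log_lowers: "lowers W (\<Sum>j\<in>K. scale_mat (complex_of_real (a j)) (N j))"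
  by (intro lowers_sum lowers_closed W_incr N)

lemma limit_mhs_exists: "limit_mhs V P \<psi> K \<Phi> a (Fe 0) W"
  unfolding limit_mhs_def
proof (intro exI [of _ N] exI [of _ Fe] conjI ballI allI)
  show "nilpotent_mat (N j)" if "j \<in> K" for j by (rule N_nilpotent [OF that])
  show "\<Phi> (z + axis j 1) = mat_exp (N j) ** \<Phi> z" if "j \<in> K" "z \<in> cover_dom K" for j z
    by (rule N_monodromy [OF that(2,1)])
  show "Fe (cover_map K z) e = (*v) (mat_exp (- (\<Sum>j\<in>K. scale_mat (z $ j) (N j))) ** \<Phi> z) ` hodge V (c z) e"
    if "z \<in> cover_dom K" for z e
    using polydisk_filtration [OF that] unfolding X_def .
  show "holo_subbundle holo_on polydisk (\<lambda>s. Fe s e)" for e by (rule Fe_subbundle)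
  show "rel_weight_filtration (\<Sum>j\<in>K. scale_mat (complex_of_real (a j)) (N j))
      (\<lambda>k. (*v) (\<Phi> z) ` weight V (c z) k) W" if "z \<in> cover_dom K" for z
    unfolding W_fun_eq [OF that] by (rule rel_weight_filtration_self [OF W_incr W_odd log_lowers])
qed simp

lemma limit_conclusion:
  assumes z: "z \<in> cover_dom K" and long: "wt_length W \<ge> 4"
    and Ft: "\<And>z e. z \<in> cover_dom K \<Longrightarrow> Ft (cover_map K z) e = (*v) (Ei z ** \<Phi> z) ` hodge V (c z) e"
    and hol: "\<And>e. holo_subbundle holo_on polydisk (\<lambda>s. Ft s e)"
    and F: "\<And>e. F e = Ft 0 e"
    and M: "rel_weight_filtration (\<Sum>j\<in>K. scale_mat (complex_of_real (a j)) (N j)) W M"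
  shows "oriented_mhs A F M (\<Phi> z *v one (c z)) (\<Phi> z *v one_dual (c z))" "hodge_tate F M"
    "M k = (*v) (\<Phi> z) ` weight V (c z) k"
    "((\<lambda>x. height (hodge V x) (weight V x) (one x) (one_dual x)) \<longlongrightarrow>
      height F M (\<Phi> z *v one (c z)) (\<Phi> z *v one_dual (c z))) (at p within - D)"
proof -
  have FM: "F = Fe 0" "M = W"
    using F limit_filtration [OF Ft hol] rel_weight_filtration_unique [OF W_incr log_lowers M] by auto
  note mhs = ht_pair_mhs [OF Fe_ht [OF polydisk_0] W_span]
  show "oriented_mhs A F M (\<Phi> z *v one (c z)) (\<Phi> z *v one_dual (c z))"
    unfolding FM oriented_mhs_def using mhs(1) betti [OF z] by blast
  show "hodge_tate F M" unfolding FM by (rule mhs(2))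
  show "M k = (*v) (\<Phi> z) ` weight V (c z) k" unfolding FM by (rule W_eq [OF z, symmetric])
  show "((\<lambda>x. height (hodge V x) (weight V x) (one x) (one_dual x)) \<longlongrightarrow>
      height F M (\<Phi> z *v one (c z)) (\<Phi> z *v one_dual (c z))) (at p within - D)"
    unfolding FM by (rule height_limit [OF z long])
qed

end

theorem theorem2:
  fixes A :: "real set"
    and atlas :: "('m::t2_space, 'r::finite) chart set"
    and S D :: "'m set"
    and V :: "('m, 'n::finite) variation"
    and one one_dual :: "'m \<Rightarrow> complex^'n"
    and p :: 'm and P :: "'m set" and \<psi> :: "'m \<Rightarrow> complex^'r" and K :: "'r set"
    and \<Phi> :: "complex^'r \<Rightarrow> complex^'n^'n" and a :: "'r \<Rightarrow> real"
  assumes "coeff_ring A"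
    and "complex_manifold atlas"
    and "normal_crossing_divisor atlas D"
    and "S = - D"
    and "gp_vmhs A atlas S V"
    and "\<forall>s\<in>S. hodge_tate (hodge V s) (weight V s)"
    and "oriented_variation A S V one one_dual"
    and "\<forall>s\<in>S. wt_length (weight V s) \<ge> 4"
    and "admissible A atlas D V"
    and "unipotent_local_monodromy A atlas D V"
    and "p \<in> D"
    and "adapted_coords atlas D p P \<psi> K"
    and "flat_frame A V (cover_dom K) (cover_pt P \<psi> K) \<Phi>"
    and "\<forall>j\<in>K. a j > 0"
  shows "(\<exists>F M. limit_mhs V P \<psi> K \<Phi> a F M) \<and>
    (\<forall>F M. limit_mhs V P \<psi> K \<Phi> a F M \<longrightarrow>
       (\<forall>z \<in> cover_dom K.
          let s = cover_pt P \<psi> K z; one_p = \<Phi> z *v one s; one_dual_p = \<Phi> z *v one_dual s in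
          oriented_mhs A F M one_p one_dual_p \<and>
          hodge_tate F M \<and>
          (\<forall>k. M k = (*v) (\<Phi> z) ` weight V s k) \<and>
          ((\<lambda>x. height (hodge V x) (weight V x) (one x) (one_dual x))
             \<longlongrightarrow> height F M one_p one_dual_p) (at p within S)))"
proof -
  interpret degeneration A atlas D V one one_dual p P \<psi> K \<Phi>
    using assms(1-9,12,13) by unfold_locales blast+
  have long: "wt_length W \<ge> 4"
  proof -
    have "wt_length W = wt_length (weight V (c base))" by (simp add: wt_length_def W_wt [OF base])
    then show ?thesis using assms(4,8) c_off(3) [OF base] by simp
  qed
  have "\<exists>N. nilpotent_mat N \<and> (\<forall>z \<in> cover_dom K. \<Phi> (z + axis j 1) = mat_exp N ** \<Phi> z)" if j: "j \<in> K" for j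
  proof -
    obtain T where T: "unipotent_mat T" "\<forall>z \<in> cover_dom K. \<Phi> (z + axis j 1) = T ** \<Phi> z"
      using assms(10,11,12,13) j unfolding unipotent_local_monodromy_def by meson
    obtain l where l: "mat_pow (T - mat 1) l = 0"
      using T(1) by (auto simp: unipotent_mat_def nilpotent_mat_def)
    show ?thesis
      using T(2) mat_exp_log [OF l] mat_log_nilpotent [OF l]
      by (intro exI [of _ "mat_log l T"]) (auto simp: nilpotent_mat_def)
  qed
  then obtain N0 where N0: "\<And>j. j \<in> K \<Longrightarrow> nilpotent_mat (N0 j) \<and>
      (\<forall>z \<in> cover_dom K. \<Phi> (z + axis j 1) = mat_exp (N0 j) ** \<Phi> z)"
    by metis
  interpret N0: log_monodromy A atlas D V one one_dual p P \<psi> K \<Phi> N0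
    by unfold_locales (use assms(9) N0 in blast)+
  show ?thesis
  proof (intro conjI allI impI ballI)
    show "\<exists>F M. limit_mhs V P \<psi> K \<Phi> a F M" using N0.limit_mhs_exists by blast
    fix F M z assume lim: "limit_mhs V P \<psi> K \<Phi> a F M" and z: "z \<in> cover_dom K"
    obtain N Ft where N: "\<forall>j\<in>K. nilpotent_mat (N j) \<and> (\<forall>z \<in> cover_dom K. \<Phi> (z + axis j 1) = mat_exp (N j) ** \<Phi> z)"
      and Ft: "\<forall>z \<in> cover_dom K. \<forall>e. Ft (cover_map K z) e =
        (*v) (mat_exp (- (\<Sum>j\<in>K. scale_mat (z $ j) (N j))) ** \<Phi> z) ` hodge V (c z) e"
      and hol: "\<forall>e. holo_subbundle holo_on polydisk (\<lambda>s. Ft s e)" and F: "\<forall>e. F e = Ft 0 e"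
      and M: "\<forall>z \<in> cover_dom K. rel_weight_filtration (\<Sum>j\<in>K. scale_mat (complex_of_real (a j)) (N j))
             (\<lambda>k. (*v) (\<Phi> z) ` weight V (c z) k) M"
      using lim unfolding limit_mhs_def by (elim exE conjE) (rule that)
    interpret N: log_monodromy A atlas D V one one_dual p P \<psi> K \<Phi> N
      by unfold_locales (use assms(9) N in blast)+
    have Ft': "Ft (cover_map K z) e = (*v) (mat_exp (- N.X z) ** \<Phi> z) ` hodge V (c z) e"
      if "z \<in> cover_dom K" for z e
      using Ft that unfolding N.X_def by blast
    have M': "rel_weight_filtration (\<Sum>j\<in>K. scale_mat (complex_of_real (a j)) (N j)) W M"
      using bspec [OF M z] unfolding W_fun_eq [OF z] .
    note lim = N.limit_conclusion [OF z long Ft' hol [rule_format] F [rule_format] M']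
    show "let s = c z; one_p = \<Phi> z *v one s; one_dual_p = \<Phi> z *v one_dual s in
          oriented_mhs A F M one_p one_dual_p \<and> hodge_tate F M \<and>
          (\<forall>k. M k = (*v) (\<Phi> z) ` weight V s k) \<and>
          ((\<lambda>x. height (hodge V x) (weight V x) (one x) (one_dual x))
             \<longlongrightarrow> height F M one_p one_dual_p) (at p within S)"
      unfolding Let_def assms(4) using lim by blast
  qed
qed

end
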